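(* Let $B$ be a noise Boolean algebra under $\mathbb{P}$ with spectral resolution $((S,\Sigma,\mu);\Psi)$. (i) $B$ is classical if and only if there exists an equivalent spectral independence probability (i.e. a spectral independence probability equivalent to $\mu$). (ii) Assume $0_{\mathbb{P}}\neq1_{\mathbb{P}}$. $B$ is black if and only if there is no non-trivial spectral independence probability.
   Context: All $\mathrm{L}^p$ and Hilbert spaces are real. $(\Omega,\mathcal{F},\mathbb{P})$ is an essentially separable probability space: some countable subset of $\mathcal{F}$ together with the $\mathbb{P}$-null sets generates $\mathcal{F}$. $\sigma(\cdots)$ denotes the $\sigma$-field generated by the indicated objects and by the null sets of the relevant measure. $\hat{\mathbb{P}}$ is the lattice of all complete sub-$\sigma$-fields of $\mathcal{F}$ (those containing $0_{\mathbb{P}}:=\mathbb{P}^{-1}(\{0,1\})$), with bottom $0_{\mathbb{P}}$, top $1_{\mathbb{P}}:=\mathcal{F}$, meet $\land=\cap$, join $\lor$ = generated $\sigma$-field. $\mathbb{P}_x$ is the conditional expectation operator on $\mathrm{L}^2(\mathbb{P})$ given $x\in\hat{\mathbb{P}}$. A noise Boolean algebra under $\mathbb{P}$ is a non-empty distributive sublattice $B$ of $\hat{\mathbb{P}}$ every element $x$ of which admits a (unique) $x'\in B$ independent of $x$ with $x\lor x'=1_{\mathbb{P}}$. $B_x:=\{y\in B:y\subset x\}$. Spectral resolution. $\mathcal{A}$ is the strong operator closure of the real linear span of $\{\mathbb{P}_x:x\in B\}$. A standard measure space is the completion of a $\sigma$-finite measure on a standard Borel space, possibly adjoined with an extra null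 set. A spectral resolution $((S,\Sigma,\mu);\Psi)$ of $B$ (it always exists) is a standard measure space $(S,\Sigma,\mu)$ with a unitary isomorphism $\Psi$ of $\mathrm{L}^2(\mathbb{P})$ onto a direct integral $\int_S^\oplus H_s\,\mu(\mathrm{d}s)$ of a $\mu$-measurable field of a.e. non-zero separable Hilbert spaces, carrying $\mathcal{A}$ onto the algebra of diagonalizable operators. For $x\in B$ the spectral set $S_x\in\Sigma$ is the a.e.-$\mu$ unique set with $\Psi(\mathbb{P}_xf)=\mathbf{1}_{S_x}\Psi(f)$ for all $f\in\mathrm{L}^2(\mathbb{P})$. There is a unique point $\emptyset_S\in S$ with $S_{0_{\mathbb{P}}}=\{\emptyset_S\}$ a.e.-$\mu$. For $x\in B$, $\Sigma_x:=\sigma(S_{u\lor x'}:u\in B_x)$. The first chaos is $H^{(1)}:=\{f\in\mathrm{L}^2(\mathbb{P}):f=\mathbb{P}[f|x]+\mathbb{P}[f|x']\text{ for all }x\in B\}$. $B$ is classical if $\sigma(H^{(1)})=1_{\mathbb{P}}$; $B$ is black if $H^{(1)}=\{0\}$ and $0_{\mathbb{P}}\ne1_{\mathbb{P}}$. A spectral independence probability (for the given spectral resolution of $B$) is a probability measure $\nu$ on $(S,\Sigma)$, absolutely continuous w.r.t. $\mu$, with $\nu(S_{0_{\mathbb{P}}})>0$ and such that $\Sigma_x$ is independent of $\Sigma_{x'}$ under $\nu$ for all $x\in B$. It is called equivalent if $\nu\sim\mu$, and non-trivial if $\nu(\{\emptyset_S\})<1$. *)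

theory Defs
  imports "HOL-Probability.Probability"
begin

text \<open>
  A sub-\<open>\<sigma>\<close>-field of \<open>M\<close> is represented by its set of events, of type \<open>'a set set\<close>. Elements of
  \<open>L\<^sup>2\<close> spaces and of direct integrals are represented by functions, and every equation between them
  is stated almost everywhere.
\<close>


section \<open>Complete sub-\<open>\<sigma>\<close>-fields\<close>

definition essentially_separable :: "'a measure \<Rightarrow> bool" where
  "essentially_separable M \<longleftrightarrow>
     (\<exists>C. countable C \<and> C \<subseteq> sets M \<and> sigma_sets (space M) (C \<union> null_sets M) = sets M)"

definition trivial_field :: "'a measure \<Rightarrow> 'a set set" where
  "trivial_field M = {A \<in> sets M. measure M A \<in> {0, 1}}"

definition complete_subfields :: "'a measure \<Rightarrow> 'a set set set" where
  "complete_subfields M =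
     {x. sigma_algebra (space M) x \<and> trivial_field M \<subseteq> x \<and> x \<subseteq> sets M}"

definition join_field :: "'a measure \<Rightarrow> 'a set set \<Rightarrow> 'a set set \<Rightarrow> 'a set set" where
  "join_field M x y = sigma_sets (space M) (x \<union> y)"

definition cexp :: "'a measure \<Rightarrow> 'a set set \<Rightarrow> ('a \<Rightarrow> real) \<Rightarrow> 'a \<Rightarrow> real" where
  "cexp M x f = real_cond_exp M (sigma (space M) x) f"


section \<open>Noise Boolean algebras\<close>

definition is_noise_complement :: "'a measure \<Rightarrow> 'a set set set \<Rightarrow> 'a set set \<Rightarrow> 'a set set \<Rightarrow> bool" where
  "is_noise_complement M B x y \<longleftrightarrow>
     y \<in> B \<and> prob_space.indep_set M x y \<and> join_field M x y = sets M"

definition noise_boolean_algebra :: "'a measure \<Rightarrow> 'a set set set \<Rightarrow> bool" where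
  "noise_boolean_algebra M B \<longleftrightarrow>
     B \<noteq> {} \<and> B \<subseteq> complete_subfields M \<and>
     (\<forall>x\<in>B. \<forall>y\<in>B. x \<inter> y \<in> B \<and> join_field M x y \<in> B) \<and>
     (\<forall>x\<in>B. \<forall>y\<in>B. \<forall>z\<in>B.
        x \<inter> join_field M y z = join_field M (x \<inter> y) (x \<inter> z)) \<and>
     (\<forall>x\<in>B. \<exists>y. is_noise_complement M B x y)"

text \<open>
  Independence of \<open>x\<close> and \<open>y\<close> forces \<open>x \<inter> y = trivial_field M\<close>, so noise complements are lattice
  complements and distributivity makes them unique.
\<close>

definition noise_complement :: "'a measure \<Rightarrow> 'a set set set \<Rightarrow> 'a set set \<Rightarrow> 'a set set" where
  "noise_complement M B x = (THE y. is_noise_complement M B x y)"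

definition below :: "'a set set set \<Rightarrow> 'a set set \<Rightarrow> 'a set set set" where
  "below B x = {y \<in> B. y \<subseteq> x}"


section \<open>Real \<open>L\<^sup>2\<close> spaces and operators on them\<close>

definition L2 :: "'a measure \<Rightarrow> ('a \<Rightarrow> real) set" where
  "L2 M = {f \<in> borel_measurable M. integrable M (\<lambda>\<omega>. (f \<omega>)\<^sup>2)}"

definition L2_norm :: "'a measure \<Rightarrow> ('a \<Rightarrow> real) \<Rightarrow> real" where
  "L2_norm M f = sqrt (LINT \<omega>|M. (f \<omega>)\<^sup>2)"

definition bounded_operator :: "'a measure \<Rightarrow> (('a \<Rightarrow> real) \<Rightarrow> ('a \<Rightarrow> real)) \<Rightarrow> bool" where
  "bounded_operator M T \<longleftrightarrow>
     (\<forall>f\<in>L2 M. T f \<in> L2 M) \<and>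
     (\<forall>f\<in>L2 M. \<forall>g\<in>L2 M. \<forall>a b.
        AE \<omega> in M. T (\<lambda>\<eta>. a * f \<eta> + b * g \<eta>) \<omega> = a * T f \<omega> + b * T g \<omega>) \<and>
     (\<exists>K. \<forall>f\<in>L2 M. L2_norm M (T f) \<le> K * L2_norm M f)"

definition cexp_span :: "'a measure \<Rightarrow> 'a set set set \<Rightarrow> (('a \<Rightarrow> real) \<Rightarrow> ('a \<Rightarrow> real)) set" where
  "cexp_span M B = {\<lambda>f \<omega>. \<Sum>x\<in>X. c x * cexp M x f \<omega> |X c. finite X \<and> X \<subseteq> B}"

text \<open>
  The sets \<open>{R. \<forall>f\<in>F. L2_norm M (T f - R f) < \<epsilon>}\<close>, for finite \<open>F\<close> and \<open>\<epsilon> > 0\<close>, form a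
  neighbourhood base at \<open>T\<close> for the strong operator topology.
\<close>

definition noise_operator_algebra ::
    "'a measure \<Rightarrow> 'a set set set \<Rightarrow> (('a \<Rightarrow> real) \<Rightarrow> ('a \<Rightarrow> real)) set" where
  "noise_operator_algebra M B =
     {T. bounded_operator M T \<and>
         (\<forall>F \<epsilon>. finite F \<and> F \<subseteq> L2 M \<and> \<epsilon> > 0 \<longrightarrow>
            (\<exists>R\<in>cexp_span M B. \<forall>f\<in>F. L2_norm M (\<lambda>\<omega>. T f \<omega> - R f \<omega>) < \<epsilon>))}"


section \<open>Standard measure spaces\<close>

definition standard_borel :: "'s measure \<Rightarrow> bool" where
  "standard_borel N \<longleftrightarrow>
     (\<exists>X. completely_metrizable_space X \<and> second_countable X \<and> space N = topspace X \<and>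
          sets N = sigma_sets (topspace X) {U. openin X U})"

text \<open>The completed standard part lives on \<open>space N\<close>; the rest of \<open>space \<mu>\<close> is the adjoined null set.\<close>

definition standard_measure_space :: "'s measure \<Rightarrow> bool" where
  "standard_measure_space \<mu> \<longleftrightarrow>
     complete_measure \<mu> \<and>
     (\<exists>N. standard_borel N \<and> sigma_finite_measure N \<and>
          space N \<subseteq> space \<mu> \<and> space \<mu> - space N \<in> null_sets \<mu> \<and>
          restrict_space \<mu> (space N) = completion N)"


section \<open>Measurable fields of Hilbert spaces and direct integrals\<close>

text \<open>
  The fibres are complete subspaces \<open>H s\<close> of one ambient inner product space. This loses no
  generality, since any family of Hilbert spaces embeds fibrewise isometrically into its \<open>l\<^sup>2\<close>-sum,
  and the measurable structure is carried separately by the set \<open>\<Gamma>\<close> of measurable sections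
  (Dixmier's definition). Values of sections outside \<open>space \<mu>\<close> are irrelevant. Separability of the
  fibres is part of the last conjunct.
\<close>

definition measurable_hilbert_field ::
    "'s measure \<Rightarrow> ('s \<Rightarrow> 'h::real_inner set) \<Rightarrow> ('s \<Rightarrow> 'h) set \<Rightarrow> bool" where
  "measurable_hilbert_field \<mu> H \<Gamma> \<longleftrightarrow>
     (\<forall>s\<in>space \<mu>. subspace (H s) \<and> uniform_space_class.complete (H s)) \<and>
     (\<forall>\<phi>\<in>\<Gamma>. \<forall>s\<in>space \<mu>. \<phi> s \<in> H s) \<and>
     (\<forall>\<phi>\<in>\<Gamma>. \<forall>\<psi>\<in>\<Gamma>. \<forall>a b. (\<lambda>s. a *\<^sub>R \<phi> s + b *\<^sub>R \<psi> s) \<in> \<Gamma>) \<and>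
     (\<forall>\<phi>\<in>\<Gamma>. (\<lambda>s. norm (\<phi> s)) \<in> borel_measurable \<mu>) \<and>
     (\<forall>\<psi>. (\<forall>s\<in>space \<mu>. \<psi> s \<in> H s) \<and> (\<forall>\<phi>\<in>\<Gamma>. (\<lambda>s. \<phi> s \<bullet> \<psi> s) \<in> borel_measurable \<mu>)
        \<longrightarrow> \<psi> \<in> \<Gamma>) \<and>
     (\<exists>e :: nat \<Rightarrow> 's \<Rightarrow> 'h. (\<forall>n. e n \<in> \<Gamma>) \<and>
        (\<forall>s\<in>space \<mu>. H s = closure (span (range (\<lambda>n. e n s)))))"

definition direct_integral :: "'s measure \<Rightarrow> ('s \<Rightarrow> 'h::real_inner) set \<Rightarrow> ('s \<Rightarrow> 'h) set" where
  "direct_integral \<mu> \<Gamma> = {\<phi> \<in> \<Gamma>. integrable \<mu> (\<lambda>s. (norm (\<phi> s))\<^sup>2)}"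

definition unitary_onto_direct_integral ::
    "'a measure \<Rightarrow> 's measure \<Rightarrow> ('s \<Rightarrow> 'h::real_inner) set \<Rightarrow> (('a \<Rightarrow> real) \<Rightarrow> 's \<Rightarrow> 'h) \<Rightarrow> bool" where
  "unitary_onto_direct_integral M \<mu> \<Gamma> \<Psi> \<longleftrightarrow>
     (\<forall>f\<in>L2 M. \<Psi> f \<in> direct_integral \<mu> \<Gamma>) \<and>
     (\<forall>f\<in>L2 M. \<forall>g\<in>L2 M. \<forall>a b.
        AE s in \<mu>. \<Psi> (\<lambda>\<omega>. a * f \<omega> + b * g \<omega>) s = a *\<^sub>R \<Psi> f s + b *\<^sub>R \<Psi> g s) \<and>
     (\<forall>f\<in>L2 M. (LINT s|\<mu>. (norm (\<Psi> f s))\<^sup>2) = (LINT \<omega>|M. (f \<omega>)\<^sup>2)) \<and>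
     (\<forall>\<phi>\<in>direct_integral \<mu> \<Gamma>. \<exists>f\<in>L2 M. AE s in \<mu>. \<Psi> f s = \<phi> s)"

definition Linf :: "'s measure \<Rightarrow> ('s \<Rightarrow> real) set" where
  "Linf \<mu> = {h \<in> borel_measurable \<mu>. \<exists>K. AE s in \<mu>. \<bar>h s\<bar> \<le> K}"

text \<open>\<open>intertwines_diagonal M \<mu> \<Psi> T h\<close>: \<open>\<Psi>\<close> carries \<open>T\<close> to the diagonalizable operator given by \<open>h\<close>.\<close>

definition intertwines_diagonal ::
    "'a measure \<Rightarrow> 's measure \<Rightarrow> (('a \<Rightarrow> real) \<Rightarrow> 's \<Rightarrow> 'h::real_inner) \<Rightarrow>
     (('a \<Rightarrow> real) \<Rightarrow> ('a \<Rightarrow> real)) \<Rightarrow> ('s \<Rightarrow> real) \<Rightarrow> bool" where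
  "intertwines_diagonal M \<mu> \<Psi> T h \<longleftrightarrow> (\<forall>f\<in>L2 M. AE s in \<mu>. \<Psi> (T f) s = h s *\<^sub>R \<Psi> f s)"


section \<open>Spectral resolutions\<close>

definition spectral_resolution ::
    "'a measure \<Rightarrow> 'a set set set \<Rightarrow> 's measure \<Rightarrow> ('s \<Rightarrow> 'h::real_inner set) \<Rightarrow>
     ('s \<Rightarrow> 'h) set \<Rightarrow> (('a \<Rightarrow> real) \<Rightarrow> 's \<Rightarrow> 'h) \<Rightarrow> bool" where
  "spectral_resolution M B \<mu> H \<Gamma> \<Psi> \<longleftrightarrow>
     standard_measure_space \<mu> \<and>
     measurable_hilbert_field \<mu> H \<Gamma> \<and>
     (AE s in \<mu>. H s \<noteq> {0}) \<and>
     unitary_onto_direct_integral M \<mu> \<Gamma> \<Psi> \<and>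
     (\<forall>T\<in>noise_operator_algebra M B. \<exists>h\<in>Linf \<mu>. intertwines_diagonal M \<mu> \<Psi> T h) \<and>
     (\<forall>h\<in>Linf \<mu>. \<exists>T\<in>noise_operator_algebra M B. intertwines_diagonal M \<mu> \<Psi> T h)"

text \<open>
  The spectral set of \<open>x\<close> is unique only up to \<open>\<mu>\<close>-null sets; the choice of a version does not
  affect anything below, because \<open>spectral_field\<close> contains the \<open>\<mu>\<close>-null sets and the measures
  considered are absolutely continuous with respect to \<open>\<mu>\<close>.
\<close>

definition spectral_set ::
    "'a measure \<Rightarrow> 's measure \<Rightarrow> (('a \<Rightarrow> real) \<Rightarrow> 's \<Rightarrow> 'h::real_inner) \<Rightarrow> 'a set set \<Rightarrow> 's set" where
  "spectral_set M \<mu> \<Psi> x =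
     (SOME A. A \<in> sets \<mu> \<and> intertwines_diagonal M \<mu> \<Psi> (cexp M x) (indicator A))"

definition empty_point ::
    "'a measure \<Rightarrow> 's measure \<Rightarrow> (('a \<Rightarrow> real) \<Rightarrow> 's \<Rightarrow> 'h::real_inner) \<Rightarrow> 's" where
  "empty_point M \<mu> \<Psi> =
     (THE p. p \<in> space \<mu> \<and> (AE s in \<mu>. s \<in> spectral_set M \<mu> \<Psi> (trivial_field M) \<longleftrightarrow> s = p))"

definition spectral_field ::
    "'a measure \<Rightarrow> 'a set set set \<Rightarrow> 's measure \<Rightarrow> (('a \<Rightarrow> real) \<Rightarrow> 's \<Rightarrow> 'h::real_inner) \<Rightarrow>
     'a set set \<Rightarrow> 's set set" where
  "spectral_field M B \<mu> \<Psi> x =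
     sigma_sets (space \<mu>)
       ({spectral_set M \<mu> \<Psi> (join_field M u (noise_complement M B x)) |u. u \<in> below B x}
        \<union> null_sets \<mu>)"


section \<open>Classical and black noise Boolean algebras\<close>

definition first_chaos :: "'a measure \<Rightarrow> 'a set set set \<Rightarrow> ('a \<Rightarrow> real) set" where
  "first_chaos M B =
     {f \<in> L2 M. \<forall>x\<in>B. AE \<omega> in M. f \<omega> = cexp M x f \<omega> + cexp M (noise_complement M B x) f \<omega>}"

definition generated_field :: "'a measure \<Rightarrow> ('a \<Rightarrow> real) set \<Rightarrow> 'a set set" where
  "generated_field M G =
     sigma_sets (space M) ({f -` A \<inter> space M |f A. f \<in> G \<and> A \<in> sets borel} \<union> null_sets M)"

definition classical :: "'a measure \<Rightarrow> 'a set set set \<Rightarrow> bool" where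
  "classical M B \<longleftrightarrow> generated_field M (first_chaos M B) = sets M"

definition black :: "'a measure \<Rightarrow> 'a set set set \<Rightarrow> bool" where
  "black M B \<longleftrightarrow> (\<forall>f\<in>first_chaos M B. AE \<omega> in M. f \<omega> = 0) \<and> trivial_field M \<noteq> sets M"


section \<open>Spectral independence probabilities\<close>

definition spectral_independence_probability ::
    "'a measure \<Rightarrow> 'a set set set \<Rightarrow> 's measure \<Rightarrow> (('a \<Rightarrow> real) \<Rightarrow> 's \<Rightarrow> 'h::real_inner) \<Rightarrow>
     's measure \<Rightarrow> bool" where
  "spectral_independence_probability M B \<mu> \<Psi> \<nu> \<longleftrightarrow>
     prob_space \<nu> \<and> sets \<nu> = sets \<mu> \<and> absolutely_continuous \<mu> \<nu> \<and>
     measure \<nu> (spectral_set M \<mu> \<Psi> (trivial_field M)) > 0 \<and>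
     (\<forall>x\<in>B. prob_space.indep_set \<nu> (spectral_field M B \<mu> \<Psi> x)
               (spectral_field M B \<mu> \<Psi> (noise_complement M B x)))"

definition equivalent_measures :: "'s measure \<Rightarrow> 's measure \<Rightarrow> bool" where
  "equivalent_measures \<nu> \<mu> \<longleftrightarrow> absolutely_continuous \<nu> \<mu> \<and> absolutely_continuous \<mu> \<nu>"

definition nontrivial_spectral_probability ::
    "'a measure \<Rightarrow> 's measure \<Rightarrow> (('a \<Rightarrow> real) \<Rightarrow> 's \<Rightarrow> 'h::real_inner) \<Rightarrow> 's measure \<Rightarrow> bool" where
  "nontrivial_spectral_probability M \<mu> \<Psi> \<nu> \<longleftrightarrow> measure \<nu> {empty_point M \<mu> \<Psi>} < 1"

end

(*
  For f in L^2, let mu_f be the spectral measure |Psi f|^2 mu. Say that a spectral point s hits x if s is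
  not in S_{x'}. For a finite partition b of unity in B and 0 < rho < 1, the multiplication by rho^{K_b},
  K_b(s) = number of cells of b hit by s, is carried by Psi to a symmetric Markov operator T_b, namely the
  product over the cells a of rho + (1 - rho) P_{a'}. Call f tight if <f - T_b f, f> tends to 0 as rho
  tends to 1, uniformly in b; this expresses that mu_f-almost every s is finite. Three facts give the theorem.

  (1) Tight vectors form a closed sublattice of L^2 that contains the first chaos. If B is classical, all
  vectors are therefore tight.

  (2) If nu is a spectral independence probability, then the integral of rho^{K_b} under nu factorises and
  is at least nu(S_0)^{1-rho}. Vectors f with mu_f << nu are therefore tight.

  (3) A tight vector is a limit of sums of products of first chaos vectors over the cells of a partition:
  a fine enough partition separates the points of s. Hence every closed subspace that contains 1 and the
  first chaos and is stable under products of independent factors contains all tight vectors.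

  Conversely, X in the first chaos has an exponential vector Z, the limit of the products of the 1 + P_a X
  over the cells a. It satisfies Z = P_x Z P_{x'} Z, so that mu_Z / |Z|^2 is a spectral independence
  probability. It is non-trivial if X is not 0. If X generates the first chaos, then the vectors f with
  mu_f << mu_Z satisfy the hypotheses of (3), and mu_Z is equivalent to mu if B is classical.
*)
theory Submission
  imports Defs
begin

section \<open>The Hilbert space of square integrable functions\<close>

text \<open>Each factor of T_b forgets one cell with probability 1 - rho and is a positive operator.
  Positivity makes tightness stable under absolute values, so that the generating property of the
  first chaos can be exploited event by event, without a chaos expansion. The bound in (2) comes
  from q^(1-rho) \<le> rho + (1-rho) q, used with q = nu(S_{a'}) in each cell a: these numbers
  multiply to nu(S_0) whatever the partition, which is the source of uniformity.

  Two obstacles shape the proof. B need not be countable, so finiteness of a spectral point is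
  expressed by bounds uniform in the partition, and exceptional sets are controlled by essential
  unions along sequences. Moreover, that the vectors f with mu_f << mu_Z are stable under products
  is not formal: mu_{fg} is a product measure only on the field generated by Sigma_y and Sigma_{y'}.
  This field is all of Sigma up to null sets because the combinations of the P_x are strongly dense
  in the operators that correspond to the diagonalizable ones; absolute continuity then passes from
  the factors to the product by Fubini's theorem.\<close>

definition ip :: "'a measure \<Rightarrow> ('a \<Rightarrow> real) \<Rightarrow> ('a \<Rightarrow> real) \<Rightarrow> real" where
  "ip M f g = (LINT \<omega>|M. f \<omega> * g \<omega>)"

lemma L2I: "f \<in> borel_measurable M \<Longrightarrow> integrable M (\<lambda>\<omega>. (f \<omega>)\<^sup>2) \<Longrightarrow> f \<in> L2 M"
  by (simp add: L2_def)

lemma L2_measurable [measurable_dest]: "f \<in> L2 M \<Longrightarrow> f \<in> borel_measurable M"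
  by (simp add: L2_def)

lemma L2_integrable_square: "f \<in> L2 M \<Longrightarrow> integrable M (\<lambda>\<omega>. (f \<omega>)\<^sup>2)"
  by (simp add: L2_def)

lemma L2_integrable_mult:
  assumes "f \<in> L2 M" "g \<in> L2 M"
  shows "integrable M (\<lambda>\<omega>. f \<omega> * g \<omega>)"
proof (rule Bochner_Integration.integrable_bound)
  show "integrable M (\<lambda>\<omega>. (f \<omega>)\<^sup>2 + (g \<omega>)\<^sup>2)"
    using assms by (auto simp: L2_def)
  show "(\<lambda>\<omega>. f \<omega> * g \<omega>) \<in> borel_measurable M"
    using assms by (auto simp: L2_def)
  have "\<bar>a * b\<bar> \<le> a\<^sup>2 + b\<^sup>2" for a b :: real
  proof -
    have "2 * (\<bar>a\<bar> * \<bar>b\<bar>) \<le> a\<^sup>2 + b\<^sup>2" using sum_squares_bound[of "\<bar>a\<bar>" "\<bar>b\<bar>"] by simp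
    moreover have "0 \<le> \<bar>a\<bar> * \<bar>b\<bar>" by simp
    ultimately show ?thesis by (simp only: abs_mult)
  qed
  then show "AE \<omega> in M. norm (f \<omega> * g \<omega>) \<le> norm ((f \<omega>)\<^sup>2 + (g \<omega>)\<^sup>2)" by simp
qed

lemma L2_lin:
  assumes "f \<in> L2 M" "g \<in> L2 M"
  shows "(\<lambda>\<omega>. a * f \<omega> + b * g \<omega>) \<in> L2 M"
proof (rule L2I)
  show "(\<lambda>\<omega>. a * f \<omega> + b * g \<omega>) \<in> borel_measurable M" using assms by (auto simp: L2_def)
  have "integrable M (\<lambda>\<omega>. a\<^sup>2 * (f \<omega>)\<^sup>2 + (2 * a * b) * (f \<omega> * g \<omega>) + b\<^sup>2 * (g \<omega>)\<^sup>2)"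
    using assms L2_integrable_mult[OF assms] by (auto simp: L2_def)
  then show "integrable M (\<lambda>\<omega>. (a * f \<omega> + b * g \<omega>)\<^sup>2)"
    by (simp add: power2_sum power_mult_distrib algebra_simps)
qed

lemma L2_scale: "f \<in> L2 M \<Longrightarrow> (\<lambda>\<omega>. a * f \<omega>) \<in> L2 M"
  using L2_lin[of f M f a 0] by simp

lemma L2_add: "f \<in> L2 M \<Longrightarrow> g \<in> L2 M \<Longrightarrow> (\<lambda>\<omega>. f \<omega> + g \<omega>) \<in> L2 M"
  using L2_lin[of f M g 1 1] by simp

lemma L2_diff: "f \<in> L2 M \<Longrightarrow> g \<in> L2 M \<Longrightarrow> (\<lambda>\<omega>. f \<omega> - g \<omega>) \<in> L2 M"
  using L2_lin[of f M g 1 "-1"] by simp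

lemma L2_abs: "f \<in> L2 M \<Longrightarrow> (\<lambda>\<omega>. \<bar>f \<omega>\<bar>) \<in> L2 M"
  by (auto simp: L2_def)

lemma L2_zero: "(\<lambda>\<omega>. 0) \<in> L2 M"
  by (auto simp: L2_def)

lemma L2_bound:
  assumes "g \<in> L2 M" "f \<in> borel_measurable M" "AE \<omega> in M. \<bar>f \<omega>\<bar> \<le> \<bar>g \<omega>\<bar>"
  shows "f \<in> L2 M"
proof (rule L2I[OF assms(2)])
  show "integrable M (\<lambda>\<omega>. (f \<omega>)\<^sup>2)"
  proof (rule Bochner_Integration.integrable_bound[OF L2_integrable_square[OF assms(1)]])
    show "(\<lambda>\<omega>. (f \<omega>)\<^sup>2) \<in> borel_measurable M" using assms(2) by simp
    show "AE \<omega> in M. norm ((f \<omega>)\<^sup>2) \<le> norm ((g \<omega>)\<^sup>2)"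
      using assms(3) by eventually_elim (simp add: abs_le_square_iff)
  qed
qed

lemma L2_cong_AE:
  "f \<in> L2 M \<Longrightarrow> g \<in> borel_measurable M \<Longrightarrow> AE \<omega> in M. g \<omega> = f \<omega> \<Longrightarrow> g \<in> L2 M"
  by (rule L2_bound[of f]) auto

lemma ip_commute: "ip M f g = ip M g f"
  by (simp add: ip_def mult.commute)

lemma ip_lin_left:
  assumes "f \<in> L2 M" "g \<in> L2 M" "h \<in> L2 M"
  shows "ip M (\<lambda>\<omega>. a * f \<omega> + b * g \<omega>) h = a * ip M f h + b * ip M g h"
proof -
  have "ip M (\<lambda>\<omega>. a * f \<omega> + b * g \<omega>) h = (LINT \<omega>|M. a * (f \<omega> * h \<omega>) + b * (g \<omega> * h \<omega>))"
    by (simp add: ip_def algebra_simps)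
  also have "\<dots> = a * ip M f h + b * ip M g h"
    using L2_integrable_mult[OF assms(1,3)] L2_integrable_mult[OF assms(2,3)] by (simp add: ip_def)
  finally show ?thesis .
qed

lemma ip_lin_right:
  assumes "f \<in> L2 M" "g \<in> L2 M" "h \<in> L2 M"
  shows "ip M h (\<lambda>\<omega>. a * f \<omega> + b * g \<omega>) = a * ip M h f + b * ip M h g"
  using ip_lin_left[OF assms] by (simp add: ip_commute)

lemma ip_diff_left:
  "f \<in> L2 M \<Longrightarrow> g \<in> L2 M \<Longrightarrow> h \<in> L2 M \<Longrightarrow> ip M (\<lambda>\<omega>. f \<omega> - g \<omega>) h = ip M f h - ip M g h"
  using ip_lin_left[of f M g h 1 "-1"] by simp

lemma ip_diff_right:
  "f \<in> L2 M \<Longrightarrow> g \<in> L2 M \<Longrightarrow> h \<in> L2 M \<Longrightarrow> ip M h (\<lambda>\<omega>. f \<omega> - g \<omega>) = ip M h f - ip M h g"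
  using ip_lin_right[of f M g h 1 "-1"] by simp

lemma ip_add_left:
  "f \<in> L2 M \<Longrightarrow> g \<in> L2 M \<Longrightarrow> h \<in> L2 M \<Longrightarrow> ip M (\<lambda>\<omega>. f \<omega> + g \<omega>) h = ip M f h + ip M g h"
  using ip_lin_left[of f M g h 1 "1"] by simp

lemma ip_add_right:
  "f \<in> L2 M \<Longrightarrow> g \<in> L2 M \<Longrightarrow> h \<in> L2 M \<Longrightarrow> ip M h (\<lambda>\<omega>. f \<omega> + g \<omega>) = ip M h f + ip M h g"
  using ip_lin_right[of f M g h 1 "1"] by simp

lemma ip_self_nonneg: "0 \<le> ip M f f"
  by (simp add: ip_def)

lemma ip_cong_AE:
  assumes "f \<in> L2 M" "g \<in> L2 M" "f' \<in> L2 M" "g' \<in> L2 M"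
    and "AE \<omega> in M. f \<omega> = f' \<omega>" "AE \<omega> in M. g \<omega> = g' \<omega>"
  shows "ip M f g = ip M f' g'"
  unfolding ip_def
proof (rule integral_cong_AE)
  show "AE \<omega> in M. f \<omega> * g \<omega> = f' \<omega> * g' \<omega>" using assms(5,6) by eventually_elim simp
qed (use assms in \<open>auto simp: L2_def\<close>)

lemma L2_norm_ip: "L2_norm M f = sqrt (ip M f f)"
  by (simp add: L2_norm_def ip_def power2_eq_square)

lemma L2_norm_square: "(L2_norm M f)\<^sup>2 = ip M f f"
  by (simp add: L2_norm_ip ip_self_nonneg)

lemma L2_norm_nonneg [simp]: "0 \<le> L2_norm M f"
  by (simp add: L2_norm_ip ip_self_nonneg)

lemma L2_norm_cong_AE:
  "f \<in> L2 M \<Longrightarrow> g \<in> L2 M \<Longrightarrow> AE \<omega> in M. f \<omega> = g \<omega> \<Longrightarrow> L2_norm M f = L2_norm M g"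
  using ip_cong_AE[of f M f g g] by (simp add: L2_norm_ip)

lemma L2_norm_zero [simp]: "L2_norm M (\<lambda>\<omega>. 0) = 0"
  by (simp add: L2_norm_def)

lemma L2_norm_eq_0:
  assumes "f \<in> L2 M" "L2_norm M f = 0"
  shows "AE \<omega> in M. f \<omega> = 0"
proof -
  have "(LINT \<omega>|M. (f \<omega>)\<^sup>2) = 0" using assms(2) by (simp add: L2_norm_def)
  then have "AE \<omega> in M. (f \<omega>)\<^sup>2 = 0"
    using integral_nonneg_eq_0_iff_AE[OF L2_integrable_square[OF assms(1)]] by simp
  then show ?thesis by simp
qed

lemma Cauchy_Schwarz_L2:
  assumes f: "f \<in> L2 M" and g: "g \<in> L2 M"
  shows "\<bar>ip M f g\<bar> \<le> L2_norm M f * L2_norm M g"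
proof -
  have q: "0 \<le> ip M f f * s\<^sup>2 + 2 * s * t * ip M f g + ip M g g * t\<^sup>2" for s t
  proof -
    have "ip M (\<lambda>\<omega>. s * f \<omega> + t * g \<omega>) (\<lambda>\<omega>. s * f \<omega> + t * g \<omega>) =
        ip M f f * s\<^sup>2 + 2 * s * t * ip M f g + ip M g g * t\<^sup>2"
      using f g by (simp add: ip_lin_left ip_lin_right L2_lin ip_commute[of M g f] power2_eq_square algebra_simps)
    then show ?thesis by (metis ip_self_nonneg)
  qed
  have "(ip M f g)\<^sup>2 \<le> ip M f f * ip M g g"
  proof (cases "ip M f f = 0")
    case True
    have "ip M f g = 0"
    proof (rule ccontr)
      assume n: "ip M f g \<noteq> 0"
      have "0 \<le> 2 * s * ip M f g + ip M g g" for s using q[of s 1] True by simp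
      \<comment> \<open>At this s the affine function of s takes the value -1.\<close>
      from this[of "- (ip M g g + 1) / (2 * ip M f g)"] n show False by (simp add: field_simps)
    qed
    then show ?thesis using True by simp
  next
    case False
    then have p: "0 < ip M f f" using ip_self_nonneg[of M f] by simp
    have "0 \<le> ip M f f * (ip M f f * ip M g g - (ip M f g)\<^sup>2)"
      \<comment> \<open>For t = \<open>ip M f f\<close> the form is minimal at s =
        \<open>- ip M f g\<close>; this scaling avoids a division.\<close>
      using q[of "- ip M f g" "ip M f f"] by (simp add: power2_eq_square algebra_simps)
    then show ?thesis using p by (simp add: zero_le_mult_iff)
  qed
  then have "sqrt ((ip M f g)\<^sup>2) \<le> sqrt (ip M f f * ip M g g)" by (rule real_sqrt_le_mono)
  then show ?thesis by (simp add: L2_norm_ip real_sqrt_mult)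
qed

lemma L2_norm_triangle:
  assumes f: "f \<in> L2 M" and g: "g \<in> L2 M"
  shows "L2_norm M (\<lambda>\<omega>. f \<omega> + g \<omega>) \<le> L2_norm M f + L2_norm M g"
proof (rule power2_le_imp_le)
  have "(L2_norm M (\<lambda>\<omega>. f \<omega> + g \<omega>))\<^sup>2 = ip M f f + 2 * ip M f g + ip M g g"
    using f g by (simp add: L2_norm_square ip_add_left ip_add_right L2_add ip_commute[of M g f])
  also have "\<dots> \<le> (L2_norm M f + L2_norm M g)\<^sup>2"
    using Cauchy_Schwarz_L2[OF f g] by (simp add: power2_sum L2_norm_square)
  finally show "(L2_norm M (\<lambda>\<omega>. f \<omega> + g \<omega>))\<^sup>2 \<le> (L2_norm M f + L2_norm M g)\<^sup>2" .
qed simp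

lemma L2_norm_minus_commute: "L2_norm M (\<lambda>\<omega>. f \<omega> - g \<omega>) = L2_norm M (\<lambda>\<omega>. g \<omega> - f \<omega>)"
  by (simp add: L2_norm_def power2_commute)

lemma L2_norm_triangle_diff:
  assumes "f \<in> L2 M" "g \<in> L2 M" "h \<in> L2 M"
  shows "L2_norm M (\<lambda>\<omega>. f \<omega> - h \<omega>) \<le> L2_norm M (\<lambda>\<omega>. f \<omega> - g \<omega>) + L2_norm M (\<lambda>\<omega>. g \<omega> - h \<omega>)"
  using L2_norm_triangle[OF L2_diff[OF assms(1,2)] L2_diff[OF assms(2,3)]] by simp

lemma L2_norm_diff_bound:
  assumes f: "f \<in> L2 M" and g: "g \<in> L2 M"
  shows "\<bar>L2_norm M f - L2_norm M g\<bar> \<le> L2_norm M (\<lambda>\<omega>. f \<omega> - g \<omega>)"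
  using L2_norm_triangle[OF g L2_diff[OF f g]] L2_norm_triangle[OF f L2_diff[OF g f]]
    L2_norm_minus_commute[of M f g] by simp

definition L2_lim :: "'a measure \<Rightarrow> (nat \<Rightarrow> 'a \<Rightarrow> real) \<Rightarrow> ('a \<Rightarrow> real) \<Rightarrow> bool" where
  "L2_lim M F f \<longleftrightarrow> (\<lambda>n. L2_norm M (\<lambda>\<omega>. F n \<omega> - f \<omega>)) \<longlonglongrightarrow> 0"

lemma L2_lim_norm:
  assumes "\<And>n. F n \<in> L2 M" "f \<in> L2 M" "L2_lim M F f"
  shows "(\<lambda>n. L2_norm M (F n)) \<longlonglongrightarrow> L2_norm M f"
proof -
  have "(\<lambda>n. L2_norm M (F n) - L2_norm M f) \<longlonglongrightarrow> 0"
    by (rule Lim_null_comparison[OF _ assms(3)[unfolded L2_lim_def]])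
      (use assms in \<open>auto intro!: always_eventually L2_norm_diff_bound\<close>)
  then show ?thesis by (simp add: LIM_zero_iff)
qed

lemma L2_lim_ip:
  assumes "\<And>n. F n \<in> L2 M" "f \<in> L2 M" "g \<in> L2 M" "L2_lim M F f"
  shows "(\<lambda>n. ip M (F n) g) \<longlonglongrightarrow> ip M f g"
proof -
  have l: "(\<lambda>n. L2_norm M (\<lambda>\<omega>. F n \<omega> - f \<omega>) * L2_norm M g) \<longlonglongrightarrow> 0"
    using tendsto_mult_right[OF assms(4)[unfolded L2_lim_def], of "L2_norm M g"] by simp
  have "(\<lambda>n. ip M (F n) g - ip M f g) \<longlonglongrightarrow> 0"
    by (rule Lim_null_comparison[OF _ l], rule always_eventually)
      (use assms Cauchy_Schwarz_L2[OF L2_diff[OF assms(1,2)] assms(3)] in \<open>simp add: ip_diff_left\<close>)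
  then show ?thesis by (simp add: LIM_zero_iff)
qed

lemma L2_lim_unique:
  assumes "\<And>n. F n \<in> L2 M" "f \<in> L2 M" "g \<in> L2 M" "L2_lim M F f" "L2_lim M F g"
  shows "AE \<omega> in M. f \<omega> = g \<omega>"
proof -
  have "(\<lambda>n. L2_norm M (\<lambda>\<omega>. F n \<omega> - f \<omega>) + L2_norm M (\<lambda>\<omega>. F n \<omega> - g \<omega>)) \<longlonglongrightarrow> 0 + 0"
    using assms(4,5) unfolding L2_lim_def by (rule tendsto_add)
  moreover have "L2_norm M (\<lambda>\<omega>. f \<omega> - g \<omega>) \<le> L2_norm M (\<lambda>\<omega>. F n \<omega> - f \<omega>) + L2_norm M (\<lambda>\<omega>. F n \<omega> - g \<omega>)" for n
    using L2_norm_triangle_diff[OF assms(2) assms(1) assms(3), of n] L2_norm_minus_commute[of M f "F n"] by simp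
  ultimately have "L2_norm M (\<lambda>\<omega>. f \<omega> - g \<omega>) \<le> 0"
    using LIMSEQ_le_const[of _ 0 "L2_norm M (\<lambda>\<omega>. f \<omega> - g \<omega>)"] by auto
  then have "L2_norm M (\<lambda>\<omega>. f \<omega> - g \<omega>) = 0" by (simp add: antisym)
  from L2_norm_eq_0[OF L2_diff[OF assms(2,3)] this] show ?thesis by simp
qed

lemma L2_lim_dominated:
  assumes F: "\<And>n. F n \<in> borel_measurable M" and f: "f \<in> borel_measurable M" and h: "h \<in> L2 M"
    and lim: "AE \<omega> in M. (\<lambda>n. F n \<omega>) \<longlonglongrightarrow> f \<omega>" and bd: "\<And>n. AE \<omega> in M. \<bar>F n \<omega>\<bar> \<le> h \<omega>"
  shows "f \<in> L2 M" "\<And>n. F n \<in> L2 M" "L2_lim M F f"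
proof -
  have bd': "AE \<omega> in M. \<forall>n. \<bar>F n \<omega>\<bar> \<le> h \<omega>" using bd by (simp add: AE_all_countable)
  have bf: "AE \<omega> in M. \<bar>f \<omega>\<bar> \<le> h \<omega>"
    using lim bd' by eventually_elim (auto intro: LIMSEQ_le_const2 tendsto_rabs)
  show f2: "f \<in> L2 M" by (rule L2_bound[OF h f]) (use bf in eventually_elim, auto)
  show F2: "F n \<in> L2 M" for n by (rule L2_bound[OF h F]) (use bd[of n] in eventually_elim, auto)
  have "(\<lambda>n. LINT \<omega>|M. (F n \<omega> - f \<omega>)\<^sup>2) \<longlonglongrightarrow> (LINT \<omega>|M. 0)"
  proof (rule integral_dominated_convergence)
    show "integrable M (\<lambda>\<omega>. (2 * h \<omega>)\<^sup>2)" by (rule L2_integrable_square[OF L2_scale[OF h]])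
    show "AE \<omega> in M. (\<lambda>n. (F n \<omega> - f \<omega>)\<^sup>2) \<longlonglongrightarrow> 0"
      using lim
    proof eventually_elim
      case (elim \<omega>)
      then have "(\<lambda>n. (F n \<omega> - f \<omega>)\<^sup>2) \<longlonglongrightarrow> (f \<omega> - f \<omega>)\<^sup>2" by (intro tendsto_intros)
      then show ?case by simp
    qed
    show "AE \<omega> in M. norm ((F n \<omega> - f \<omega>)\<^sup>2) \<le> (2 * h \<omega>)\<^sup>2" for n
      using bf bd[of n]
    proof eventually_elim
      case (elim \<omega>)
      then have "\<bar>F n \<omega> - f \<omega>\<bar> \<le> \<bar>2 * h \<omega>\<bar>" by linarith
      then have "(F n \<omega> - f \<omega>)\<^sup>2 \<le> (2 * h \<omega>)\<^sup>2" by (simp only: abs_le_square_iff)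
      then show ?case by simp
    qed
  qed (use F f in auto)
  then have "(\<lambda>n. sqrt (LINT \<omega>|M. (F n \<omega> - f \<omega>)\<^sup>2)) \<longlonglongrightarrow> sqrt 0"
    by (intro tendsto_real_sqrt) simp
  then show "L2_lim M F f" by (simp add: L2_lim_def L2_norm_def)
qed

section \<open>Closed subspaces of L2\<close>

definition closed_subspace :: "'a measure \<Rightarrow> ('a \<Rightarrow> real) set \<Rightarrow> bool" where
  "closed_subspace M V \<longleftrightarrow> V \<subseteq> L2 M \<and> V \<noteq> {} \<and>
     (\<forall>f\<in>V. \<forall>g\<in>V. \<forall>a b. (\<lambda>\<omega>. a * f \<omega> + b * g \<omega>) \<in> V) \<and>
     (\<forall>f\<in>L2 M. (\<forall>\<epsilon>>0. \<exists>g\<in>V. L2_norm M (\<lambda>\<omega>. f \<omega> - g \<omega>) < \<epsilon>) \<longrightarrow> f \<in> V)"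

lemma closed_subspace_L2: "closed_subspace M V \<Longrightarrow> f \<in> V \<Longrightarrow> f \<in> L2 M"
  unfolding closed_subspace_def by blast

lemma closed_subspace_lin:
  "closed_subspace M V \<Longrightarrow> f \<in> V \<Longrightarrow> g \<in> V \<Longrightarrow> (\<lambda>\<omega>. a * f \<omega> + b * g \<omega>) \<in> V"
  unfolding closed_subspace_def by simp

lemma closed_subspace_approx:
  "closed_subspace M V \<Longrightarrow> f \<in> L2 M \<Longrightarrow> (\<And>\<epsilon>. 0 < \<epsilon> \<Longrightarrow> \<exists>g\<in>V. L2_norm M (\<lambda>\<omega>. f \<omega> - g \<omega>) < \<epsilon>) \<Longrightarrow> f \<in> V"
  unfolding closed_subspace_def by simp

lemma closed_subspace_scale: "closed_subspace M V \<Longrightarrow> f \<in> V \<Longrightarrow> (\<lambda>\<omega>. a * f \<omega>) \<in> V"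
  using closed_subspace_lin[of M V f f a 0] by simp

lemma closed_subspace_add: "closed_subspace M V \<Longrightarrow> f \<in> V \<Longrightarrow> g \<in> V \<Longrightarrow> (\<lambda>\<omega>. f \<omega> + g \<omega>) \<in> V"
  using closed_subspace_lin[of M V f g 1 1] by simp

lemma closed_subspace_diff: "closed_subspace M V \<Longrightarrow> f \<in> V \<Longrightarrow> g \<in> V \<Longrightarrow> (\<lambda>\<omega>. f \<omega> - g \<omega>) \<in> V"
  using closed_subspace_lin[of M V f g 1 "-1"] by simp

lemma closed_subspace_zero: "closed_subspace M V \<Longrightarrow> (\<lambda>\<omega>. 0) \<in> V"
proof -
  assume V: "closed_subspace M V"
  then obtain f where "f \<in> V" unfolding closed_subspace_def by blast
  from closed_subspace_scale[OF V this, of 0] show ?thesis by simp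
qed

lemma closed_subspace_sum:
  "closed_subspace M V \<Longrightarrow> (\<And>i. i \<in> I \<Longrightarrow> f i \<in> V) \<Longrightarrow> (\<lambda>\<omega>. \<Sum>i\<in>I. f i \<omega>) \<in> V"
  by (induction I rule: infinite_finite_induct) (auto intro: closed_subspace_add closed_subspace_zero)

text \<open>Functions equal almost everywhere are at distance 0, so a set closed under approximation
  automatically respects null sets. Membership can then be treated as a property of classes.\<close>

lemma closed_subspace_AE:
  assumes V: "closed_subspace M V" and f: "f \<in> V" and g: "g \<in> L2 M" and ae: "AE \<omega> in M. f \<omega> = g \<omega>"
  shows "g \<in> V"
proof (rule closed_subspace_approx[OF V g])
  fix \<epsilon> :: real assume "0 < \<epsilon>"
  have "L2_norm M (\<lambda>\<omega>. g \<omega> - f \<omega>) = L2_norm M (\<lambda>\<omega>. 0)"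
    by (rule L2_norm_cong_AE) (use ae closed_subspace_L2[OF V f] g in \<open>auto intro: L2_diff L2_zero\<close>)
  then show "\<exists>h\<in>V. L2_norm M (\<lambda>\<omega>. g \<omega> - h \<omega>) < \<epsilon>" using f \<open>0 < \<epsilon>\<close> by (intro bexI[of _ f]) auto
qed

lemma closed_subspace_lim:
  assumes V: "closed_subspace M V" and F: "\<And>n. F n \<in> V" and f: "f \<in> L2 M" and l: "L2_lim M F f"
  shows "f \<in> V"
proof (rule closed_subspace_approx[OF V f])
  fix \<epsilon> :: real assume "0 < \<epsilon>"
  then have "\<forall>\<^sub>F n in sequentially. L2_norm M (\<lambda>\<omega>. F n \<omega> - f \<omega>) < \<epsilon>"
    using l by (simp add: L2_lim_def order_tendstoD(2))
  then obtain n where "L2_norm M (\<lambda>\<omega>. F n \<omega> - f \<omega>) < \<epsilon>"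
    using eventually_happens trivial_limit_sequentially by blast
  then show "\<exists>g\<in>V. L2_norm M (\<lambda>\<omega>. f \<omega> - g \<omega>) < \<epsilon>"
    using F by (auto simp: L2_norm_minus_commute)
qed

lemma (in finite_measure) L2_const: "(\<lambda>\<omega>. c) \<in> L2 M"
  by (auto simp: L2_def)

lemma (in finite_measure) L2_indicator: "A \<in> sets M \<Longrightarrow> indicator A \<in> L2 M"
  by (rule L2_bound[OF L2_const[of 1]]) (auto simp: indicator_def)

lemma (in finite_measure) L2_integrable: "f \<in> L2 M \<Longrightarrow> integrable M f"
  using L2_integrable_mult[OF _ L2_const[of 1], of f] by simp

lemma (in prob_space) L2_norm_one: "L2_norm M (\<lambda>\<omega>. 1) = 1"
  by (simp add: L2_norm_def prob_space)

lemma (in prob_space) ip_const: "ip M f (\<lambda>\<omega>. c) = c * expectation f"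
  by (simp add: ip_def mult.commute)

lemma (in prob_space) expectation_abs_le_L2_norm:
  assumes "f \<in> L2 M" shows "expectation (\<lambda>\<omega>. \<bar>f \<omega>\<bar>) \<le> L2_norm M f"
proof -
  have "ip M (\<lambda>\<omega>. \<bar>f \<omega>\<bar>) (\<lambda>\<omega>. 1) \<le> L2_norm M (\<lambda>\<omega>. \<bar>f \<omega>\<bar>) * L2_norm M (\<lambda>\<omega>. 1)"
    using Cauchy_Schwarz_L2[OF L2_abs[OF assms] L2_const[of 1]] by linarith
  moreover have "L2_norm M (\<lambda>\<omega>. \<bar>f \<omega>\<bar>) = L2_norm M f" by (simp add: L2_norm_def)
  ultimately show ?thesis by (simp add: ip_const L2_norm_one)
qed

text \<open>Riesz-Fischer. A fast subsequence converges almost everywhere because its increments are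
  summable in L1; Fatou's lemma carries the Cauchy bound over to the limit, for the whole sequence
  at once.\<close>

lemma (in prob_space) L2_complete:
  assumes F: "\<And>n. F n \<in> L2 M"
    and C: "\<And>\<epsilon>. 0 < \<epsilon> \<Longrightarrow> \<exists>N. \<forall>m\<ge>N. \<forall>n\<ge>N. L2_norm M (\<lambda>\<omega>. F m \<omega> - F n \<omega>) < \<epsilon>"
  obtains f where "f \<in> L2 M" "L2_lim M F f"
proof -
  have [measurable]: "F n \<in> borel_measurable M" for n using F by (rule L2_measurable)
  obtain N where N: "\<And>k m n. N k \<le> m \<Longrightarrow> N k \<le> n \<Longrightarrow> L2_norm M (\<lambda>\<omega>. F m \<omega> - F n \<omega>) < (1/2)^k"
  proof -
    have "\<forall>k. \<exists>N. \<forall>m\<ge>N. \<forall>n\<ge>N. L2_norm M (\<lambda>\<omega>. F m \<omega> - F n \<omega>) < (1/2::real)^k" using C by simp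
    then show ?thesis using that by metis
  qed
  \<comment> \<open>Summing the \<open>N j\<close> makes the indices monotone while keeping
    \<open>r k\<close> above \<open>N k\<close>.\<close>
  define r where "r k = (\<Sum>j\<le>k. N j)" for k
  have rN: "N k \<le> r k" for k unfolding r_def by (rule member_le_sum) auto
  have rm: "r k \<le> r (Suc k)" for k by (simp add: r_def)
  have d: "L2_norm M (\<lambda>\<omega>. F (r (Suc k)) \<omega> - F (r k) \<omega>) \<le> (1/2)^k" for k
    using N[OF order_trans[OF rN rm] rN] by (simp add: less_imp_le)
  let ?g = "\<lambda>k \<omega>. \<bar>F (r (Suc k)) \<omega> - F (r k) \<omega>\<bar>"
  have gk: "(\<integral>\<^sup>+ \<omega>. ennreal (?g k \<omega>) \<partial>M) \<le> ennreal ((1/2)^k)" for k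
  proof -
    have "integrable M (?g k)" using L2_integrable[OF L2_abs[OF L2_diff[OF F F]]] .
    then have "(\<integral>\<^sup>+ \<omega>. ennreal (?g k \<omega>) \<partial>M) = ennreal (expectation (?g k))"
      by (rule nn_integral_eq_integral) simp
    also have "\<dots> \<le> ennreal ((1/2)^k)"
      using expectation_abs_le_L2_norm[OF L2_diff[OF F F]] d[of k] by (intro ennreal_leI) (rule order_trans)
    finally show ?thesis .
  qed
  have "(\<integral>\<^sup>+ \<omega>. (\<Sum>k. ennreal (?g k \<omega>)) \<partial>M) = (\<Sum>k. \<integral>\<^sup>+ \<omega>. ennreal (?g k \<omega>) \<partial>M)"
    by (rule nn_integral_suminf) measurable
  also have "\<dots> \<le> (\<Sum>k. ennreal ((1/2)^k))" by (intro suminf_le gk) auto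
  also have "\<dots> = ennreal 2"
    using suminf_geometric[of "1/2::real"] by (subst suminf_ennreal2) (auto intro: summable_geometric)
  finally have "(\<integral>\<^sup>+ \<omega>. (\<Sum>k. ennreal (?g k \<omega>)) \<partial>M) \<noteq> \<infinity>"
    by (metis ennreal_less_top infinity_ennreal_def leD)
  then have "AE \<omega> in M. (\<Sum>k. ennreal (?g k \<omega>)) \<noteq> \<infinity>"
    by (intro nn_integral_PInf_AE) measurable
  then have conv: "AE \<omega> in M. (\<lambda>k. F (r k) \<omega>) \<longlonglongrightarrow> lim (\<lambda>k. F (r k) \<omega>)"
  proof eventually_elim
    case (elim \<omega>)
    then have "summable (\<lambda>k. norm (F (r (Suc k)) \<omega> - F (r k) \<omega>))"
      by (intro summable_suminf_not_top) (auto simp: infinity_ennreal_def)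
    then have "summable (\<lambda>k. F (r (Suc k)) \<omega> - F (r k) \<omega>)" by (rule summable_norm_cancel)
    then have "convergent (\<lambda>n. (\<Sum>k<n. F (r (Suc k)) \<omega> - F (r k) \<omega>) + F (r 0) \<omega>)"
      by (intro convergent_add convergent_const) (simp add: summable_iff_convergent)
    then have "convergent (\<lambda>n. F (r n) \<omega>)" by (simp add: sum_lessThan_telescope[of "\<lambda>k. F (r k) \<omega>"])
    then show ?case by (simp add: convergent_LIMSEQ_iff)
  qed
  define f where "f \<omega> = lim (\<lambda>k. F (r k) \<omega>)" for \<omega>
  have fm [measurable]: "f \<in> borel_measurable M" unfolding f_def by measurable
  \<comment> \<open>With n fixed, the distances of \<open>F n\<close> to the terms of the
    subsequence are controlled from index k on, and Fatou needs nothing more than their limit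
    inferior.\<close>
  have bound: "(\<integral>\<^sup>+ \<omega>. ennreal ((f \<omega> - F n \<omega>)\<^sup>2) \<partial>M) \<le> ennreal (((1/2)^k)\<^sup>2)" if n: "N k \<le> n" for k n
  proof -
    have "(\<integral>\<^sup>+ \<omega>. ennreal ((f \<omega> - F n \<omega>)\<^sup>2) \<partial>M)
        = (\<integral>\<^sup>+ \<omega>. liminf (\<lambda>j. ennreal ((F (r j) \<omega> - F n \<omega>)\<^sup>2)) \<partial>M)"
    proof (rule nn_integral_cong_AE)
      show "AE \<omega> in M. ennreal ((f \<omega> - F n \<omega>)\<^sup>2) = liminf (\<lambda>j. ennreal ((F (r j) \<omega> - F n \<omega>)\<^sup>2))"
        using conv
      proof eventually_elim
        case (elim \<omega>)
        then have "(\<lambda>j. ennreal ((F (r j) \<omega> - F n \<omega>)\<^sup>2)) \<longlonglongrightarrow> ennreal ((f \<omega> - F n \<omega>)\<^sup>2)"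
          unfolding f_def by (intro tendsto_ennrealI tendsto_intros)
        then show ?case by (rule lim_imp_Liminf[OF trivial_limit_sequentially, symmetric])
      qed
    qed
    also have "\<dots> \<le> liminf (\<lambda>j. \<integral>\<^sup>+ \<omega>. ennreal ((F (r j) \<omega> - F n \<omega>)\<^sup>2) \<partial>M)"
      by (rule nn_integral_liminf) measurable
    also have "\<dots> \<le> liminf (\<lambda>j. ennreal (((1/2)^k)\<^sup>2))"
    proof (rule Liminf_mono)
      have "(\<integral>\<^sup>+ \<omega>. ennreal ((F (r j) \<omega> - F n \<omega>)\<^sup>2) \<partial>M) \<le> ennreal (((1/2)^k)\<^sup>2)" if "k \<le> j" for j
      proof -
        have "r k \<le> r j" using that rm by (rule lift_Suc_mono_le[rotated])
        then have "N k \<le> r j" using rN[of k] by simp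
        then have b: "(L2_norm M (\<lambda>\<omega>. F (r j) \<omega> - F n \<omega>))\<^sup>2 \<le> ((1/2)^k)\<^sup>2"
          using N[OF _ n] by (intro power_mono) (auto simp: less_imp_le)
        have "(\<integral>\<^sup>+ \<omega>. ennreal ((F (r j) \<omega> - F n \<omega>)\<^sup>2) \<partial>M) = ennreal ((L2_norm M (\<lambda>\<omega>. F (r j) \<omega> - F n \<omega>))\<^sup>2)"
          using L2_integrable_square[OF L2_diff[OF F[of "r j"] F[of n]]]
          by (subst nn_integral_eq_integral) (auto simp: L2_norm_def)
        then show ?thesis using b by (simp add: ennreal_leI)
      qed
      then show "\<forall>\<^sub>F j in sequentially. (\<integral>\<^sup>+ \<omega>. ennreal ((F (r j) \<omega> - F n \<omega>)\<^sup>2) \<partial>M) \<le> ennreal (((1/2)^k)\<^sup>2)"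
        by (auto simp: eventually_sequentially)
    qed
    also have "\<dots> = ennreal (((1/2)^k)\<^sup>2)" by (simp add: Liminf_const)
    finally show ?thesis .
  qed
  have dL2: "(\<lambda>\<omega>. f \<omega> - F n \<omega>) \<in> L2 M" if n: "N k \<le> n" for k n
  proof (rule L2I)
    show "integrable M (\<lambda>\<omega>. (f \<omega> - F n \<omega>)\<^sup>2)"
      by (rule integrableI_bounded) (use bound[OF n] in \<open>auto simp: le_less_trans\<close>)
  qed measurable
  have fL2: "f \<in> L2 M" using L2_add[OF dL2[OF order_refl, of 0] F[of "N 0"]] by simp
  have nb: "L2_norm M (\<lambda>\<omega>. F n \<omega> - f \<omega>) \<le> (1/2)^k" if n: "N k \<le> n" for k n
  proof -
    have "ennreal (LINT \<omega>|M. (f \<omega> - F n \<omega>)\<^sup>2) \<le> ennreal (((1/2)^k)\<^sup>2)"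
      using bound[OF n] L2_integrable_square[OF dL2[OF n]] by (subst (asm) nn_integral_eq_integral) auto
    then have "(LINT \<omega>|M. (f \<omega> - F n \<omega>)\<^sup>2) \<le> ((1/2)^k)\<^sup>2" by (simp add: ennreal_le_iff)
    then have "L2_norm M (\<lambda>\<omega>. f \<omega> - F n \<omega>) \<le> sqrt (((1/2)^k)\<^sup>2)"
      unfolding L2_norm_def by (rule real_sqrt_le_mono)
    then show ?thesis by (simp add: L2_norm_minus_commute[of M f])
  qed
  have "L2_lim M F f"
    unfolding L2_lim_def
  proof (rule LIMSEQ_I)
    fix \<epsilon> :: real assume "0 < \<epsilon>"
    then obtain k where k: "(1/2)^k < \<epsilon>" using real_arch_pow_inv[of \<epsilon> "1/2"] by auto
    have "norm (L2_norm M (\<lambda>\<omega>. F n \<omega> - f \<omega>) - 0) < \<epsilon>" if "N k \<le> n" for n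
      using nb[OF that] k by simp
    then show "\<exists>n0. \<forall>n\<ge>n0. norm (L2_norm M (\<lambda>\<omega>. F n \<omega> - f \<omega>) - 0) < \<epsilon>" by blast
  qed
  with fL2 show thesis by (rule that)
qed

text \<open>Dynkin's argument: the events whose indicator lies in V are stable under complements and
  countable disjoint unions, since V is linear, contains 1 and contains dominated limits.\<close>

lemma (in finite_measure) closed_subspace_indicators:
  assumes V: "closed_subspace M V"
    and G: "G \<subseteq> sets M" "Int_stable G" and G1: "\<And>A. A \<in> G \<Longrightarrow> indicator A \<in> V" and V1: "(\<lambda>\<omega>. 1) \<in> V"
    and A: "A \<in> sigma_sets (space M) G"
  shows "indicator A \<in> V"
proof -
  have sub: "sigma_sets (space M) G \<subseteq> sets M" using G(1) by (rule sets.sigma_sets_subset)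
  have GP: "G \<subseteq> Pow (space M)" using G(1) sets.space_closed by blast
  from A show ?thesis
  proof (induction rule: sigma_sets_induct_disjoint[OF G(2) GP, consumes 1, case_names basic empty compl union])
    case (basic A) then show ?case by (rule G1)
  next
    case empty
    then show ?case using closed_subspace_zero[OF V] by (simp add: indicator_def[abs_def])
  next
    case (compl A)
    then have "A \<in> sets M" using sub by auto
    then show ?case
      by (intro closed_subspace_AE[OF V closed_subspace_diff[OF V V1 compl(2)]])
        (auto intro!: L2_indicator AE_I2 split: split_indicator)
  next
    case (union A)
    have As [measurable]: "A i \<in> sets M" for i using union(2) sub by auto
    let ?F = "\<lambda>n \<omega>. \<Sum>i<n. indicator (A i) \<omega> :: real"
    have eq: "?F n \<omega> = indicator (\<Union>i<n. A i) \<omega>" for n \<omega>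
      using union(1) by (subst indicator_UN_disjoint) (auto simp: disjoint_family_on_def)
    show ?case
    proof (rule closed_subspace_lim[OF V])
      show "?F n \<in> V" for n using union(3) by (intro closed_subspace_sum[OF V])
      show "indicator (\<Union>i. A i) \<in> L2 M" by (rule L2_indicator) measurable
      have "(\<lambda>n. ?F n \<omega>) \<longlonglongrightarrow> indicator (\<Union>i. A i) \<omega>" for \<omega>
        unfolding eq by (rule LIMSEQ_indicator_UN)
      then show "L2_lim M ?F (indicator (\<Union>i. A i))"
        by (intro L2_lim_dominated(3)[OF _ _ L2_const[of 1]]) (auto simp: eq split: split_indicator)
    qed
  qed
qed

text \<open>The approximating simple functions are measurable for F, hence combinations of
  indicators in V. Their bound by twice the size of f provides the dominating function that turns
  pointwise convergence into convergence in L2.\<close>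

lemma (in finite_measure) closed_subspace_dense:
  assumes V: "closed_subspace M V" and F: "space F = space M" "sets F \<subseteq> sets M"
    and I: "\<And>A. A \<in> sets F \<Longrightarrow> indicator A \<in> V"
    and f: "f \<in> L2 M" "f \<in> borel_measurable F"
  shows "f \<in> V"
proof -
  from borel_measurable_implies_sequence_metric[OF f(2), of 0]
  obtain s where s: "\<And>i. simple_function F (s i)"
    and lim: "\<And>x. x \<in> space F \<Longrightarrow> (\<lambda>i. s i x) \<longlonglongrightarrow> f x"
    and bd: "\<And>i x. x \<in> space F \<Longrightarrow> dist (s i x) 0 \<le> 2 * dist (f x) 0" by blast
  have sm: "s i \<in> borel_measurable M" for i
  proof -
    have "s i \<in> borel_measurable F" using s by (rule borel_measurable_simple_function)
    then show ?thesis using F by (auto simp: measurable_def)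
  qed
  have fm: "f \<in> borel_measurable M" using f by (auto simp: L2_def)
  note L = L2_lim_dominated[OF sm fm L2_abs[OF L2_scale[OF f(1), of 2]]]
  have L1: "AE \<omega> in M. (\<lambda>n. s n \<omega>) \<longlonglongrightarrow> f \<omega>" using lim F by auto
  have L2': "AE \<omega> in M. \<bar>s n \<omega>\<bar> \<le> \<bar>2 * f \<omega>\<bar>" for n using bd F by (auto simp: dist_norm abs_mult)
  show ?thesis
  proof (rule closed_subspace_lim[OF V _ f(1) L(3)[OF L1 L2']])
    fix n
    have fin: "finite (s n ` space F)" using s by (simp add: simple_function_def)
    have A: "s n -` {y} \<inter> space F \<in> sets F" for y using simple_functionD(2)[OF s] .
    have "(\<lambda>\<omega>. \<Sum>y\<in>s n ` space F. y * indicator (s n -` {y} \<inter> space F) \<omega>) \<in> V"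
      by (intro closed_subspace_sum[OF V] closed_subspace_scale[OF V] I A)
    moreover have "AE \<omega> in M. (\<Sum>y\<in>s n ` space F. y * indicator (s n -` {y} \<inter> space F) \<omega>) = s n \<omega>"
    proof (rule AE_I2)
      fix \<omega> assume "\<omega> \<in> space M"
      then have w: "\<omega> \<in> space F" using F by simp
      have "(\<Sum>y\<in>s n ` space F. y * indicator (s n -` {y} \<inter> space F) \<omega>) = (\<Sum>y\<in>s n ` space F. if y = s n \<omega> then y else 0)"
        using w by (intro sum.cong) (auto split: split_indicator)
      also have "\<dots> = s n \<omega>" using w fin by (simp add: sum.delta)
      finally show "(\<Sum>y\<in>s n ` space F. y * indicator (s n -` {y} \<inter> space F) \<omega>) = s n \<omega>" .
    qed
    ultimately show "s n \<in> V" by (rule closed_subspace_AE[OF V _ L(2)[OF L1 L2']])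
  qed
qed

section \<open>Independence and integrals\<close>

lemma (in prob_space) indep_set_integral_mult:
  assumes ind: "indep_set x y"
    and F: "space F = space M" "sets F = x" and G: "space G = space M" "sets G = y"
    and f: "f \<in> borel_measurable F" "integrable M f" and g: "g \<in> borel_measurable G" "integrable M g"
  shows "integrable M (\<lambda>\<omega>. f \<omega> * g \<omega>)"
    and "(LINT \<omega>|M. f \<omega> * g \<omega>) = (LINT \<omega>|M. f \<omega>) * (LINT \<omega>|M. g \<omega> :: real)"
proof -
  have 1: "sigma_sets (space M) {f -` A \<inter> space M |A. A \<in> sets borel} \<subseteq> x"
    unfolding F(2)[symmetric] F(1)[symmetric]
    using f(1) by (intro sets.sigma_sets_subset) (auto simp: measurable_sets)
  have 2: "sigma_sets (space M) {g -` A \<inter> space M |A. A \<in> sets borel} \<subseteq> y"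
    unfolding G(2)[symmetric] G(1)[symmetric]
    using g(1) by (intro sets.sigma_sets_subset) (auto simp: measurable_sets)
  have "indep_set (sigma_sets (space M) {f -` A \<inter> space M |A. A \<in> sets borel})
      (sigma_sets (space M) {g -` A \<inter> space M |A. A \<in> sets borel})"
  proof (rule indep_setI)
    show "sigma_sets (space M) {f -` A \<inter> space M |A. A \<in> sets borel} \<subseteq> events"
      using 1 indep_setD_ev1[OF ind] by (rule order_trans)
    show "sigma_sets (space M) {g -` A \<inter> space M |A. A \<in> sets borel} \<subseteq> events"
      using 2 indep_setD_ev2[OF ind] by (rule order_trans)
  qed (use indep_setD[OF ind] 1 2 in blast)
  then have "indep_var borel f borel g"
    using f(2) g(2) by (simp only: indep_var_eq borel_measurable_integrable simp_thms)
  from indep_var_integrable[OF this f(2) g(2)] indep_var_lebesgue_integral[OF this f(2) g(2)]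
  show "integrable M (\<lambda>\<omega>. f \<omega> * g \<omega>)"
    and "(LINT \<omega>|M. f \<omega> * g \<omega>) = (LINT \<omega>|M. f \<omega>) * (LINT \<omega>|M. g \<omega>)" by auto
qed

section \<open>Conditional expectations on square integrable functions\<close>

text \<open>Conditional expectations are developed for arbitrary sub-sigma-fields, so that they also
  apply to the field generated by the first chaos.\<close>

definition subfields :: "'a measure \<Rightarrow> 'a set set set" where
  "subfields M = {x. sigma_algebra (space M) x \<and> x \<subseteq> sets M}"

lemma complete_subfields_subset: "complete_subfields M \<subseteq> subfields M"
  by (auto simp: complete_subfields_def subfields_def)

lemma sets_subfield: "x \<in> subfields M \<Longrightarrow> sets (sigma (space M) x) = x"
  using sets.space_closed[of M]
  by (auto simp: subfields_def sigma_algebra.sigma_sets_eq sets_measure_of_conv)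

lemma space_subfield: "space (sigma (space M) x) = space M"
  by (rule space_measure_of_conv)

lemma join_field_subfields: "x \<in> subfields M \<Longrightarrow> y \<in> subfields M \<Longrightarrow> join_field M x y \<in> subfields M"
  unfolding subfields_def join_field_def
  using sets.space_closed[of M] sets.sigma_sets_subset[of "x \<union> y" M]
  by (auto intro!: sigma_algebra_sigma_sets)

lemma join_field_upper: "x \<subseteq> join_field M x y" "y \<subseteq> join_field M x y"
  by (auto simp: join_field_def)

lemma join_field_least: "z \<in> subfields M \<Longrightarrow> x \<subseteq> z \<Longrightarrow> y \<subseteq> z \<Longrightarrow> join_field M x y \<subseteq> z"
  using sigma_algebra.sigma_sets_subset[of "space M" z "x \<union> y"] by (simp add: join_field_def subfields_def)

text \<open>The L2 functions measurable for x up to null sets, encoded as the fixed vectors of the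
  projection: no choice of a measurable representative enters.\<close>

definition L2_sub :: "'a measure \<Rightarrow> 'a set set \<Rightarrow> ('a \<Rightarrow> real) set" where
  "L2_sub M x = {f \<in> L2 M. AE \<omega> in M. f \<omega> = cexp M x f \<omega>}"

lemma L2_sub_L2: "f \<in> L2_sub M x \<Longrightarrow> f \<in> L2 M"
  by (simp add: L2_sub_def)

lemma L2_sub_AE: "f \<in> L2_sub M x \<Longrightarrow> AE \<omega> in M. f \<omega> = cexp M x f \<omega>"
  by (simp add: L2_sub_def)

lemma cexp_borel_measurable: "cexp M x f \<in> borel_measurable (sigma (space M) x)"
  by (simp add: cexp_def)

lemma cexp_borel_measurable2 [measurable]: "cexp M x f \<in> borel_measurable M"
  by (simp add: cexp_def)

lemma subfield_measurable:
  "x \<in> subfields M \<Longrightarrow> f \<in> borel_measurable (sigma (space M) x) \<Longrightarrow> f \<in> borel_measurable M"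
  unfolding measurable_def by (auto simp: sets_subfield space_subfield subfields_def)

lemma subfield_measurable_mono:
  "x \<in> subfields M \<Longrightarrow> y \<in> subfields M \<Longrightarrow> x \<subseteq> y \<Longrightarrow> f \<in> borel_measurable (sigma (space M) x) \<Longrightarrow>
   f \<in> borel_measurable (sigma (space M) y)"
  unfolding measurable_def by (auto simp: sets_subfield space_subfield)

context prob_space
begin

lemma sigma_finite_subfield:
  assumes "x \<in> subfields M" shows "sigma_finite_subalgebra M (sigma (space M) x)"
proof (rule finite_measure_subalgebra_is_sigma_finite)
  show "finite_measure_subalgebra M (sigma (space M) x)"
    using assms by unfold_locales (auto simp: subalgebra_def sets_subfield space_subfield subfields_def)
qed

lemma subalgebra_subfields:
  "x \<in> subfields M \<Longrightarrow> y \<in> subfields M \<Longrightarrow> x \<subseteq> y \<Longrightarrow> subalgebra (sigma (space M) y) (sigma (space M) x)"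
  by (auto simp: subalgebra_def sets_subfield space_subfield)

lemma cexp_L2:
  assumes x: "x \<in> subfields M" and f: "f \<in> L2 M"
  shows "cexp M x f \<in> L2 M"
proof -
  interpret F: sigma_finite_subalgebra M "sigma (space M) x" using x by (rule sigma_finite_subfield)
  have "integrable M (\<lambda>\<omega>. (real_cond_exp M (sigma (space M) x) f \<omega>)\<^sup>2)"
    by (rule F.integrable_convex_cond_exp[where I=UNIV, OF L2_integrable[OF f]])
      (use L2_integrable_square[OF f] convex_power2 in auto)
  then show ?thesis by (auto simp: cexp_def L2_def)
qed

lemma cexp_integral_mult:
  assumes x: "x \<in> subfields M" and "f \<in> borel_measurable M" and "g \<in> borel_measurable (sigma (space M) x)"
    and "integrable M (\<lambda>\<omega>. g \<omega> * f \<omega>)"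
  shows "(LINT \<omega>|M. g \<omega> * cexp M x f \<omega>) = (LINT \<omega>|M. g \<omega> * f \<omega>)"
proof -
  interpret F: sigma_finite_subalgebra M "sigma (space M) x" using x by (rule sigma_finite_subfield)
  show ?thesis unfolding cexp_def by (rule F.real_cond_exp_intg(2)[OF assms(4,3,2)])
qed

lemma cexp_cong:
  assumes x: "x \<in> subfields M" and "f \<in> L2 M" "g \<in> L2 M" "AE \<omega> in M. f \<omega> = g \<omega>"
  shows "AE \<omega> in M. cexp M x f \<omega> = cexp M x g \<omega>"
proof -
  interpret F: sigma_finite_subalgebra M "sigma (space M) x" using x by (rule sigma_finite_subfield)
  show ?thesis unfolding cexp_def by (rule F.real_cond_exp_cong) (use assms in \<open>auto simp: L2_def\<close>)
qed

lemma cexp_lin: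
  assumes x: "x \<in> subfields M" and f: "f \<in> L2 M" and g: "g \<in> L2 M"
  shows "AE \<omega> in M. cexp M x (\<lambda>\<omega>. a * f \<omega> + b * g \<omega>) \<omega> = a * cexp M x f \<omega> + b * cexp M x g \<omega>"
proof -
  interpret F: sigma_finite_subalgebra M "sigma (space M) x" using x by (rule sigma_finite_subfield)
  have "integrable M f" "integrable M g" using L2_integrable f g by auto
  then have "AE \<omega> in M. real_cond_exp M (sigma (space M) x) (\<lambda>\<omega>. a * f \<omega> + b * g \<omega>) \<omega> =
      real_cond_exp M (sigma (space M) x) (\<lambda>\<omega>. a * f \<omega>) \<omega> + real_cond_exp M (sigma (space M) x) (\<lambda>\<omega>. b * g \<omega>) \<omega>"
    "AE \<omega> in M. real_cond_exp M (sigma (space M) x) (\<lambda>\<omega>. a * f \<omega>) \<omega> = a * real_cond_exp M (sigma (space M) x) f \<omega>"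
    "AE \<omega> in M. real_cond_exp M (sigma (space M) x) (\<lambda>\<omega>. b * g \<omega>) \<omega> = b * real_cond_exp M (sigma (space M) x) g \<omega>"
    by (auto intro!: F.real_cond_exp_add F.real_cond_exp_cmult)
  then show ?thesis unfolding cexp_def by eventually_elim simp
qed

lemma cexp_mono:
  assumes x: "x \<in> subfields M" and f: "f \<in> L2 M" and g: "g \<in> L2 M" and "AE \<omega> in M. f \<omega> \<le> g \<omega>"
  shows "AE \<omega> in M. cexp M x f \<omega> \<le> cexp M x g \<omega>"
proof -
  interpret F: sigma_finite_subalgebra M "sigma (space M) x" using x by (rule sigma_finite_subfield)
  show ?thesis unfolding cexp_def
    by (rule F.real_cond_exp_mono) (use assms L2_integrable in auto)
qed

lemma cexp_nested:
  assumes x: "x \<in> subfields M" and y: "y \<in> subfields M" and xy: "x \<subseteq> y" and f: "f \<in> L2 M"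
  shows "AE \<omega> in M. cexp M x (cexp M y f) \<omega> = cexp M x f \<omega>"
proof -
  interpret F: sigma_finite_subalgebra M "sigma (space M) x" using x by (rule sigma_finite_subfield)
  show ?thesis unfolding cexp_def
    by (rule F.real_cond_exp_nested_subalg[OF _ subalgebra_subfields[OF x y xy] L2_integrable[OF f]])
      (use y in \<open>auto simp: subalgebra_def sets_subfield space_subfield subfields_def\<close>)
qed

lemma L2_subI:
  assumes x: "x \<in> subfields M" and f: "f \<in> L2 M" and g: "g \<in> borel_measurable (sigma (space M) x)"
    and ae: "AE \<omega> in M. f \<omega> = g \<omega>"
  shows "f \<in> L2_sub M x"
proof -
  interpret F: sigma_finite_subalgebra M "sigma (space M) x" using x by (rule sigma_finite_subfield)
  have gM: "g \<in> borel_measurable M" using subfield_measurable[OF x g] .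
  have g2: "g \<in> L2 M" by (rule L2_cong_AE[OF f gM]) (use ae in eventually_elim, simp)
  have "AE \<omega> in M. cexp M x g \<omega> = g \<omega>" unfolding cexp_def
    by (rule F.real_cond_exp_F_meas[OF L2_integrable[OF g2] g])
  with cexp_cong[OF x f g2 ae] ae have "AE \<omega> in M. f \<omega> = cexp M x f \<omega>" by eventually_elim simp
  then show ?thesis using f by (simp add: L2_sub_def)
qed

lemma cexp_L2_sub: "x \<in> subfields M \<Longrightarrow> f \<in> L2 M \<Longrightarrow> cexp M x f \<in> L2_sub M x"
  by (rule L2_subI[OF _ _ cexp_borel_measurable]) (auto intro: cexp_L2)

lemma L2_sub_mono:
  assumes x: "x \<in> subfields M" and y: "y \<in> subfields M" and xy: "x \<subseteq> y" and f: "f \<in> L2_sub M x"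
  shows "f \<in> L2_sub M y"
  using f by (intro L2_subI[OF y _ subfield_measurable_mono[OF x y xy cexp_borel_measurable]])
    (auto simp: L2_sub_def)

lemma cexp_nested':
  assumes x: "x \<in> subfields M" and y: "y \<in> subfields M" and xy: "x \<subseteq> y" and f: "f \<in> L2 M"
  shows "AE \<omega> in M. cexp M y (cexp M x f) \<omega> = cexp M x f \<omega>"
  using L2_sub_AE[OF L2_sub_mono[OF x y xy cexp_L2_sub[OF x f]]] by eventually_elim simp

lemma L2_sub_const: "x \<in> subfields M \<Longrightarrow> (\<lambda>\<omega>. c) \<in> L2_sub M x"
  by (rule L2_subI[of _ _ "\<lambda>_. c"]) (auto intro: L2_const)

lemma L2_sub_indicator: "x \<in> subfields M \<Longrightarrow> A \<in> x \<Longrightarrow> indicator A \<in> L2_sub M x"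
  by (rule L2_subI[of _ _ "indicator A"])
    (auto simp: sets_subfield intro!: L2_indicator borel_measurable_indicator, auto simp: subfields_def)

lemma ip_cexp:
  assumes x: "x \<in> subfields M" and f: "f \<in> L2 M" and g: "g \<in> L2_sub M x"
  shows "ip M (cexp M x f) g = ip M f g"
proof -
  have g2: "g \<in> L2 M" and gc: "cexp M x g \<in> L2 M" using L2_sub_L2[OF g] cexp_L2[OF x] by auto
  have "ip M (cexp M x f) g = ip M (cexp M x f) (cexp M x g)"
    by (rule ip_cong_AE) (use L2_sub_AE[OF g] cexp_L2[OF x f] g2 gc in auto)
  also have "\<dots> = ip M f (cexp M x g)"
    using cexp_integral_mult[OF x L2_measurable[OF f] cexp_borel_measurable L2_integrable_mult[OF gc f]]
    by (simp add: ip_def mult.commute)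
  also have "\<dots> = ip M f g"
    by (rule ip_cong_AE) (use L2_sub_AE[OF g] f g2 gc in auto)
  finally show ?thesis .
qed

lemma ip_cexp_cexp:
  "x \<in> subfields M \<Longrightarrow> f \<in> L2 M \<Longrightarrow> ip M (cexp M x f) f = ip M (cexp M x f) (cexp M x f)"
  by (metis ip_cexp cexp_L2_sub ip_commute)

lemma cexp_norm_le:
  assumes x: "x \<in> subfields M" and f: "f \<in> L2 M"
  shows "L2_norm M (cexp M x f) \<le> L2_norm M f"
proof (cases "L2_norm M (cexp M x f) = 0")
  case False
  have "(L2_norm M (cexp M x f))\<^sup>2 \<le> L2_norm M (cexp M x f) * L2_norm M f"
    using ip_cexp_cexp[OF x f] Cauchy_Schwarz_L2[OF cexp_L2[OF x f] f] by (simp add: L2_norm_square)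
  then show ?thesis using False L2_norm_nonneg[of M "cexp M x f"] by (simp add: power2_eq_square)
qed simp

lemma cexp_diff:
  "x \<in> subfields M \<Longrightarrow> f \<in> L2 M \<Longrightarrow> g \<in> L2 M \<Longrightarrow>
   AE \<omega> in M. cexp M x (\<lambda>\<omega>. f \<omega> - g \<omega>) \<omega> = cexp M x f \<omega> - cexp M x g \<omega>"
  using cexp_lin[of x f g 1 "-1"] by simp

lemma cexp_add:
  "x \<in> subfields M \<Longrightarrow> f \<in> L2 M \<Longrightarrow> g \<in> L2 M \<Longrightarrow>
   AE \<omega> in M. cexp M x (\<lambda>\<omega>. f \<omega> + g \<omega>) \<omega> = cexp M x f \<omega> + cexp M x g \<omega>"
  using cexp_lin[of x f g 1 "1"] by simp

lemma cexp_norm_diff: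
  assumes x: "x \<in> subfields M" and f: "f \<in> L2 M" and g: "g \<in> L2 M"
  shows "L2_norm M (\<lambda>\<omega>. cexp M x f \<omega> - cexp M x g \<omega>) \<le> L2_norm M (\<lambda>\<omega>. f \<omega> - g \<omega>)"
proof -
  have "L2_norm M (\<lambda>\<omega>. cexp M x f \<omega> - cexp M x g \<omega>) = L2_norm M (cexp M x (\<lambda>\<omega>. f \<omega> - g \<omega>))"
  proof (rule L2_norm_cong_AE)
    show "AE \<omega> in M. cexp M x f \<omega> - cexp M x g \<omega> = cexp M x (\<lambda>\<omega>. f \<omega> - g \<omega>) \<omega>"
      using cexp_diff[OF x f g] by eventually_elim simp
  qed (intro L2_diff cexp_L2 x f g)+
  also have "\<dots> \<le> L2_norm M (\<lambda>\<omega>. f \<omega> - g \<omega>)" by (rule cexp_norm_le[OF x L2_diff[OF f g]])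
  finally show ?thesis .
qed

lemma L2_lim_cexp:
  assumes x: "x \<in> subfields M" and F: "\<And>n. F n \<in> L2 M" and f: "f \<in> L2 M" and l: "L2_lim M F f"
  shows "L2_lim M (\<lambda>n. cexp M x (F n)) (cexp M x f)"
  unfolding L2_lim_def
  by (rule Lim_null_comparison[OF _ l[unfolded L2_lim_def]])
    (use cexp_norm_diff[OF x F f] in \<open>auto intro: always_eventually\<close>)

lemma expectation_cexp:
  assumes x: "x \<in> subfields M" and f: "f \<in> L2 M"
  shows "expectation (cexp M x f) = expectation f"
  using ip_cexp[OF x f L2_sub_const[OF x, of 1]] by (simp add: ip_def)

text \<open>The fixed vectors of a linear contraction are closed: if g is fixed, the distance from f
  to its conditional expectation is at most twice the distance from f to g.\<close>

lemma closed_subspace_L2_sub: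
  assumes x: "x \<in> subfields M" shows "closed_subspace M (L2_sub M x)"
  unfolding closed_subspace_def
proof (intro conjI ballI allI impI)
  show "L2_sub M x \<subseteq> L2 M" by (auto simp: L2_sub_def)
  show "L2_sub M x \<noteq> {}" using L2_sub_const[OF x, of 0] by auto
next
  fix f g a b assume f: "f \<in> L2_sub M x" and g: "g \<in> L2_sub M x"
  have f2: "f \<in> L2 M" and g2: "g \<in> L2 M" using f g by (auto simp: L2_sub_def)
  have "AE \<omega> in M. a * f \<omega> + b * g \<omega> = cexp M x (\<lambda>\<omega>. a * f \<omega> + b * g \<omega>) \<omega>"
    using L2_sub_AE[OF f] L2_sub_AE[OF g] cexp_lin[OF x f2 g2, of a b] by eventually_elim simp
  then show "(\<lambda>\<omega>. a * f \<omega> + b * g \<omega>) \<in> L2_sub M x" using L2_lin[OF f2 g2] by (simp add: L2_sub_def)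
next
  fix f assume f: "f \<in> L2 M" and a: "\<forall>\<epsilon>>0. \<exists>g\<in>L2_sub M x. L2_norm M (\<lambda>\<omega>. f \<omega> - g \<omega>) < \<epsilon>"
  have c: "cexp M x f \<in> L2 M" by (rule cexp_L2[OF x f])
  have "L2_norm M (\<lambda>\<omega>. f \<omega> - cexp M x f \<omega>) \<le> \<epsilon>" if \<epsilon>: "0 < \<epsilon>" for \<epsilon>
  proof -
    obtain g where g: "g \<in> L2_sub M x" and d: "L2_norm M (\<lambda>\<omega>. f \<omega> - g \<omega>) < \<epsilon> / 2"
      using a \<epsilon> by (meson half_gt_zero)
    have g2: "g \<in> L2 M" using g by (simp add: L2_sub_def)
    have "L2_norm M (\<lambda>\<omega>. g \<omega> - cexp M x f \<omega>) = L2_norm M (\<lambda>\<omega>. cexp M x g \<omega> - cexp M x f \<omega>)"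
    proof (rule L2_norm_cong_AE)
      show "AE \<omega> in M. g \<omega> - cexp M x f \<omega> = cexp M x g \<omega> - cexp M x f \<omega>"
        using L2_sub_AE[OF g] by eventually_elim simp
    qed (intro L2_diff cexp_L2 x f g2)+
    also have "\<dots> \<le> L2_norm M (\<lambda>\<omega>. f \<omega> - g \<omega>)"
      using cexp_norm_diff[OF x g2 f] L2_norm_minus_commute[of M f g] by simp
    finally show ?thesis using L2_norm_triangle_diff[OF f g2 c] d by simp
  qed
  then have "L2_norm M (\<lambda>\<omega>. f \<omega> - cexp M x f \<omega>) \<le> 0" by (rule field_le_epsilon[where y=0, simplified])
  then have "L2_norm M (\<lambda>\<omega>. f \<omega> - cexp M x f \<omega>) = 0" by (simp add: antisym)
  from L2_norm_eq_0[OF L2_diff[OF f c] this] show "f \<in> L2_sub M x" using f by (simp add: L2_sub_def)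
qed

lemma cexp_pull_out:
  assumes x: "x \<in> subfields M" and g: "g \<in> L2_sub M x" and f: "f \<in> L2 M" and fg: "(\<lambda>\<omega>. g \<omega> * f \<omega>) \<in> L2 M"
  shows "AE \<omega> in M. cexp M x (\<lambda>\<omega>. g \<omega> * f \<omega>) \<omega> = g \<omega> * cexp M x f \<omega>"
proof -
  interpret F: sigma_finite_subalgebra M "sigma (space M) x" using x by (rule sigma_finite_subfield)
  \<comment> \<open>The pull-out rule asks for exact measurability, which g has only up to null
    sets; its conditional expectation is a measurable version.\<close>
  have ae: "AE \<omega> in M. cexp M x g \<omega> * f \<omega> = g \<omega> * f \<omega>" using L2_sub_AE[OF g] by eventually_elim simp
  have fg': "(\<lambda>\<omega>. cexp M x g \<omega> * f \<omega>) \<in> L2 M"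
    by (rule L2_cong_AE[OF fg _ ae]) (use f in measurable)
  have "AE \<omega> in M. cexp M x (\<lambda>\<omega>. cexp M x g \<omega> * f \<omega>) \<omega> = cexp M x g \<omega> * cexp M x f \<omega>"
    unfolding cexp_def[of M x f] cexp_def[of M x "\<lambda>\<omega>. cexp M x g \<omega> * f \<omega>"]
    by (rule F.real_cond_exp_mult[OF cexp_borel_measurable L2_measurable[OF f] L2_integrable[OF fg']])
  with cexp_cong[OF x fg' fg ae] L2_sub_AE[OF g] show ?thesis by eventually_elim simp
qed

text \<open>A product of two L2 functions is in general only integrable. Independence makes the
  product of the squares integrable, so products of independent factors stay in L2.\<close>

lemma indep_product:
  assumes x: "x \<in> subfields M" and y: "y \<in> subfields M" and ind: "indep_set x y"
    and f: "f \<in> L2_sub M x" and g: "g \<in> L2_sub M y"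
  shows "(\<lambda>\<omega>. f \<omega> * g \<omega>) \<in> L2 M" and "expectation (\<lambda>\<omega>. f \<omega> * g \<omega>) = expectation f * expectation g"
proof -
  let ?f = "cexp M x f" and ?g = "cexp M y g"
  have f2: "f \<in> L2 M" "?f \<in> L2 M" and g2: "g \<in> L2 M" "?g \<in> L2 M"
    using cexp_L2[OF x] cexp_L2[OF y] L2_sub_L2[OF f] L2_sub_L2[OF g] by auto
  note I = indep_set_integral_mult[OF ind space_subfield sets_subfield[OF x] space_subfield sets_subfield[OF y]]
  have "integrable M (\<lambda>\<omega>. (?f \<omega>)\<^sup>2 * (?g \<omega>)\<^sup>2)"
    by (rule I(1)) (use L2_integrable_square f2 g2 in
        \<open>auto intro!: borel_measurable_power cexp_borel_measurable\<close>)
  then have fg: "(\<lambda>\<omega>. ?f \<omega> * ?g \<omega>) \<in> L2 M"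
    by (intro L2I) (auto simp: power_mult_distrib)
  have ae: "AE \<omega> in M. f \<omega> * g \<omega> = ?f \<omega> * ?g \<omega>"
    using L2_sub_AE[OF f] L2_sub_AE[OF g] by eventually_elim simp
  show fg': "(\<lambda>\<omega>. f \<omega> * g \<omega>) \<in> L2 M" by (rule L2_cong_AE[OF fg _ ae]) (use f2 g2 in measurable)
  have "expectation (\<lambda>\<omega>. f \<omega> * g \<omega>) = expectation (\<lambda>\<omega>. ?f \<omega> * ?g \<omega>)"
    by (rule integral_cong_AE[OF L2_measurable[OF fg'] L2_measurable[OF fg] ae])
  also have "\<dots> = expectation ?f * expectation ?g"
    by (rule I(2)) (use L2_integrable f2 g2 in \<open>auto intro!: cexp_borel_measurable\<close>)
  finally show "expectation (\<lambda>\<omega>. f \<omega> * g \<omega>) = expectation f * expectation g"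
    using expectation_cexp[OF x f2(1)] expectation_cexp[OF y g2(1)] by simp
qed

lemma indep_product_sub:
  assumes x: "x \<in> subfields M" and y: "y \<in> subfields M" and z: "z \<in> subfields M" "x \<subseteq> z" "y \<subseteq> z"
    and ind: "indep_set x y" and f: "f \<in> L2_sub M x" and g: "g \<in> L2_sub M y"
  shows "(\<lambda>\<omega>. f \<omega> * g \<omega>) \<in> L2_sub M z"
proof (rule L2_subI[OF z(1) indep_product(1)[OF x y ind f g]])
  show "(\<lambda>\<omega>. cexp M x f \<omega> * cexp M y g \<omega>) \<in> borel_measurable (sigma (space M) z)"
    by (intro borel_measurable_times subfield_measurable_mono[OF x z(1,2)]
        subfield_measurable_mono[OF y z(1,3)] cexp_borel_measurable)
  show "AE \<omega> in M. f \<omega> * g \<omega> = cexp M x f \<omega> * cexp M y g \<omega>"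
    using L2_sub_AE[OF f] L2_sub_AE[OF g] by eventually_elim simp
qed

text \<open>Multiplication embeds the Hilbert tensor product of L2(x) and L2(y) isometrically into
  L2: the integrand regroups into a factor for x and a factor for y.\<close>

lemma ip_indep_product:
  assumes x: "x \<in> subfields M" and y: "y \<in> subfields M" and ind: "indep_set x y"
    and f: "f \<in> L2_sub M x" "f' \<in> L2_sub M x" and g: "g \<in> L2_sub M y" "g' \<in> L2_sub M y"
  shows "ip M (\<lambda>\<omega>. f \<omega> * g \<omega>) (\<lambda>\<omega>. f' \<omega> * g' \<omega>) = ip M f f' * ip M g g'"
proof -
  let ?f = "cexp M x f" and ?g = "cexp M y g" and ?f' = "cexp M x f'" and ?g' = "cexp M y g'"
  note f2 = L2_sub_L2[OF f(1)] L2_sub_L2[OF f(2)] and g2 = L2_sub_L2[OF g(1)] L2_sub_L2[OF g(2)]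
  have c: "?f \<in> L2 M" "?f' \<in> L2 M" "?g \<in> L2 M" "?g' \<in> L2 M"
    using cexp_L2[OF x] cexp_L2[OF y] f2 g2 by auto
  note I = indep_set_integral_mult[OF ind space_subfield sets_subfield[OF x] space_subfield sets_subfield[OF y]]
  have "ip M (\<lambda>\<omega>. f \<omega> * g \<omega>) (\<lambda>\<omega>. f' \<omega> * g' \<omega>) = (LINT \<omega>|M. (?f \<omega> * ?f' \<omega>) * (?g \<omega> * ?g' \<omega>))"
    unfolding ip_def
  proof (rule integral_cong_AE)
    show "AE \<omega> in M. f \<omega> * g \<omega> * (f' \<omega> * g' \<omega>) = ?f \<omega> * ?f' \<omega> * (?g \<omega> * ?g' \<omega>)"
      using L2_sub_AE[OF f(1)] L2_sub_AE[OF g(1)] L2_sub_AE[OF f(2)] L2_sub_AE[OF g(2)]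
      by eventually_elim simp
  qed (use f2 g2 in measurable)
  also have "\<dots> = (LINT \<omega>|M. ?f \<omega> * ?f' \<omega>) * (LINT \<omega>|M. ?g \<omega> * ?g' \<omega>)"
    by (rule I(2)) (use L2_integrable_mult c in \<open>auto intro!: borel_measurable_times cexp_borel_measurable\<close>)
  also have "\<dots> = ip M f f' * ip M g g'"
    using ip_cong_AE[OF f2 c(1,2) L2_sub_AE[OF f(1)] L2_sub_AE[OF f(2)]]
      ip_cong_AE[OF g2 c(3,4) L2_sub_AE[OF g(1)] L2_sub_AE[OF g(2)]]
    by (simp add: ip_def)
  finally show ?thesis .
qed

lemma L2_norm_indep_product:
  assumes "x \<in> subfields M" "y \<in> subfields M" "indep_set x y" "f \<in> L2_sub M x" "g \<in> L2_sub M y"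
  shows "L2_norm M (\<lambda>\<omega>. f \<omega> * g \<omega>) = L2_norm M f * L2_norm M g"
  using ip_indep_product[OF assms(1-4,4,5,5)] by (simp add: L2_norm_ip real_sqrt_mult)

text \<open>Joint continuity of multiplication, by multiplicativity of the norm on independent
  factors. Without independence, products of L2 limits converge only in L1.\<close>

lemma L2_lim_indep_product:
  assumes x: "x \<in> subfields M" and y: "y \<in> subfields M" and ind: "indep_set x y"
    and F: "\<And>n. F n \<in> L2_sub M x" "f \<in> L2_sub M x" and G: "\<And>n. G n \<in> L2_sub M y" "g \<in> L2_sub M y"
    and lF: "L2_lim M F f" and lG: "L2_lim M G g"
  shows "L2_lim M (\<lambda>n \<omega>. F n \<omega> * G n \<omega>) (\<lambda>\<omega>. f \<omega> * g \<omega>)"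
proof -
  note S = closed_subspace_diff[OF closed_subspace_L2_sub]
  let ?d = "\<lambda>n. L2_norm M (\<lambda>\<omega>. F n \<omega> - f \<omega>) * L2_norm M (G n) + L2_norm M f * L2_norm M (\<lambda>\<omega>. G n \<omega> - g \<omega>)"
  have bd: "L2_norm M (\<lambda>\<omega>. F n \<omega> * G n \<omega> - f \<omega> * g \<omega>) \<le> ?d n" for n
  proof -
    have "L2_norm M (\<lambda>\<omega>. F n \<omega> * G n \<omega> - f \<omega> * g \<omega>) =
       L2_norm M (\<lambda>\<omega>. (F n \<omega> - f \<omega>) * G n \<omega> + f \<omega> * (G n \<omega> - g \<omega>))"
      by (rule arg_cong[where f="L2_norm M"]) (simp add: fun_eq_iff algebra_simps)
    also have "\<dots> \<le> L2_norm M (\<lambda>\<omega>. (F n \<omega> - f \<omega>) * G n \<omega>) + L2_norm M (\<lambda>\<omega>. f \<omega> * (G n \<omega> - g \<omega>))"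
      by (intro L2_norm_triangle indep_product(1)[OF x y ind] S[OF x] S[OF y] F G)
    also have "\<dots> = ?d n"
      by (simp only: L2_norm_indep_product[OF x y ind S[OF x F] G(1)]
          L2_norm_indep_product[OF x y ind F(2) S[OF y G]])
    finally show ?thesis .
  qed
  have "?d \<longlonglongrightarrow> 0 * L2_norm M g + L2_norm M f * 0"
    using L2_lim_norm[OF L2_sub_L2[OF G(1)] L2_sub_L2[OF G(2)] lG] lF lG
    unfolding L2_lim_def by (intro tendsto_intros)
  then have l: "?d \<longlonglongrightarrow> 0" by simp
  show ?thesis unfolding L2_lim_def
  proof (rule Lim_null_comparison[OF always_eventually l], rule allI)
    show "norm (L2_norm M (\<lambda>\<omega>. F n \<omega> * G n \<omega> - f \<omega> * g \<omega>)) \<le> ?d n" for n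
      using bd[of n] by simp
  qed
qed

text \<open>Products of indicators are total in L2 of the join, because the intersections of an
  event of x with an event of y form a generating family stable under intersections. Statements on a
  cell are thereby reduced to products over its two halves.\<close>

lemma indep_product_dense:
  assumes x: "x \<in> subfields M" and y: "y \<in> subfields M" and ind: "indep_set x y" and V: "closed_subspace M V"
    and P: "\<And>A C. A \<in> x \<Longrightarrow> C \<in> y \<Longrightarrow> (\<lambda>\<omega>. indicator A \<omega> * indicator C \<omega>) \<in> V"
    and f: "f \<in> L2_sub M (join_field M x y)"
  shows "f \<in> V"
proof -
  let ?z = "join_field M x y"
  interpret x: sigma_algebra "space M" x using x by (simp add: subfields_def)
  interpret y: sigma_algebra "space M" y using y by (simp add: subfields_def)
  have z: "?z \<in> subfields M" by (rule join_field_subfields[OF x y])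
  let ?G = "{A \<inter> C |A C. A \<in> x \<and> C \<in> y}"
  have GM: "?G \<subseteq> sets M" using x y by (auto simp: subfields_def)
  have GI: "Int_stable ?G"
  proof (rule Int_stableI)
    fix a b assume "a \<in> ?G" "b \<in> ?G"
    then obtain A C A' C' where "a = A \<inter> C" "b = A' \<inter> C'" "A \<in> x" "A' \<in> x" "C \<in> y" "C' \<in> y" by auto
    then have "a \<inter> b = (A \<inter> A') \<inter> (C \<inter> C')" "A \<inter> A' \<in> x" "C \<inter> C' \<in> y" by auto
    then show "a \<inter> b \<in> ?G" by blast
  qed
  have "x \<subseteq> ?G"
  proof
    fix A assume "A \<in> x"
    moreover from this have "A = A \<inter> space M" using x.sets_into_space by auto
    ultimately show "A \<in> ?G" using y.top by blast
  qed
  moreover have "y \<subseteq> ?G"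
  proof
    fix C assume "C \<in> y"
    moreover from this have "C = space M \<inter> C" using y.sets_into_space by auto
    ultimately show "C \<in> ?G" using x.top by blast
  qed
  ultimately have "x \<union> y \<subseteq> ?G" by simp
  then have zG: "?z \<subseteq> sigma_sets (space M) ?G"
    unfolding join_field_def by (intro sigma_sets_mono') auto
  have I: "indicator A \<in> V" if "A \<in> ?G" for A
    using that P by (auto simp: indicator_inter_arith[abs_def])
  have "(\<lambda>\<omega>. indicator (space M) \<omega> * indicator (space M) \<omega>) \<in> V" by (rule P) auto
  then have V1: "(\<lambda>\<omega>. 1) \<in> V" by (rule closed_subspace_AE[OF V _ L2_const]) auto
  have "cexp M ?z f \<in> V"
  proof (rule closed_subspace_dense[OF V])
    show "space (sigma (space M) ?z) = space M" by (rule space_subfield)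
    show "sets (sigma (space M) ?z) \<subseteq> sets M" using z by (simp add: sets_subfield) (simp add: subfields_def)
    show "indicator A \<in> V" if "A \<in> sets (sigma (space M) ?z)" for A
      using that zG closed_subspace_indicators[OF V GM GI I V1] by (auto simp: sets_subfield[OF z])
  qed (use cexp_L2[OF z L2_sub_L2[OF f]] cexp_borel_measurable in auto)
  then show ?thesis
    by (rule closed_subspace_AE[OF V _ L2_sub_L2[OF f]]) (use L2_sub_AE[OF f] in eventually_elim, simp)
qed

end

section \<open>Noise Boolean algebras\<close>

lemma closed_subspace_orthogonal:
  assumes h: "h \<in> L2 M" shows "closed_subspace M {k \<in> L2 M. ip M h k = 0}"
  unfolding closed_subspace_def
proof (intro conjI ballI allI impI)
  show "{k \<in> L2 M. ip M h k = 0} \<noteq> {}" using L2_zero[of M] by (auto simp: ip_def intro!: exI[of _ "\<lambda>_. 0"])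
next
  fix f g a b assume "f \<in> {k \<in> L2 M. ip M h k = 0}" "g \<in> {k \<in> L2 M. ip M h k = 0}"
  then show "(\<lambda>\<omega>. a * f \<omega> + b * g \<omega>) \<in> {k \<in> L2 M. ip M h k = 0}"
    using h by (simp add: L2_lin ip_lin_right)
next
  fix f assume f: "f \<in> L2 M"
    and a: "\<forall>\<epsilon>>0. \<exists>g\<in>{k \<in> L2 M. ip M h k = 0}. L2_norm M (\<lambda>\<omega>. f \<omega> - g \<omega>) < \<epsilon>"
  have "\<bar>ip M h f\<bar> \<le> 0 + \<epsilon>" if "0 < \<epsilon>" for \<epsilon>
  proof -
    \<comment> \<open>Adding 1 keeps the quotient defined when h vanishes.\<close>
    have p: "0 < \<epsilon> / (L2_norm M h + 1)" using that by (simp add: add_nonneg_pos)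
    with a obtain g where g: "g \<in> L2 M" "ip M h g = 0" "L2_norm M (\<lambda>\<omega>. f \<omega> - g \<omega>) < \<epsilon> / (L2_norm M h + 1)"
      by blast
    have "\<bar>ip M h f\<bar> = \<bar>ip M h (\<lambda>\<omega>. f \<omega> - g \<omega>)\<bar>" using g f h by (simp add: ip_diff_right)
    also have "\<dots> \<le> L2_norm M h * L2_norm M (\<lambda>\<omega>. f \<omega> - g \<omega>)" by (rule Cauchy_Schwarz_L2[OF h L2_diff[OF f g(1)]])
    also have "\<dots> \<le> (L2_norm M h + 1) * (\<epsilon> / (L2_norm M h + 1))"
      using g(3) by (intro mult_mono) (auto simp: add_nonneg_nonneg)
    also have "\<dots> = \<epsilon>" by (simp add: add_nonneg_eq_0_iff)
    finally show ?thesis by simp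
  qed
  then have "\<bar>ip M h f\<bar> \<le> 0" by (rule field_le_epsilon)
  then show "f \<in> {k \<in> L2 M. ip M h k = 0}" using f by simp
qed auto

text \<open>The difference of g and its projection to v is measurable for x and orthogonal to L2(v).
  Independence of x and z makes it orthogonal to all products of indicators from v and z, hence to
  L2 of their join.\<close>

lemma (in prob_space) cexp_join_indep:
  assumes v: "v \<in> subfields M" and x: "x \<in> subfields M" and z: "z \<in> subfields M" and vx: "v \<subseteq> x"
    and ind: "indep_set x z" and g: "g \<in> L2_sub M x"
  shows "AE \<omega> in M. cexp M (join_field M v z) g \<omega> = cexp M v g \<omega>"
proof -
  let ?j = "join_field M v z"
  have j: "?j \<in> subfields M" by (rule join_field_subfields[OF v z])
  have g2: "g \<in> L2 M" using g by (rule L2_sub_L2)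
  have vg: "cexp M v g \<in> L2_sub M v" by (rule cexp_L2_sub[OF v g2])
  have vg2: "cexp M v g \<in> L2 M" using vg by (rule L2_sub_L2)
  define h where "h = (\<lambda>\<omega>. g \<omega> - cexp M v g \<omega>)"
  have hx: "h \<in> L2_sub M x" unfolding h_def
    by (rule closed_subspace_diff[OF closed_subspace_L2_sub[OF x] g L2_sub_mono[OF v x vx vg]])
  then have h2: "h \<in> L2 M" by (rule L2_sub_L2)
  have hv: "ip M h k = 0" if "k \<in> L2_sub M v" for k
    using ip_cexp[OF v g2 that] L2_sub_L2[OF that] g2 vg2 by (simp add: h_def ip_diff_left)
  have "ip M (\<lambda>\<omega>. h \<omega> * 1) (\<lambda>\<omega>. indicator A \<omega> * indicator C \<omega>) = 0" if "A \<in> v" "C \<in> z" for A C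
    using ip_indep_product[OF x z ind hx L2_sub_mono[OF v x vx L2_sub_indicator[OF v that(1)]]
        L2_sub_const[OF z, of 1] L2_sub_indicator[OF z that(2)]]
      hv[OF L2_sub_indicator[OF v that(1)]] by simp
  moreover have "(\<lambda>\<omega>. indicator A \<omega> * indicator C \<omega>) \<in> L2 M" if "A \<in> v" "C \<in> z" for A C
    using indep_product(1)[OF x z ind L2_sub_mono[OF v x vx L2_sub_indicator[OF v that(1)]]
        L2_sub_indicator[OF z that(2)]] .
  ultimately have P: "(\<lambda>\<omega>. indicator A \<omega> * indicator C \<omega>) \<in> {k \<in> L2 M. ip M h k = 0}" if "A \<in> v" "C \<in> z" for A C
    using that by simp
  have ind': "indep_set v z"
    using ind vx by (auto simp: indep_sets2_eq)
  have jh: "cexp M ?j h \<in> L2 M" by (rule cexp_L2[OF j h2])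
  have "cexp M ?j h \<in> {k \<in> L2 M. ip M h k = 0}"
    by (rule indep_product_dense[OF v z ind' closed_subspace_orthogonal[OF h2] P cexp_L2_sub[OF j h2]])
  then have "L2_norm M (cexp M ?j h) = 0"
    using ip_cexp_cexp[OF j h2] by (simp add: L2_norm_ip ip_commute)
  from L2_norm_eq_0[OF jh this] cexp_diff[OF j g2 vg2]
    cexp_nested'[OF v j join_field_upper(1) g2]
  show ?thesis unfolding h_def by eventually_elim simp
qed

section \<open>The lattice and its commuting conditional expectations\<close>

locale noise = prob_space M for M :: "'a measure" +
  fixes B :: "'a set set set"
  assumes nba: "noise_boolean_algebra M B"
begin

abbreviation Bot :: "'a set set" where "Bot \<equiv> trivial_field M"
abbreviation J :: "'a set set \<Rightarrow> 'a set set \<Rightarrow> 'a set set" where "J \<equiv> join_field M"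
abbreviation cp :: "'a set set \<Rightarrow> 'a set set" where "cp \<equiv> noise_complement M B"

lemma B_complete: "x \<in> B \<Longrightarrow> x \<in> complete_subfields M"
  using nba by (auto simp: noise_boolean_algebra_def)

lemma B_sub [simp]: "x \<in> B \<Longrightarrow> x \<in> subfields M"
  using B_complete complete_subfields_subset by blast

lemma Bot_le: "x \<in> B \<Longrightarrow> Bot \<subseteq> x"
  using B_complete by (auto simp: complete_subfields_def)

lemma B_le_top: "x \<in> B \<Longrightarrow> x \<subseteq> sets M"
  using B_complete by (auto simp: complete_subfields_def)

lemma meet_B [simp]: "x \<in> B \<Longrightarrow> y \<in> B \<Longrightarrow> x \<inter> y \<in> B"
  using nba by (auto simp: noise_boolean_algebra_def)

lemma join_B [simp]: "x \<in> B \<Longrightarrow> y \<in> B \<Longrightarrow> J x y \<in> B"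
  using nba by (auto simp: noise_boolean_algebra_def)

lemma B_distrib: "x \<in> B \<Longrightarrow> y \<in> B \<Longrightarrow> z \<in> B \<Longrightarrow> x \<inter> J y z = J (x \<inter> y) (x \<inter> z)"
  using nba by (simp add: noise_boolean_algebra_def)

lemma J_commute: "J x y = J y x"
  by (simp add: join_field_def Un_commute)

lemma J_least: "z \<in> B \<Longrightarrow> x \<subseteq> z \<Longrightarrow> y \<subseteq> z \<Longrightarrow> J x y \<subseteq> z"
  by (rule join_field_least) auto

lemma J_absorb: "x \<in> B \<Longrightarrow> y \<subseteq> x \<Longrightarrow> J x y = x"
  using J_least[of x x y] join_field_upper(1)[of x M y] by auto

lemma indep_meet_Bot:
  assumes "indep_set x y" shows "x \<inter> y \<subseteq> Bot"
proof
  fix A assume A: "A \<in> x \<inter> y"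
  then have "prob (A \<inter> A) = prob A * prob A" using indep_setD[OF assms] by blast
  then have "prob A * (prob A - 1) = 0" by (simp add: algebra_simps)
  then show "A \<in> Bot" using A indep_setD_ev1[OF assms] by (auto simp: trivial_field_def)
qed

text \<open>The usual argument in a distributive lattice, with independence providing disjointness.
  One inclusion is enough, by symmetry in y and z.\<close>

lemma is_noise_complement_unique:
  assumes x: "x \<in> B" and "is_noise_complement M B x y" "is_noise_complement M B x z"
  shows "y \<subseteq> z"
proof -
  have y: "y \<in> B" "indep_set x y" and z: "z \<in> B" "J x z = sets M"
    using assms by (auto simp: is_noise_complement_def)
  have "y = y \<inter> J x z" using y z B_le_top by auto
  also have "\<dots> = J (y \<inter> x) (y \<inter> z)" by (rule B_distrib[OF y(1) x z(1)])
  also have "\<dots> \<subseteq> z" using indep_meet_Bot[OF y(2)] Bot_le[OF z(1)] by (intro J_least[OF z(1)]) auto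
  finally show ?thesis .
qed

lemma cp_is_complement: assumes x: "x \<in> B" shows "is_noise_complement M B x (cp x)"
proof -
  have "\<forall>x\<in>B. \<exists>y. is_noise_complement M B x y" using nba by (simp add: noise_boolean_algebra_def)
  then obtain y where y: "is_noise_complement M B x y" using x by blast
  show ?thesis unfolding noise_complement_def
  proof (rule theI[of "is_noise_complement M B x", OF y])
    fix z assume "is_noise_complement M B x z"
    then show "z = y" using is_noise_complement_unique[OF x] y by (intro subset_antisym) auto
  qed
qed

lemma cp_B [simp]: "x \<in> B \<Longrightarrow> cp x \<in> B"
  using cp_is_complement by (simp add: is_noise_complement_def)

lemma cp_indep: "x \<in> B \<Longrightarrow> indep_set x (cp x)"
  using cp_is_complement by (simp add: is_noise_complement_def)

lemma J_cp: "x \<in> B \<Longrightarrow> J x (cp x) = sets M"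
  using cp_is_complement by (simp add: is_noise_complement_def)

lemma meet_cp: "x \<in> B \<Longrightarrow> x \<inter> cp x = Bot"
  using indep_meet_Bot[OF cp_indep, of x] Bot_le[of x] Bot_le[of "cp x"] by auto

lemma Bot_B [simp]: "Bot \<in> B"
proof -
  obtain x where "x \<in> B" using nba by (auto simp: noise_boolean_algebra_def)
  then show ?thesis using meet_cp[of x] meet_B[of x "cp x"] by simp
qed

lemma top_B [simp]: "sets M \<in> B"
  using J_cp[OF Bot_B] join_B[OF Bot_B cp_B[OF Bot_B]] by simp

text \<open>The step on which every later induction over partitions rests: z cuts the cell a into
  two cells that generate it.\<close>

lemma split_B: assumes "a \<in> B" "z \<in> B" shows "J (a \<inter> z) (a \<inter> cp z) = a"
proof -
  have "J (a \<inter> z) (a \<inter> cp z) = a \<inter> J z (cp z)" using assms by (simp add: B_distrib)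
  then show ?thesis using J_cp[OF assms(2)] B_le_top[OF assms(1)] by auto
qed

lemma disjoint_le_cp: "x \<in> B \<Longrightarrow> y \<in> B \<Longrightarrow> y \<inter> x \<subseteq> Bot \<Longrightarrow> y \<subseteq> cp x"
  using split_B[of y x] J_least[of "cp x" "y \<inter> x" "y \<inter> cp x"] Bot_le[of "cp x"] by auto

lemma cp_antimono: "x \<in> B \<Longrightarrow> y \<in> B \<Longrightarrow> x \<subseteq> y \<Longrightarrow> cp y \<subseteq> cp x"
  using meet_cp[of y] by (intro disjoint_le_cp) auto

lemma cp_cp [simp]: assumes x: "x \<in> B" shows "cp (cp x) = x"
proof
  show "x \<subseteq> cp (cp x)" using x meet_cp[OF x] by (intro disjoint_le_cp) auto
  have "cp (cp x) = J (cp (cp x) \<inter> x) (cp (cp x) \<inter> cp x)" using x by (simp add: split_B)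
  also have "\<dots> \<subseteq> x" using x meet_cp[of "cp x"] Bot_le[OF x] by (intro J_least[OF x]) auto
  finally show "cp (cp x) \<subseteq> x" .
qed

lemma cp_meet: assumes x: "x \<in> B" and y: "y \<in> B" shows "cp (x \<inter> y) = J (cp x) (cp y)"
proof
  show "J (cp x) (cp y) \<subseteq> cp (x \<inter> y)"
    using x y by (intro J_least cp_antimono) auto
  have "cp (J (cp x) (cp y)) \<subseteq> cp (cp x)" "cp (J (cp x) (cp y)) \<subseteq> cp (cp y)"
    using x y join_field_upper[where M=M and x="cp x" and y="cp y"] by (intro cp_antimono; simp)+
  then have "cp (J (cp x) (cp y)) \<subseteq> x \<inter> y" using x y by simp
  then have "cp (x \<inter> y) \<subseteq> cp (cp (J (cp x) (cp y)))" using x y by (intro cp_antimono) auto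
  then show "cp (x \<inter> y) \<subseteq> J (cp x) (cp y)" using x y by simp
qed

lemma cp_join: "x \<in> B \<Longrightarrow> y \<in> B \<Longrightarrow> cp (J x y) = cp x \<inter> cp y"
  using cp_meet[of "cp x" "cp y"] cp_cp[of "cp x \<inter> cp y"] by simp

lemma cp_Bot: "cp Bot = sets M"
  using J_cp[OF Bot_B] J_absorb[of "cp Bot" Bot] Bot_le[of "cp Bot"] by (simp add: J_commute)

lemma cp_top: "cp (sets M) = Bot"
  using cp_cp[OF Bot_B] by (simp add: cp_Bot)

lemma cp_split_meet: "a \<in> B \<Longrightarrow> z \<in> B \<Longrightarrow> cp (a \<inter> z) \<inter> cp (a \<inter> cp z) = cp a"
  using cp_join[of "a \<inter> z" "a \<inter> cp z"] split_B[of a z] by simp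

lemma meet_cp_meet: assumes "a \<in> B" "y \<in> B" shows "a \<inter> cp (a \<inter> y) = a \<inter> cp y"
proof -
  have "a \<inter> cp (a \<inter> y) = J (a \<inter> cp a) (a \<inter> cp y)" using assms by (simp add: cp_meet B_distrib)
  then show ?thesis using assms meet_cp[of a] J_absorb[of "a \<inter> cp y" Bot] Bot_le[of "a \<inter> cp y"]
    by (simp add: J_commute)
qed

lemma indep_disjoint:
  assumes x: "x \<in> B" and y: "y \<in> B" and d: "x \<inter> y \<subseteq> Bot" shows "indep_set x y"
proof -
  have "y \<subseteq> cp x" using disjoint_le_cp[OF x y] d by auto
  then show ?thesis using cp_indep[OF x] by (auto simp: indep_sets2_eq)
qed

lemma indep_split: "a \<in> B \<Longrightarrow> z \<in> B \<Longrightarrow> indep_set (a \<inter> z) (a \<inter> cp z)"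
  using meet_cp[of z] by (intro indep_disjoint) auto

lemma indep_Bot: "x \<in> B \<Longrightarrow> indep_set Bot x"
  by (intro indep_disjoint) auto

lemma L2_sub_top: "L2_sub M (sets M) = L2 M"
proof -
  have "f \<in> L2_sub M (sets M)" if "f \<in> L2 M" for f
  proof (rule L2_subI[OF B_sub[OF top_B] that])
    show "f \<in> borel_measurable (sigma (space M) (sets M))"
      using L2_measurable[OF that] measurable_cong_sets[OF sets_subfield[OF B_sub[OF top_B]] refl] by blast
  qed simp
  then show ?thesis by (auto simp: L2_sub_def)
qed

lemma cexp_top: "f \<in> L2 M \<Longrightarrow> AE \<omega> in M. cexp M (sets M) f \<omega> = f \<omega>"
  using L2_sub_AE[of f M "sets M"] L2_sub_top by (auto simp: eq_commute)

text \<open>This commutation is what makes the algebra diagonalizable. By distributivity y lies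
  below the join of its meet with x and the complement of x. Given that join, a function of x has
  the same conditional expectation as given the meet alone, since the complement is independent of
  x.\<close>

lemma cexp_cexp:
  assumes x: "x \<in> B" and y: "y \<in> B" and f: "f \<in> L2 M"
  shows "AE \<omega> in M. cexp M y (cexp M x f) \<omega> = cexp M (x \<inter> y) f \<omega>"
proof -
  let ?v = "x \<inter> y" and ?j = "J (x \<inter> y) (cp x)"
  have g: "cexp M x f \<in> L2_sub M x" and g2: "cexp M x f \<in> L2 M" using x f by (auto intro: cexp_L2_sub cexp_L2)
  have "y = J (y \<inter> x) (y \<inter> cp x)" using x y by (simp add: split_B)
  also have "\<dots> \<subseteq> ?j" using x y join_field_upper[where M=M and x="x \<inter> y" and y="cp x"]
    by (intro J_least) auto
  finally have yj: "y \<subseteq> ?j" .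
  have 1: "AE \<omega> in M. cexp M ?j (cexp M x f) \<omega> = cexp M ?v (cexp M x f) \<omega>"
    by (rule cexp_join_indep[OF _ _ _ _ cp_indep g]) (use x y in auto)
  have 2: "AE \<omega> in M. cexp M y (cexp M ?j (cexp M x f)) \<omega> = cexp M y (cexp M x f) \<omega>"
    by (rule cexp_nested[OF _ _ yj g2]) (use x y in auto)
  have 3: "AE \<omega> in M. cexp M y (cexp M ?j (cexp M x f)) \<omega> = cexp M y (cexp M ?v (cexp M x f)) \<omega>"
    by (rule cexp_cong[OF _ _ _ 1]) (use x y g2 in \<open>auto intro!: cexp_L2\<close>)
  have 4: "AE \<omega> in M. cexp M y (cexp M ?v (cexp M x f)) \<omega> = cexp M ?v (cexp M x f) \<omega>"
    by (rule cexp_nested'[OF _ _ _ g2]) (use x y in auto)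
  have 5: "AE \<omega> in M. cexp M ?v (cexp M x f) \<omega> = cexp M ?v f \<omega>"
    by (rule cexp_nested[OF _ _ _ f]) (use x y in auto)
  from 2 3 4 5 show ?thesis by eventually_elim simp
qed

text \<open>\<open>Bot\<close> is independent of every event, in particular of itself, so a function
  measurable for it has variance 0.\<close>

lemma cexp_Bot:
  assumes f: "f \<in> L2 M" shows "AE \<omega> in M. cexp M Bot f \<omega> = expectation f"
proof -
  let ?h = "\<lambda>\<omega>. cexp M Bot f \<omega> - expectation f"
  have s: "Bot \<in> subfields M" "sets M \<in> subfields M" by (rule B_sub, simp)+
  have h: "?h \<in> L2_sub M Bot"
    by (intro closed_subspace_diff[OF closed_subspace_L2_sub[OF s(1)]] cexp_L2_sub L2_sub_const s f)
  have h2: "?h \<in> L2 M" by (rule L2_sub_L2[OF h])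
  have "expectation (\<lambda>\<omega>. ?h \<omega> * ?h \<omega>) = expectation ?h * expectation ?h"
    by (rule indep_product(2)[OF s indep_Bot[OF top_B] h]) (simp add: L2_sub_top h2)
  moreover have "expectation ?h = 0"
    using expectation_cexp[OF s(1) f] L2_integrable[OF cexp_L2[OF s(1) f]] by (simp add: prob_space)
  ultimately have "L2_norm M ?h = 0" by (simp add: L2_norm_ip ip_def)
  from L2_norm_eq_0[OF h2 this] show ?thesis by eventually_elim simp
qed

section \<open>The first chaos\<close>

abbreviation FC :: "('a \<Rightarrow> real) set" where "FC \<equiv> first_chaos M B"

lemma FC_L2: "X \<in> FC \<Longrightarrow> X \<in> L2 M"
  by (simp add: first_chaos_def)

lemma FC_AE: "X \<in> FC \<Longrightarrow> z \<in> B \<Longrightarrow> AE \<omega> in M. X \<omega> = cexp M z X \<omega> + cexp M (cp z) X \<omega>"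
  by (simp add: first_chaos_def)

text \<open>The defining identity for \<open>Bot\<close> and its complement, the whole field, reads
  X = E X + X.\<close>

lemma FC_mean:
  assumes X: "X \<in> FC" shows "expectation X = 0"
proof -
  have "AE \<omega> in M. expectation X = 0"
    using FC_AE[OF X Bot_B] cexp_top[OF FC_L2[OF X]] cexp_Bot[OF FC_L2[OF X]]
    unfolding cp_Bot by eventually_elim simp
  then show ?thesis by simp
qed

text \<open>Projecting X = P_z X + P_{z'} X to a. The projections of a first chaos vector are thus
  additive over partitions, like a measure with values in L2.\<close>

lemma FC_split:
  assumes X: "X \<in> FC" and a: "a \<in> B" and z: "z \<in> B"
  shows "AE \<omega> in M. cexp M a X \<omega> = cexp M (a \<inter> z) X \<omega> + cexp M (a \<inter> cp z) X \<omega>"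
proof -
  have X2: "X \<in> L2 M" by (rule FC_L2[OF X])
  have c: "cexp M z X \<in> L2 M" "cexp M (cp z) X \<in> L2 M" using z X2 by (auto intro: cexp_L2)
  have 1: "AE \<omega> in M. cexp M a X \<omega> = cexp M a (\<lambda>\<omega>. cexp M z X \<omega> + cexp M (cp z) X \<omega>) \<omega>"
    by (rule cexp_cong[OF B_sub[OF a] X2 L2_add[OF c] FC_AE[OF X z]])
  from 1 cexp_add[OF B_sub[OF a] c] cexp_cexp[OF z a X2] cexp_cexp[OF cp_B[OF z] a X2]
  show ?thesis by eventually_elim (simp add: Int_commute)
qed

end

section \<open>Spectral resolutions\<close>

locale noise_spectral = noise M B for M :: "'a measure" and B :: "'a set set set" +
  fixes \<mu> :: "'s measure" and H :: "'s \<Rightarrow> 'h::real_inner set" and \<Gamma> :: "('s \<Rightarrow> 'h) set"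
    and \<Psi> :: "('a \<Rightarrow> real) \<Rightarrow> 's \<Rightarrow> 'h"
  assumes sr: "spectral_resolution M B \<mu> H \<Gamma> \<Psi>"
begin

lemma mhf: "measurable_hilbert_field \<mu> H \<Gamma>"
  using sr by (simp add: spectral_resolution_def)

lemma \<Gamma>_H: "\<phi> \<in> \<Gamma> \<Longrightarrow> s \<in> space \<mu> \<Longrightarrow> \<phi> s \<in> H s"
  using mhf[unfolded measurable_hilbert_field_def, THEN conjunct2, THEN conjunct1] by blast

lemma H_subspace: "s \<in> space \<mu> \<Longrightarrow> subspace (H s)"
  using mhf[unfolded measurable_hilbert_field_def, THEN conjunct1] by blast

lemma \<Gamma>_lin: "\<phi> \<in> \<Gamma> \<Longrightarrow> \<psi> \<in> \<Gamma> \<Longrightarrow> (\<lambda>s. a *\<^sub>R \<phi> s + b *\<^sub>R \<psi> s) \<in> \<Gamma>"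
  by (rule mhf[unfolded measurable_hilbert_field_def, THEN conjunct2, THEN conjunct2, THEN conjunct1, rule_format])

lemma \<Gamma>_norm: "\<phi> \<in> \<Gamma> \<Longrightarrow> (\<lambda>s. norm (\<phi> s)) \<in> borel_measurable \<mu>"
  by (rule mhf[unfolded measurable_hilbert_field_def, THEN conjunct2, THEN conjunct2, THEN conjunct2,
        THEN conjunct1, rule_format])

lemma \<Gamma>_I:
  "(\<And>s. s \<in> space \<mu> \<Longrightarrow> \<psi> s \<in> H s) \<Longrightarrow> (\<And>\<phi>. \<phi> \<in> \<Gamma> \<Longrightarrow> (\<lambda>s. \<phi> s \<bullet> \<psi> s) \<in> borel_measurable \<mu>) \<Longrightarrow> \<psi> \<in> \<Gamma>"
  by (rule mhf[unfolded measurable_hilbert_field_def, THEN conjunct2, THEN conjunct2, THEN conjunct2,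
        THEN conjunct2, THEN conjunct1, rule_format]) blast

lemma \<Gamma>_dense:
  "\<exists>e :: nat \<Rightarrow> 's \<Rightarrow> 'h. (\<forall>n. e n \<in> \<Gamma>) \<and> (\<forall>s\<in>space \<mu>. H s = closure (span (range (\<lambda>n. e n s))))"
  by (rule mhf[unfolded measurable_hilbert_field_def, THEN conjunct2, THEN conjunct2, THEN conjunct2,
        THEN conjunct2, THEN conjunct2])

lemma \<Gamma>_inner:
  assumes "\<phi> \<in> \<Gamma>" "\<psi> \<in> \<Gamma>" shows "(\<lambda>s. \<phi> s \<bullet> \<psi> s) \<in> borel_measurable \<mu>"
proof -
  have "(\<lambda>s. norm (\<phi> s + \<psi> s)) \<in> borel_measurable \<mu>" using \<Gamma>_norm[OF \<Gamma>_lin[OF assms, of 1 1]] by simp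
  then show ?thesis unfolding dot_norm using \<Gamma>_norm[OF assms(1)] \<Gamma>_norm[OF assms(2)] by simp
qed

lemma \<Gamma>_scale:
  assumes h: "h \<in> borel_measurable \<mu>" and p: "\<phi> \<in> \<Gamma>" shows "(\<lambda>s. h s *\<^sub>R \<phi> s) \<in> \<Gamma>"
proof (rule \<Gamma>_I)
  show "h s *\<^sub>R \<phi> s \<in> H s" if "s \<in> space \<mu>" for s
    using subspace_scale[OF H_subspace[OF that] \<Gamma>_H[OF p that]] .
  show "(\<lambda>s. \<psi> s \<bullet> h s *\<^sub>R \<phi> s) \<in> borel_measurable \<mu>" if "\<psi> \<in> \<Gamma>" for \<psi>
    using h \<Gamma>_inner[OF that p] by simp
qed

lemma uni: "unitary_onto_direct_integral M \<mu> \<Gamma> \<Psi>"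
  using sr by (simp add: spectral_resolution_def)

lemma \<Psi>_\<Gamma>: "f \<in> L2 M \<Longrightarrow> \<Psi> f \<in> \<Gamma>"
  using uni by (simp add: unitary_onto_direct_integral_def direct_integral_def)

lemma \<Psi>_integrable: "f \<in> L2 M \<Longrightarrow> integrable \<mu> (\<lambda>s. (norm (\<Psi> f s))\<^sup>2)"
  using uni by (simp add: unitary_onto_direct_integral_def direct_integral_def)

lemma \<Psi>_lin: "f \<in> L2 M \<Longrightarrow> g \<in> L2 M \<Longrightarrow>
    AE s in \<mu>. \<Psi> (\<lambda>\<omega>. a * f \<omega> + b * g \<omega>) s = a *\<^sub>R \<Psi> f s + b *\<^sub>R \<Psi> g s"
  using uni by (simp add: unitary_onto_direct_integral_def)

lemma \<Psi>_iso: "f \<in> L2 M \<Longrightarrow> (LINT s|\<mu>. (norm (\<Psi> f s))\<^sup>2) = ip M f f"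
  using uni by (simp add: unitary_onto_direct_integral_def ip_def power2_eq_square)

lemma \<Psi>_surj: "\<phi> \<in> \<Gamma> \<Longrightarrow> integrable \<mu> (\<lambda>s. (norm (\<phi> s))\<^sup>2) \<Longrightarrow> \<exists>f\<in>L2 M. AE s in \<mu>. \<Psi> f s = \<phi> s"
  using uni by (simp add: unitary_onto_direct_integral_def direct_integral_def)

lemma \<Psi>_norm_measurable [measurable (raw)]: "f \<in> L2 M \<Longrightarrow> (\<lambda>s. norm (\<Psi> f s)) \<in> borel_measurable \<mu>"
  by (rule \<Gamma>_norm[OF \<Psi>_\<Gamma>])

lemma \<Psi>_nonzero_sets: "f \<in> L2 M \<Longrightarrow> {s \<in> space \<mu>. \<Psi> f s \<noteq> 0} \<in> sets \<mu>"
proof -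
  assume "f \<in> L2 M"
  then have [measurable]: "(\<lambda>s. norm (\<Psi> f s)) \<in> borel_measurable \<mu>" by (rule \<Psi>_norm_measurable)
  have "{s \<in> space \<mu>. norm (\<Psi> f s) \<noteq> 0} \<in> sets \<mu>" by measurable
  then show ?thesis by simp
qed

lemma \<Psi>_diff: "f \<in> L2 M \<Longrightarrow> g \<in> L2 M \<Longrightarrow> AE s in \<mu>. \<Psi> (\<lambda>\<omega>. f \<omega> - g \<omega>) s = \<Psi> f s - \<Psi> g s"
  using \<Psi>_lin[of f g 1 "-1"] by simp

lemma \<Psi>_add: "f \<in> L2 M \<Longrightarrow> g \<in> L2 M \<Longrightarrow> AE s in \<mu>. \<Psi> (\<lambda>\<omega>. f \<omega> + g \<omega>) s = \<Psi> f s + \<Psi> g s"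
  using \<Psi>_lin[of f g 1 "1"] by simp

lemma \<Psi>_eq_0:
  assumes f: "f \<in> L2 M" shows "(AE s in \<mu>. \<Psi> f s = 0) \<longleftrightarrow> (AE \<omega> in M. f \<omega> = 0)"
proof -
  have "(AE s in \<mu>. \<Psi> f s = 0) \<longleftrightarrow> (LINT s|\<mu>. (norm (\<Psi> f s))\<^sup>2) = 0"
    using integral_nonneg_eq_0_iff_AE[OF \<Psi>_integrable[OF f]] by simp
  also have "\<dots> \<longleftrightarrow> (LINT \<omega>|M. (f \<omega>)\<^sup>2) = 0" using \<Psi>_iso[OF f] by (simp add: ip_def power2_eq_square)
  also have "\<dots> \<longleftrightarrow> (AE \<omega> in M. f \<omega> = 0)"
    using integral_nonneg_eq_0_iff_AE[OF L2_integrable_square[OF f]] by simp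
  finally show ?thesis .
qed

lemma \<Psi>_eq_iff:
  assumes f: "f \<in> L2 M" and g: "g \<in> L2 M"
  shows "(AE s in \<mu>. \<Psi> f s = \<Psi> g s) \<longleftrightarrow> (AE \<omega> in M. f \<omega> = g \<omega>)"
proof -
  have "(AE s in \<mu>. \<Psi> f s = \<Psi> g s) \<longleftrightarrow> (AE s in \<mu>. \<Psi> (\<lambda>\<omega>. f \<omega> - g \<omega>) s = 0)"
    by (rule eventually_subst) (use \<Psi>_diff[OF f g] in eventually_elim, simp)
  then show ?thesis using \<Psi>_eq_0[OF L2_diff[OF f g]] by simp
qed

lemma \<Psi>_cong: "f \<in> L2 M \<Longrightarrow> g \<in> L2 M \<Longrightarrow> AE \<omega> in M. f \<omega> = g \<omega> \<Longrightarrow> AE s in \<mu>. \<Psi> f s = \<Psi> g s"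
  by (simp add: \<Psi>_eq_iff)

lemma \<Psi>_inj: "f \<in> L2 M \<Longrightarrow> g \<in> L2 M \<Longrightarrow> AE s in \<mu>. \<Psi> f s = \<Psi> g s \<Longrightarrow> AE \<omega> in M. f \<omega> = g \<omega>"
  by (simp add: \<Psi>_eq_iff)

lemma \<Psi>_inner:
  assumes f: "f \<in> L2 M" and g: "g \<in> L2 M"
  shows "integrable \<mu> (\<lambda>s. \<Psi> f s \<bullet> \<Psi> g s)" and "(LINT s|\<mu>. \<Psi> f s \<bullet> \<Psi> g s) = ip M f g"
proof -
  note fg = L2_add[OF f g]
  have ae: "AE s in \<mu>. ((norm (\<Psi> (\<lambda>\<omega>. f \<omega> + g \<omega>) s))\<^sup>2 - (norm (\<Psi> f s))\<^sup>2 - (norm (\<Psi> g s))\<^sup>2) / 2 = \<Psi> f s \<bullet> \<Psi> g s"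
    using \<Psi>_add[OF f g] by eventually_elim (simp add: dot_norm)
  have m: "(\<lambda>s. \<Psi> f s \<bullet> \<Psi> g s) \<in> borel_measurable \<mu>" by (rule \<Gamma>_inner[OF \<Psi>_\<Gamma>[OF f] \<Psi>_\<Gamma>[OF g]])
  have i: "integrable \<mu> (\<lambda>s. ((norm (\<Psi> (\<lambda>\<omega>. f \<omega> + g \<omega>) s))\<^sup>2 - (norm (\<Psi> f s))\<^sup>2 - (norm (\<Psi> g s))\<^sup>2) / 2)"
    using \<Psi>_integrable f g fg by simp
  show "integrable \<mu> (\<lambda>s. \<Psi> f s \<bullet> \<Psi> g s)"
    by (rule Bochner_Integration.integrable_cong_AE_imp[OF i m]) (use ae in eventually_elim, simp)
  have "(LINT s|\<mu>. \<Psi> f s \<bullet> \<Psi> g s) = (ip M (\<lambda>\<omega>. f \<omega> + g \<omega>) (\<lambda>\<omega>. f \<omega> + g \<omega>) - ip M f f - ip M g g) / 2"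
    using integral_cong_AE[OF borel_measurable_integrable[OF i] m ae] \<Psi>_integrable f g fg
    by (simp add: \<Psi>_iso)
  also have "\<dots> = ip M f g" using f g by (simp add: ip_add_left ip_add_right fg ip_commute[of M g f])
  finally show "(LINT s|\<mu>. \<Psi> f s \<bullet> \<Psi> g s) = ip M f g" .
qed

text \<open>Only the sets of the standard Borel space N are transported through the completion and
  the adjoined null set; they suffice to exhaust the space by sets of finite measure and to separate
  points.\<close>

lemma standard_part:
  obtains N where "standard_borel N" "sigma_finite_measure N" "space N \<in> sets \<mu>"
    "space \<mu> - space N \<in> null_sets \<mu>" "\<And>A. A \<in> sets N \<Longrightarrow> A \<in> sets \<mu> \<and> emeasure \<mu> A = emeasure N A"
proof -
  obtain N where N: "standard_borel N" "sigma_finite_measure N" "space N \<subseteq> space \<mu>"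
    "space \<mu> - space N \<in> null_sets \<mu>" "restrict_space \<mu> (space N) = completion N"
    using sr by (auto simp: spectral_resolution_def standard_measure_space_def)
  have "space N = space \<mu> - (space \<mu> - space N)" using N(3) by auto
  then have s: "space N \<in> sets \<mu>" using N(4) by (metis null_setsD2 sets.compl_sets)
  have "A \<in> sets \<mu> \<and> emeasure \<mu> A = emeasure N A" if A: "A \<in> sets N" for A
  proof -
    have "A \<in> sets (restrict_space \<mu> (space N))" unfolding N(5) using A by (rule sets_completionI_sets)
    then obtain A' where "A' \<in> sets \<mu>" "A = space N \<inter> A'" by (auto simp: sets_restrict_space)
    then have "A \<in> sets \<mu>" using s by auto
    moreover have "emeasure (restrict_space \<mu> (space N)) A = emeasure \<mu> A"
      using s A sets.sets_into_space[OF A] by (intro emeasure_restrict_space) auto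
    moreover have "emeasure (completion N) A = emeasure N A" using A by simp
    ultimately show ?thesis using N(5) by simp
  qed
  with N s show ?thesis using that by blast
qed

lemma sigma_finite_\<mu>: "sigma_finite_measure \<mu>"
proof -
  obtain N where N: "sigma_finite_measure N" "space N \<in> sets \<mu>" "space \<mu> - space N \<in> null_sets \<mu>"
    "\<And>A. A \<in> sets N \<Longrightarrow> A \<in> sets \<mu> \<and> emeasure \<mu> A = emeasure N A"
    using standard_part by metis
  obtain A where A: "countable A" "A \<subseteq> sets N" "\<Union>A = space N" "\<forall>a\<in>A. emeasure N a \<noteq> \<infinity>"
    using sigma_finite_measure.sigma_finite_countable[OF N(1)] by blast
  show ?thesis
  proof
    show "\<exists>A. countable A \<and> A \<subseteq> sets \<mu> \<and> \<Union> A = space \<mu> \<and> (\<forall>a\<in>A. emeasure \<mu> a \<noteq> \<infinity>)"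
    proof (intro exI[of _ "insert (space \<mu> - space N) A"] conjI)
      show "\<Union> (insert (space \<mu> - space N) A) = space \<mu>"
        using A(3) sets.sets_into_space[OF N(2)] by auto
      show "\<forall>a\<in>insert (space \<mu> - space N) A. emeasure \<mu> a \<noteq> \<infinity>"
        using N(3,4) A(2,4) by (auto dest: subsetD)
      show "insert (space \<mu> - space N) A \<subseteq> sets \<mu>" using N(3,4) A(2) by auto
    qed (use A in auto)
  qed
qed

text \<open>A vector of full support reduces statements about multipliers, valid almost everywhere,
  to statements about this one vector. At each point it is the first non-zero value of a fundamental
  sequence of sections, rescaled to the length of a positive square integrable function.\<close>

lemma full_support: obtains f\<^sub>0 where "f\<^sub>0 \<in> L2 M" "AE s in \<mu>. \<Psi> f\<^sub>0 s \<noteq> 0"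
proof -
  interpret mu: sigma_finite_measure \<mu> by (rule sigma_finite_\<mu>)
  obtain e :: "nat \<Rightarrow> 's \<Rightarrow> 'h" where e': "\<forall>n. e n \<in> \<Gamma>"
    and eH': "\<forall>s\<in>space \<mu>. H s = closure (span (range (\<lambda>n. e n s)))"
    using \<Gamma>_dense by (elim exE conjE)
  note e = e'[rule_format] and eH = eH'[rule_format]
  have [measurable]: "(\<lambda>s. norm (e n s)) \<in> borel_measurable \<mu>" for n by (rule \<Gamma>_norm[OF e])
  obtain h where h [measurable]: "h \<in> borel_measurable \<mu>" and hf: "integral\<^sup>N \<mu> h \<noteq> \<infinity>"
    and hp: "\<And>s. s \<in> space \<mu> \<Longrightarrow> 0 < h s \<and> h s < \<infinity>"
    using mu.Ex_finite_integrable_function by blast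
  define p where "p s = sqrt (enn2real (h s))" for s
  have [measurable]: "p \<in> borel_measurable \<mu>" unfolding p_def by measurable
  have pp: "0 < p s" if "s \<in> space \<mu>" for s
    using hp[OF that] by (simp add: p_def enn2real_positive_iff)
  have pint: "integrable \<mu> (\<lambda>s. (p s)\<^sup>2)"
  proof (rule integrableI_bounded)
    have "(\<integral>\<^sup>+ s. ennreal (norm ((p s)\<^sup>2)) \<partial>\<mu>) = integral\<^sup>N \<mu> h"
      by (rule nn_integral_cong) (use hp in \<open>auto simp: p_def\<close>)
    then show "(\<integral>\<^sup>+ s. ennreal (norm ((p s)\<^sup>2)) \<partial>\<mu>) < \<infinity>" using hf by (simp add: less_top)
  qed measurable
  \<comment> \<open>Where all sections vanish the index is arbitrary and \<open>\<phi>\<close> is 0;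
    this can happen only where the fibre is zero, that is on a null set.\<close>
  define n where "n s = (LEAST n. norm (e n s) \<noteq> 0)" for s
  have n [measurable]: "n \<in> measurable \<mu> (count_space UNIV)" unfolding n_def by measurable
  define \<phi> where "\<phi> s = (p s / norm (e (n s) s)) *\<^sub>R e (n s) s" for s
  have \<phi>: "\<phi> \<in> \<Gamma>"
  proof (rule \<Gamma>_I)
    show "\<phi> s \<in> H s" if "s \<in> space \<mu>" for s
      unfolding \<phi>_def using subspace_scale[OF H_subspace[OF that] \<Gamma>_H[OF e that]] .
    show "(\<lambda>s. \<psi> s \<bullet> \<phi> s) \<in> borel_measurable \<mu>" if \<psi>: "\<psi> \<in> \<Gamma>" for \<psi>
    proof -
      have [measurable]: "(\<lambda>s. \<psi> s \<bullet> e k s) \<in> borel_measurable \<mu>" for k by (rule \<Gamma>_inner[OF \<psi> e])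
      have "(\<lambda>s. p s / norm (e k s) * (\<psi> s \<bullet> e k s)) \<in> borel_measurable \<mu>" for k by measurable
      from measurable_compose_countable[OF this n]
      show ?thesis unfolding \<phi>_def by (simp add: inner_scaleR_right)
    qed
  qed
  have nn: "norm (\<phi> s) = p s" if "s \<in> space \<mu>" "\<exists>k. e k s \<noteq> 0" for s
  proof -
    have "norm (e (n s) s) \<noteq> 0" unfolding n_def by (rule LeastI_ex) (use that(2) in auto)
    then show ?thesis using pp[OF that(1)] by (simp add: \<phi>_def)
  qed
  have "norm (\<phi> s) \<le> p s" if "s \<in> space \<mu>" for s
    using pp[OF that] by (simp add: \<phi>_def)
  then have "integrable \<mu> (\<lambda>s. (norm (\<phi> s))\<^sup>2)"
    using \<Gamma>_norm[OF \<phi>] by (intro Bochner_Integration.integrable_bound[OF pint] AE_I2) (auto intro: power_mono)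
  from \<Psi>_surj[OF \<phi> this] obtain f where f: "f \<in> L2 M" "AE s in \<mu>. \<Psi> f s = \<phi> s" by blast
  have "AE s in \<mu>. H s \<noteq> {0}" using sr by (simp add: spectral_resolution_def)
  with f(2) AE_space have "AE s in \<mu>. \<Psi> f s \<noteq> 0"
  proof eventually_elim
    case (elim s)
    have "\<exists>k. e k s \<noteq> 0"
    proof (rule ccontr)
      assume "\<not> (\<exists>k. e k s \<noteq> 0)"
      then have "range (\<lambda>n. e n s) = {0}" by auto
      then have "H s = {0}" using eH[OF elim(2)] by simp
      with elim(3) show False by simp
    qed
    then have "norm (\<Psi> f s) = p s" using nn[OF elim(2)] elim(1) by simp
    then show ?case using pp[OF elim(2)] by auto
  qed
  with f(1) show ?thesis by (rule that)
qed

text \<open>The spectral projection of A. It is a chosen representative of a class, so every rule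
  about it holds almost everywhere.\<close>

definition Pr :: "'s set \<Rightarrow> ('a \<Rightarrow> real) \<Rightarrow> 'a \<Rightarrow> real" where
  "Pr A f = (SOME g. g \<in> L2 M \<and> (AE s in \<mu>. \<Psi> g s = indicator A s *\<^sub>R \<Psi> f s))"

lemma
  assumes A: "A \<in> sets \<mu>" and f: "f \<in> L2 M"
  shows Pr_L2: "Pr A f \<in> L2 M" and \<Psi>_Pr: "AE s in \<mu>. \<Psi> (Pr A f) s = indicator A s *\<^sub>R \<Psi> f s"
proof -
  have m: "(\<lambda>s. indicator A s *\<^sub>R \<Psi> f s) \<in> \<Gamma>" by (rule \<Gamma>_scale[OF _ \<Psi>_\<Gamma>[OF f]]) (use A in simp)
  have "integrable \<mu> (\<lambda>s. (norm (indicator A s *\<^sub>R \<Psi> f s))\<^sup>2)"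
    using \<Gamma>_norm[OF m]
    by (intro Bochner_Integration.integrable_bound[OF \<Psi>_integrable[OF f]] AE_I2) (auto split: split_indicator)
  from \<Psi>_surj[OF m this] have "\<exists>g. g \<in> L2 M \<and> (AE s in \<mu>. \<Psi> g s = indicator A s *\<^sub>R \<Psi> f s)" by blast
  from someI_ex[OF this] show "Pr A f \<in> L2 M" "AE s in \<mu>. \<Psi> (Pr A f) s = indicator A s *\<^sub>R \<Psi> f s"
    by (auto simp: Pr_def)
qed

lemma Pr_eqI:
  assumes "A \<in> sets \<mu>" "f \<in> L2 M" "g \<in> L2 M" "AE s in \<mu>. \<Psi> g s = indicator A s *\<^sub>R \<Psi> f s"
  shows "AE \<omega> in M. g \<omega> = Pr A f \<omega>"
  by (rule \<Psi>_inj[OF assms(3) Pr_L2[OF assms(1,2)]])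
    (use assms(4) \<Psi>_Pr[OF assms(1,2)] in eventually_elim, simp)

section \<open>Spectral sets and the support of a vector\<close>

abbreviation S :: "'a set set \<Rightarrow> 's set" where "S \<equiv> spectral_set M \<mu> \<Psi>"

lemma cexp_in_algebra:
  assumes x: "x \<in> B" shows "cexp M x \<in> noise_operator_algebra M B"
proof -
  have xs: "x \<in> subfields M" using x by simp
  have "cexp M x \<in> cexp_span M B"
    unfolding cexp_span_def by (rule CollectI, rule exI[of _ "{x}"], rule exI[of _ "\<lambda>_. 1"]) (use x in auto)
  moreover have "bounded_operator M (cexp M x)"
    unfolding bounded_operator_def
    by (intro conjI ballI allI exI[of _ 1]) (use xs cexp_L2 cexp_lin cexp_norm_le in auto)
  ultimately show ?thesis unfolding noise_operator_algebra_def
    by (auto intro!: bexI[of _ "cexp M x"])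
qed

text \<open>The conditional expectation lies in the algebra, so it acts as multiplication by some h.
  Idempotence, tested on a vector of full support, forces h to take only the values 0 and 1; hence a
  set as in the definition of \<open>spectral_set\<close> exists.\<close>

lemma
  assumes x: "x \<in> B"
  shows S_sets [measurable]: "S x \<in> sets \<mu>"
    and S_cexp: "f \<in> L2 M \<Longrightarrow> AE s in \<mu>. \<Psi> (cexp M x f) s = indicator (S x) s *\<^sub>R \<Psi> f s"
proof -
  have xs: "x \<in> subfields M" using x by simp
  have "\<forall>T\<in>noise_operator_algebra M B. \<exists>h\<in>Linf \<mu>. intertwines_diagonal M \<mu> \<Psi> T h"
    using sr by (simp add: spectral_resolution_def)
  from bspec[OF this cexp_in_algebra[OF x]] obtain h where h: "h \<in> Linf \<mu>"
    and ih: "intertwines_diagonal M \<mu> \<Psi> (cexp M x) h" by blast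
  have hm: "h \<in> borel_measurable \<mu>" using h by (simp add: Linf_def)
  have hh: "AE s in \<mu>. \<Psi> (cexp M x f) s = h s *\<^sub>R \<Psi> f s" if "f \<in> L2 M" for f
    using ih that by (simp add: intertwines_diagonal_def)
  obtain f\<^sub>0 where f0: "f\<^sub>0 \<in> L2 M" "AE s in \<mu>. \<Psi> f\<^sub>0 s \<noteq> 0" by (rule full_support)
  have "AE s in \<mu>. \<Psi> (cexp M x (cexp M x f\<^sub>0)) s = \<Psi> (cexp M x f\<^sub>0) s"
    by (rule \<Psi>_cong) (use cexp_nested[OF xs xs order_refl f0(1)] xs f0(1) in \<open>auto intro: cexp_L2\<close>)
  with hh[OF f0(1)] hh[OF cexp_L2[OF xs f0(1)]] f0(2) have h01: "AE s in \<mu>. h s = 0 \<or> h s = 1"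
  proof eventually_elim
    case (elim s)
    then have "(h s * h s - h s) *\<^sub>R \<Psi> f\<^sub>0 s = 0" by (simp add: algebra_simps)
    then have "h s * (h s - 1) = 0" using elim by (simp add: algebra_simps)
    then show ?case by simp
  qed
  let ?A = "{s \<in> space \<mu>. h s = 1}"
  have A: "?A \<in> sets \<mu>" using hm by measurable
  have "AE s in \<mu>. \<Psi> (cexp M x f) s = indicator ?A s *\<^sub>R \<Psi> f s" if "f \<in> L2 M" for f
    using hh[OF that] h01 AE_space by eventually_elim (auto simp: indicator_def)
  then have "?A \<in> sets \<mu> \<and> intertwines_diagonal M \<mu> \<Psi> (cexp M x) (indicator ?A)"
    using A by (simp add: intertwines_diagonal_def)
  from someI[of "\<lambda>A. A \<in> sets \<mu> \<and> intertwines_diagonal M \<mu> \<Psi> (cexp M x) (indicator A)", OF this]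
  show "S x \<in> sets \<mu>" "f \<in> L2 M \<Longrightarrow> AE s in \<mu>. \<Psi> (cexp M x f) s = indicator (S x) s *\<^sub>R \<Psi> f s"
    by (auto simp: spectral_set_def intertwines_diagonal_def)
qed

text \<open>\<open>cexp_cexp\<close> tested on a vector of full support. The exceptional null set
  depends on x and y, which is why statements about all of B at once need separate care.\<close>

lemma S_meet:
  assumes x: "x \<in> B" and y: "y \<in> B" shows "AE s in \<mu>. s \<in> S (x \<inter> y) \<longleftrightarrow> s \<in> S x \<and> s \<in> S y"
proof -
  obtain f where f: "f \<in> L2 M" "AE s in \<mu>. \<Psi> f s \<noteq> 0" by (rule full_support)
  have c: "cexp M x f \<in> L2 M" using x f by (auto intro: cexp_L2)
  have "AE s in \<mu>. \<Psi> (cexp M y (cexp M x f)) s = \<Psi> (cexp M (x \<inter> y) f) s"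
    by (rule \<Psi>_cong[OF _ _ cexp_cexp[OF x y f(1)]]) (use x y f c in \<open>auto intro: cexp_L2\<close>)
  with S_cexp[OF x f(1)] S_cexp[OF y c] S_cexp[OF meet_B[OF x y] f(1)] f(2)
  show ?thesis by eventually_elim (auto split: split_indicator_asm split_indicator)
qed

lemma S_top: "AE s in \<mu>. s \<in> S (sets M)"
proof -
  obtain f where f: "f \<in> L2 M" "AE s in \<mu>. \<Psi> f s \<noteq> 0" by (rule full_support)
  have "AE s in \<mu>. \<Psi> (cexp M (sets M) f) s = \<Psi> f s"
    by (rule \<Psi>_cong[OF _ f(1) cexp_top[OF f(1)]]) (use f in \<open>auto intro: cexp_L2\<close>)
  with S_cexp[OF top_B f(1)] f(2) show ?thesis
    by eventually_elim (auto split: split_indicator_asm split_indicator)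
qed

lemma S_mono:
  assumes x: "x \<in> B" and y: "y \<in> B" and "x \<subseteq> y" shows "AE s in \<mu>. s \<in> S x \<longrightarrow> s \<in> S y"
proof -
  have "x \<inter> y = x" using assms(3) by auto
  then have "AE s in \<mu>. s \<in> S x \<longleftrightarrow> s \<in> S x \<and> s \<in> S y" using S_meet[OF x y] by simp
  then show ?thesis by eventually_elim blast
qed

text \<open>Being fixed by P_x means, after \<open>\<Psi>\<close>, being fixed by multiplication
  with the indicator of \<open>S x\<close>.\<close>

lemma L2_sub_iff_\<Psi>:
  assumes x: "x \<in> B" and f: "f \<in> L2 M"
  shows "f \<in> L2_sub M x \<longleftrightarrow> (AE s in \<mu>. \<Psi> f s \<noteq> 0 \<longrightarrow> s \<in> S x)"
proof -
  have "f \<in> L2_sub M x \<longleftrightarrow> (AE s in \<mu>. \<Psi> f s = \<Psi> (cexp M x f) s)"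
    using f x \<Psi>_eq_iff[OF f cexp_L2[OF B_sub[OF x] f]] by (simp add: L2_sub_def)
  also have "\<dots> \<longleftrightarrow> (AE s in \<mu>. \<Psi> f s \<noteq> 0 \<longrightarrow> s \<in> S x)"
  proof
    assume "AE s in \<mu>. \<Psi> f s = \<Psi> (cexp M x f) s"
    with S_cexp[OF x f] show "AE s in \<mu>. \<Psi> f s \<noteq> 0 \<longrightarrow> s \<in> S x"
      by eventually_elim (auto split: split_indicator_asm split_indicator)
  next
    assume "AE s in \<mu>. \<Psi> f s \<noteq> 0 \<longrightarrow> s \<in> S x"
    with S_cexp[OF x f] show "AE s in \<mu>. \<Psi> f s = \<Psi> (cexp M x f) s"
      by eventually_elim (auto split: split_indicator_asm split_indicator)
  qed
  finally show ?thesis .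
qed

lemma Pr_L2_sub:
  assumes A: "A \<in> sets \<mu>" and x: "x \<in> B" and f: "f \<in> L2_sub M x" shows "Pr A f \<in> L2_sub M x"
proof -
  have f2: "f \<in> L2 M" by (rule L2_sub_L2[OF f])
  have "AE s in \<mu>. \<Psi> f s \<noteq> 0 \<longrightarrow> s \<in> S x" using f L2_sub_iff_\<Psi>[OF x f2] by simp
  with \<Psi>_Pr[OF A f2] have "AE s in \<mu>. \<Psi> (Pr A f) s \<noteq> 0 \<longrightarrow> s \<in> S x" by eventually_elim auto
  then show ?thesis using L2_sub_iff_\<Psi>[OF x Pr_L2[OF A f2]] by simp
qed

lemma ip_Pr:
  assumes A: "A \<in> sets \<mu>" and f: "f \<in> L2 M"
  shows "ip M (Pr A f) (Pr A f) = (LINT s|\<mu>. indicator A s * (norm (\<Psi> f s))\<^sup>2)"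
proof -
  have n: "(\<lambda>s. norm (\<Psi> f s)) \<in> borel_measurable \<mu>" "(\<lambda>s. norm (\<Psi> (Pr A f) s)) \<in> borel_measurable \<mu>"
    using \<Psi>_norm_measurable f Pr_L2[OF A f] by auto
  have "ip M (Pr A f) (Pr A f) = (LINT s|\<mu>. (norm (\<Psi> (Pr A f) s))\<^sup>2)"
    using \<Psi>_iso[OF Pr_L2[OF A f]] by simp
  also have "\<dots> = (LINT s|\<mu>. indicator A s * (norm (\<Psi> f s))\<^sup>2)"
  proof (rule integral_cong_AE)
    show "AE s in \<mu>. (norm (\<Psi> (Pr A f) s))\<^sup>2 = indicator A s * (norm (\<Psi> f s))\<^sup>2"
      using \<Psi>_Pr[OF A f] by eventually_elim (auto split: split_indicator)
  qed (use n A in auto)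
  finally show ?thesis .
qed

text \<open>At a point lying in neither \<open>S z\<close> nor \<open>S (cp z)\<close> the identity
  gives \<open>\<Psi> f s\<close> = 0, at a point in both it gives \<open>\<Psi> f s\<close> = 2
  \<open>\<Psi> f s\<close>. So the first chaos lives on points that behave like sets with a single
  element.\<close>

lemma FC_iff_\<Psi>:
  assumes f: "f \<in> L2 M"
  shows "f \<in> FC \<longleftrightarrow> (\<forall>z\<in>B. AE s in \<mu>. \<Psi> f s \<noteq> 0 \<longrightarrow> (s \<in> S z \<longleftrightarrow> s \<notin> S (cp z)))"
proof -
  have "(AE \<omega> in M. f \<omega> = cexp M z f \<omega> + cexp M (cp z) f \<omega>) \<longleftrightarrow>
      (AE s in \<mu>. \<Psi> f s \<noteq> 0 \<longrightarrow> (s \<in> S z \<longleftrightarrow> s \<notin> S (cp z)))" if z: "z \<in> B" for z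
  proof -
    have c: "cexp M z f \<in> L2 M" "cexp M (cp z) f \<in> L2 M" using z f by (auto intro!: cexp_L2)
    have ae: "AE s in \<mu>. \<Psi> (\<lambda>\<omega>. cexp M z f \<omega> + cexp M (cp z) f \<omega>) s = (indicator (S z) s + indicator (S (cp z)) s) *\<^sub>R \<Psi> f s"
      using \<Psi>_add[OF c] S_cexp[OF z f] S_cexp[OF cp_B[OF z] f] by eventually_elim (simp add: scaleR_left_distrib)
    have "(AE \<omega> in M. f \<omega> = cexp M z f \<omega> + cexp M (cp z) f \<omega>) \<longleftrightarrow>
        (AE s in \<mu>. \<Psi> f s = \<Psi> (\<lambda>\<omega>. cexp M z f \<omega> + cexp M (cp z) f \<omega>) s)"
      using \<Psi>_eq_iff[OF f L2_add[OF c]] by simp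
    also have "\<dots> \<longleftrightarrow> (AE s in \<mu>. \<Psi> f s \<noteq> 0 \<longrightarrow> (s \<in> S z \<longleftrightarrow> s \<notin> S (cp z)))"
    proof
      assume "AE s in \<mu>. \<Psi> f s = \<Psi> (\<lambda>\<omega>. cexp M z f \<omega> + cexp M (cp z) f \<omega>) s"
      with ae show "AE s in \<mu>. \<Psi> f s \<noteq> 0 \<longrightarrow> (s \<in> S z \<longleftrightarrow> s \<notin> S (cp z))"
        by eventually_elim (auto simp: scaleR_2 split: split_indicator_asm split_indicator)
    next
      assume "AE s in \<mu>. \<Psi> f s \<noteq> 0 \<longrightarrow> (s \<in> S z \<longleftrightarrow> s \<notin> S (cp z))"
      with ae show "AE s in \<mu>. \<Psi> f s = \<Psi> (\<lambda>\<omega>. cexp M z f \<omega> + cexp M (cp z) f \<omega>) s"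
        by eventually_elim (auto split: split_indicator_asm split_indicator)
    qed
    finally show ?thesis .
  qed
  then show ?thesis using f by (simp add: first_chaos_def)
qed

lemma Pr_FC:
  assumes A: "A \<in> sets \<mu>" and f: "f \<in> FC" shows "Pr A f \<in> FC"
proof -
  have f2: "f \<in> L2 M" by (rule FC_L2[OF f])
  have "AE s in \<mu>. \<Psi> (Pr A f) s \<noteq> 0 \<longrightarrow> (s \<in> S z \<longleftrightarrow> s \<notin> S (cp z))" if z: "z \<in> B" for z
  proof -
    have "AE s in \<mu>. \<Psi> f s \<noteq> 0 \<longrightarrow> (s \<in> S z \<longleftrightarrow> s \<notin> S (cp z))" using f z FC_iff_\<Psi>[OF f2] by simp
    with \<Psi>_Pr[OF A f2] show ?thesis by eventually_elim auto
  qed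
  then show ?thesis using FC_iff_\<Psi>[OF Pr_L2[OF A f2]] by simp
qed

end

text \<open>An uncountable union is replaced by a countable one of maximal measure: a member of the
  family not covered up to a null set would increase the supremum.\<close>

lemma (in finite_measure) essential_union:
  assumes I: "I \<noteq> {}" and A: "\<And>i. i \<in> I \<Longrightarrow> A i \<in> sets M"
  shows "\<exists>y::nat \<Rightarrow> 'i. (\<forall>k. y k \<in> I) \<and> (\<forall>i\<in>I. AE s in M. s \<in> A i \<longrightarrow> (\<exists>k. s \<in> A (y k)))"
proof -
  let ?Y = "{y :: nat \<Rightarrow> 'i. \<forall>k. y k \<in> I}"
  let ?m = "\<lambda>y. measure M (\<Union>k. A (y k))"
  define c where "c = (SUP y\<in>?Y. ?m y)"
  have Y: "?Y \<noteq> {}" using I by auto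
  have bdd: "bdd_above (?m ` ?Y)" by (rule bdd_aboveI[of _ "measure M (space M)"]) (auto intro: bounded_measure)
  have le: "?m y \<le> c" if "y \<in> ?Y" for y unfolding c_def by (rule cSUP_upper[OF that bdd])
  have "\<exists>y\<in>?Y. c - 1 / Suc n < ?m y" for n
    using less_cSUP_iff[OF Y bdd, of "c - 1 / Suc n"] by (simp add: c_def)
  then obtain y where y: "\<And>n. y n \<in> ?Y" and yc: "\<And>n. c - 1 / Suc n < ?m (y n)" by metis
  \<comment> \<open>Countably many sequences, with measures approaching the supremum, are merged
    into one by the pairing of natural numbers.\<close>
  define z where "z k = (case prod_decode k of (n, j) \<Rightarrow> y n j)" for k
  have z: "z \<in> ?Y" using y by (auto simp: z_def split: prod.split)
  have zy: "(\<Union>k. A (y n k)) \<subseteq> (\<Union>k. A (z k))" for n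
  proof
    fix s assume "s \<in> (\<Union>k. A (y n k))"
    then obtain j where "s \<in> A (y n j)" by auto
    then have "s \<in> A (z (prod_encode (n, j)))" by (simp add: z_def)
    then show "s \<in> (\<Union>k. A (z k))" by blast
  qed
  have Us: "(\<Union>k. A (x k)) \<in> sets M" if "x \<in> ?Y" for x using that A by auto
  have zc: "c \<le> ?m z"
  proof (rule field_le_epsilon)
    fix e :: real assume "0 < e"
    then obtain n where "1 / Suc n < e" using nat_approx_posE by blast
    moreover have "?m (y n) \<le> ?m z" by (rule finite_measure_mono[OF zy Us[OF z]])
    ultimately show "c \<le> ?m z + e" using yc[of n] by simp
  qed
  have "AE s in M. s \<in> A i \<longrightarrow> (\<exists>k. s \<in> A (z k))" if i: "i \<in> I" for i
  proof -
    \<comment> \<open>Putting i in front of z yields another admissible sequence, whose union cannot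
      be larger in measure than c.\<close>
    define x where "x k = (case k of 0 \<Rightarrow> i | Suc j \<Rightarrow> z j)" for k
    have x: "x \<in> ?Y" using z i by (auto simp: x_def split: nat.split)
    have "A i \<union> (\<Union>k. A (z k)) \<subseteq> (\<Union>k. A (x k))"
    proof
      fix s assume "s \<in> A i \<union> (\<Union>k. A (z k))"
      then consider "s \<in> A (x 0)" | j where "s \<in> A (x (Suc j))" by (auto simp: x_def)
      then show "s \<in> (\<Union>k. A (x k))" by cases auto
    qed
    then have "measure M (A i \<union> (\<Union>k. A (z k))) \<le> ?m x" by (rule finite_measure_mono[OF _ Us[OF x]])
    then have "measure M (A i \<union> (\<Union>k. A (z k))) \<le> ?m z" using le[OF x] zc by simp
    moreover have "measure M (A i \<union> (\<Union>k. A (z k))) = ?m z + measure M (A i - (\<Union>k. A (z k)))"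
      using finite_measure_Union'[OF Us[OF z] A[OF i]] by (simp add: Un_commute)
    ultimately have "measure M (A i - (\<Union>k. A (z k))) = 0" by (simp add: antisym)
    then have "A i - (\<Union>k. A (z k)) \<in> null_sets M"
      using A[OF i] Us[OF z] by (auto simp: null_sets_def emeasure_eq_measure)
    from AE_not_in[OF this] show ?thesis by eventually_elim auto
  qed
  then show ?thesis using z by blast
qed

context noise_spectral
begin

section \<open>Spectral measures, spectral fields and products\<close>

definition spectral_measure :: "('a \<Rightarrow> real) \<Rightarrow> 's measure" where
  "spectral_measure f = density \<mu> (\<lambda>s. ennreal ((norm (\<Psi> f s))\<^sup>2))"

lemma sets_spectral_measure [simp, measurable_cong]: "sets (spectral_measure f) = sets \<mu>"
  by (simp add: spectral_measure_def)

lemma space_spectral_measure [simp]: "space (spectral_measure f) = space \<mu>"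
  by (simp add: spectral_measure_def)

lemma emeasure_spectral_measure:
  assumes f: "f \<in> L2 M" and A: "A \<in> sets \<mu>"
  shows "emeasure (spectral_measure f) A = ennreal (ip M (Pr A f) (Pr A f))"
proof -
  have [measurable]: "(\<lambda>s. norm (\<Psi> f s)) \<in> borel_measurable \<mu>" using f by (rule \<Psi>_norm_measurable)
  have i: "integrable \<mu> (\<lambda>s. indicator A s * (norm (\<Psi> f s))\<^sup>2)"
    using integrable_mult_indicator[OF A \<Psi>_integrable[OF f]] by simp
  have "emeasure (spectral_measure f) A = (\<integral>\<^sup>+ s. ennreal ((norm (\<Psi> f s))\<^sup>2) * indicator A s \<partial>\<mu>)"
    unfolding spectral_measure_def by (rule emeasure_density) (use A in measurable)
  also have "\<dots> = (\<integral>\<^sup>+ s. ennreal (indicator A s * (norm (\<Psi> f s))\<^sup>2) \<partial>\<mu>)"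
    by (rule nn_integral_cong) (auto split: split_indicator)
  also have "\<dots> = ennreal (LINT s|\<mu>. indicator A s * (norm (\<Psi> f s))\<^sup>2)"
    by (rule nn_integral_eq_integral[OF i]) auto
  finally show ?thesis by (simp add: ip_Pr[OF A f])
qed

lemma finite_measure_spectral_measure: "f \<in> L2 M \<Longrightarrow> finite_measure (spectral_measure f)"
  by (rule finite_measureI) (simp add: emeasure_spectral_measure)

lemma AE_spectral_measure: "f \<in> L2 M \<Longrightarrow> (AE s in spectral_measure f. P s) \<longleftrightarrow> (AE s in \<mu>. \<Psi> f s \<noteq> 0 \<longrightarrow> P s)"
  unfolding spectral_measure_def using \<Psi>_norm_measurable[of f] by (subst AE_density) auto

text \<open>The spectral measure of a vector of full support is finite and has the null sets of
  \<open>\<mu>\<close>.\<close>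

lemma essential_union_\<mu>:
  assumes I: "I \<noteq> {}" and A: "\<And>i. i \<in> I \<Longrightarrow> A i \<in> sets \<mu>"
  shows "\<exists>y::nat \<Rightarrow> 'i. (\<forall>k. y k \<in> I) \<and> (\<forall>i\<in>I. AE s in \<mu>. s \<in> A i \<longrightarrow> (\<exists>k. s \<in> A (y k)))"
proof -
  obtain f where f: "f \<in> L2 M" "AE s in \<mu>. \<Psi> f s \<noteq> 0" by (rule full_support)
  interpret F: finite_measure "spectral_measure f" by (rule finite_measure_spectral_measure[OF f(1)])
  obtain y :: "nat \<Rightarrow> 'i" where y: "\<forall>k. y k \<in> I"
    and ae: "\<forall>i\<in>I. AE s in spectral_measure f. s \<in> A i \<longrightarrow> (\<exists>k. s \<in> A (y k))"
    using F.essential_union[OF I, of A] A by auto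
  have "AE s in \<mu>. s \<in> A i \<longrightarrow> (\<exists>k. s \<in> A (y k))" if "i \<in> I" for i
    using bspec[OF ae that, unfolded AE_spectral_measure[OF f(1)]] f(2) by eventually_elim blast
  then show ?thesis using y by blast
qed

abbreviation Sig :: "'a set set \<Rightarrow> 's set set" where "Sig \<equiv> spectral_field M B \<mu> \<Psi>"

lemma Sig_gen:
  assumes x: "x \<in> B"
  shows "{S (J u (cp x)) |u. u \<in> below B x} \<union> null_sets \<mu> \<subseteq> sets \<mu>"
  using x by (auto simp: below_def intro!: S_sets)

lemma Sig_sets: "x \<in> B \<Longrightarrow> Sig x \<subseteq> sets \<mu>"
  unfolding spectral_field_def by (intro sets.sigma_sets_subset Sig_gen)

lemma sigma_algebra_Sig: "x \<in> B \<Longrightarrow> sigma_algebra (space \<mu>) (Sig x)"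
  unfolding spectral_field_def
  by (rule sigma_algebra_sigma_sets[OF order_trans[OF Sig_gen sets.space_closed]])

lemma S_in_Sig:
  assumes x: "x \<in> B" and v: "v \<in> B" and "cp x \<subseteq> v" shows "S v \<in> Sig x"
proof -
  have "v \<inter> cp x = cp x" using assms(3) by auto
  then have "J (v \<inter> x) (cp x) = v" using split_B[OF v x] by simp
  then have "S v \<in> {S (J u (cp x)) |u. u \<in> below B x}"
    using x v by (intro CollectI exI[of _ "v \<inter> x"]) (auto simp: below_def)
  then show ?thesis unfolding spectral_field_def by blast
qed

text \<open>Whether a cell inside x is hit is an event of \<open>Sig x\<close>.\<close>

lemma S_cp_in_Sig: "x \<in> B \<Longrightarrow> a \<in> B \<Longrightarrow> a \<subseteq> x \<Longrightarrow> S (cp a) \<in> Sig x"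
  by (intro S_in_Sig cp_antimono) auto

lemma Pr_cong:
  assumes A: "A \<in> sets \<mu>" and f: "f \<in> L2 M" and g: "g \<in> L2 M" and ae: "AE \<omega> in M. f \<omega> = g \<omega>"
  shows "AE \<omega> in M. Pr A f \<omega> = Pr A g \<omega>"
proof (rule Pr_eqI[OF A g Pr_L2[OF A f]])
  show "AE s in \<mu>. \<Psi> (Pr A f) s = indicator A s *\<^sub>R \<Psi> g s"
    using \<Psi>_Pr[OF A f] \<Psi>_cong[OF f g ae] by eventually_elim simp
qed

lemma Pr_Int:
  assumes A: "A \<in> sets \<mu>" and C: "C \<in> sets \<mu>" and f: "f \<in> L2 M"
  shows "AE \<omega> in M. Pr A (Pr C f) \<omega> = Pr (A \<inter> C) f \<omega>"
proof (rule Pr_eqI[OF _ f])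
  show "AE s in \<mu>. \<Psi> (Pr A (Pr C f)) s = indicator (A \<inter> C) s *\<^sub>R \<Psi> f s"
    using \<Psi>_Pr[OF A Pr_L2[OF C f]] \<Psi>_Pr[OF C f] by eventually_elim (auto split: split_indicator)
qed (use A C f in \<open>auto intro: Pr_L2\<close>)

lemma Pr_compl:
  assumes A: "A \<in> sets \<mu>" and f: "f \<in> L2 M"
  shows "AE \<omega> in M. f \<omega> - Pr A f \<omega> = Pr (space \<mu> - A) f \<omega>"
proof (rule Pr_eqI[OF _ f])
  show "AE s in \<mu>. \<Psi> (\<lambda>\<omega>. f \<omega> - Pr A f \<omega>) s = indicator (space \<mu> - A) s *\<^sub>R \<Psi> f s"
    using \<Psi>_Pr[OF A f] \<Psi>_diff[OF f Pr_L2[OF A f]] AE_space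
    by eventually_elim (auto split: split_indicator)
qed (use A f in \<open>auto intro: L2_diff Pr_L2\<close>)

lemma Pr_empty: assumes f: "f \<in> L2 M" shows "AE \<omega> in M. Pr {} f \<omega> = 0"
  using \<Psi>_Pr[OF sets.empty_sets f] \<Psi>_eq_0[OF Pr_L2[OF sets.empty_sets f]] by simp

lemma Pr_diff_norm:
  assumes A: "A \<in> sets \<mu>" and C: "C \<in> sets \<mu>" and AC: "A \<subseteq> C" and f: "f \<in> L2 M"
  shows "(L2_norm M (\<lambda>\<omega>. Pr A f \<omega> - Pr C f \<omega>))\<^sup>2 = measure (spectral_measure f) (C - A)"
proof -
  have d: "(\<lambda>\<omega>. Pr C f \<omega> - Pr A f \<omega>) \<in> L2 M" using Pr_L2 A C f by (auto intro: L2_diff)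
  have "AE \<omega> in M. Pr C f \<omega> - Pr A f \<omega> = Pr (C - A) f \<omega>"
  proof (rule Pr_eqI[OF _ f d])
    show "AE s in \<mu>. \<Psi> (\<lambda>\<omega>. Pr C f \<omega> - Pr A f \<omega>) s = indicator (C - A) s *\<^sub>R \<Psi> f s"
      using \<Psi>_Pr[OF A f] \<Psi>_Pr[OF C f] \<Psi>_diff[OF Pr_L2[OF C f] Pr_L2[OF A f]]
      by eventually_elim (use AC in \<open>auto split: split_indicator\<close>)
  qed (use A C in auto)
  then have "L2_norm M (\<lambda>\<omega>. Pr C f \<omega> - Pr A f \<omega>) = L2_norm M (Pr (C - A) f)"
    by (intro L2_norm_cong_AE d Pr_L2 sets.Diff A C f)
  then have "(L2_norm M (\<lambda>\<omega>. Pr A f \<omega> - Pr C f \<omega>))\<^sup>2 = ip M (Pr (C - A) f) (Pr (C - A) f)"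
    by (simp add: L2_norm_minus_commute[of M "Pr A f"] L2_norm_square)
  then show ?thesis using A C by (simp add: measure_def emeasure_spectral_measure[OF f] ip_self_nonneg)
qed

lemma Pr_lim:
  assumes U: "\<And>n. U n \<in> sets \<mu>" and inc: "incseq U" and f: "f \<in> L2 M"
  shows "L2_lim M (\<lambda>n. Pr (U n) f) (Pr (\<Union>n. U n) f)"
proof -
  interpret F: finite_measure "spectral_measure f" by (rule finite_measure_spectral_measure[OF f])
  have V: "(\<Union>n. U n) \<in> sets \<mu>" using U by auto
  have "(\<lambda>n. measure (spectral_measure f) (U n)) \<longlonglongrightarrow> measure (spectral_measure f) (\<Union>n. U n)"
    by (rule F.finite_Lim_measure_incseq[OF _ inc]) (use U in auto)
  then have "(\<lambda>n. sqrt (measure (spectral_measure f) (\<Union>n. U n) - measure (spectral_measure f) (U n))) \<longlonglongrightarrow> sqrt (measure (spectral_measure f) (\<Union>n. U n) - measure (spectral_measure f) (\<Union>n. U n))"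
    by (intro tendsto_intros)
  moreover have "L2_norm M (\<lambda>\<omega>. Pr (U n) f \<omega> - Pr (\<Union>n. U n) f \<omega>) = sqrt (measure (spectral_measure f) (\<Union>n. U n) - measure (spectral_measure f) (U n))" for n
  proof -
    have "(L2_norm M (\<lambda>\<omega>. Pr (U n) f \<omega> - Pr (\<Union>n. U n) f \<omega>))\<^sup>2 = measure (spectral_measure f) ((\<Union>n. U n) - U n)"
      by (rule Pr_diff_norm[OF U V _ f]) auto
    also have "\<dots> = measure (spectral_measure f) (\<Union>n. U n) - measure (spectral_measure f) (U n)"
      by (rule F.finite_measure_Diff) (use U V in auto)
    finally show ?thesis by (metis L2_norm_nonneg real_sqrt_abs abs_of_nonneg)
  qed
  ultimately show ?thesis by (simp add: L2_lim_def)
qed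

lemma cexp_Pr:
  assumes x: "x \<in> B" and f: "f \<in> L2 M" shows "AE \<omega> in M. cexp M x f \<omega> = Pr (S x) f \<omega>"
  by (rule Pr_eqI[OF S_sets[OF x] f _ S_cexp[OF x f]]) (use x f in \<open>auto intro: cexp_L2\<close>)

lemma L2_lim_cong_AE:
  assumes "\<And>n. F n \<in> L2 M" "\<And>n. G n \<in> L2 M" "f \<in> L2 M" "\<And>n. AE \<omega> in M. F n \<omega> = G n \<omega>" "L2_lim M F f"
  shows "L2_lim M G f"
proof -
  have "L2_norm M (\<lambda>\<omega>. F n \<omega> - f \<omega>) = L2_norm M (\<lambda>\<omega>. G n \<omega> - f \<omega>)" for n
    by (rule L2_norm_cong_AE[OF L2_diff[OF assms(1,3)] L2_diff[OF assms(2,3)]])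
      (use assms(4)[of n] in eventually_elim, simp)
  then show ?thesis using assms(5) by (simp add: L2_lim_def)
qed

text \<open>An event of \<open>Sig x\<close> acts on the x-factor only. For a generator the
  projection is the conditional expectation given some v above the complement of x; h is measurable
  for v and comes out. The property then extends to the generated sigma-field.\<close>

lemma Pr_product:
  assumes x: "x \<in> B" and A: "A \<in> Sig x" and g: "g \<in> L2_sub M x" and h: "h \<in> L2_sub M (cp x)"
  shows "AE \<omega> in M. Pr A (\<lambda>\<omega>. g \<omega> * h \<omega>) \<omega> = Pr A g \<omega> * h \<omega>"
proof -
  note sx = B_sub[OF x] and scx = B_sub[OF cp_B[OF x]] and ind = cp_indep[OF x]
  note prod = indep_product(1)[OF sx scx ind]
  \<comment> \<open>Quantifying over all g and h allows iteration: \<open>Pr C g\<close> is again an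
    admissible first factor.\<close>
  define P where "P A \<longleftrightarrow> A \<in> sets \<mu> \<and> (\<forall>g\<in>L2_sub M x. \<forall>h\<in>L2_sub M (cp x).
      AE \<omega> in M. Pr A (\<lambda>\<omega>. g \<omega> * h \<omega>) \<omega> = Pr A g \<omega> * h \<omega>)" for A
  have PI: "P A" if "A \<in> sets \<mu>" "\<And>g h. g \<in> L2_sub M x \<Longrightarrow> h \<in> L2_sub M (cp x) \<Longrightarrow>
      AE \<omega> in M. Pr A (\<lambda>\<omega>. g \<omega> * h \<omega>) \<omega> = Pr A g \<omega> * h \<omega>" for A
    using that by (simp add: P_def)
  have Ps: "A \<in> sets \<mu>" if "P A" for A using that by (simp add: P_def)
  have PD: "AE \<omega> in M. Pr A (\<lambda>\<omega>. g \<omega> * h \<omega>) \<omega> = Pr A g \<omega> * h \<omega>"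
    if "P A" "g \<in> L2_sub M x" "h \<in> L2_sub M (cp x)" for A g h
    using that by (simp add: P_def)
  have Pc: "P (space \<mu> - A)" if A: "P A" for A
  proof (rule PI)
    show "space \<mu> - A \<in> sets \<mu>" using Ps[OF A] by auto
    fix g h assume g: "g \<in> L2_sub M x" and h: "h \<in> L2_sub M (cp x)"
    show "AE \<omega> in M. Pr (space \<mu> - A) (\<lambda>\<omega>. g \<omega> * h \<omega>) \<omega> = Pr (space \<mu> - A) g \<omega> * h \<omega>"
      using PD[OF A g h] Pr_compl[OF Ps[OF A] L2_sub_L2[OF g]] Pr_compl[OF Ps[OF A] prod[OF g h]]
    proof eventually_elim
      case (elim \<omega>)
      show ?case unfolding elim(2,3)[symmetric] elim(1) by (simp only: left_diff_distrib)
    qed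
  qed
  have Pi: "P (A \<inter> C)" if A: "P A" and C: "P C" for A C
  proof (rule PI)
    show "A \<inter> C \<in> sets \<mu>" using Ps[OF A] Ps[OF C] by auto
    fix g h assume g: "g \<in> L2_sub M x" and h: "h \<in> L2_sub M (cp x)"
    have Cg: "Pr C g \<in> L2_sub M x" by (rule Pr_L2_sub[OF Ps[OF C] x g])
    have 1: "AE \<omega> in M. Pr A (Pr C (\<lambda>\<omega>. g \<omega> * h \<omega>)) \<omega> = Pr A (\<lambda>\<omega>. Pr C g \<omega> * h \<omega>) \<omega>"
      by (rule Pr_cong[OF Ps[OF A] Pr_L2[OF Ps[OF C] prod[OF g h]] prod[OF Cg h] PD[OF C g h]])
    show "AE \<omega> in M. Pr (A \<inter> C) (\<lambda>\<omega>. g \<omega> * h \<omega>) \<omega> = Pr (A \<inter> C) g \<omega> * h \<omega>"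
      using 1 PD[OF A Cg h] Pr_Int[OF Ps[OF A] Ps[OF C] prod[OF g h]] Pr_Int[OF Ps[OF A] Ps[OF C] L2_sub_L2[OF g]]
    proof eventually_elim
      case (elim \<omega>)
      show ?case unfolding elim(3)[symmetric] elim(4)[symmetric] by (simp only: elim(1,2))
    qed
  qed
  have Pe: "P {}"
  proof (rule PI)
    fix g h assume g: "g \<in> L2_sub M x" and h: "h \<in> L2_sub M (cp x)"
    show "AE \<omega> in M. Pr {} (\<lambda>\<omega>. g \<omega> * h \<omega>) \<omega> = Pr {} g \<omega> * h \<omega>"
      using Pr_empty[OF prod[OF g h]] Pr_empty[OF L2_sub_L2[OF g]] by eventually_elim simp
  qed simp
  have Pu: "P (A \<union> C)" if A: "P A" and C: "P C" for A C
  proof -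
    have "A \<union> C = space \<mu> - ((space \<mu> - A) \<inter> (space \<mu> - C))"
      using sets.sets_into_space[OF Ps[OF A]] sets.sets_into_space[OF Ps[OF C]] by auto
    then show ?thesis using Pc[OF Pi[OF Pc[OF A] Pc[OF C]]] by simp
  qed
  \<comment> \<open>Increasing finite unions have the property, and both sides converge in L2, the
    right one by continuity of multiplication of independent factors.\<close>
  have PU: "P (\<Union>i. A i)" if A: "\<And>i. P (A i)" for A :: "nat \<Rightarrow> 's set"
  proof (rule PI)
    define U where "U n = (\<Union>i<n. A i)" for n
    have U: "P (U n)" for n
    proof (induction n)
      case 0 then show ?case by (simp add: U_def Pe)
    next
      case (Suc n)
      have "U (Suc n) = A n \<union> U n" by (auto simp: U_def less_Suc_eq)
      then show ?case using Pu[OF A Suc.IH, of n] by simp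
    qed
    have inc: "incseq U" unfolding U_def by (intro monoI) (auto intro: order_less_le_trans)
    have eq: "(\<Union>i. A i) = (\<Union>n. U n)" unfolding U_def by blast
    show V: "(\<Union>i. A i) \<in> sets \<mu>" using Ps[OF A] by auto
    note V' = V[unfolded eq]
    fix g h assume g: "g \<in> L2_sub M x" and h: "h \<in> L2_sub M (cp x)"
    note UL = Pr_L2_sub[OF Ps[OF U] x g]
    have "L2_lim M (\<lambda>n. Pr (U n) (\<lambda>\<omega>. g \<omega> * h \<omega>)) (\<lambda>\<omega>. Pr (\<Union>n. U n) g \<omega> * h \<omega>)"
    proof (rule L2_lim_cong_AE)
      show "L2_lim M (\<lambda>n \<omega>. Pr (U n) g \<omega> * h \<omega>) (\<lambda>\<omega>. Pr (\<Union>n. U n) g \<omega> * h \<omega>)"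
        by (rule L2_lim_indep_product[OF sx scx ind UL Pr_L2_sub[OF V' x g] h h
              Pr_lim[OF Ps[OF U] inc L2_sub_L2[OF g]]]) (simp add: L2_lim_def)
      show "AE \<omega> in M. Pr (U n) g \<omega> * h \<omega> = Pr (U n) (\<lambda>\<omega>. g \<omega> * h \<omega>) \<omega>" for n
        using PD[OF U[of n] g h] by eventually_elim simp
    qed (use prod[OF UL h] prod[OF Pr_L2_sub[OF V' x g] h] Pr_L2[OF Ps[OF U] prod[OF g h]] in auto)
    from L2_lim_unique[OF Pr_L2[OF Ps[OF U] prod[OF g h]] Pr_L2[OF V' prod[OF g h]]
        prod[OF Pr_L2_sub[OF V' x g] h] Pr_lim[OF Ps[OF U] inc prod[OF g h]] this]
    show "AE \<omega> in M. Pr (\<Union>i. A i) (\<lambda>\<omega>. g \<omega> * h \<omega>) \<omega> = Pr (\<Union>i. A i) g \<omega> * h \<omega>" unfolding eq .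
  qed
  have "P A"
    using A unfolding spectral_field_def
  proof (induction rule: sigma_sets.induct)
    case (Basic A)
    then consider u where "u \<in> below B x" "A = S (J u (cp x))" | "A \<in> null_sets \<mu>" by auto
    then show ?case
    proof cases
      case 1
      define v where "v = J u (cp x)"
      have v: "v \<in> B" using 1(1) x by (simp add: v_def below_def)
      have cv: "cp x \<subseteq> v" unfolding v_def by (rule join_field_upper(2))
      show ?thesis
      proof (rule PI)
        show "A \<in> sets \<mu>" using 1(2) v by (simp add: v_def[symmetric] S_sets)
        fix g h assume g: "g \<in> L2_sub M x" and h: "h \<in> L2_sub M (cp x)"
        have hv: "h \<in> L2_sub M v" by (rule L2_sub_mono[OF scx B_sub[OF v] cv h])
        have "AE \<omega> in M. cexp M v (\<lambda>\<omega>. h \<omega> * g \<omega>) \<omega> = h \<omega> * cexp M v g \<omega>"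
          by (rule cexp_pull_out[OF B_sub[OF v] hv L2_sub_L2[OF g]]) (use prod[OF g h] in \<open>simp add: mult.commute\<close>)
        with cexp_Pr[OF v prod[OF g h]] cexp_Pr[OF v L2_sub_L2[OF g]]
        show "AE \<omega> in M. Pr A (\<lambda>\<omega>. g \<omega> * h \<omega>) \<omega> = Pr A g \<omega> * h \<omega>"
          unfolding 1(2) v_def[symmetric] by eventually_elim (simp add: mult.commute)
      qed
    next
      case 2
      have z: "AE \<omega> in M. Pr A f \<omega> = 0" if f: "f \<in> L2 M" for f
      proof -
        have "AE s in \<mu>. \<Psi> (Pr A f) s = 0"
          using AE_not_in[OF 2] \<Psi>_Pr[OF null_setsD2[OF 2] f] by eventually_elim simp
        then show ?thesis using \<Psi>_eq_0[OF Pr_L2[OF null_setsD2[OF 2] f]] by simp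
      qed
      show ?thesis
      proof (rule PI[OF null_setsD2[OF 2]])
        fix g h assume g: "g \<in> L2_sub M x" and h: "h \<in> L2_sub M (cp x)"
        show "AE \<omega> in M. Pr A (\<lambda>\<omega>. g \<omega> * h \<omega>) \<omega> = Pr A g \<omega> * h \<omega>"
          using z[OF prod[OF g h]] z[OF L2_sub_L2[OF g]] by eventually_elim simp
      qed
    qed
  next
    case Empty show ?case by (rule Pe)
  next
    case (Compl A) from Pc[OF Compl.IH] show ?case .
  next
    case (Union A) from PU[OF Union.IH] show ?case .
  qed
  from PD[OF this g h] show ?thesis .
qed

text \<open>One factor at a time: \<open>Pr_product\<close> is used for x and for its complement,
  whose own complement is x again.\<close>

lemma Pr_product2:
  assumes x: "x \<in> B" and A: "A \<in> Sig x" and C: "C \<in> Sig (cp x)" and g: "g \<in> L2_sub M x" and h: "h \<in> L2_sub M (cp x)"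
  shows "AE \<omega> in M. Pr (A \<inter> C) (\<lambda>\<omega>. g \<omega> * h \<omega>) \<omega> = Pr A g \<omega> * Pr C h \<omega>"
proof -
  note sx = B_sub[OF x] and scx = B_sub[OF cp_B[OF x]]
  note prod = indep_product(1)[OF sx scx cp_indep[OF x]]
  have A': "A \<in> sets \<mu>" and C': "C \<in> sets \<mu>" using A C x Sig_sets[OF x] Sig_sets[OF cp_B[OF x]] by auto
  have Ch: "Pr C h \<in> L2_sub M (cp x)" using x by (intro Pr_L2_sub C' h) auto
  have hg: "AE \<omega> in M. Pr C (\<lambda>\<omega>. g \<omega> * h \<omega>) \<omega> = g \<omega> * Pr C h \<omega>"
    using Pr_product[OF cp_B[OF x] C h, of g] g x by (simp add: mult.commute)
  have 1: "AE \<omega> in M. Pr A (Pr C (\<lambda>\<omega>. g \<omega> * h \<omega>)) \<omega> = Pr A (\<lambda>\<omega>. g \<omega> * Pr C h \<omega>) \<omega>"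
    by (rule Pr_cong[OF A' Pr_L2[OF C' prod[OF g h]] prod[OF g Ch] hg])
  from 1 Pr_product[OF x A g Ch] Pr_Int[OF A' C' prod[OF g h]]
  show ?thesis by eventually_elim simp
qed

text \<open>The range of the projection to \<open>Bot\<close> consists of the constants. Two
  disjoint non-null parts of \<open>S Bot\<close> would give two orthogonal non-zero
  constants.\<close>

lemma S_Bot_atom:
  assumes A: "A \<in> sets \<mu>" shows "(AE s in \<mu>. s \<in> S Bot \<longrightarrow> s \<in> A) \<or> (AE s in \<mu>. s \<in> S Bot \<longrightarrow> s \<notin> A)"
proof -
  obtain f where f: "f \<in> L2 M" "AE s in \<mu>. \<Psi> f s \<noteq> 0" by (rule full_support)
  let ?p = "Pr (S Bot \<inter> A) f" and ?q = "Pr (S Bot - A) f"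
  have SB: "S Bot \<in> sets \<mu>" by (rule S_sets) simp
  have AS: "S Bot \<inter> A \<in> sets \<mu>" "S Bot - A \<in> sets \<mu>" using A SB by auto
  have const: "AE \<omega> in M. Pr C f \<omega> = expectation (Pr C f)" if "C \<subseteq> S Bot" "C \<in> sets \<mu>" for C
  proof -
    have "AE s in \<mu>. \<Psi> (Pr C f) s \<noteq> 0 \<longrightarrow> s \<in> S Bot"
      using \<Psi>_Pr[OF that(2) f(1)]
      by eventually_elim (use that(1) in \<open>auto split: split_indicator_asm\<close>)
    then have "Pr C f \<in> L2_sub M Bot" using L2_sub_iff_\<Psi>[OF Bot_B Pr_L2[OF that(2) f(1)]] by simp
    from L2_sub_AE[OF this] cexp_Bot[OF Pr_L2[OF that(2) f(1)]] show ?thesis by eventually_elim simp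
  qed
  have z: "AE s in \<mu>. s \<in> S Bot \<longrightarrow> s \<notin> C" if C: "C \<subseteq> S Bot" "C \<in> sets \<mu>" and 0: "expectation (Pr C f) = 0" for C
  proof -
    have "AE \<omega> in M. Pr C f \<omega> = 0" using const[OF C] 0 by simp
    then have "AE s in \<mu>. \<Psi> (Pr C f) s = 0" using \<Psi>_eq_0[OF Pr_L2[OF C(2) f(1)]] by simp
    with \<Psi>_Pr[OF C(2) f(1)] f(2) show ?thesis by eventually_elim (auto split: split_indicator_asm)
  qed
  have "AE s in \<mu>. \<Psi> ?p s \<bullet> \<Psi> ?q s = 0"
    using \<Psi>_Pr[OF AS(1) f(1)] \<Psi>_Pr[OF AS(2) f(1)] by eventually_elim (auto split: split_indicator)
  then have "(LINT s|\<mu>. \<Psi> ?p s \<bullet> \<Psi> ?q s) = 0" by (rule integral_eq_zero_AE)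
  then have "ip M ?p ?q = 0" using \<Psi>_inner(2)[OF Pr_L2[OF AS(1) f(1)] Pr_L2[OF AS(2) f(1)]] by simp
  moreover have "ip M ?p ?q = ip M (\<lambda>_. expectation ?p) (\<lambda>_. expectation ?q)"
    by (rule ip_cong_AE) (use AS f(1) const in \<open>auto intro!: Pr_L2 L2_const\<close>)
  ultimately have "expectation ?p * expectation ?q = 0" by (simp add: ip_def prob_space)
  then consider "expectation ?p = 0" | "expectation ?q = 0" by auto
  then show ?thesis
  proof cases
    case 1
    from z[OF _ AS(1) 1] have "AE s in \<mu>. s \<in> S Bot \<longrightarrow> s \<notin> A" by auto
    then show ?thesis ..
  next
    case 2
    from z[OF _ AS(2) 2] have "AE s in \<mu>. s \<in> S Bot \<longrightarrow> s \<in> A" by auto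
    then show ?thesis ..
  qed
qed

lemma S_Bot_nonnull: "\<not> (AE s in \<mu>. s \<notin> S Bot)"
proof
  assume a: "AE s in \<mu>. s \<notin> S Bot"
  have "(\<lambda>\<omega>. 1) \<in> L2_sub M Bot" by (rule L2_sub_const) simp
  then have "AE s in \<mu>. \<Psi> (\<lambda>\<omega>. 1) s \<noteq> 0 \<longrightarrow> s \<in> S Bot" using L2_sub_iff_\<Psi>[OF Bot_B L2_const] by simp
  with a have "AE s in \<mu>. \<Psi> (\<lambda>\<omega>. 1) s = 0" by eventually_elim blast
  then have "AE \<omega> in M. (1::real) = 0" using \<Psi>_eq_0[OF L2_const, of 1] by simp
  then show False by simp
qed

section \<open>The point of the trivial field\<close>

abbreviation ept :: 's where "ept \<equiv> empty_point M \<mu> \<Psi>"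

text \<open>An atom of a standard measure sits at a point: each set of a countable base, or its
  complement, contains \<open>S Bot\<close> up to a null set, and the intersection of these
  countably many choices cannot contain two points of a Hausdorff space.\<close>

lemma empty_point: "{ept} \<in> sets \<mu>" "AE s in \<mu>. s \<in> S Bot \<longleftrightarrow> s = ept"
proof -
  obtain N where N: "standard_borel N" "space N \<in> sets \<mu>" "space \<mu> - space N \<in> null_sets \<mu>"
    "\<And>A. A \<in> sets N \<Longrightarrow> A \<in> sets \<mu> \<and> emeasure \<mu> A = emeasure N A"
    using standard_part by metis
  obtain X where X: "completely_metrizable_space X" "second_countable X" "space N = topspace X"
    "sets N = sigma_sets (topspace X) {U. openin X U}"
    using N(1) by (auto simp: standard_borel_def)
  obtain \<V> where V: "countable \<V>" "\<forall>V\<in>\<V>. openin X V" "\<forall>U x. openin X U \<and> x \<in> U \<longrightarrow> (\<exists>V\<in>\<V>. x \<in> V \<and> V \<subseteq> U)"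
    using X(2) unfolding second_countable_def by blast
  have Vs: "V \<in> sets \<mu>" if "V \<in> \<V>" for V
    using V(2) that N(4) X(4) by auto
  \<comment> \<open>Of V and its complement, the one that carries \<open>S Bot\<close>;
    \<open>S_Bot_atom\<close> guarantees that one of them does.\<close>
  define good where "good V = (if AE s in \<mu>. s \<in> S Bot \<longrightarrow> s \<in> V then V else space \<mu> - V)" for V
  have good_s: "good V \<in> sets \<mu>" if "V \<in> \<V>" for V using Vs[OF that] by (auto simp: good_def)
  have good_AE: "AE s in \<mu>. s \<in> S Bot \<longrightarrow> s \<in> good V" if "V \<in> \<V>" for V
  proof (cases "AE s in \<mu>. s \<in> S Bot \<longrightarrow> s \<in> V")
    case False
    then have "AE s in \<mu>. s \<in> S Bot \<longrightarrow> s \<notin> V" using S_Bot_atom[OF Vs[OF that]] by simp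
    with AE_space show ?thesis by eventually_elim (use False in \<open>auto simp: good_def\<close>)
  qed (simp add: good_def)
  have SB: "S Bot \<in> sets \<mu>" by (rule S_sets) simp
  define G where "G = S Bot \<inter> space N \<inter> {s \<in> space \<mu>. \<forall>V\<in>\<V>. s \<in> good V}"
  have "{s \<in> space \<mu>. \<forall>V\<in>\<V>. s \<in> good V} = space \<mu> - (\<Union>V\<in>\<V>. space \<mu> - good V)" by auto
  moreover have "(\<Union>V\<in>\<V>. space \<mu> - good V) \<in> sets \<mu>"
    by (rule sets.countable_UN'[OF V(1)]) (use good_s in auto)
  ultimately have "{s \<in> space \<mu>. \<forall>V\<in>\<V>. s \<in> good V} \<in> sets \<mu>" by simp
  then have Gs: "G \<in> sets \<mu>" using SB N(2) by (auto simp: G_def)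
  have "AE s in \<mu>. \<forall>V\<in>\<V>. s \<in> S Bot \<longrightarrow> s \<in> good V"
    by (subst AE_ball_countable[OF V(1)]) (intro ballI good_AE)
  with AE_not_in[OF N(3)] AE_space have SG: "AE s in \<mu>. s \<in> S Bot \<longrightarrow> s \<in> G"
    by eventually_elim (auto simp: G_def)
  \<comment> \<open>\<open>G\<close> contains almost all of \<open>S Bot\<close>, which is not a
    null set.\<close>
  have "G \<noteq> {}" using SG S_Bot_nonnull by auto
  then obtain p where p: "p \<in> G" by auto
  then have pS: "p \<in> S Bot" by (simp add: G_def)
  have "q = p" if q: "q \<in> G" for q
  proof (rule ccontr)
    assume ne: "q \<noteq> p"
    have "Hausdorff_space X" using X(1) completely_metrizable_imp_metrizable_space metrizable_imp_Hausdorff_space by blast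
    moreover have "p \<in> topspace X" "q \<in> topspace X" using p q X(3) by (auto simp: G_def)
    ultimately obtain U where "openin X U" "p \<in> U" "q \<notin> U"
      using ne unfolding Hausdorff_space_def disjnt_iff by metis
    then obtain V where V': "V \<in> \<V>" "p \<in> V" "q \<notin> V" using V(3) by blast
    have "p \<in> good V" "q \<in> good V" using p q V' by (auto simp: G_def)
    then show False using V' by (auto simp: good_def split: if_splits)
  qed
  then have Gp: "G = {p}" using p by blast
  have ae: "AE s in \<mu>. s \<in> S Bot \<longleftrightarrow> s = p"
    using SG by eventually_elim (use pS Gp in auto)
  have "ept = p"
    unfolding empty_point_def
  proof (rule the_equality)
    show "p \<in> space \<mu> \<and> (AE s in \<mu>. s \<in> S Bot \<longleftrightarrow> s = p)"
      using ae p sets.sets_into_space[OF Gs] by auto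
    fix q assume q: "q \<in> space \<mu> \<and> (AE s in \<mu>. s \<in> S Bot \<longleftrightarrow> s = q)"
    show "q = p"
    proof (rule ccontr)
      assume "q \<noteq> p"
      from ae conjunct2[OF q] have "AE s in \<mu>. s \<notin> S Bot"
        by eventually_elim (use \<open>q \<noteq> p\<close> in auto)
      then show False using S_Bot_nonnull by simp
    qed
  qed
  then show "{ept} \<in> sets \<mu>" "AE s in \<mu>. s \<in> S Bot \<longleftrightarrow> s = ept" using ae Gs Gp by auto
qed

section \<open>Tight vectors\<close>

text \<open>
  Partitions are encoded by lists: \<open>zs\<close> splits \<open>a\<close> into the meets of \<open>a\<close> with \<open>z\<close> or \<open>cp z\<close>, \<open>z\<close> running
  through \<open>zs\<close>. Some cells may be trivial; they are never hit. The weight is \<open>\<rho>\<close> to the number of cells hit.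
\<close>

primrec hit_weight :: "real \<Rightarrow> 'a set set list \<Rightarrow> 'a set set \<Rightarrow> 's \<Rightarrow> real" where
  "hit_weight \<rho> [] a s = \<rho> + (1 - \<rho>) * indicator (S (cp a)) s"
| "hit_weight \<rho> (z # zs) a s = hit_weight \<rho> zs (a \<inter> z) s * hit_weight \<rho> zs (a \<inter> cp z) s"

primrec markov :: "real \<Rightarrow> 'a set set list \<Rightarrow> 'a set set \<Rightarrow> ('a \<Rightarrow> real) \<Rightarrow> 'a \<Rightarrow> real" where
  "markov \<rho> [] a f = (\<lambda>\<omega>. \<rho> * f \<omega> + (1 - \<rho>) * cexp M (cp a) f \<omega>)"
| "markov \<rho> (z # zs) a f = markov \<rho> zs (a \<inter> z) (markov \<rho> zs (a \<inter> cp z) f)"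

lemma hit_weight_measurable: "set zs \<subseteq> B \<Longrightarrow> a \<in> B \<Longrightarrow> hit_weight \<rho> zs a \<in> borel_measurable \<mu>"
proof (induction zs arbitrary: a)
  case Nil
  have [measurable]: "S (cp a) \<in> sets \<mu>" using Nil by (intro S_sets) simp
  show ?case unfolding hit_weight.simps[abs_def] by measurable
next
  case (Cons z zs)
  then show ?case unfolding hit_weight.simps[abs_def] by (intro borel_measurable_times) auto
qed

lemma hit_weight_mono: "0 \<le> \<rho> \<Longrightarrow> \<rho> \<le> \<sigma> \<Longrightarrow> \<sigma> \<le> 1 \<Longrightarrow> 0 \<le> hit_weight \<rho> zs a s \<and> hit_weight \<rho> zs a s \<le> hit_weight \<sigma> zs a s \<and> hit_weight \<sigma> zs a s \<le> 1"
proof (induction zs arbitrary: a)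
  case Nil then show ?case by (auto split: split_indicator)
next
  case (Cons z zs)
  from Cons.IH[OF Cons.prems, of "a \<inter> z"] Cons.IH[OF Cons.prems, of "a \<inter> cp z"]
  have "0 \<le> hit_weight \<rho> zs (a \<inter> z) s" "hit_weight \<rho> zs (a \<inter> z) s \<le> hit_weight \<sigma> zs (a \<inter> z) s" "hit_weight \<sigma> zs (a \<inter> z) s \<le> 1"
    "0 \<le> hit_weight \<rho> zs (a \<inter> cp z) s" "hit_weight \<rho> zs (a \<inter> cp z) s \<le> hit_weight \<sigma> zs (a \<inter> cp z) s" "hit_weight \<sigma> zs (a \<inter> cp z) s \<le> 1"
    by auto
  then show ?case by (auto intro!: mult_mono mult_le_one)
qed

lemma hit_weight_bounds: "0 \<le> \<rho> \<Longrightarrow> \<rho> \<le> 1 \<Longrightarrow> 0 \<le> hit_weight \<rho> zs a s" "0 \<le> \<rho> \<Longrightarrow> \<rho> \<le> 1 \<Longrightarrow> hit_weight \<rho> zs a s \<le> 1"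
  using hit_weight_mono[of \<rho> \<rho> zs a s] by auto

lemma markov_L2: "set zs \<subseteq> B \<Longrightarrow> a \<in> B \<Longrightarrow> f \<in> L2 M \<Longrightarrow> markov \<rho> zs a f \<in> L2 M"
  by (induction zs arbitrary: a f) (auto intro!: L2_lin cexp_L2)

text \<open>All factors are diagonal at once under \<open>\<Psi>\<close>, so the order of
  composition in the recursion is immaterial.\<close>

lemma \<Psi>_markov:
  "set zs \<subseteq> B \<Longrightarrow> a \<in> B \<Longrightarrow> f \<in> L2 M \<Longrightarrow> AE s in \<mu>. \<Psi> (markov \<rho> zs a f) s = hit_weight \<rho> zs a s *\<^sub>R \<Psi> f s"
proof (induction zs arbitrary: a f)
  case Nil
  then have c: "cp a \<in> B" "cexp M (cp a) f \<in> L2 M" by (auto intro!: cexp_L2)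
  have "AE s in \<mu>. \<Psi> (\<lambda>\<omega>. \<rho> * f \<omega> + (1 - \<rho>) * cexp M (cp a) f \<omega>) s = \<rho> *\<^sub>R \<Psi> f s + (1 - \<rho>) *\<^sub>R \<Psi> (cexp M (cp a) f) s"
    by (rule \<Psi>_lin[OF Nil(3) c(2)])
  with S_cexp[OF c(1) Nil(3)] show ?case
    unfolding markov.simps by eventually_elim (simp add: scaleR_left_distrib)
next
  case (Cons z zs)
  then have z: "set zs \<subseteq> B" "a \<inter> z \<in> B" "a \<inter> cp z \<in> B" by auto
  from Cons.IH[OF z(1,3) Cons.prems(3)] Cons.IH[OF z(1,2) markov_L2[OF z(1,3) Cons.prems(3)], of \<rho>]
  show ?case unfolding markov.simps by eventually_elim (simp add: mult.commute)
qed

text \<open>Each factor is a convex combination of the identity and a conditional expectation, hence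
  positive.\<close>

lemma markov_mono:
  "set zs \<subseteq> B \<Longrightarrow> a \<in> B \<Longrightarrow> f \<in> L2 M \<Longrightarrow> g \<in> L2 M \<Longrightarrow> 0 \<le> \<rho> \<Longrightarrow> \<rho> \<le> 1 \<Longrightarrow> AE \<omega> in M. f \<omega> \<le> g \<omega> \<Longrightarrow>
   AE \<omega> in M. markov \<rho> zs a f \<omega> \<le> markov \<rho> zs a g \<omega>"
proof (induction zs arbitrary: a f g)
  case Nil
  have "AE \<omega> in M. cexp M (cp a) f \<omega> \<le> cexp M (cp a) g \<omega>"
    by (rule cexp_mono) (use Nil in auto)
  with Nil(7) show ?case
    unfolding markov.simps by eventually_elim (use Nil(5,6) in \<open>auto intro!: add_mono mult_left_mono\<close>)
next
  case (Cons z zs)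
  then show ?case unfolding markov.simps by (intro Cons.IH markov_L2) auto
qed

text \<open>Together with monotonicity this yields \<bar>T f\<bar> \<le> T \<bar>f\<bar>, the
  inequality behind \<open>defect_abs\<close>.\<close>

lemma markov_minus:
  assumes zs: "set zs \<subseteq> B" and a: "a \<in> B" and f: "f \<in> L2 M"
  shows "AE \<omega> in M. markov \<rho> zs a (\<lambda>\<omega>. - 1 * f \<omega>) \<omega> = - 1 * markov \<rho> zs a f \<omega>"
proof (rule \<Psi>_inj)
  have m: "(\<lambda>\<omega>. - 1 * f \<omega>) \<in> L2 M" "(\<lambda>\<omega>. - 1 * markov \<rho> zs a f \<omega>) \<in> L2 M"
    using L2_scale[OF f, of "-1"] L2_scale[OF markov_L2[OF zs a f], of "-1" \<rho>] by auto
  show "markov \<rho> zs a (\<lambda>\<omega>. - 1 * f \<omega>) \<in> L2 M" by (rule markov_L2[OF zs a m(1)])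
  show "(\<lambda>\<omega>. - 1 * markov \<rho> zs a f \<omega>) \<in> L2 M" by (rule m(2))
  have "AE s in \<mu>. \<Psi> (\<lambda>\<omega>. - 1 * f \<omega>) s = - \<Psi> f s" using \<Psi>_lin[OF f f, of "-1" 0] by simp
  moreover have "AE s in \<mu>. \<Psi> (\<lambda>\<omega>. - 1 * markov \<rho> zs a f \<omega>) s = - \<Psi> (markov \<rho> zs a f) s"
    using \<Psi>_lin[OF markov_L2[OF zs a f] markov_L2[OF zs a f], of "-1" \<rho> 0 \<rho>] by simp
  ultimately show "AE s in \<mu>. \<Psi> (markov \<rho> zs a (\<lambda>\<omega>. - 1 * f \<omega>)) s = \<Psi> (\<lambda>\<omega>. - 1 * markov \<rho> zs a f \<omega>) s"
    using \<Psi>_markov[OF zs a m(1), of \<rho>] \<Psi>_markov[OF zs a f, of \<rho>] by eventually_elim simp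
qed

text \<open>This is the quadratic form <f - T f, f>, see \<open>defect_ip\<close>. The spectral
  expression shows its dependence on \<open>\<rho>\<close> and on the partition, the operator
  expression its behaviour under absolute values.\<close>

definition defect :: "real \<Rightarrow> 'a set set list \<Rightarrow> ('a \<Rightarrow> real) \<Rightarrow> real" where
  "defect \<rho> zs f = (LINT s|\<mu>. (1 - hit_weight \<rho> zs (sets M) s) * (norm (\<Psi> f s))\<^sup>2)"

lemma hit_weight_integrable:
  assumes zs: "set zs \<subseteq> B" and a: "a \<in> B" and f: "f \<in> L2 M" and r: "0 \<le> \<rho>" "\<rho> \<le> 1"
  shows "integrable \<mu> (\<lambda>s. hit_weight \<rho> zs a s * (norm (\<Psi> f s))\<^sup>2)" "integrable \<mu> (\<lambda>s. (1 - hit_weight \<rho> zs a s) * (norm (\<Psi> f s))\<^sup>2)"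
proof -
  have m: "hit_weight \<rho> zs a \<in> borel_measurable \<mu>" "(\<lambda>s. norm (\<Psi> f s)) \<in> borel_measurable \<mu>"
    using hit_weight_measurable[OF zs a] \<Psi>_norm_measurable[OF f] by auto
  show 1: "integrable \<mu> (\<lambda>s. hit_weight \<rho> zs a s * (norm (\<Psi> f s))\<^sup>2)"
    by (rule Bochner_Integration.integrable_bound[OF \<Psi>_integrable[OF f]])
      (use m hit_weight_bounds[OF r, of zs a] in \<open>auto simp: abs_mult intro!: AE_I2 mult_left_le_one_le\<close>)
  have "integrable \<mu> (\<lambda>s. (norm (\<Psi> f s))\<^sup>2 - hit_weight \<rho> zs a s * (norm (\<Psi> f s))\<^sup>2)"
    by (intro Bochner_Integration.integrable_diff 1 \<Psi>_integrable[OF f])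
  then show "integrable \<mu> (\<lambda>s. (1 - hit_weight \<rho> zs a s) * (norm (\<Psi> f s))\<^sup>2)" by (simp add: left_diff_distrib)
qed

lemma defect_ip:
  assumes zs: "set zs \<subseteq> B" and f: "f \<in> L2 M" and r: "0 \<le> \<rho>" "\<rho> \<le> 1"
  shows "defect \<rho> zs f = ip M f f - ip M (markov \<rho> zs (sets M) f) f"
proof -
  note i = hit_weight_integrable[OF zs top_B f r]
  have T: "markov \<rho> zs (sets M) f \<in> L2 M" by (rule markov_L2[OF zs top_B f])
  have "ip M (markov \<rho> zs (sets M) f) f = (LINT s|\<mu>. \<Psi> (markov \<rho> zs (sets M) f) s \<bullet> \<Psi> f s)"
    by (rule \<Psi>_inner(2)[OF T f, symmetric])
  also have "\<dots> = (LINT s|\<mu>. hit_weight \<rho> zs (sets M) s * (norm (\<Psi> f s))\<^sup>2)"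
  proof (rule integral_cong_AE)
    show "AE s in \<mu>. \<Psi> (markov \<rho> zs (sets M) f) s \<bullet> \<Psi> f s = hit_weight \<rho> zs (sets M) s * (norm (\<Psi> f s))\<^sup>2"
      using \<Psi>_markov[OF zs top_B f, of \<rho>] by eventually_elim (simp add: dot_square_norm)
  qed (use \<Psi>_inner(1)[OF T f] i(1) in auto)
  finally have "ip M (markov \<rho> zs (sets M) f) f = \<dots>" .
  moreover have "defect \<rho> zs f = (LINT s|\<mu>. (norm (\<Psi> f s))\<^sup>2 - hit_weight \<rho> zs (sets M) s * (norm (\<Psi> f s))\<^sup>2)"
    by (simp add: defect_def left_diff_distrib)
  ultimately show ?thesis using i(1) \<Psi>_integrable[OF f] \<Psi>_iso[OF f] by simp
qed

text \<open>A symmetric Markov operator contracts the quadratic form \<open>f \<mapsto> \<langle>f - T f, f\<rangle>\<close> under \<open>f \<mapsto> \<bar>f\<bar>\<close>.\<close>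

lemma defect_abs:
  assumes zs: "set zs \<subseteq> B" and f: "f \<in> L2 M" and r: "0 \<le> \<rho>" "\<rho> \<le> 1"
  shows "defect \<rho> zs (\<lambda>\<omega>. \<bar>f \<omega>\<bar>) \<le> defect \<rho> zs f"
proof -
  let ?T = "markov \<rho> zs (sets M)" and ?f = "\<lambda>\<omega>. \<bar>f \<omega>\<bar>"
  note af = L2_abs[OF f] and T = markov_L2[OF zs top_B]
  have m: "(\<lambda>\<omega>. - 1 * f \<omega>) \<in> L2 M" using L2_scale[OF f, of "-1"] .
  have 1: "AE \<omega> in M. ?T f \<omega> \<le> ?T ?f \<omega>" by (rule markov_mono[OF zs top_B f af r]) simp
  have 2: "AE \<omega> in M. ?T (\<lambda>\<omega>. - 1 * f \<omega>) \<omega> \<le> ?T ?f \<omega>" by (rule markov_mono[OF zs top_B m af r]) simp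
  have "ip M (?T f) f \<le> ip M (?T ?f) ?f"
    unfolding ip_def
  proof (rule integral_mono_AE)
    show "AE \<omega> in M. ?T f \<omega> * f \<omega> \<le> ?T ?f \<omega> * \<bar>f \<omega>\<bar>"
      using 1 2 markov_minus[OF zs top_B f, of \<rho>]
    proof eventually_elim
      case (elim \<omega>)
      then have "\<bar>?T f \<omega>\<bar> \<le> ?T ?f \<omega>" by simp
      then have "\<bar>?T f \<omega>\<bar> * \<bar>f \<omega>\<bar> \<le> ?T ?f \<omega> * \<bar>f \<omega>\<bar>" by (intro mult_right_mono) auto
      moreover have "?T f \<omega> * f \<omega> \<le> \<bar>?T f \<omega>\<bar> * \<bar>f \<omega>\<bar>" by (simp add: abs_mult[symmetric])
      ultimately show ?case by linarith
    qed
  qed (use L2_integrable_mult[OF T[OF f] f] L2_integrable_mult[OF T[OF af] af] in auto)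
  moreover have "ip M ?f ?f = ip M f f" by (simp add: ip_def)
  ultimately show ?thesis by (simp add: defect_ip[OF zs _ r] f af)
qed

lemma defect_le_norm:
  assumes zs: "set zs \<subseteq> B" and f: "f \<in> L2 M" and r: "0 \<le> \<rho>" "\<rho> \<le> 1"
  shows "defect \<rho> zs f \<le> (L2_norm M f)\<^sup>2"
proof -
  have "defect \<rho> zs f \<le> (LINT s|\<mu>. (norm (\<Psi> f s))\<^sup>2)"
    unfolding defect_def
    by (rule integral_mono[OF hit_weight_integrable(2)[OF zs top_B f r] \<Psi>_integrable[OF f]])
      (use hit_weight_bounds[OF r, of zs "sets M"] in \<open>auto intro: mult_left_le_one_le\<close>)
  then show ?thesis by (simp add: \<Psi>_iso[OF f] L2_norm_square)
qed

lemma defect_antimono: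
  assumes zs: "set zs \<subseteq> B" and f: "f \<in> L2 M" and r: "0 \<le> \<rho>" "\<rho> \<le> \<sigma>" "\<sigma> \<le> 1"
  shows "defect \<sigma> zs f \<le> defect \<rho> zs f"
  unfolding defect_def
proof (rule integral_mono)
  show "integrable \<mu> (\<lambda>s. (1 - hit_weight \<sigma> zs (sets M) s) * (norm (\<Psi> f s))\<^sup>2)"
    "integrable \<mu> (\<lambda>s. (1 - hit_weight \<rho> zs (sets M) s) * (norm (\<Psi> f s))\<^sup>2)"
    using hit_weight_integrable(2)[OF zs top_B f] r by auto
  show "(1 - hit_weight \<sigma> zs (sets M) s) * (norm (\<Psi> f s))\<^sup>2 \<le> (1 - hit_weight \<rho> zs (sets M) s) * (norm (\<Psi> f s))\<^sup>2" for s
    using hit_weight_mono[OF r, of zs "sets M" s] by (intro mult_right_mono) auto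
qed

lemma defect_lin:
  assumes zs: "set zs \<subseteq> B" and f: "f \<in> L2 M" and g: "g \<in> L2 M" and r: "0 \<le> \<rho>" "\<rho> \<le> 1"
  shows "defect \<rho> zs (\<lambda>\<omega>. a * f \<omega> + b * g \<omega>) \<le> 2 * a\<^sup>2 * defect \<rho> zs f + 2 * b\<^sup>2 * defect \<rho> zs g"
proof -
  note i = hit_weight_integrable(2)[OF zs top_B _ r]
  have n: "(norm (a *\<^sub>R u + b *\<^sub>R v))\<^sup>2 \<le> 2 * a\<^sup>2 * (norm u)\<^sup>2 + 2 * b\<^sup>2 * (norm v)\<^sup>2" for u v :: 'h
  proof -
    have "(norm (a *\<^sub>R u + b *\<^sub>R v))\<^sup>2 \<le> (\<bar>a\<bar> * norm u + \<bar>b\<bar> * norm v)\<^sup>2"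
      using norm_triangle_ineq[of "a *\<^sub>R u" "b *\<^sub>R v"] by (intro power_mono) auto
    also have "\<dots> \<le> 2 * (\<bar>a\<bar> * norm u)\<^sup>2 + 2 * (\<bar>b\<bar> * norm v)\<^sup>2"
      using sum_squares_bound[of "\<bar>a\<bar> * norm u" "\<bar>b\<bar> * norm v"] by (simp add: power2_sum)
    finally show ?thesis by (simp add: power_mult_distrib)
  qed
  have "defect \<rho> zs (\<lambda>\<omega>. a * f \<omega> + b * g \<omega>) \<le> (LINT s|\<mu>. 2 * a\<^sup>2 * ((1 - hit_weight \<rho> zs (sets M) s) * (norm (\<Psi> f s))\<^sup>2) +
      2 * b\<^sup>2 * ((1 - hit_weight \<rho> zs (sets M) s) * (norm (\<Psi> g s))\<^sup>2))"
    unfolding defect_def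
  proof (rule integral_mono_AE[OF i[OF L2_lin[OF f g]]])
    show "AE s in \<mu>. (1 - hit_weight \<rho> zs (sets M) s) * (norm (\<Psi> (\<lambda>\<omega>. a * f \<omega> + b * g \<omega>) s))\<^sup>2 \<le>
       2 * a\<^sup>2 * ((1 - hit_weight \<rho> zs (sets M) s) * (norm (\<Psi> f s))\<^sup>2) +
       2 * b\<^sup>2 * ((1 - hit_weight \<rho> zs (sets M) s) * (norm (\<Psi> g s))\<^sup>2)"
      using \<Psi>_lin[OF f g, of a b]
    proof eventually_elim
      case (elim s)
      have "(1 - hit_weight \<rho> zs (sets M) s) * (norm (\<Psi> (\<lambda>\<omega>. a * f \<omega> + b * g \<omega>) s))\<^sup>2 \<le>
          (1 - hit_weight \<rho> zs (sets M) s) * (2 * a\<^sup>2 * (norm (\<Psi> f s))\<^sup>2 + 2 * b\<^sup>2 * (norm (\<Psi> g s))\<^sup>2)"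
        unfolding elim using hit_weight_bounds(2)[OF r, of zs "sets M" s] n by (intro mult_left_mono) auto
      then show ?case by (simp add: algebra_simps)
    qed
  qed (use i[OF f] i[OF g] in auto)
  also have "\<dots> = 2 * a\<^sup>2 * defect \<rho> zs f + 2 * b\<^sup>2 * defect \<rho> zs g"
    using i[OF f] i[OF g] by (simp add: defect_def)
  finally show ?thesis .
qed

text \<open>As the defect decreases in \<open>\<rho>\<close>, one \<open>\<rho>\<close> for each
  \<open>\<epsilon>\<close> already expresses the uniform limit at 1.\<close>

definition tight :: "('a \<Rightarrow> real) set" where
  "tight = {f \<in> L2 M. \<forall>\<epsilon>>0. \<exists>\<rho>. 0 < \<rho> \<and> \<rho> < 1 \<and> (\<forall>zs. set zs \<subseteq> B \<longrightarrow> defect \<rho> zs f \<le> \<epsilon>)}"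

lemma tight_L2: "f \<in> tight \<Longrightarrow> f \<in> L2 M"
  by (simp add: tight_def)

lemma tightD:
  assumes "f \<in> tight" "0 < \<epsilon>"
  obtains \<rho> where "0 < \<rho>" "\<rho> < 1" "\<And>zs. set zs \<subseteq> B \<Longrightarrow> defect \<rho> zs f \<le> \<epsilon>"
  using assms unfolding tight_def by blast

lemma tightI:
  assumes "f \<in> L2 M" "\<And>\<epsilon>. 0 < \<epsilon> \<Longrightarrow> \<exists>\<rho>. 0 < \<rho> \<and> \<rho> < 1 \<and> (\<forall>zs. set zs \<subseteq> B \<longrightarrow> defect \<rho> zs f \<le> \<epsilon>)"
  shows "f \<in> tight"
  using assms by (simp add: tight_def)

lemma tight_abs: assumes f: "f \<in> tight" shows "(\<lambda>\<omega>. \<bar>f \<omega>\<bar>) \<in> tight"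
proof (rule tightI[OF L2_abs[OF tight_L2[OF f]]])
  fix \<epsilon> :: real assume "0 < \<epsilon>"
  then obtain \<rho> where r: "0 < \<rho>" "\<rho> < 1" "\<And>zs. set zs \<subseteq> B \<Longrightarrow> defect \<rho> zs f \<le> \<epsilon>" using tightD[OF f] by blast
  show "\<exists>\<rho>. 0 < \<rho> \<and> \<rho> < 1 \<and> (\<forall>zs. set zs \<subseteq> B \<longrightarrow> defect \<rho> zs (\<lambda>\<omega>. \<bar>f \<omega>\<bar>) \<le> \<epsilon>)"
  proof (intro exI[of _ \<rho>] conjI allI impI)
    fix zs assume zs: "set zs \<subseteq> B"
    show "defect \<rho> zs (\<lambda>\<omega>. \<bar>f \<omega>\<bar>) \<le> \<epsilon>"
      using defect_abs[OF zs tight_L2[OF f], of \<rho>] r(1,2) r(3)[OF zs] by simp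
  qed (use r in auto)
qed

text \<open>A criterion for vectors carried by points that hit at most one cell of any partition:
  the weight is then \<open>\<rho>\<close> or 1.\<close>

lemma tight_core:
  assumes f: "f \<in> L2 M"
    and w: "\<And>\<rho> zs. 0 < \<rho> \<Longrightarrow> \<rho> < 1 \<Longrightarrow> set zs \<subseteq> B \<Longrightarrow> AE s in \<mu>. \<Psi> f s \<noteq> 0 \<longrightarrow> \<rho> \<le> hit_weight \<rho> zs (sets M) s"
  shows "f \<in> tight"
proof (rule tightI[OF f])
  fix \<epsilon> :: real assume e: "0 < \<epsilon>"
  \<comment> \<open>\<open>\<delta>\<close> is 1 - rho; the first entry keeps rho in (0, 1), the
    second makes \<open>\<delta>\<close> times the squared norm at most
    \<open>\<epsilon>\<close>.\<close>
  define \<delta> where "\<delta> = min (1/2) (\<epsilon> / (ip M f f + 1))"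
  have nn: "0 \<le> ip M f f" by (rule ip_self_nonneg)
  then have d: "0 < \<delta>" "\<delta> < 1" using e by (auto simp: \<delta>_def min_less_iff_disj)
  show "\<exists>\<rho>. 0 < \<rho> \<and> \<rho> < 1 \<and> (\<forall>zs. set zs \<subseteq> B \<longrightarrow> defect \<rho> zs f \<le> \<epsilon>)"
  proof (intro exI[of _ "1 - \<delta>"] conjI allI impI)
    fix zs assume zs: "set zs \<subseteq> B"
    have "defect (1 - \<delta>) zs f \<le> (LINT s|\<mu>. \<delta> * (norm (\<Psi> f s))\<^sup>2)"
      unfolding defect_def
    proof (rule integral_mono_AE)
      have "AE s in \<mu>. \<Psi> f s \<noteq> 0 \<longrightarrow> 1 - \<delta> \<le> hit_weight (1 - \<delta>) zs (sets M) s"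
        by (rule w[OF _ _ zs]) (use d in auto)
      then show "AE s in \<mu>. (1 - hit_weight (1 - \<delta>) zs (sets M) s) * (norm (\<Psi> f s))\<^sup>2 \<le> \<delta> * (norm (\<Psi> f s))\<^sup>2"
      proof eventually_elim
        case (elim s) then show ?case by (cases "\<Psi> f s = 0") (auto intro!: mult_right_mono)
      qed
    qed (use hit_weight_integrable(2)[OF zs top_B f] d \<Psi>_integrable[OF f] in auto)
    also have "\<dots> = \<delta> * ip M f f" using \<Psi>_iso[OF f] by simp
    also have "\<dots> \<le> \<epsilon> / (ip M f f + 1) * (ip M f f + 1)"
      using nn d by (intro mult_mono) (auto simp: \<delta>_def)
    also have "\<dots> = \<epsilon>" using nn by simp
    finally show "defect (1 - \<delta>) zs f \<le> \<epsilon>" .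
  qed (use d in auto)
qed

lemma closed_subspace_tight: "closed_subspace M tight"
  unfolding closed_subspace_def
proof (intro conjI ballI allI impI)
  show "tight \<subseteq> L2 M" by (auto simp: tight_def)
  have "(\<lambda>\<omega>. 0) \<in> tight"
  proof (rule tight_core[OF L2_zero])
    have "AE s in \<mu>. \<Psi> (\<lambda>\<omega>. 0) s = 0" using \<Psi>_eq_0[OF L2_zero] by simp
    then show "AE s in \<mu>. \<Psi> (\<lambda>\<omega>. 0) s \<noteq> 0 \<longrightarrow> \<rho> \<le> hit_weight \<rho> zs (sets M) s" for \<rho> zs
      by eventually_elim simp
  qed
  then show "tight \<noteq> {}" by auto
next
  fix f g a b assume f: "f \<in> tight" and g: "g \<in> tight"
  note f2 = tight_L2[OF f] and g2 = tight_L2[OF g]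
  show "(\<lambda>\<omega>. a * f \<omega> + b * g \<omega>) \<in> tight"
  proof (rule tightI[OF L2_lin[OF f2 g2]])
    fix \<epsilon> :: real assume "0 < \<epsilon>"
    \<comment> \<open>The factors of \<open>defect_lin\<close> added up; the summand 1 keeps K
      positive when a = b = 0.\<close>
    define K where "K = 2 * a\<^sup>2 + 2 * b\<^sup>2 + 1"
    have K: "0 < K" by (simp add: K_def add_nonneg_pos)
    then have e: "0 < \<epsilon> / K" using \<open>0 < \<epsilon>\<close> by simp
    obtain \<rho> where r: "0 < \<rho>" "\<rho> < 1" "\<And>zs. set zs \<subseteq> B \<Longrightarrow> defect \<rho> zs f \<le> \<epsilon> / K"
      using tightD[OF f e] by blast
    obtain \<sigma> where s: "0 < \<sigma>" "\<sigma> < 1" "\<And>zs. set zs \<subseteq> B \<Longrightarrow> defect \<sigma> zs g \<le> \<epsilon> / K"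
      using tightD[OF g e] by blast
    let ?m = "max \<rho> \<sigma>"
    show "\<exists>\<rho>. 0 < \<rho> \<and> \<rho> < 1 \<and> (\<forall>zs. set zs \<subseteq> B \<longrightarrow> defect \<rho> zs (\<lambda>\<omega>. a * f \<omega> + b * g \<omega>) \<le> \<epsilon>)"
    proof (intro exI[of _ ?m] conjI allI impI)
      fix zs assume zs: "set zs \<subseteq> B"
      have 1: "defect ?m zs f \<le> \<epsilon> / K" using defect_antimono[OF zs f2, of \<rho> ?m] r(1,2) s(2) r(3)[OF zs] by simp
      have 2: "defect ?m zs g \<le> \<epsilon> / K" using defect_antimono[OF zs g2, of \<sigma> ?m] s(1,2) r(2) s(3)[OF zs] by simp
      have "defect ?m zs (\<lambda>\<omega>. a * f \<omega> + b * g \<omega>) \<le> 2 * a\<^sup>2 * defect ?m zs f + 2 * b\<^sup>2 * defect ?m zs g"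
        by (rule defect_lin[OF zs f2 g2]) (use r s in auto)
      also have "\<dots> \<le> 2 * a\<^sup>2 * (\<epsilon> / K) + 2 * b\<^sup>2 * (\<epsilon> / K)"
        using 1 2 by (intro add_mono mult_left_mono) auto
      also have "\<dots> \<le> K * (\<epsilon> / K)" using e by (simp only: K_def distrib_right)
      also have "\<dots> = \<epsilon>" using K by simp
      finally show "defect ?m zs (\<lambda>\<omega>. a * f \<omega> + b * g \<omega>) \<le> \<epsilon>" .
    qed (use r s in auto)
  qed
next
  fix f assume f: "f \<in> L2 M" and a: "\<forall>\<epsilon>>0. \<exists>g\<in>tight. L2_norm M (\<lambda>\<omega>. f \<omega> - g \<omega>) < \<epsilon>"
  show "f \<in> tight"
  proof (rule tightI[OF f])
    fix \<epsilon> :: real assume e: "0 < \<epsilon>"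
    \<comment> \<open>The entry 1 gives \<delta>^2 \<le> \<delta>, so the defect of the error is at
      most \<epsilon>/4; the factors 2 of \<open>defect_lin\<close> bring the total to
      \<epsilon>.\<close>
    define \<delta> where "\<delta> = min 1 (\<epsilon> / 4)"
    have d: "0 < \<delta>" using e by (simp add: \<delta>_def)
    obtain g where g: "g \<in> tight" and gd: "L2_norm M (\<lambda>\<omega>. f \<omega> - g \<omega>) < \<delta>" using a d by blast
    have g2: "g \<in> L2 M" by (rule tight_L2[OF g])
    have "(L2_norm M (\<lambda>\<omega>. f \<omega> - g \<omega>))\<^sup>2 \<le> \<delta> * 1"
      unfolding power2_eq_square using gd d by (intro mult_mono) (auto simp: \<delta>_def)
    then have dd: "(L2_norm M (\<lambda>\<omega>. f \<omega> - g \<omega>))\<^sup>2 \<le> \<epsilon> / 4" by (simp add: \<delta>_def)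
    obtain \<rho> where r: "0 < \<rho>" "\<rho> < 1" "\<And>zs. set zs \<subseteq> B \<Longrightarrow> defect \<rho> zs g \<le> \<epsilon> / 4"
      using tightD[OF g, of "\<epsilon> / 4"] e by auto
    show "\<exists>\<rho>. 0 < \<rho> \<and> \<rho> < 1 \<and> (\<forall>zs. set zs \<subseteq> B \<longrightarrow> defect \<rho> zs f \<le> \<epsilon>)"
    proof (intro exI[of _ \<rho>] conjI allI impI)
      fix zs assume zs: "set zs \<subseteq> B"
      have "defect \<rho> zs f = defect \<rho> zs (\<lambda>\<omega>. 1 * g \<omega> + 1 * (f \<omega> - g \<omega>))" by simp
      also have "\<dots> \<le> 2 * 1\<^sup>2 * defect \<rho> zs g + 2 * 1\<^sup>2 * defect \<rho> zs (\<lambda>\<omega>. f \<omega> - g \<omega>)"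
        by (rule defect_lin[OF zs g2 L2_diff[OF f g2]]) (use r in auto)
      finally show "defect \<rho> zs f \<le> \<epsilon>"
        using r(3)[OF zs] defect_le_norm[OF zs L2_diff[OF f g2], of \<rho>] dd r(1,2) by simp
    qed (use r in auto)
  qed
qed

text \<open>A point carrying a first chaos vector lies in one of \<open>S z\<close> and
  \<open>S (cp z)\<close>, hence misses one of the two halves of any cell. Cutting cells therefore
  never changes the number of hits, and the weight is that of the undivided cell.\<close>

lemma FC_tight: assumes f: "f \<in> FC" shows "f \<in> tight"
proof (rule tight_core[OF FC_L2[OF f]])
  fix \<rho> :: real and zs assume r: "0 < \<rho>" "\<rho> < 1" and zs: "set zs \<subseteq> B"
  have "AE s in \<mu>. \<Psi> f s \<noteq> 0 \<longrightarrow> hit_weight \<rho> zs a s = hit_weight \<rho> [] a s" if "a \<in> B" for a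
    using zs that
  proof (induction zs arbitrary: a)
    case (Cons z zs)
    then have B: "z \<in> B" "a \<in> B" "a \<inter> z \<in> B" "a \<inter> cp z \<in> B" "set zs \<subseteq> B" by auto
    have c: "cp (a \<inter> z) \<in> B" "cp (a \<inter> cp z) \<in> B" "cp z \<in> B" using B by auto
    have 1: "AE s in \<mu>. \<Psi> f s \<noteq> 0 \<longrightarrow> (s \<in> S z \<longleftrightarrow> s \<notin> S (cp z))"
      using f B(1) FC_iff_\<Psi>[OF FC_L2[OF f]] by simp
    have 2: "AE s in \<mu>. s \<in> S (cp z) \<longrightarrow> s \<in> S (cp (a \<inter> z))"
    proof (rule S_mono)
      show "cp z \<subseteq> cp (a \<inter> z)" using B by (intro cp_antimono) auto
    qed (use B c in auto)
    have 3: "AE s in \<mu>. s \<in> S z \<longrightarrow> s \<in> S (cp (a \<inter> cp z))"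
    proof (rule S_mono)
      have "cp (cp z) \<subseteq> cp (a \<inter> cp z)" using B by (intro cp_antimono) auto
      then show "z \<subseteq> cp (a \<inter> cp z)" using B by simp
    qed (use B c in auto)
    have 4: "AE s in \<mu>. s \<in> S (cp a) \<longleftrightarrow> s \<in> S (cp (a \<inter> z)) \<and> s \<in> S (cp (a \<inter> cp z))"
      using S_meet[OF c(1,2)] cp_split_meet[OF B(2,1)] by simp
    from Cons.IH[OF B(5,3)] Cons.IH[OF B(5,4)] 1 2 3 4
    show ?case
    proof eventually_elim
      case (elim s)
      show ?case
      proof
        assume p: "\<Psi> f s \<noteq> 0"
        then have w: "hit_weight \<rho> (z # zs) a s = hit_weight \<rho> [] (a \<inter> z) s * hit_weight \<rho> [] (a \<inter> cp z) s" using elim(1,2) by simp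
        consider "s \<in> S (cp (a \<inter> z))" "s \<in> S (cp (a \<inter> cp z))" | "s \<in> S (cp (a \<inter> z))" "s \<notin> S (cp (a \<inter> cp z))"
          | "s \<notin> S (cp (a \<inter> z))" "s \<in> S (cp (a \<inter> cp z))" using p elim(3,4,5) by blast
        then show "hit_weight \<rho> (z # zs) a s = hit_weight \<rho> [] a s"
          unfolding w using elim(6) by cases simp_all
      qed
    qed
  qed simp
  from this[OF top_B] show "AE s in \<mu>. \<Psi> f s \<noteq> 0 \<longrightarrow> \<rho> \<le> hit_weight \<rho> zs (sets M) s"
    by eventually_elim (use r in \<open>auto split: split_indicator\<close>)
qed

text \<open>Constants live on \<open>S Bot\<close>, which is contained in every spectral set up to
  null sets, so no cell is hit.\<close>

lemma one_tight: "(\<lambda>\<omega>. 1) \<in> tight"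
proof (rule tight_core[OF L2_const])
  fix \<rho> :: real and zs assume r: "0 < \<rho>" "\<rho> < 1" and zs: "set zs \<subseteq> B"
  have "(\<lambda>\<omega>. 1) \<in> L2_sub M Bot" by (rule L2_sub_const) simp
  then have 0: "AE s in \<mu>. \<Psi> (\<lambda>\<omega>. 1) s \<noteq> 0 \<longrightarrow> s \<in> S Bot" using L2_sub_iff_\<Psi>[OF Bot_B L2_const] by simp
  have "AE s in \<mu>. s \<in> S Bot \<longrightarrow> hit_weight \<rho> zs a s = 1" if "a \<in> B" for a
    using zs that
  proof (induction zs arbitrary: a)
    case Nil
    have "AE s in \<mu>. s \<in> S Bot \<longrightarrow> s \<in> S (cp a)" by (rule S_mono) (use Nil Bot_le in auto)
    then show ?case by eventually_elim simp
  next
    case (Cons z zs)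
    then have "set zs \<subseteq> B" "a \<inter> z \<in> B" "a \<inter> cp z \<in> B" by auto
    from Cons.IH[OF this(1,2)] Cons.IH[OF this(1,3)] show ?case by eventually_elim simp
  qed
  from 0 this[OF top_B] show "AE s in \<mu>. \<Psi> (\<lambda>\<omega>. 1) s \<noteq> 0 \<longrightarrow> \<rho> \<le> hit_weight \<rho> zs (sets M) s"
    by eventually_elim (use r in auto)
qed

section \<open>Lattice operations and tight events\<close>

lemma tight_max:
  assumes f: "f \<in> tight" and g: "g \<in> tight" shows "(\<lambda>\<omega>. max (f \<omega>) (g \<omega>)) \<in> tight"
proof -
  note V = closed_subspace_tight
  have "(\<lambda>\<omega>. 1/2 * (f \<omega> + g \<omega>) + 1/2 * \<bar>f \<omega> - g \<omega>\<bar>) \<in> tight"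
    by (intro closed_subspace_lin[OF V] closed_subspace_add[OF V f g] tight_abs closed_subspace_diff[OF V f g])
  moreover have "(\<lambda>\<omega>. 1/2 * (f \<omega> + g \<omega>) + 1/2 * \<bar>f \<omega> - g \<omega>\<bar>) = (\<lambda>\<omega>. max (f \<omega>) (g \<omega>))"
    by (auto simp: fun_eq_iff max_def abs_if field_simps)
  ultimately show ?thesis by simp
qed

text \<open>The passage from functions to sigma-fields: as the tight vectors form a closed lattice
  with 1, these events form a sigma-field containing the null sets, and a tight function is
  measurable for it.\<close>

definition tight_event :: "'a set \<Rightarrow> bool" where
  "tight_event A \<longleftrightarrow> A \<in> sets M \<and> indicator A \<in> tight"

lemma tight_event_compl: assumes A: "tight_event A" shows "tight_event (space M - A)"
proof -
  have s: "A \<in> sets M" using A by (simp add: tight_event_def)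
  have "(\<lambda>\<omega>. 1 - indicator A \<omega> :: real) \<in> tight"
    using A by (intro closed_subspace_diff[OF closed_subspace_tight one_tight]) (simp add: tight_event_def)
  then have "indicator (space M - A) \<in> tight"
    by (rule closed_subspace_AE[OF closed_subspace_tight])
      (use s in \<open>auto intro!: L2_indicator AE_I2 split: split_indicator\<close>)
  then show ?thesis using s by (simp add: tight_event_def)
qed

lemma tight_event_empty: "tight_event {}"
  using closed_subspace_zero[OF closed_subspace_tight] by (simp add: tight_event_def indicator_def[abs_def])

lemma tight_event_Un: assumes "tight_event A" "tight_event C" shows "tight_event (A \<union> C)"
proof -
  have "(\<lambda>\<omega>. max (indicator A \<omega>) (indicator C \<omega>) :: real) \<in> tight"
    using assms by (intro tight_max) (auto simp: tight_event_def)
  moreover have "(\<lambda>\<omega>. max (indicator A \<omega>) (indicator C \<omega>) :: real) = indicator (A \<union> C)"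
    by (auto simp: fun_eq_iff split: split_indicator)
  ultimately show ?thesis using assms by (auto simp: tight_event_def)
qed

lemma tight_event_UN:
  fixes A :: "nat \<Rightarrow> 'a set"
  assumes A: "\<And>i. tight_event (A i)" shows "tight_event (\<Union>i. A i)"
proof -
  have s: "A i \<in> sets M" for i using A by (simp add: tight_event_def)
  have fin: "tight_event (\<Union>i<n. A i)" for n
    by (induction n) (auto simp: lessThan_Suc tight_event_empty intro!: tight_event_Un A)
  have "indicator (\<Union>i. A i) \<in> tight"
  proof (rule closed_subspace_lim[OF closed_subspace_tight])
    show "indicator (\<Union>i<n. A i) \<in> tight" for n using fin by (simp add: tight_event_def)
    show "indicator (\<Union>i. A i) \<in> L2 M" using s by (intro L2_indicator) auto
    show "L2_lim M (\<lambda>n. indicator (\<Union>i<n. A i)) (indicator (\<Union>i. A i))"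
    proof (rule L2_lim_dominated(3)[OF _ _ L2_const[of 1]])
      show "AE \<omega> in M. (\<lambda>n. indicator (\<Union>i<n. A i) \<omega> :: real) \<longlonglongrightarrow> indicator (\<Union>i. A i) \<omega>"
        by (intro AE_I2 LIMSEQ_indicator_UN)
    qed (use s in \<open>auto split: split_indicator intro!: borel_measurable_indicator\<close>)
  qed
  then show ?thesis using s by (auto simp: tight_event_def)
qed

lemma tight_event_null: assumes A: "A \<in> null_sets M" shows "tight_event A"
proof -
  have "(indicator A :: 'a \<Rightarrow> real) \<in> tight"
  proof (rule closed_subspace_AE[OF closed_subspace_tight closed_subspace_zero[OF closed_subspace_tight]])
    show "(indicator A :: 'a \<Rightarrow> real) \<in> L2 M" using A by (intro L2_indicator) auto
    show "AE \<omega> in M. (0::real) = indicator A \<omega>" using AE_not_in[OF A] by eventually_elim simp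
  qed
  then show ?thesis using A by (auto simp: tight_event_def)
qed

lemma tight_event_greater:
  assumes f: "f \<in> tight" shows "tight_event {\<omega> \<in> space M. c < f \<omega>}"
proof -
  note V = closed_subspace_tight and f2 = tight_L2[OF f]
  have [measurable]: "f \<in> borel_measurable M" using f2 by (rule L2_measurable)
  let ?A = "{\<omega> \<in> space M. c < f \<omega>}"
  have A: "?A \<in> sets M" by measurable
  have const: "(\<lambda>\<omega>. k) \<in> tight" for k :: real using closed_subspace_scale[OF V one_tight, of k] by simp
  \<comment> \<open>This is the minimum of 1 and n (f - c)^+, written with maxima; it increases to
    the indicator of f > c.\<close>
  define F where "F n \<omega> = 1 - max 0 (1 - real n * max 0 (f \<omega> - c))" for n \<omega>
  have F: "F n \<in> tight" for n
    unfolding F_def[abs_def]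
    by (intro closed_subspace_diff[OF V] tight_max closed_subspace_scale[OF V] const f)
  have "indicator ?A \<in> tight"
  proof (rule closed_subspace_lim[OF V F])
    show "indicator ?A \<in> L2 M" by (rule L2_indicator[OF A])
    show "L2_lim M F (indicator ?A)"
    proof (rule L2_lim_dominated(3)[OF _ _ L2_const[of 1]])
      show "F n \<in> borel_measurable M" for n by (rule L2_measurable[OF tight_L2[OF F]])
      show "AE \<omega> in M. \<bar>F n \<omega>\<bar> \<le> 1" for n
        unfolding F_def by (intro AE_I2) (auto simp: max_def)
      show "AE \<omega> in M. (\<lambda>n. F n \<omega>) \<longlonglongrightarrow> indicator ?A \<omega>"
      proof (rule AE_I2)
        fix \<omega> assume w: "\<omega> \<in> space M"
        show "(\<lambda>n. F n \<omega>) \<longlonglongrightarrow> indicator ?A \<omega>"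
        proof (cases "c < f \<omega>")
          case True
          then obtain m :: nat where "1 < real m * (f \<omega> - c)" using reals_Archimedean3[of "f \<omega> - c"] by auto
          then have "1 < real n * (f \<omega> - c)" if "m \<le> n" for n
            using True that by (smt (verit) mult_right_mono of_nat_mono)
          then have "F n \<omega> = 1" if "m \<le> n" for n using that True by (fastforce simp: F_def max_def)
          then have "\<forall>\<^sub>F n in sequentially. F n \<omega> = 1" by (auto simp: eventually_sequentially)
          then show ?thesis using True w by (simp add: tendsto_eventually)
        next
          case False
          then have "F n \<omega> = 0" for n by (simp add: F_def max_def)
          then show ?thesis using False by simp
        qed
      qed
    qed (use A in auto)
  qed
  then show ?thesis using A by (simp add: tight_event_def)
qed

lemma tight_event_vimage:
  assumes f: "f \<in> tight" and A: "A \<in> sets borel" shows "tight_event (f -` A \<inter> space M)"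
proof -
  have "A \<in> sigma_sets UNIV (range (\<lambda>a::real. {a<..}))"
    using A unfolding borel_Ioi by (simp add: sets_measure_of)
  then show ?thesis
  proof (induction rule: sigma_sets.induct)
    case (Basic A)
    then obtain c where "A = {c<..}" by auto
    then have "f -` A \<inter> space M = {\<omega> \<in> space M. c < f \<omega>}" by auto
    then show ?case using tight_event_greater[OF f, of c] by simp
  next
    case Empty then show ?case by (simp add: tight_event_empty)
  next
    case (Compl A)
    have "f -` (UNIV - A) \<inter> space M = space M - (f -` A \<inter> space M)" by auto
    then show ?case using tight_event_compl[OF Compl.IH] by simp
  next
    case (Union A)
    have "f -` (\<Union>i. A i) \<inter> space M = (\<Union>i. f -` A i \<inter> space M)" by auto
    then show ?case using tight_event_UN[OF Union.IH] by simp
  qed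
qed

lemma classical_tight: assumes c: "classical M B" shows "tight = L2 M"
proof
  show "tight \<subseteq> L2 M" using tight_L2 by blast
  have ev: "tight_event A" if "A \<in> sets M" for A
  proof -
    have "A \<in> generated_field M FC" using that c by (simp add: classical_def)
    then show ?thesis unfolding generated_field_def
    proof (induction rule: sigma_sets.induct)
      case (Basic A)
      then show ?case using tight_event_null tight_event_vimage[OF FC_tight] by auto
    next
      case Empty show ?case by (rule tight_event_empty)
    next
      case (Compl A) show ?case by (rule tight_event_compl[OF Compl.IH])
    next
      case (Union A) show ?case by (rule tight_event_UN[OF Union.IH])
    qed
  qed
  show "L2 M \<subseteq> tight"
  proof
    fix f assume f: "f \<in> L2 M"
    show "f \<in> tight"
      by (rule closed_subspace_dense[OF closed_subspace_tight refl order_refl _ f L2_measurable[OF f]])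
        (use ev in \<open>simp add: tight_event_def\<close>)
  qed
qed

section \<open>Spectral independence implies tightness\<close>

lemma sets_Sig: "x \<in> B \<Longrightarrow> sets (sigma (space \<mu>) (Sig x)) = Sig x"
  by (rule sigma_algebra.sets_measure_of_eq[OF sigma_algebra_Sig])

lemma hit_weight_Sig:
  "set zs \<subseteq> B \<Longrightarrow> x \<in> B \<Longrightarrow> a \<in> B \<Longrightarrow> a \<subseteq> x \<Longrightarrow> hit_weight \<rho> zs a \<in> borel_measurable (sigma (space \<mu>) (Sig x))"
proof (induction zs arbitrary: a)
  case Nil
  have "S (cp a) \<in> sets (sigma (space \<mu>) (Sig x))" using Nil S_cp_in_Sig by (simp add: sets_Sig)
  then show ?case unfolding hit_weight.simps[abs_def] by measurable
next
  case (Cons z zs)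
  show ?case unfolding hit_weight.simps[abs_def]
    by (intro borel_measurable_times Cons.IH) (use Cons.prems in auto)
qed

text \<open>Weighted inequality between geometric and arithmetic means of 1 and q, that is convexity
  of exp between 0 and ln q.\<close>

lemma powr_weighted_le:
  assumes "0 \<le> q" "0 < \<rho>" "\<rho> < 1" shows "q powr (1 - \<rho>) \<le> \<rho> + (1 - \<rho>) * (q::real)"
proof (cases "q = 0")
  case False
  then have q: "0 < q" using assms by simp
  have "exp ((1 - (1 - \<rho>)) *\<^sub>R 0 + (1 - \<rho>) *\<^sub>R ln q) \<le> (1 - (1 - \<rho>)) * exp 0 + (1 - \<rho>) * exp (ln q)"
    by (rule convex_onD[OF exp_convex]) (use assms in auto)
  then show ?thesis using q by (simp add: powr_def)
qed (use assms in auto)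

text \<open>In a single cell the expectation is rho + (1 - rho) q with q the mass of
  \<open>S (cp a)\<close>, and \<open>powr_weighted_le\<close> applies. Both sides are
  multiplicative over the two halves of a cell by independence. The power form of the bound is
  chosen because it depends on the cell a only and not on its partition.\<close>

lemma expectation_hit_weight_ge:
  assumes sip: "spectral_independence_probability M B \<mu> \<Psi> \<nu>" and r: "0 < \<rho>" "\<rho> < 1"
  shows "set zs \<subseteq> B \<Longrightarrow> a \<in> B \<Longrightarrow> measure \<nu> (S (cp a)) powr (1 - \<rho>) \<le> (LINT s|\<nu>. hit_weight \<rho> zs a s)"
proof (induction zs arbitrary: a)
  interpret \<nu>: prob_space \<nu> using sip by (simp add: spectral_independence_probability_def)
  have sets: "sets \<nu> = sets \<mu>" using sip by (simp add: spectral_independence_probability_def)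
  case Nil
  have s: "S (cp a) \<in> sets \<nu>" using Nil sets S_sets by simp
  then have "(LINT s|\<nu>. hit_weight \<rho> [] a s) = \<rho> + (1 - \<rho>) * measure \<nu> (S (cp a))"
    by (simp add: \<nu>.prob_space \<nu>.emeasure_eq_measure)
  then show ?case using powr_weighted_le[OF _ r, of "measure \<nu> (S (cp a))"] by simp
next
  interpret \<nu>: prob_space \<nu> using sip by (simp add: spectral_independence_probability_def)
  have sets: "sets \<nu> = sets \<mu>" and space: "space \<nu> = space \<mu>" and ac: "absolutely_continuous \<mu> \<nu>"
    using sip sets_eq_imp_space_eq by (auto simp: spectral_independence_probability_def)
  case (Cons z zs)
  then have z: "z \<in> B" and B: "set zs \<subseteq> B" "a \<inter> z \<in> B" "a \<inter> cp z \<in> B" "cp z \<in> B" by auto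
  have ind: "\<nu>.indep_set (Sig z) (Sig (cp z))"
    using sip z by (simp add: spectral_independence_probability_def)
  have w1: "hit_weight \<rho> zs (a \<inter> z) \<in> borel_measurable (sigma (space \<mu>) (Sig z))"
    and w2: "hit_weight \<rho> zs (a \<inter> cp z) \<in> borel_measurable (sigma (space \<mu>) (Sig (cp z)))"
    using hit_weight_Sig[OF B(1) z B(2)] hit_weight_Sig[OF B(1,4,3)] by auto
  have i: "integrable \<nu> (hit_weight \<rho> zs b)" if "b \<in> B" for b
  proof (rule \<nu>.integrable_const_bound[of _ 1])
    show "hit_weight \<rho> zs b \<in> borel_measurable \<nu>"
      using hit_weight_measurable[OF B(1) that] measurable_cong_sets[OF sets refl] by blast
  qed (use hit_weight_bounds[of \<rho> zs b] r in auto)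
  have s1: "S (cp (a \<inter> z)) \<in> Sig z" and s2: "S (cp (a \<inter> cp z)) \<in> Sig (cp z)"
    using z B by (auto intro!: S_cp_in_Sig)
  have S12: "S (cp (a \<inter> z)) \<in> sets \<mu>" "S (cp (a \<inter> cp z)) \<in> sets \<mu>" "S (cp a) \<in> sets \<mu>"
    using B Cons.prems by (auto intro!: S_sets)
  have "AE s in \<mu>. s \<in> S (cp a) \<longleftrightarrow> s \<in> S (cp (a \<inter> z)) \<and> s \<in> S (cp (a \<inter> cp z))"
    using S_meet[of "cp (a \<inter> z)" "cp (a \<inter> cp z)"] cp_split_meet[of a z] Cons.prems by simp
  then have "AE s in \<nu>. s \<in> S (cp a) \<longleftrightarrow> s \<in> S (cp (a \<inter> z)) \<inter> S (cp (a \<inter> cp z))"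
    using absolutely_continuous_AE[OF sets ac] by simp
  then have "measure \<nu> (S (cp a)) = measure \<nu> (S (cp (a \<inter> z)) \<inter> S (cp (a \<inter> cp z)))"
    by (rule \<nu>.finite_measure_eq_AE) (use S12 sets in auto)
  also have "\<dots> = measure \<nu> (S (cp (a \<inter> z))) * measure \<nu> (S (cp (a \<inter> cp z)))"
    by (rule \<nu>.indep_setD[OF ind s1 s2])
  finally have "measure \<nu> (S (cp a)) powr (1 - \<rho>) =
      measure \<nu> (S (cp (a \<inter> z))) powr (1 - \<rho>) * measure \<nu> (S (cp (a \<inter> cp z))) powr (1 - \<rho>)"
    by (simp add: powr_mult)
  also have "\<dots> \<le> (LINT s|\<nu>. hit_weight \<rho> zs (a \<inter> z) s) * (LINT s|\<nu>. hit_weight \<rho> zs (a \<inter> cp z) s)"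
    by (intro mult_mono Cons.IH B) (use hit_weight_bounds(1)[of \<rho> zs "a \<inter> z"] r in \<open>auto intro!: integral_nonneg_AE\<close>)
  also have "\<dots> = (LINT s|\<nu>. hit_weight \<rho> zs (a \<inter> z) s * hit_weight \<rho> zs (a \<inter> cp z) s)"
    by (rule \<nu>.indep_set_integral_mult(2)[OF ind _ sets_Sig[OF z] _ sets_Sig[OF B(4)] w1 i[OF B(2)] w2 i[OF B(3)], symmetric])
      (simp_all add: space space_measure_of_conv)
  finally show ?case by simp
qed

text \<open>The density D is exported so that absolute continuity of a spectral measure with respect
  to \<open>\<nu>\<close> can be stated as vanishing of \<open>\<Psi> f\<close> on the zeros of D.
  Bounded densities come first, truncation and closedness of \<open>tight\<close> give the
  rest.\<close>

lemma spectral_independence_tight: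
  assumes sip: "spectral_independence_probability M B \<mu> \<Psi> \<nu>"
  obtains D where "D \<in> borel_measurable \<mu>" "\<And>s. 0 \<le> D s" "\<nu> = density \<mu> (\<lambda>s. ennreal (D s))"
    "\<And>f. f \<in> L2 M \<Longrightarrow> AE s in \<mu>. D s = 0 \<longrightarrow> \<Psi> f s = 0 \<Longrightarrow> f \<in> tight"
proof -
  interpret \<nu>: prob_space \<nu> using sip by (simp add: spectral_independence_probability_def)
  interpret \<mu>: sigma_finite_measure \<mu> by (rule sigma_finite_\<mu>)
  have sets: "sets \<nu> = sets \<mu>" and ac: "absolutely_continuous \<mu> \<nu>"
    and pos: "0 < measure \<nu> (S Bot)"
    using sip by (auto simp: spectral_independence_probability_def)
  obtain D where D: "D \<in> borel_measurable \<mu>" "AE s in \<mu>. RN_deriv \<mu> \<nu> s = ennreal (D s)" "\<And>s. 0 \<le> D s"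
    using \<mu>.real_RN_deriv[OF \<nu>.finite_measure_axioms ac sets] by metis
  have \<nu>: "\<nu> = density \<mu> (\<lambda>s. ennreal (D s))"
    using \<mu>.density_RN_deriv[OF ac sets] density_cong[OF _ _ D(2)] D(1) by simp
  \<comment> \<open>The defect is at most C times the expectation of 1 - weight under
    \<open>\<nu>\<close>, hence at most C (1 - c^t) with c the mass of \<open>S Bot\<close> and t =
    1 - rho. As c > 0, this tends to 0 with t.\<close>
  have core: "f \<in> tight" if f: "f \<in> L2 M" and C: "0 < C" and bd: "AE s in \<mu>. (norm (\<Psi> f s))\<^sup>2 \<le> C * D s" for f and C :: real
  proof (rule tightI[OF f])
    fix \<epsilon> :: real assume e: "0 < \<epsilon>"
    let ?c = "measure \<nu> (S Bot)"
    have "((\<lambda>t. C * (1 - ?c powr t)) \<longlongrightarrow> C * (1 - ?c powr 0)) (at_right 0)"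
      using pos by (intro tendsto_intros) auto
    then have "\<forall>\<^sub>F t in at_right 0. C * (1 - ?c powr t) < \<epsilon>" using pos e by (intro order_tendstoD(2)) auto
    then obtain b where b: "0 < b" "\<And>t. 0 < t \<Longrightarrow> t < b \<Longrightarrow> C * (1 - ?c powr t) < \<epsilon>"
      unfolding eventually_at_right_field by blast
    \<comment> \<open>Half of the minimum lies strictly below both b and 1.\<close>
    define t where "t = min b 1 / 2"
    have t: "0 < t" "t < 1" "t < b" using b by (auto simp: t_def min_def)
    show "\<exists>\<rho>. 0 < \<rho> \<and> \<rho> < 1 \<and> (\<forall>zs. set zs \<subseteq> B \<longrightarrow> defect \<rho> zs f \<le> \<epsilon>)"
    proof (intro exI[of _ "1 - t"] conjI allI impI)
      fix zs assume zs: "set zs \<subseteq> B"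
      let ?w = "hit_weight (1 - t) zs (sets M)"
      have wm: "?w \<in> borel_measurable \<mu>" by (rule hit_weight_measurable[OF zs top_B])
      have wb: "0 \<le> ?w s" "?w s \<le> 1" for s using hit_weight_bounds[of "1 - t" zs "sets M" s] t by auto
      have iw: "integrable \<nu> ?w"
      proof (rule \<nu>.integrable_const_bound[of _ 1])
        show "?w \<in> borel_measurable \<nu>" using wm measurable_cong_sets[OF sets refl] by blast
      qed (use wb in auto)
      have iD: "integrable \<mu> (\<lambda>s. D s * (1 - ?w s))"
        using Bochner_Integration.integrable_diff[OF \<nu>.integrable_const[of 1] iw] D wm
        unfolding \<nu> by (subst (asm) integrable_real_density) auto
      have "defect (1 - t) zs f \<le> (LINT s|\<mu>. C * (D s * (1 - ?w s)))"
        unfolding defect_def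
      proof (rule integral_mono_AE[OF hit_weight_integrable(2)[OF zs top_B f]])
        show "AE s in \<mu>. (1 - ?w s) * (norm (\<Psi> f s))\<^sup>2 \<le> C * (D s * (1 - ?w s))"
          using bd
        proof eventually_elim
          case (elim s)
          have "(1 - ?w s) * (norm (\<Psi> f s))\<^sup>2 \<le> (1 - ?w s) * (C * D s)"
            using elim wb[of s] by (intro mult_left_mono) auto
          then show ?case by (simp add: mult_ac)
        qed
      qed (use t iD in auto)
      also have "\<dots> = C * (LINT s|\<nu>. 1 - ?w s)"
        unfolding \<nu> using D wm by (subst integral_real_density) auto
      also have "(LINT s|\<nu>. 1 - ?w s) = 1 - (LINT s|\<nu>. ?w s)" using iw by (simp add: \<nu>.prob_space)
      also have "C * \<dots> \<le> C * (1 - ?c powr t)"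
        using expectation_hit_weight_ge[OF sip _ _ zs top_B, of "1 - t"] t C by (simp add: cp_top)
      finally show "defect (1 - t) zs f \<le> \<epsilon>" using b(2)[OF t(1,3)] by simp
    qed (use t in auto)
  qed
  have "f \<in> tight" if f: "f \<in> L2 M" and z: "AE s in \<mu>. D s = 0 \<longrightarrow> \<Psi> f s = 0" for f
  proof -
    have [measurable]: "(\<lambda>s. norm (\<Psi> f s)) \<in> borel_measurable \<mu>" using f by (rule \<Psi>_norm_measurable)
    note [measurable] = D(1)
    \<comment> \<open>On \<open>U n\<close> the spectral density of f is at most n + 1 times D, with
      n + 1 rather than n since \<open>core\<close> asks for a positive constant. These sets exhaust
      the support of \<open>\<Psi> f\<close>, because \<open>\<Psi> f\<close> vanishes where D
      does.\<close>
    define U where "U n = {s \<in> space \<mu>. (norm (\<Psi> f s))\<^sup>2 \<le> real (Suc n) * D s}" for n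
    have U: "U n \<in> sets \<mu>" for n unfolding U_def by measurable
    have inc: "incseq U" unfolding U_def
      by (rule incseq_SucI) (use D(3) in \<open>auto intro: order_trans[OF _ mult_right_mono]\<close>)
    have Pf: "Pr (U n) f \<in> tight" for n
    proof (rule core[OF Pr_L2[OF U f], of "real (Suc n)"])
      show "AE s in \<mu>. (norm (\<Psi> (Pr (U n) f) s))\<^sup>2 \<le> real (Suc n) * D s"
        using \<Psi>_Pr[OF U f, of n] by eventually_elim (use D(3) in \<open>auto simp: U_def split: split_indicator\<close>)
    qed simp
    have V: "(\<Union>n. U n) \<in> sets \<mu>" using U by auto
    have "AE s in \<mu>. \<Psi> f s = indicator (\<Union>n. U n) s *\<^sub>R \<Psi> f s"
      using z AE_space
    proof eventually_elim
      case (elim s)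
      show ?case
      proof (cases "D s = 0")
        case False
        then have "0 < D s" using D(3)[of s] by simp
        then obtain n :: nat where "(norm (\<Psi> f s))\<^sup>2 < real n * D s" using reals_Archimedean3 by blast
        moreover have "real n * D s \<le> real (Suc n) * D s" using D(3)[of s] by (intro mult_right_mono) auto
        ultimately have "s \<in> U n" using elim by (simp add: U_def)
        then show ?thesis by (auto split: split_indicator)
      qed (use elim in simp)
    qed
    from Pr_eqI[OF V f f this] have ae: "AE \<omega> in M. Pr (\<Union>n. U n) f \<omega> = f \<omega>" by eventually_elim simp
    have "Pr (\<Union>n. U n) f \<in> tight"
      by (rule closed_subspace_lim[OF closed_subspace_tight Pf Pr_L2[OF V f] Pr_lim[OF U inc f]])
    then show ?thesis by (rule closed_subspace_AE[OF closed_subspace_tight _ f ae])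
  qed
  with D(1,3) \<nu> show ?thesis by (rule that)
qed

section \<open>Tight vectors are generated by the first chaos\<close>

lemma Pr_lin:
  assumes A: "A \<in> sets \<mu>" and f: "f \<in> L2 M" and g: "g \<in> L2 M"
  shows "AE \<omega> in M. a * Pr A f \<omega> + b * Pr A g \<omega> = Pr A (\<lambda>\<omega>. a * f \<omega> + b * g \<omega>) \<omega>"
proof (rule Pr_eqI[OF A L2_lin[OF f g] L2_lin[OF Pr_L2[OF A f] Pr_L2[OF A g]]])
  show "AE s in \<mu>. \<Psi> (\<lambda>\<omega>. a * Pr A f \<omega> + b * Pr A g \<omega>) s = indicator A s *\<^sub>R \<Psi> (\<lambda>\<omega>. a * f \<omega> + b * g \<omega>) s"
    using \<Psi>_lin[OF f g, of a b] \<Psi>_lin[OF Pr_L2[OF A f] Pr_L2[OF A g], of a b] \<Psi>_Pr[OF A f] \<Psi>_Pr[OF A g]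
    by eventually_elim (simp add: scaleR_right_distrib mult_ac)
qed

lemma Pr_norm_diff:
  assumes A: "A \<in> sets \<mu>" and f: "f \<in> L2 M" and g: "g \<in> L2 M"
  shows "L2_norm M (\<lambda>\<omega>. Pr A f \<omega> - Pr A g \<omega>) \<le> L2_norm M (\<lambda>\<omega>. f \<omega> - g \<omega>)"
proof -
  note d = L2_diff[OF f g]
  have "AE \<omega> in M. Pr A f \<omega> - Pr A g \<omega> = Pr A (\<lambda>\<omega>. f \<omega> - g \<omega>) \<omega>"
    using Pr_lin[OF A f g, of 1 "-1"] by simp
  then have "L2_norm M (\<lambda>\<omega>. Pr A f \<omega> - Pr A g \<omega>) = L2_norm M (Pr A (\<lambda>\<omega>. f \<omega> - g \<omega>))"
    by (intro L2_norm_cong_AE L2_diff Pr_L2 A f g)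
  also have "\<dots> \<le> L2_norm M (\<lambda>\<omega>. f \<omega> - g \<omega>)"
  proof -
    have "(LINT s|\<mu>. indicator A s * (norm (\<Psi> (\<lambda>\<omega>. f \<omega> - g \<omega>) s))\<^sup>2) \<le> (LINT s|\<mu>. (norm (\<Psi> (\<lambda>\<omega>. f \<omega> - g \<omega>) s))\<^sup>2)"
    proof (rule integral_mono[OF _ \<Psi>_integrable[OF d]])
      show "integrable \<mu> (\<lambda>s. indicator A s * (norm (\<Psi> (\<lambda>\<omega>. f \<omega> - g \<omega>) s))\<^sup>2)"
        using integrable_mult_indicator[OF A \<Psi>_integrable[OF d]] by simp
    qed (auto split: split_indicator)
    then show ?thesis unfolding L2_norm_ip ip_Pr[OF A d] \<Psi>_iso[OF d] by (rule real_sqrt_le_mono)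
  qed
  finally show ?thesis .
qed

text \<open>Used twice: to reduce a claim about projections of all vectors of a cell to products of
  indicators, and to recognise the vectors with spectral measure absolutely continuous with respect
  to a given one as a closed subspace.\<close>

lemma closed_subspace_Pr_vimage:
  assumes A: "A \<in> sets \<mu>" and D: "closed_subspace M D" shows "closed_subspace M {f \<in> L2 M. Pr A f \<in> D}"
  unfolding closed_subspace_def
proof (intro conjI ballI allI impI)
  have "Pr A (\<lambda>\<omega>. 0) \<in> D"
  proof (rule closed_subspace_AE[OF D closed_subspace_zero[OF D] Pr_L2[OF A L2_zero]])
    show "AE \<omega> in M. 0 = Pr A (\<lambda>\<omega>. 0) \<omega>" using Pr_lin[OF A L2_zero L2_zero, of 0 0] by simp
  qed
  then have "(\<lambda>\<omega>. 0) \<in> {f \<in> L2 M. Pr A f \<in> D}" using L2_zero by simp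
  then show "{f \<in> L2 M. Pr A f \<in> D} \<noteq> {}" by blast
next
  fix f g a b assume fg: "f \<in> {f \<in> L2 M. Pr A f \<in> D}" "g \<in> {f \<in> L2 M. Pr A f \<in> D}"
  then have l: "(\<lambda>\<omega>. a * f \<omega> + b * g \<omega>) \<in> L2 M" by (auto intro: L2_lin)
  have "Pr A (\<lambda>\<omega>. a * f \<omega> + b * g \<omega>) \<in> D"
    by (rule closed_subspace_AE[OF D closed_subspace_lin[OF D] Pr_L2[OF A l] Pr_lin[OF A]]) (use fg in auto)
  with l show "(\<lambda>\<omega>. a * f \<omega> + b * g \<omega>) \<in> {f \<in> L2 M. Pr A f \<in> D}" by simp
next
  fix f assume f: "f \<in> L2 M"
    and a: "\<forall>\<epsilon>>0. \<exists>g\<in>{f \<in> L2 M. Pr A f \<in> D}. L2_norm M (\<lambda>\<omega>. f \<omega> - g \<omega>) < \<epsilon>"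
  have "Pr A f \<in> D"
  proof (rule closed_subspace_approx[OF D Pr_L2[OF A f]])
    fix \<epsilon> :: real assume "0 < \<epsilon>"
    then obtain g where g: "g \<in> L2 M" "Pr A g \<in> D" "L2_norm M (\<lambda>\<omega>. f \<omega> - g \<omega>) < \<epsilon>" using a by blast
    then show "\<exists>g\<in>D. L2_norm M (\<lambda>\<omega>. Pr A f \<omega> - g \<omega>) < \<epsilon>" using Pr_norm_diff[OF A f g(1)] by force
  qed
  then show "f \<in> {f \<in> L2 M. Pr A f \<in> D}" using f by simp
qed auto

text \<open>
  \<open>unsplit a\<close> consists of the points that no \<open>y \<in> B\<close> splits inside \<open>a\<close>. As \<open>B\<close> may be uncountable, the essential
  union of the sets \<open>split_by a y\<close> is taken along a sequence \<open>split_seq a\<close>.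
\<close>

definition split_by :: "'a set set \<Rightarrow> 'a set set \<Rightarrow> 's set" where
  "split_by a y = space \<mu> - (S (cp (a \<inter> y)) \<union> S (cp (a \<inter> cp y)))"

definition split_seq :: "'a set set \<Rightarrow> nat \<Rightarrow> 'a set set" where
  "split_seq a = (SOME y. (\<forall>k. y k \<in> B) \<and> (\<forall>i\<in>B. AE s in \<mu>. s \<in> split_by a i \<longrightarrow> (\<exists>k. s \<in> split_by a (y k))))"

definition unsplit :: "'a set set \<Rightarrow> 's set" where
  "unsplit a = space \<mu> - (\<Union>k. split_by a (split_seq a k))"

text \<open>The points that have at most one element in each cell of the partition, in the picture
  of spectral points as sets.\<close>

primrec separated :: "'a set set list \<Rightarrow> 'a set set \<Rightarrow> 's set" where
  "separated [] a = unsplit a"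
| "separated (z # zs) a = separated zs (a \<inter> z) \<inter> separated zs (a \<inter> cp z)"

lemma split_by_sets: "a \<in> B \<Longrightarrow> y \<in> B \<Longrightarrow> split_by a y \<in> sets \<mu>"
  unfolding split_by_def by (intro sets.compl_sets sets.Un S_sets) auto

lemma
  assumes a: "a \<in> B"
  shows split_seq_B: "split_seq a k \<in> B"
    and split_seq_AE: "i \<in> B \<Longrightarrow> AE s in \<mu>. s \<in> split_by a i \<longrightarrow> (\<exists>k. s \<in> split_by a (split_seq a k))"
proof -
  have "B \<noteq> {}" using Bot_B by blast
  from someI_ex[OF essential_union_\<mu>[OF this, where A="split_by a", OF split_by_sets[OF a]]]
  show "split_seq a k \<in> B" "i \<in> B \<Longrightarrow> AE s in \<mu>. s \<in> split_by a i \<longrightarrow> (\<exists>k. s \<in> split_by a (split_seq a k))"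
    unfolding split_seq_def[symmetric] by auto
qed

lemma split_by_Sig: "x \<in> B \<Longrightarrow> a \<in> B \<Longrightarrow> a \<subseteq> x \<Longrightarrow> y \<in> B \<Longrightarrow> split_by a y \<in> Sig x"
proof -
  assume x: "x \<in> B" and a: "a \<in> B" and ax: "a \<subseteq> x" and y: "y \<in> B"
  interpret sigma_algebra "space \<mu>" "Sig x" by (rule sigma_algebra_Sig[OF x])
  show ?thesis unfolding split_by_def by (intro compl_sets Un S_cp_in_Sig) (use x a ax y in auto)
qed

lemma unsplit_Sig: "x \<in> B \<Longrightarrow> a \<in> B \<Longrightarrow> a \<subseteq> x \<Longrightarrow> unsplit a \<in> Sig x"
proof -
  assume x: "x \<in> B" and a: "a \<in> B" and ax: "a \<subseteq> x"
  interpret sigma_algebra "space \<mu>" "Sig x" by (rule sigma_algebra_Sig[OF x])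
  show ?thesis unfolding unsplit_def
    by (intro compl_sets countable_UN) (use split_by_Sig[OF x a ax split_seq_B[OF a]] in auto)
qed

lemma separated_Sig: "set zs \<subseteq> B \<Longrightarrow> x \<in> B \<Longrightarrow> a \<in> B \<Longrightarrow> a \<subseteq> x \<Longrightarrow> separated zs a \<in> Sig x"
proof (induction zs arbitrary: a)
  case Nil then show ?case by (simp add: unsplit_Sig)
next
  case (Cons z zs)
  interpret sigma_algebra "space \<mu>" "Sig x" by (rule sigma_algebra_Sig[OF Cons.prems(2)])
  show ?case unfolding separated.simps by (intro Int Cons.IH) (use Cons.prems in auto)
qed

text \<open>For s in \<open>S a\<close>, lying in \<open>S (cp z)\<close> means not hitting the half
  \<open>a \<inter> z\<close>, and symmetrically. An unsplit point does not hit both halves, and a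
  point outside \<open>S Bot\<close> does not miss both. So exactly one of \<open>S z\<close> and
  \<open>S (cp z)\<close> contains it, as \<open>FC_iff_\<Psi>\<close> demands.\<close>

lemma unsplit_FC:
  assumes a: "a \<in> B" and f: "f \<in> L2_sub M a" shows "Pr (unsplit a - S Bot) f \<in> FC"
proof -
  have f2: "f \<in> L2 M" by (rule L2_sub_L2[OF f])
  have A: "unsplit a - S Bot \<in> sets \<mu>" using unsplit_Sig[OF a a order_refl] Sig_sets[OF a] S_sets[OF Bot_B] by auto
  have "AE s in \<mu>. \<Psi> (Pr (unsplit a - S Bot) f) s \<noteq> 0 \<longrightarrow> (s \<in> S z \<longleftrightarrow> s \<notin> S (cp z))" if z: "z \<in> B" for z
  proof -
    have B: "cp z \<in> B" "cp (a \<inter> z) \<in> B" "cp (a \<inter> cp z) \<in> B" using a z by auto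
    have 1: "AE s in \<mu>. s \<in> S (a \<inter> cp z) \<longleftrightarrow> s \<in> S a \<and> s \<in> S (cp (a \<inter> z))"
      using S_meet[OF a B(2)] meet_cp_meet[OF a z] by simp
    have 2: "AE s in \<mu>. s \<in> S (a \<inter> z) \<longleftrightarrow> s \<in> S a \<and> s \<in> S (cp (a \<inter> cp z))"
      using S_meet[OF a B(3)] meet_cp_meet[OF a B(1)] z by simp
    have 3: "AE s in \<mu>. s \<in> S Bot \<longleftrightarrow> s \<in> S z \<and> s \<in> S (cp z)" using S_meet[OF z B(1)] meet_cp[OF z] by simp
    have 4: "AE s in \<mu>. \<Psi> f s \<noteq> 0 \<longrightarrow> s \<in> S a" using f L2_sub_iff_\<Psi>[OF a f2] by simp
    from 1 2 3 4 \<Psi>_Pr[OF A f2] split_seq_AE[OF a z] S_meet[OF a z] S_meet[OF a B(1)] AE_space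
    show ?thesis
    proof eventually_elim
      case (elim s)
      show ?case
      proof
        assume "\<Psi> (Pr (unsplit a - S Bot) f) s \<noteq> 0"
        then have s: "s \<in> unsplit a" "s \<notin> S Bot" "s \<in> S a" using elim(4,5) by (auto split: split_indicator_asm)
        then have "s \<notin> split_by a z" using elim(6) by (auto simp: unsplit_def)
        then have "s \<in> S (cp (a \<inter> z)) \<or> s \<in> S (cp (a \<inter> cp z))" using elim(9) by (auto simp: split_by_def)
        then show "s \<in> S z \<longleftrightarrow> s \<notin> S (cp z)" using elim s by blast
      qed
    qed
  qed
  then show ?thesis using FC_iff_\<Psi>[OF Pr_L2[OF A f2]] by blast
qed

section \<open>Refining a partition increases the number of hits\<close>

lemma hit_weight_le_leaf: "set zs \<subseteq> B \<Longrightarrow> a \<in> B \<Longrightarrow> 0 \<le> \<rho> \<Longrightarrow> \<rho> \<le> 1 \<Longrightarrow> AE s in \<mu>. hit_weight \<rho> zs a s \<le> hit_weight \<rho> [] a s"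
proof (induction zs arbitrary: a)
  case (Cons z zs)
  then have B: "z \<in> B" "a \<in> B" "a \<inter> z \<in> B" "a \<inter> cp z \<in> B" "set zs \<subseteq> B" by auto
  have 4: "AE s in \<mu>. s \<in> S (cp a) \<longleftrightarrow> s \<in> S (cp (a \<inter> z)) \<and> s \<in> S (cp (a \<inter> cp z))"
    using S_meet[of "cp (a \<inter> z)" "cp (a \<inter> cp z)"] B cp_split_meet[OF B(2,1)] by simp
  from Cons.IH[OF B(5,3) Cons.prems(3,4)] Cons.IH[OF B(5,4) Cons.prems(3,4)] 4
  show ?case
  proof eventually_elim
    case (elim s)
    have "hit_weight \<rho> (z # zs) a s \<le> hit_weight \<rho> [] (a \<inter> z) s * hit_weight \<rho> [] (a \<inter> cp z) s"
      unfolding hit_weight.simps(2) by (rule mult_mono[OF elim(1,2)]) (rule hit_weight_bounds(1)[OF Cons.prems(3,4)])+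
    also have "\<dots> \<le> hit_weight \<rho> [] a s"
      using Cons.prems(3,4) elim(3) by (auto split: split_indicator simp: mult_left_le)
    finally show ?case .
  qed
qed simp

text \<open>If s hits both parts of a cut by y, and y occurs in the list, at least two cells are
  hit. Either the first element z already separates s, or s misses one half and y still splits it
  inside the other half.\<close>

lemma hit_weight_split_by:
  "set zs \<subseteq> B \<Longrightarrow> a \<in> B \<Longrightarrow> y \<in> set zs \<Longrightarrow> 0 \<le> \<rho> \<Longrightarrow> \<rho> \<le> 1 \<Longrightarrow>
   AE s in \<mu>. s \<in> split_by a y \<longrightarrow> hit_weight \<rho> zs a s \<le> \<rho> * \<rho>"
proof (induction zs arbitrary: a)
  case (Cons z zs)
  note r = Cons.prems(4,5)
  have B: "z \<in> B" "a \<in> B" "a \<inter> z \<in> B" "a \<inter> cp z \<in> B" "set zs \<subseteq> B" "y \<in> B" "cp z \<in> B" "cp y \<in> B"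
    using Cons.prems by auto
  have both: "AE s in \<mu>. s \<notin> S (cp (a \<inter> z)) \<longrightarrow> s \<notin> S (cp (a \<inter> cp z)) \<longrightarrow> hit_weight \<rho> (z # zs) a s \<le> \<rho> * \<rho>"
    using hit_weight_le_leaf[OF B(5,3) r] hit_weight_le_leaf[OF B(5,4) r]
  proof eventually_elim
    case (elim s)
    show ?case
    proof (intro impI)
      assume "s \<notin> S (cp (a \<inter> z))" "s \<notin> S (cp (a \<inter> cp z))"
      then have "hit_weight \<rho> zs (a \<inter> z) s \<le> \<rho>" "hit_weight \<rho> zs (a \<inter> cp z) s \<le> \<rho>" using elim by auto
      then show "hit_weight \<rho> (z # zs) a s \<le> \<rho> * \<rho>"
        unfolding hit_weight.simps(2) using hit_weight_bounds(1)[OF r] r by (intro mult_mono) auto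
    qed
  qed
  show ?case
  proof (cases "y = z")
    case True
    from both show ?thesis by eventually_elim (use True in \<open>auto simp: split_by_def\<close>)
  next
    case False
    then have y: "y \<in> set zs" using Cons.prems by auto
    \<comment> \<open>If s misses \<open>a \<inter> cp u\<close>, all it has in a is in
      \<open>a \<inter> u\<close>, so being split by y is inherited by that half.\<close>
    have child: "AE s in \<mu>. s \<in> split_by a y \<longrightarrow> s \<in> S (cp (a \<inter> cp u)) \<longrightarrow> s \<in> split_by (a \<inter> u) y" if u: "u \<in> B" for u
    proof -
      have half: "AE s in \<mu>. s \<in> S (cp (a \<inter> cp u)) \<longrightarrow> s \<in> S (cp (a \<inter> u \<inter> v)) \<longrightarrow> s \<in> S (cp (a \<inter> v))" if v: "v \<in> B" for v
      proof -
        have B': "cp (a \<inter> v \<inter> u) \<in> B" "cp (a \<inter> v \<inter> cp u) \<in> B" "cp (a \<inter> cp u) \<in> B" using B u v by auto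
        have 1: "AE s in \<mu>. s \<in> S (cp (a \<inter> v)) \<longleftrightarrow> s \<in> S (cp (a \<inter> v \<inter> u)) \<and> s \<in> S (cp (a \<inter> v \<inter> cp u))"
          using S_meet[OF B'(1,2)] cp_split_meet[of "a \<inter> v" u] B u v by simp
        have 2: "AE s in \<mu>. s \<in> S (cp (a \<inter> cp u)) \<longrightarrow> s \<in> S (cp (a \<inter> v \<inter> cp u))"
        proof (rule S_mono[OF B'(3,2)])
          show "cp (a \<inter> cp u) \<subseteq> cp (a \<inter> v \<inter> cp u)" using B u v by (intro cp_antimono) auto
        qed
        have "a \<inter> u \<inter> v = a \<inter> v \<inter> u" by auto
        with 1 2 show ?thesis by (auto elim!: eventually_elim2)
      qed
      from half[OF B(6)] half[OF B(8)] show ?thesis by eventually_elim (auto simp: split_by_def)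
    qed
    have c1: "AE s in \<mu>. s \<in> split_by a y \<longrightarrow> s \<in> S (cp (a \<inter> cp z)) \<longrightarrow> s \<in> split_by (a \<inter> z) y" by (rule child[OF B(1)])
    have c2: "AE s in \<mu>. s \<in> split_by a y \<longrightarrow> s \<in> S (cp (a \<inter> z)) \<longrightarrow> s \<in> split_by (a \<inter> cp z) y"
      using child[OF B(7)] B(1) by simp
    from both c1 c2 Cons.IH[OF B(5,3) y r] Cons.IH[OF B(5,4) y r]
    show ?thesis
    proof eventually_elim
      case (elim s)
      have m: "u * v \<le> \<rho> * \<rho>" if "u \<le> \<rho> * \<rho>" "v \<le> 1" "0 \<le> u" "0 \<le> v" for u v :: real
        using mult_mono[OF that(1,2)] that r by simp
      note b = hit_weight_bounds[OF r, of zs]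
      show ?case
      proof
        assume h: "s \<in> split_by a y"
        consider "s \<notin> S (cp (a \<inter> z))" "s \<notin> S (cp (a \<inter> cp z))" | "s \<in> S (cp (a \<inter> cp z))" | "s \<in> S (cp (a \<inter> z))" by blast
        then show "hit_weight \<rho> (z # zs) a s \<le> \<rho> * \<rho>"
        proof cases
          case 1 then show ?thesis using elim(1) by blast
        next
          case 2 then show ?thesis using elim(2,4) h m[OF _ b(2) b(1) b(1)] by simp
        next
          case 3
          then have "hit_weight \<rho> zs (a \<inter> cp z) s * hit_weight \<rho> zs (a \<inter> z) s \<le> \<rho> * \<rho>" using elim(3,5) h m[OF _ b(2) b(1) b(1)] by simp
          then show ?thesis by (simp add: mult.commute)
        qed
      qed
    qed
  qed
qed simp

text \<open>Finite counterpart of the complement of \<open>separated\<close>, with the candidates ys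
  in place of the sequences \<open>split_seq\<close>.\<close>

primrec split_set :: "'a set set list \<Rightarrow> 'a set set \<Rightarrow> 'a set set list \<Rightarrow> 's set" where
  "split_set [] a ys = (\<Union>y\<in>set ys. split_by a y)"
| "split_set (z # zs) a ys = split_set zs (a \<inter> z) ys \<union> split_set zs (a \<inter> cp z) ys"

lemma split_set_sets: "set zs \<subseteq> B \<Longrightarrow> a \<in> B \<Longrightarrow> set ys \<subseteq> B \<Longrightarrow> split_set zs a ys \<in> sets \<mu>"
proof (induction zs arbitrary: a)
  case Nil
  then show ?case unfolding split_set.simps by (intro sets.finite_UN split_by_sets) auto
next
  case (Cons z zs)
  then show ?case unfolding split_set.simps by (intro sets.Un Cons.IH) auto
qed

lemma split_set_mono: "set ys \<subseteq> set ys' \<Longrightarrow> split_set zs a ys \<subseteq> split_set zs a ys'"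
proof (induction zs arbitrary: a)
  case Nil then show ?case unfolding split_set.simps by (intro UN_mono) auto
next
  case (Cons z zs) then show ?case unfolding split_set.simps by (intro Un_mono)
qed

text \<open>Appending ys refines every cell of zs. A cell in which s is split contributes at least
  two hits instead of one, which costs a factor \<open>\<rho>\<close>; the other cells cannot gain
  weight.\<close>

lemma hit_weight_append:
  "set zs \<subseteq> B \<Longrightarrow> set ys \<subseteq> B \<Longrightarrow> a \<in> B \<Longrightarrow> 0 \<le> \<rho> \<Longrightarrow> \<rho> \<le> 1 \<Longrightarrow>
   AE s in \<mu>. hit_weight \<rho> (zs @ ys) a s \<le> hit_weight \<rho> zs a s \<and> (s \<in> split_set zs a ys \<longrightarrow> hit_weight \<rho> (zs @ ys) a s \<le> \<rho> * hit_weight \<rho> zs a s)"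
proof (induction zs arbitrary: a)
  case Nil
  note r = Nil(4,5)
  have 1: "AE s in \<mu>. \<forall>y\<in>set ys. s \<in> split_by a y \<longrightarrow> hit_weight \<rho> ys a s \<le> \<rho> * \<rho>"
    using hit_weight_split_by[OF Nil(2,3) _ r] by (intro AE_finite_allI) auto
  have 2: "AE s in \<mu>. \<forall>y\<in>set ys. s \<in> S (cp a) \<longrightarrow> s \<in> S (cp (a \<inter> y))"
    using Nil by (intro AE_finite_allI S_mono cp_antimono) auto
  from 1 2 hit_weight_le_leaf[OF Nil(2,3) r] show ?case
  proof eventually_elim
    case (elim s)
    have "hit_weight \<rho> ys a s \<le> \<rho> * hit_weight \<rho> [] a s" if "s \<in> split_set [] a ys"
    proof -
      from that obtain y where y: "y \<in> set ys" "s \<in> split_by a y" by auto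
      \<comment> \<open>A split cell is hit, so its undivided weight is exactly
        \<open>\<rho>\<close> and the bound \<rho>^2 is \<open>\<rho>\<close> times that
        weight.\<close>
      then have "s \<notin> S (cp a)" using elim(2) by (auto simp: split_by_def)
      moreover have "hit_weight \<rho> ys a s \<le> \<rho> * \<rho>" using elim(1) y by blast
      ultimately show ?thesis by simp
    qed
    then show ?case using elim(3) by (simp only: append_Nil) blast
  qed
next
  case (Cons z zs)
  note r = Cons.prems(4,5)
  have B: "set zs \<subseteq> B" "set ys \<subseteq> B" "a \<inter> z \<in> B" "a \<inter> cp z \<in> B" using Cons.prems by auto
  from Cons.IH[OF B(1,2,3) r] Cons.IH[OF B(1,2,4) r] show ?case
  proof eventually_elim
    case (elim s)
    let ?u = "hit_weight \<rho> (zs @ ys) (a \<inter> z) s" and ?v = "hit_weight \<rho> (zs @ ys) (a \<inter> cp z) s"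
    let ?u' = "hit_weight \<rho> zs (a \<inter> z) s" and ?v' = "hit_weight \<rho> zs (a \<inter> cp z) s"
    have nn: "0 \<le> ?u" "0 \<le> ?v" "0 \<le> ?u'" "0 \<le> ?v'" using hit_weight_bounds(1)[OF r] by auto
    have "?u * ?v \<le> ?u' * ?v'" using elim nn by (intro mult_mono) auto
    moreover have "?u * ?v \<le> \<rho> * (?u' * ?v')" if "s \<in> split_set zs (a \<inter> z) ys"
    proof -
      have "?u * ?v \<le> (\<rho> * ?u') * ?v'" using elim nn that r by (intro mult_mono) auto
      then show ?thesis by (simp add: mult_ac)
    qed
    moreover have "?u * ?v \<le> \<rho> * (?u' * ?v')" if "s \<in> split_set zs (a \<inter> cp z) ys"
    proof -
      have "?u * ?v \<le> ?u' * (\<rho> * ?v')" using elim nn that r by (intro mult_mono) auto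
      then show ?thesis by (simp add: mult_ac)
    qed
    ultimately show ?case by auto
  qed
qed

text \<open>The first n splitting elements of all cells go into one list. Using them also in cells
  they were not chosen for only enlarges the split set, so the complement of
  \<open>separated\<close> is still exhausted as n grows.\<close>

primrec splitters :: "'a set set list \<Rightarrow> 'a set set \<Rightarrow> nat \<Rightarrow> 'a set set list" where
  "splitters [] a n = map (split_seq a) [0..<n]"
| "splitters (z # zs) a n = splitters zs (a \<inter> z) n @ splitters zs (a \<inter> cp z) n"

lemma splitters_B: "set zs \<subseteq> B \<Longrightarrow> a \<in> B \<Longrightarrow> set (splitters zs a n) \<subseteq> B"
  by (induction zs arbitrary: a) (auto simp: split_seq_B)

lemma splitters_mono: "n \<le> m \<Longrightarrow> set (splitters zs a n) \<subseteq> set (splitters zs a m)"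
proof (induction zs arbitrary: a)
  case Nil then show ?case by auto
next
  case (Cons z zs) then show ?case unfolding splitters.simps set_append by (intro Un_mono)
qed

lemma compl_separated: "space \<mu> - separated zs a \<subseteq> (\<Union>n. split_set zs a (splitters zs a n))"
proof (induction zs arbitrary: a)
  case Nil
  show ?case
  proof
    fix s assume "s \<in> space \<mu> - separated [] a"
    then obtain k where "s \<in> split_by a (split_seq a k)" by (auto simp: unsplit_def)
    then have "s \<in> split_set [] a (splitters [] a (Suc k))" by auto
    then show "s \<in> (\<Union>n. split_set [] a (splitters [] a n))" by blast
  qed
next
  case (Cons z zs)
  have 1: "split_set zs (a \<inter> z) (splitters zs (a \<inter> z) n) \<subseteq> split_set (z # zs) a (splitters (z # zs) a n)" for n
    using split_set_mono[of "splitters zs (a \<inter> z) n" "splitters (z # zs) a n" zs "a \<inter> z"] by auto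
  have 2: "split_set zs (a \<inter> cp z) (splitters zs (a \<inter> cp z) n) \<subseteq> split_set (z # zs) a (splitters (z # zs) a n)" for n
    using split_set_mono[of "splitters zs (a \<inter> cp z) n" "splitters (z # zs) a n" zs "a \<inter> cp z"] by auto
  have "space \<mu> - separated (z # zs) a = (space \<mu> - separated zs (a \<inter> z)) \<union> (space \<mu> - separated zs (a \<inter> cp z))"
    by auto
  also have "\<dots> \<subseteq> (\<Union>n. split_set zs (a \<inter> z) (splitters zs (a \<inter> z) n)) \<union> (\<Union>n. split_set zs (a \<inter> cp z) (splitters zs (a \<inter> cp z) n))"
    by (intro Un_mono Cons.IH)
  also have "\<dots> \<subseteq> (\<Union>n. split_set (z # zs) a (splitters (z # zs) a n))"
    by (intro Un_least UN_mono subset_refl 1 2)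
  finally show ?case .
qed

text \<open>The partition is chosen with almost maximal defect. A refinement cannot increase the
  defect much further, while each point it splits would contribute to such an increase; hence few
  points are split by any refinement.\<close>

lemma tight_separated:
  assumes f: "f \<in> tight" and e: "0 < \<epsilon>"
  obtains zs where "set zs \<subseteq> B" "measure (spectral_measure f) (space \<mu> - separated zs (sets M)) \<le> 2 * \<epsilon>"
proof -
  have f2: "f \<in> L2 M" by (rule tight_L2[OF f])
  interpret F: finite_measure "spectral_measure f" by (rule finite_measure_spectral_measure[OF f2])
  obtain \<rho> where r: "0 < \<rho>" "\<rho> < 1" and defect_le: "\<And>zs. set zs \<subseteq> B \<Longrightarrow> defect \<rho> zs f \<le> \<epsilon>"
    using tightD[OF f e] by blast
  have r': "0 \<le> \<rho>" "\<rho> \<le> 1" using r by auto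
  let ?Z = "{zs. set zs \<subseteq> B}"
  define c where "c = (SUP zs\<in>?Z. defect \<rho> zs f)"
  have Z: "?Z \<noteq> {}" by (auto intro: exI[of _ "[]"])
  have bdd: "bdd_above ((\<lambda>zs. defect \<rho> zs f) ` ?Z)" using defect_le by (intro bdd_aboveI[of _ \<epsilon>]) auto
  \<comment> \<open>The tolerance carries the factor 1 - rho in order to cancel the factor by which
    splitting changes the weight.\<close>
  have "c - (1 - \<rho>) * \<epsilon> < c" using r e by simp
  then obtain zs where zs: "set zs \<subseteq> B" and zc: "c - (1 - \<rho>) * \<epsilon> < defect \<rho> zs f"
    using less_cSUP_iff[OF Z bdd] unfolding c_def by blast
  have key: "measure (spectral_measure f) (split_set zs (sets M) ys) \<le> 2 * \<epsilon>" if ys: "set ys \<subseteq> B" for ys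
  proof -
    let ?D = "split_set zs (sets M) ys" and ?w = "hit_weight \<rho> zs (sets M)" and ?n = "\<lambda>s. (norm (\<Psi> f s))\<^sup>2"
    have D: "?D \<in> sets \<mu>" by (rule split_set_sets[OF zs top_B ys])
    have zy: "set (zs @ ys) \<subseteq> B" using zs ys by simp
    note i1 = hit_weight_integrable[OF zs top_B f2 r'] and i2 = hit_weight_integrable[OF zy top_B f2 r']
    have iD: "integrable \<mu> (\<lambda>s. indicator ?D s * (?w s * ?n s))" "integrable \<mu> (\<lambda>s. indicator ?D s * ?n s)"
      using integrable_mult_indicator[OF D i1(1)] integrable_mult_indicator[OF D \<Psi>_integrable[OF f2]] by simp_all
    \<comment> \<open>On the split set the weight w drops to at most rho w, so 1 - weight rises by
      at least (1 - rho) w; elsewhere it does not decrease.\<close>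
    have "(1 - \<rho>) * (LINT s|\<mu>. indicator ?D s * (?w s * ?n s)) \<le> (LINT s|\<mu>. (1 - hit_weight \<rho> (zs @ ys) (sets M) s) * ?n s - (1 - ?w s) * ?n s)"
    proof (subst integral_mult_right_zero[symmetric], rule integral_mono_AE)
      show "AE s in \<mu>. (1 - \<rho>) * (indicator ?D s * (?w s * ?n s)) \<le> (1 - hit_weight \<rho> (zs @ ys) (sets M) s) * ?n s - (1 - ?w s) * ?n s"
        using hit_weight_append[OF zs ys top_B r']
      proof eventually_elim
        case (elim s)
        have "(1 - \<rho>) * (indicator ?D s * ?w s) \<le> ?w s - hit_weight \<rho> (zs @ ys) (sets M) s"
          using elim by (auto split: split_indicator simp: algebra_simps)
        then have "(1 - \<rho>) * (indicator ?D s * ?w s) * ?n s \<le> (?w s - hit_weight \<rho> (zs @ ys) (sets M) s) * ?n s"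
          by (rule mult_right_mono) simp
        then show ?case by (simp add: algebra_simps)
      qed
    qed (use iD i1 i2 in auto)
    also have "\<dots> = defect \<rho> (zs @ ys) f - defect \<rho> zs f" using i1 i2 by (simp add: defect_def)
    also have "\<dots> \<le> (1 - \<rho>) * \<epsilon>"
      using cSUP_upper[OF _ bdd, of "zs @ ys"] zy zc unfolding c_def by simp
    finally have 1: "(LINT s|\<mu>. indicator ?D s * (?w s * ?n s)) \<le> \<epsilon>" using r by simp
    have "measure (spectral_measure f) ?D = (LINT s|\<mu>. indicator ?D s * ?n s)"
      using emeasure_spectral_measure[OF f2 D] by (simp add: measure_def ip_self_nonneg ip_Pr[OF D f2])
    \<comment> \<open>Writing 1 = w + (1 - w) on the split set: the first part has just been
      bounded, the second is at most the defect of zs.\<close>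
    also have "\<dots> \<le> (LINT s|\<mu>. indicator ?D s * (?w s * ?n s) + (1 - ?w s) * ?n s)"
    proof (rule integral_mono[OF iD(2)])
      show "indicator ?D s * ?n s \<le> indicator ?D s * (?w s * ?n s) + (1 - ?w s) * ?n s" for s
        using hit_weight_bounds(2)[OF r', of zs "sets M" s] by (auto split: split_indicator simp: algebra_simps mult_left_le)
    qed (use iD i1 in auto)
    also have "\<dots> \<le> 2 * \<epsilon>" using 1 defect_le[OF zs] iD i1 by (simp add: defect_def)
    finally show ?thesis .
  qed
  define U where "U n = split_set zs (sets M) (splitters zs (sets M) n)" for n
  have ylB: "set (splitters zs (sets M) n) \<subseteq> B" for n by (rule splitters_B[OF zs top_B])
  have Us: "U n \<in> sets \<mu>" for n unfolding U_def by (rule split_set_sets[OF zs top_B ylB])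
  have inc: "incseq U" unfolding U_def by (intro monoI split_set_mono splitters_mono)
  have "(\<lambda>n. measure (spectral_measure f) (U n)) \<longlonglongrightarrow> measure (spectral_measure f) (\<Union>n. U n)"
    by (rule F.finite_Lim_measure_incseq[OF _ inc]) (use Us in auto)
  \<comment> \<open>The bound does not depend on the list of splitters, so it survives the
    increasing limit over all the sequences \<open>split_seq\<close>.\<close>
  then have "measure (spectral_measure f) (\<Union>n. U n) \<le> 2 * \<epsilon>"
    by (rule LIMSEQ_le_const2) (use key[OF ylB] in \<open>auto simp: U_def\<close>)
  moreover have "measure (spectral_measure f) (space \<mu> - separated zs (sets M)) \<le> measure (spectral_measure f) (\<Union>n. U n)"
    by (rule F.finite_measure_mono) (use compl_separated[of zs "sets M"] Us in \<open>auto simp: U_def\<close>)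
  ultimately show ?thesis using that[OF zs] by simp
qed

text \<open>Isolating this as a closure principle allows three choices of D: the constants, the
  functions measurable for the field generated by the first chaos, and the vectors whose spectral
  measure is absolutely continuous with respect to that of an exponential vector.\<close>

lemma tight_subset:
  assumes D: "closed_subspace M D" and D1: "(\<lambda>\<omega>. 1) \<in> D" and FCD: "FC \<subseteq> D"
    and prod: "\<And>y f g. y \<in> B \<Longrightarrow> f \<in> D \<Longrightarrow> f \<in> L2_sub M y \<Longrightarrow> g \<in> D \<Longrightarrow> g \<in> L2_sub M (cp y) \<Longrightarrow> (\<lambda>\<omega>. f \<omega> * g \<omega>) \<in> D"
  shows "tight \<subseteq> D"
proof
  have separated_D: "Pr (separated zs a) f \<in> D" if "set zs \<subseteq> B" "a \<in> B" "f \<in> L2_sub M a" for zs a f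
    using that
  proof (induction zs arbitrary: a f)
    case Nil
    then have a: "a \<in> B" and f: "f \<in> L2_sub M a" and f2: "f \<in> L2 M" by (auto dest: L2_sub_L2)
    have F: "unsplit a \<in> sets \<mu>" using unsplit_Sig[OF a a order_refl] Sig_sets[OF a] by blast
    then have F': "unsplit a - S Bot \<in> sets \<mu>" using S_sets[OF Bot_B] by blast
    let ?k = "Pr (unsplit a) f" and ?X = "Pr (unsplit a - S Bot) f"
    have k: "?k \<in> L2 M" and X: "?X \<in> L2 M" using F F' f2 by (auto intro: Pr_L2)
    \<comment> \<open>In a single unsplit cell a vector is its mean plus a first chaos vector: the
      mean is the part on \<open>S Bot\<close>, and \<open>unsplit_FC\<close> handles the remainder
      \<open>?X\<close>.\<close>
    have c: "cexp M Bot ?k \<in> L2 M" by (rule cexp_L2[OF B_sub[OF Bot_B] k])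
    have "(\<lambda>\<omega>. expectation ?k) \<in> D" using closed_subspace_scale[OF D D1, of "expectation ?k"] by simp
    then have "cexp M Bot ?k \<in> D"
      by (rule closed_subspace_AE[OF D _ c]) (use cexp_Bot[OF k] in eventually_elim, simp)
    moreover have "?X \<in> D" using unsplit_FC[OF a f] FCD by blast
    ultimately have s: "(\<lambda>\<omega>. ?X \<omega> + cexp M Bot ?k \<omega>) \<in> D" by (intro closed_subspace_add[OF D])
    have "AE s in \<mu>. \<Psi> (\<lambda>\<omega>. ?X \<omega> + cexp M Bot ?k \<omega>) s = indicator (unsplit a) s *\<^sub>R \<Psi> f s"
      using \<Psi>_add[OF X c] S_cexp[OF Bot_B k] \<Psi>_Pr[OF F f2] \<Psi>_Pr[OF F' f2]
      by eventually_elim (auto split: split_indicator)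
    from Pr_eqI[OF F f2 L2_add[OF X c] this] show ?case
      unfolding separated.simps by (rule closed_subspace_AE[OF D s k])
  next
    case (Cons z zs)
    have B: "z \<in> B" "a \<in> B" "set zs \<subseteq> B" "a \<inter> z \<in> B" "a \<inter> cp z \<in> B" "cp z \<in> B" using Cons.prems by auto
    have r1: "separated zs (a \<inter> z) \<in> Sig z" and r2: "separated zs (a \<inter> cp z) \<in> Sig (cp z)" using B by (auto intro!: separated_Sig)
    then have separated: "separated zs (a \<inter> z) \<in> sets \<mu>" "separated zs (a \<inter> cp z) \<in> sets \<mu>"
      using Sig_sets[OF B(1)] Sig_sets[OF B(6)] by auto
    then have R: "separated (z # zs) a \<in> sets \<mu>" by auto
    \<comment> \<open>By density only products of indicators from the two halves have to be treated;
      on these the projection factorises and the induction hypothesis applies to each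
      factor.\<close>
    have "f \<in> {f \<in> L2 M. Pr (separated (z # zs) a) f \<in> D}"
    proof (rule indep_product_dense[OF B_sub[OF B(4)] B_sub[OF B(5)] indep_split[OF B(2,1)] closed_subspace_Pr_vimage[OF R D]])
      show "f \<in> L2_sub M (J (a \<inter> z) (a \<inter> cp z))" using Cons.prems(3) split_B[OF B(2,1)] by simp
      fix A C assume "A \<in> a \<inter> z" "C \<in> a \<inter> cp z"
      then have g: "indicator A \<in> L2_sub M (a \<inter> z)" and h: "indicator C \<in> L2_sub M (a \<inter> cp z)"
        using B by (auto intro!: L2_sub_indicator)
      have g': "indicator A \<in> L2_sub M z" and h': "indicator C \<in> L2_sub M (cp z)"
        using L2_sub_mono[OF _ _ _ g, of z] L2_sub_mono[OF _ _ _ h, of "cp z"] B by auto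
      have gh: "(\<lambda>\<omega>. indicator A \<omega> * indicator C \<omega> :: real) \<in> L2 M"
        by (rule indep_product(1)[OF B_sub[OF B(1)] B_sub[OF B(6)] cp_indep[OF B(1)] g' h'])
      have "(\<lambda>\<omega>. Pr (separated zs (a \<inter> z)) (indicator A) \<omega> * Pr (separated zs (a \<inter> cp z)) (indicator C) \<omega>) \<in> D"
        by (rule prod[OF B(1) Cons.IH[OF B(3,4) g] Pr_L2_sub[OF separated(1) B(1) g'] Cons.IH[OF B(3,5) h] Pr_L2_sub[OF separated(2) B(6) h']])
      then have "Pr (separated (z # zs) a) (\<lambda>\<omega>. indicator A \<omega> * indicator C \<omega>) \<in> D"
        by (rule closed_subspace_AE[OF D _ Pr_L2[OF R gh]])
          (use Pr_product2[OF B(1) r1 r2 g' h'] in \<open>eventually_elim, simp\<close>)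
      then show "(\<lambda>\<omega>. indicator A \<omega> * indicator C \<omega>) \<in> {f \<in> L2 M. Pr (separated (z # zs) a) f \<in> D}"
        using gh by simp
    qed
    then show ?case by simp
  qed
  fix f assume f: "f \<in> tight"
  have f2: "f \<in> L2 M" by (rule tight_L2[OF f])
  show "f \<in> D"
  proof (rule closed_subspace_approx[OF D f2])
    fix \<delta> :: real assume d: "0 < \<delta>"
    \<comment> \<open>\<open>tight_separated\<close> doubles the tolerance, so the squared distance
      is at most \<delta>^2/2, strictly below \<delta>^2.\<close>
    obtain zs where zs: "set zs \<subseteq> B" and m: "measure (spectral_measure f) (space \<mu> - separated zs (sets M)) \<le> 2 * (\<delta>\<^sup>2 / 4)"
      using tight_separated[OF f, of "\<delta>\<^sup>2 / 4"] d by auto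
    let ?R = "separated zs (sets M)"
    have R: "?R \<in> sets \<mu>" using separated_Sig[OF zs top_B top_B order_refl] Sig_sets[OF top_B] by blast
    have R': "space \<mu> - ?R \<in> sets \<mu>" using R by auto
    have "L2_norm M (\<lambda>\<omega>. f \<omega> - Pr ?R f \<omega>) = L2_norm M (Pr (space \<mu> - ?R) f)"
      by (rule L2_norm_cong_AE[OF L2_diff[OF f2 Pr_L2[OF R f2]] Pr_L2[OF R' f2] Pr_compl[OF R f2]])
    also have "(\<dots>)\<^sup>2 = measure (spectral_measure f) (space \<mu> - ?R)"
      using emeasure_spectral_measure[OF f2 R'] by (simp add: measure_def ip_self_nonneg L2_norm_square)
    finally have "(L2_norm M (\<lambda>\<omega>. f \<omega> - Pr ?R f \<omega>))\<^sup>2 \<le> \<delta>\<^sup>2 / 2" using m by simp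
    also have "\<dots> < \<delta>\<^sup>2" using d by simp
    finally have "L2_norm M (\<lambda>\<omega>. f \<omega> - Pr ?R f \<omega>) < \<delta>" using d by (simp add: power_less_imp_less_base)
    moreover have "Pr ?R f \<in> D" by (rule separated_D[OF zs top_B]) (simp add: L2_sub_top f2)
    ultimately show "\<exists>g\<in>D. L2_norm M (\<lambda>\<omega>. f \<omega> - g \<omega>) < \<delta>" by blast
  qed
qed

section \<open>Absolute continuity of spectral measures of products\<close>

lemma \<Psi>_span:
  assumes "finite X" "X \<subseteq> B" and f: "f \<in> L2 M"
  shows "(\<lambda>\<omega>. \<Sum>x\<in>X. c x * cexp M x f \<omega>) \<in> L2 M \<and>
    (AE s in \<mu>. \<Psi> (\<lambda>\<omega>. \<Sum>x\<in>X. c x * cexp M x f \<omega>) s = (\<Sum>x\<in>X. c x * indicator (S x) s) *\<^sub>R \<Psi> f s)"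
  using assms(1,2)
proof (induction X rule: finite_induct)
  case empty
  have "AE s in \<mu>. \<Psi> (\<lambda>\<omega>. 0) s = 0" using \<Psi>_eq_0[OF L2_zero] by simp
  then show ?case using L2_zero by simp
next
  case (insert x X)
  then have x: "x \<in> B" and X: "X \<subseteq> B" by auto
  let ?R = "\<lambda>\<omega>. \<Sum>x\<in>X. c x * cexp M x f \<omega>"
  have R: "?R \<in> L2 M" and ae: "AE s in \<mu>. \<Psi> ?R s = (\<Sum>x\<in>X. c x * indicator (S x) s) *\<^sub>R \<Psi> f s"
    using insert.IH[OF X] by auto
  have c: "cexp M x f \<in> L2 M" using x f by (auto intro: cexp_L2)
  have eq: "(\<lambda>\<omega>. \<Sum>x\<in>insert x X. c x * cexp M x f \<omega>) = (\<lambda>\<omega>. c x * cexp M x f \<omega> + 1 * ?R \<omega>)"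
    using insert by (simp add: fun_eq_iff)
  have "AE s in \<mu>. \<Psi> (\<lambda>\<omega>. c x * cexp M x f \<omega> + 1 * ?R \<omega>) s = (\<Sum>x\<in>insert x X. c x * indicator (S x) s) *\<^sub>R \<Psi> f s"
    using \<Psi>_lin[OF c R, of "c x" 1] ae S_cexp[OF x f]
  proof eventually_elim
    case (elim s)
    show ?case unfolding elim(1) elim(2) elim(3) sum.insert[OF insert.hyps(1,2)]
      by (simp only: scaleR_left_distrib scaleR_scaleR mult_1_left)
  qed
  then show ?case unfolding eq using L2_lin[OF c R] by blast
qed

text \<open>With \<open>S_meet\<close>, this writes \<open>S x\<close> as the intersection of an
  event of \<open>Sig y\<close> and an event of \<open>Sig (cp y)\<close>.\<close>

lemma meet_joins: assumes x: "x \<in> B" and y: "y \<in> B" shows "J x (cp y) \<inter> J x y = x"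
proof -
  have "J x (cp y) \<inter> J x y = J (J x (cp y) \<inter> x) (J x (cp y) \<inter> y)" using x y by (simp add: B_distrib)
  also have "J x (cp y) \<inter> x = x" using join_field_upper(1)[of x M "cp y"] by auto
  also have "J x (cp y) \<inter> y = J (y \<inter> x) (y \<inter> cp y)" using x y B_distrib[of y x "cp y"] by (simp add: Int_commute)
  also have "J x \<dots> = x"
    using x y meet_cp[OF y] Bot_le[OF x] by (intro J_absorb J_least) auto
  finally show ?thesis .
qed

text \<open>Multiplication by the indicator of E comes from an operator in the algebra, that is from
  a strong limit of combinations of the P_x, and each of these multiplies by a combination of
  rectangle indicators. The join of the two fields is encoded by the diagonal map into the product
  space, where Fubini's theorem is available.\<close>

lemma sets_generated:
  assumes y: "y \<in> B" and E: "E \<in> sets \<mu>"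
  obtains Q where "Q \<in> sets (sigma (space \<mu>) (Sig y) \<Otimes>\<^sub>M sigma (space \<mu>) (Sig (cp y)))"
    "AE s in \<mu>. s \<in> E \<longleftrightarrow> (s, s) \<in> Q"
proof -
  let ?P1 = "sigma (space \<mu>) (Sig y)" and ?P2 = "sigma (space \<mu>) (Sig (cp y))"
  obtain f where f: "f \<in> L2 M" and f0: "AE s in \<mu>. \<Psi> f s \<noteq> 0" by (rule full_support)
  interpret N: finite_measure "spectral_measure f" by (rule finite_measure_spectral_measure[OF f])
  have "indicator E \<in> Linf \<mu>" using E by (auto simp: Linf_def intro!: exI[of _ 1] AE_I2 split: split_indicator)
  moreover have "\<forall>h\<in>Linf \<mu>. \<exists>T\<in>noise_operator_algebra M B. intertwines_diagonal M \<mu> \<Psi> T h"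
    using sr by (simp add: spectral_resolution_def)
  ultimately obtain T where T: "T \<in> noise_operator_algebra M B" and TE: "intertwines_diagonal M \<mu> \<Psi> T (indicator E)"
    by blast
  have Tf: "T f \<in> L2 M" using T f by (simp add: noise_operator_algebra_def bounded_operator_def)
  have \<Psi>T: "AE s in \<mu>. \<Psi> (T f) s = indicator E s *\<^sub>R \<Psi> f s" using TE f by (simp add: intertwines_diagonal_def)
  \<comment> \<open>One test vector is enough, since a vector of full support determines a
    multiplier almost everywhere.\<close>
  have "\<exists>R\<in>cexp_span M B. L2_norm M (\<lambda>\<omega>. T f \<omega> - R f \<omega>) < \<epsilon>" if "0 < \<epsilon>" for \<epsilon>
  proof -
    have "\<forall>F \<epsilon>. finite F \<and> F \<subseteq> L2 M \<and> \<epsilon> > 0 \<longrightarrow>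
            (\<exists>R\<in>cexp_span M B. \<forall>f\<in>F. L2_norm M (\<lambda>\<omega>. T f \<omega> - R f \<omega>) < \<epsilon>)"
      using T by (simp add: noise_operator_algebra_def)
    from this[rule_format, of "{f}" \<epsilon>] that f show ?thesis by auto
  qed
  then have "\<exists>X c. finite X \<and> X \<subseteq> B \<and> L2_norm M (\<lambda>\<omega>. T f \<omega> - (\<Sum>x\<in>X. c x * cexp M x f \<omega>)) < \<epsilon>" if "0 < \<epsilon>" for \<epsilon>
    using that unfolding cexp_span_def by fastforce
  then have "\<forall>n. \<exists>X c. finite X \<and> X \<subseteq> B \<and>
      L2_norm M (\<lambda>\<omega>. T f \<omega> - (\<Sum>x\<in>X. c x * cexp M x f \<omega>)) < 1 / real (Suc n)"
    by simp
  from choice[OF this] obtain X where "\<forall>n. \<exists>c. finite (X n) \<and> X n \<subseteq> B \<and>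
      L2_norm M (\<lambda>\<omega>. T f \<omega> - (\<Sum>x\<in>X n. c x * cexp M x f \<omega>)) < 1 / real (Suc n)" ..
  from choice[OF this] obtain c where Xc': "\<forall>n. finite (X n) \<and> X n \<subseteq> B \<and>
      L2_norm M (\<lambda>\<omega>. T f \<omega> - (\<Sum>x\<in>X n. c n x * cexp M x f \<omega>)) < 1 / real (Suc n)" ..
  then have X: "\<And>n. finite (X n)" "\<And>n. X n \<subseteq> B"
    and Xc: "\<And>n. L2_norm M (\<lambda>\<omega>. T f \<omega> - (\<Sum>x\<in>X n. c n x * cexp M x f \<omega>)) < 1 / real (Suc n)"
    by blast+
  define h where "h n s = (\<Sum>x\<in>X n. c n x * indicator (S x) s)" for n s
  have hm [measurable]: "h n \<in> borel_measurable \<mu>" for n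
    unfolding h_def[abs_def] using S_sets[OF subsetD[OF X(2)]] by (intro borel_measurable_sum borel_measurable_times borel_measurable_indicator) auto
  note [measurable] = E
  let ?R = "\<lambda>n \<omega>. \<Sum>x\<in>X n. c n x * cexp M x f \<omega>"
  have R: "?R n \<in> L2 M" and \<Psi>R: "AE s in \<mu>. \<Psi> (?R n) s = h n s *\<^sub>R \<Psi> f s" for n
    using \<Psi>_span[OF X(1)[of n] X(2)[of n] f, of "c n"] by (auto simp: h_def)
  let ?u = "\<lambda>n s. (indicator E s - h n s)\<^sup>2"
  have d: "AE s in \<mu>. (norm (\<Psi> (\<lambda>\<omega>. T f \<omega> - ?R n \<omega>) s))\<^sup>2 = (norm (\<Psi> f s))\<^sup>2 * ?u n s" for n
    using \<Psi>_diff[OF Tf R[of n]] \<Psi>T \<Psi>R[of n]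
    by eventually_elim (simp add: scaleR_left_diff_distrib[symmetric] power_mult_distrib mult.commute)
  have nm [measurable]: "(\<lambda>s. norm (\<Psi> f s)) \<in> borel_measurable \<mu>" by (rule \<Psi>_norm_measurable[OF f])
  have i\<mu>: "integrable \<mu> (\<lambda>s. (norm (\<Psi> f s))\<^sup>2 * ?u n s)" for n
    by (rule Bochner_Integration.integrable_cong_AE_imp[OF \<Psi>_integrable[OF L2_diff[OF Tf R[of n]]]])
      (intro borel_measurable_times borel_measurable_power borel_measurable_diff nm hm borel_measurable_indicator E,
       use d[of n] in eventually_elim, simp)
  have iN: "integrable (spectral_measure f) (?u n)" for n
    unfolding spectral_measure_def by (subst integrable_real_density) (use i\<mu>[of n] in auto)
  have "(LINT s|spectral_measure f. ?u n s) = (LINT s|\<mu>. (norm (\<Psi> f s))\<^sup>2 * ?u n s)" for n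
    unfolding spectral_measure_def by (subst integral_real_density) auto
  moreover have "(LINT s|\<mu>. (norm (\<Psi> f s))\<^sup>2 * ?u n s) = (L2_norm M (\<lambda>\<omega>. T f \<omega> - ?R n \<omega>))\<^sup>2" for n
    unfolding L2_norm_square \<Psi>_iso[OF L2_diff[OF Tf R[of n]], symmetric]
    by (rule integral_cong_AE) (use i\<mu>[of n] \<Psi>_integrable[OF L2_diff[OF Tf R[of n]]] d[of n] in auto)
  ultimately have nu: "(LINT s|spectral_measure f. norm (?u n s)) = (L2_norm M (\<lambda>\<omega>. T f \<omega> - ?R n \<omega>))\<^sup>2" for n by simp
  have "(\<lambda>n. L2_norm M (\<lambda>\<omega>. T f \<omega> - ?R n \<omega>)) \<longlonglongrightarrow> 0"
    by (rule Lim_null_comparison[OF _ LIMSEQ_Suc[OF lim_inverse_n']])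
      (use Xc in \<open>auto intro!: always_eventually less_imp_le\<close>)
  then have "(\<lambda>n. (L2_norm M (\<lambda>\<omega>. T f \<omega> - ?R n \<omega>))\<^sup>2) \<longlonglongrightarrow> 0\<^sup>2" by (rule tendsto_power)
  then have "(\<lambda>n. LINT s|spectral_measure f. norm (?u n s)) \<longlonglongrightarrow> 0" by (simp only: nu) simp
  \<comment> \<open>Strong convergence at f is convergence of the multipliers in L2 of the spectral
    measure of f, hence almost everywhere along a subsequence.\<close>
  from tendsto_L1_AE_subseq[OF iN this]
  obtain r :: "nat \<Rightarrow> nat" where r: "AE s in spectral_measure f. (\<lambda>n. ?u (r n) s) \<longlonglongrightarrow> 0" by blast
  let ?x1 = "\<lambda>x. J x (cp y)" and ?x2 = "\<lambda>x. J x y"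
  \<comment> \<open>The multiplier \<open>h n\<close> in two variables: by \<open>meet_joins\<close>
    each indicator is a product of one factor per coordinate, and on the diagonal \<open>h n\<close>
    is recovered.\<close>
  define k where "k n pq = (\<Sum>x\<in>X n. c n x * (indicator (S (?x1 x)) (fst pq) * indicator (S (?x2 x)) (snd pq)))" for n and pq :: "'s \<times> 's"
  have km: "k n \<in> borel_measurable (?P1 \<Otimes>\<^sub>M ?P2)" for n
  proof -
    have "(\<lambda>pq. c n x * (indicator (S (?x1 x)) (fst pq) * indicator (S (?x2 x)) (snd pq))) \<in> borel_measurable (?P1 \<Otimes>\<^sub>M ?P2)"
      if "x \<in> X n" for x
    proof -
      have x: "x \<in> B" using that X by blast
      have 1: "S (?x1 x) \<in> sets ?P1" unfolding sets_Sig[OF y]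
        by (rule S_in_Sig[OF y]) (use x y join_field_upper(2) in auto)
      have 2: "S (?x2 x) \<in> sets ?P2" unfolding sets_Sig[OF cp_B[OF y]]
        by (rule S_in_Sig[OF cp_B[OF y]]) (use x y join_field_upper(2) in auto)
      show ?thesis using 1 2 by measurable
    qed
    then show ?thesis unfolding k_def[abs_def] by (rule borel_measurable_sum)
  qed
  have kh: "AE s in \<mu>. k n (s, s) = h n s" for n
  proof -
    have "AE s in \<mu>. \<forall>x\<in>X n. s \<in> S x \<longleftrightarrow> s \<in> S (?x1 x) \<and> s \<in> S (?x2 x)"
    proof (rule AE_finite_allI[OF X(1)])
      fix x assume "x \<in> X n"
      then have x: "x \<in> B" using X by blast
      show "AE s in \<mu>. s \<in> S x \<longleftrightarrow> s \<in> S (?x1 x) \<and> s \<in> S (?x2 x)"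
        using S_meet[of "?x1 x" "?x2 x"] x y meet_joins[OF x y] by simp
    qed
    then show ?thesis
      by eventually_elim (auto simp: k_def h_def intro!: sum.cong split: split_indicator)
  qed
  \<comment> \<open>On the diagonal the limit is almost everywhere 0 or 1, so a threshold of 1/2
    recovers E. Stating it as an eventual inequality keeps Q measurable whether or not the sequence
    converges off the diagonal.\<close>
  let ?Q = "{pq \<in> space (?P1 \<Otimes>\<^sub>M ?P2). \<exists>m. \<forall>n\<ge>m. 1/2 < k (r n) pq}"
  have Q: "?Q \<in> sets (?P1 \<Otimes>\<^sub>M ?P2)" using km by measurable
  have "AE s in \<mu>. \<forall>n. k n (s, s) = h n s" using kh by (simp add: AE_all_countable)
  with f0 r[unfolded AE_spectral_measure[OF f]] AE_space have "AE s in \<mu>. s \<in> E \<longleftrightarrow> (s, s) \<in> ?Q"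
  proof eventually_elim
    case (elim s)
    have "(\<lambda>n. sqrt (?u (r n) s)) \<longlonglongrightarrow> sqrt 0" using elim(1,2) by (intro tendsto_real_sqrt) auto
    then have "(\<lambda>n. \<bar>indicator E s - h (r n) s\<bar>) \<longlonglongrightarrow> 0" by simp
    then have "\<forall>\<^sub>F n in sequentially. \<bar>indicator E s - h (r n) s\<bar> < 1/2" by (rule order_tendstoD(2)) simp
    then obtain m where m: "\<And>n. m \<le> n \<Longrightarrow> \<bar>indicator E s - h (r n) s\<bar> < 1/2"
      by (auto simp: eventually_sequentially)
    have sp: "(s, s) \<in> space (?P1 \<Otimes>\<^sub>M ?P2)" using elim by (simp add: space_pair_measure space_measure_of_conv)
    show ?case
    proof
      assume "s \<in> E"
      then have "1/2 < k (r n) (s, s)" if "m \<le> n" for n using m[OF that] elim(4) by (auto simp: abs_if split: if_splits)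
      then show "(s, s) \<in> ?Q" using sp by blast
    next
      assume "(s, s) \<in> ?Q"
      then obtain m' where "\<And>n. m' \<le> n \<Longrightarrow> 1/2 < k (r n) (s, s)" by auto
      then have "1/2 < h (r (max m m')) s" using elim(4) by simp
      then show "s \<in> E" using m[of "max m m'"] by (auto simp: abs_if split: if_splits split_indicator_asm)
    qed
  qed
  with Q show ?thesis by (rule that)
qed

text \<open>The restriction of a spectral measure to the smaller field, written as an image measure
  under the identity.\<close>

definition spectral_measure_on :: "'a set set \<Rightarrow> ('a \<Rightarrow> real) \<Rightarrow> 's measure" where
  "spectral_measure_on x f = distr (spectral_measure f) (sigma (space \<mu>) (Sig x)) (\<lambda>s. s)"

lemma id_measurable_Sig: "x \<in> B \<Longrightarrow> (\<lambda>s. s) \<in> measurable (spectral_measure f) (sigma (space \<mu>) (Sig x))"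
  using Sig_sets[of x] by (intro measurableI) (auto simp: sets_Sig space_measure_of_conv dest: sets.sets_into_space)

lemma emeasure_spectral_measure_on:
  assumes x: "x \<in> B" and A: "A \<in> Sig x" shows "emeasure (spectral_measure_on x f) A = emeasure (spectral_measure f) A"
proof -
  have "(\<lambda>s. s) -` A \<inter> space (spectral_measure f) = A" using A Sig_sets[OF x] by (auto dest: sets.sets_into_space)
  then show ?thesis unfolding spectral_measure_on_def using A x by (subst emeasure_distr) (auto simp: sets_Sig id_measurable_Sig)
qed

text \<open>On a rectangle the projection of the product factorises by \<open>Pr_product2\<close>,
  and norms of independent products multiply.\<close>

lemma product_spectral_measure:
  assumes y: "y \<in> B" and f: "f \<in> L2_sub M y" and g: "g \<in> L2_sub M (cp y)"
  shows "spectral_measure_on y f \<Otimes>\<^sub>M spectral_measure_on (cp y) g =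
    distr (spectral_measure (\<lambda>\<omega>. f \<omega> * g \<omega>)) (sigma (space \<mu>) (Sig y) \<Otimes>\<^sub>M sigma (space \<mu>) (Sig (cp y))) (\<lambda>s. (s, s))"
proof (rule pair_measure_eqI)
  note cy = cp_B[OF y]
  note prod = indep_product(1)[OF B_sub[OF y] B_sub[OF cy] cp_indep[OF y]]
  note f2 = L2_sub_L2[OF f] and g2 = L2_sub_L2[OF g]
  interpret F: finite_measure "spectral_measure f" by (rule finite_measure_spectral_measure[OF f2])
  interpret G: finite_measure "spectral_measure g" by (rule finite_measure_spectral_measure[OF g2])
  have "finite_measure (spectral_measure_on y f)" unfolding spectral_measure_on_def by (rule F.finite_measure_distr[OF id_measurable_Sig[OF y]])
  then show "sigma_finite_measure (spectral_measure_on y f)" by (simp add: finite_measure_def)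
  have "finite_measure (spectral_measure_on (cp y) g)" unfolding spectral_measure_on_def by (rule G.finite_measure_distr[OF id_measurable_Sig[OF cy]])
  then show "sigma_finite_measure (spectral_measure_on (cp y) g)" by (simp add: finite_measure_def)
  have s1: "sets (spectral_measure_on y f) = sets (sigma (space \<mu>) (Sig y))" and s2: "sets (spectral_measure_on (cp y) g) = sets (sigma (space \<mu>) (Sig (cp y)))"
    by (simp_all add: spectral_measure_on_def)
  show "sets (spectral_measure_on y f \<Otimes>\<^sub>M spectral_measure_on (cp y) g) = sets (distr (spectral_measure (\<lambda>\<omega>. f \<omega> * g \<omega>))
      (sigma (space \<mu>) (Sig y) \<Otimes>\<^sub>M sigma (space \<mu>) (Sig (cp y))) (\<lambda>s. (s, s)))"
    using sets_pair_measure_cong[OF s1 s2] by simp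
  fix A C assume "A \<in> sets (spectral_measure_on y f)" "C \<in> sets (spectral_measure_on (cp y) g)"
  then have A: "A \<in> Sig y" and C: "C \<in> Sig (cp y)" by (simp_all add: s1 s2 sets_Sig[OF y] sets_Sig[OF cy])
  have A': "A \<in> sets \<mu>" and C': "C \<in> sets \<mu>" using A C Sig_sets[OF y] Sig_sets[OF cy] by auto
  let ?fg = "\<lambda>\<omega>. f \<omega> * g \<omega>"
  have fg: "?fg \<in> L2 M" by (rule prod[OF f g])
  have AC: "A \<inter> C \<in> sets \<mu>" using A' C' by auto
  note Pf = Pr_L2_sub[OF A' y f] and Pg = Pr_L2_sub[OF C' cy g]
  have m: "(\<lambda>s. (s, s)) \<in> measurable (spectral_measure ?fg) (sigma (space \<mu>) (Sig y) \<Otimes>\<^sub>M sigma (space \<mu>) (Sig (cp y)))"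
    by (intro measurable_Pair id_measurable_Sig y cy)
  have "A \<times> C \<in> sets (sigma (space \<mu>) (Sig y) \<Otimes>\<^sub>M sigma (space \<mu>) (Sig (cp y)))"
    using A C by (intro pair_measureI) (simp_all add: sets_Sig[OF y] sets_Sig[OF cy])
  moreover have "(\<lambda>s. (s, s)) -` (A \<times> C) \<inter> space (spectral_measure ?fg) = A \<inter> C"
    using sets.sets_into_space[OF A'] by auto
  ultimately have "emeasure (distr (spectral_measure ?fg) (sigma (space \<mu>) (Sig y) \<Otimes>\<^sub>M sigma (space \<mu>) (Sig (cp y))) (\<lambda>s. (s, s))) (A \<times> C)
      = emeasure (spectral_measure ?fg) (A \<inter> C)" using m by (simp add: emeasure_distr)
  also have "\<dots> = ennreal (ip M (Pr (A \<inter> C) ?fg) (Pr (A \<inter> C) ?fg))" by (rule emeasure_spectral_measure[OF fg AC])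
  also have "ip M (Pr (A \<inter> C) ?fg) (Pr (A \<inter> C) ?fg) = ip M (\<lambda>\<omega>. Pr A f \<omega> * Pr C g \<omega>) (\<lambda>\<omega>. Pr A f \<omega> * Pr C g \<omega>)"
    using Pr_product2[OF y A C f g] by (intro ip_cong_AE Pr_L2[OF AC fg] prod[OF Pf Pg])
  also have "\<dots> = ip M (Pr A f) (Pr A f) * ip M (Pr C g) (Pr C g)"
    by (rule ip_indep_product[OF B_sub[OF y] B_sub[OF cy] cp_indep[OF y] Pf Pf Pg Pg])
  also have "ennreal \<dots> = emeasure (spectral_measure_on y f) A * emeasure (spectral_measure_on (cp y) g) C"
    by (simp add: emeasure_spectral_measure_on[OF y A] emeasure_spectral_measure_on[OF cy C] emeasure_spectral_measure[OF f2 A'] emeasure_spectral_measure[OF g2 C'] ennreal_mult ip_self_nonneg)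
  finally show "emeasure (spectral_measure_on y f) A * emeasure (spectral_measure_on (cp y) g) C = emeasure (distr (spectral_measure ?fg)
      (sigma (space \<mu>) (Sig y) \<Otimes>\<^sub>M sigma (space \<mu>) (Sig (cp y))) (\<lambda>s. (s, s))) (A \<times> C)" by simp
qed

lemma spectral_measure_on_null:
  assumes x: "x \<in> B" and f: "f \<in> L2 M" and f': "f' \<in> L2 M" and ac: "AE s in \<mu>. \<Psi> f' s = 0 \<longrightarrow> \<Psi> f s = 0"
    and A: "A \<in> Sig x" and 0: "emeasure (spectral_measure_on x f') A = 0"
  shows "emeasure (spectral_measure_on x f) A = 0"
proof -
  have A': "A \<in> sets \<mu>" using A Sig_sets[OF x] by auto
  have "A \<in> null_sets (spectral_measure f')" using 0 A' emeasure_spectral_measure_on[OF x A] by (auto simp: null_sets_def)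
  then have "AE s in spectral_measure f'. s \<notin> A" by (rule AE_not_in)
  then have "AE s in \<mu>. \<Psi> f' s \<noteq> 0 \<longrightarrow> s \<notin> A" by (simp add: AE_spectral_measure[OF f'])
  with ac have "AE s in \<mu>. \<Psi> f s \<noteq> 0 \<longrightarrow> s \<notin> A" by eventually_elim blast
  then have "AE s in spectral_measure f. s \<notin> A" by (simp add: AE_spectral_measure[OF f])
  then have "emeasure (spectral_measure f) A = 0" using A' by (subst (asm) AE_iff_null_sets[symmetric]) auto
  then show ?thesis by (simp add: emeasure_spectral_measure_on[OF x A])
qed

text \<open>Since all of the spectral field is generated by the two factors, null sets can be tested
  in the product space. There a set is null exactly if almost all its sections are, and both this
  almost all and the null sections pass from f', g' to f, g.\<close>

lemma product_absolutely_continuous: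
  assumes y: "y \<in> B" and f: "f \<in> L2_sub M y" "f' \<in> L2_sub M y" and g: "g \<in> L2_sub M (cp y)" "g' \<in> L2_sub M (cp y)"
    and acf: "AE s in \<mu>. \<Psi> f' s = 0 \<longrightarrow> \<Psi> f s = 0" and acg: "AE s in \<mu>. \<Psi> g' s = 0 \<longrightarrow> \<Psi> g s = 0"
  shows "AE s in \<mu>. \<Psi> (\<lambda>\<omega>. f' \<omega> * g' \<omega>) s = 0 \<longrightarrow> \<Psi> (\<lambda>\<omega>. f \<omega> * g \<omega>) s = 0"
proof -
  note cy = cp_B[OF y]
  note prod = indep_product(1)[OF B_sub[OF y] B_sub[OF cy] cp_indep[OF y]]
  let ?P = "sigma (space \<mu>) (Sig y) \<Otimes>\<^sub>M sigma (space \<mu>) (Sig (cp y))"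
  \<comment> \<open>The zeros of the product that should dominate; the claim is that the spectral
    measure of \<open>f * g\<close> gives them mass 0.\<close>
  let ?E = "space \<mu> - {s \<in> space \<mu>. \<Psi> (\<lambda>\<omega>. f' \<omega> * g' \<omega>) s \<noteq> 0}"
  have E: "?E \<in> sets \<mu>" using \<Psi>_nonzero_sets[OF prod[OF f(2) g(2)]] by auto
  obtain Q where Q: "Q \<in> sets ?P" and EQ: "AE s in \<mu>. s \<in> ?E \<longleftrightarrow> (s, s) \<in> Q"
    by (rule sets_generated[OF y E])
  have Qn: "emeasure (spectral_measure_on y u \<Otimes>\<^sub>M spectral_measure_on (cp y) v) Q = 0 \<longleftrightarrow> (AE s in \<mu>. \<Psi> (\<lambda>\<omega>. u \<omega> * v \<omega>) s \<noteq> 0 \<longrightarrow> (s, s) \<notin> Q)"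
    if u: "u \<in> L2_sub M y" and v: "v \<in> L2_sub M (cp y)" for u v
  proof -
    have m: "(\<lambda>s. (s, s)) \<in> measurable (spectral_measure (\<lambda>\<omega>. u \<omega> * v \<omega>)) ?P"
      by (intro measurable_Pair id_measurable_Sig y cy)
    have "emeasure (spectral_measure_on y u \<Otimes>\<^sub>M spectral_measure_on (cp y) v) Q = 0 \<longleftrightarrow> Q \<in> null_sets (distr (spectral_measure (\<lambda>\<omega>. u \<omega> * v \<omega>)) ?P (\<lambda>s. (s, s)))"
      using Q by (simp add: product_spectral_measure[OF y u v] null_sets_def)
    also have "\<dots> \<longleftrightarrow> (AE p in distr (spectral_measure (\<lambda>\<omega>. u \<omega> * v \<omega>)) ?P (\<lambda>s. (s, s)). p \<notin> Q)"
      by (rule AE_iff_null_sets) (use Q in simp)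
    also have "\<dots> \<longleftrightarrow> (AE s in spectral_measure (\<lambda>\<omega>. u \<omega> * v \<omega>). (s, s) \<notin> Q)"
    proof (rule AE_distr_iff[OF m])
      have "{p \<in> space ?P. p \<notin> Q} = space ?P - Q" by auto
      then show "{p \<in> space ?P. p \<notin> Q} \<in> sets ?P" using Q by simp
    qed
    also have "\<dots> \<longleftrightarrow> (AE s in \<mu>. \<Psi> (\<lambda>\<omega>. u \<omega> * v \<omega>) s \<noteq> 0 \<longrightarrow> (s, s) \<notin> Q)" by (rule AE_spectral_measure[OF prod[OF u v]])
    finally show ?thesis .
  qed
  interpret F: finite_measure "spectral_measure f" by (rule finite_measure_spectral_measure[OF L2_sub_L2[OF f(1)]])
  interpret F': finite_measure "spectral_measure f'" by (rule finite_measure_spectral_measure[OF L2_sub_L2[OF f(2)]])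
  interpret G: finite_measure "spectral_measure g" by (rule finite_measure_spectral_measure[OF L2_sub_L2[OF g(1)]])
  interpret G': finite_measure "spectral_measure g'" by (rule finite_measure_spectral_measure[OF L2_sub_L2[OF g(2)]])
  interpret dG: finite_measure "spectral_measure_on (cp y) g" unfolding spectral_measure_on_def by (rule G.finite_measure_distr[OF id_measurable_Sig[OF cy]])
  interpret dG': finite_measure "spectral_measure_on (cp y) g'" unfolding spectral_measure_on_def by (rule G'.finite_measure_distr[OF id_measurable_Sig[OF cy]])
  have sd: "sets (spectral_measure_on x u) = Sig x" if "x \<in> B" for x u using that by (simp add: spectral_measure_on_def sets_Sig)
  have sP: "sets (spectral_measure_on y u \<Otimes>\<^sub>M spectral_measure_on (cp y) v) = sets ?P" for u v
    by (rule sets_pair_measure_cong) (simp_all add: sd y cy sets_Sig)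
  have "AE s in \<mu>. \<Psi> (\<lambda>\<omega>. f' \<omega> * g' \<omega>) s \<noteq> 0 \<longrightarrow> (s, s) \<notin> Q"
    using EQ by eventually_elim auto
  then have "emeasure (spectral_measure_on y f' \<Otimes>\<^sub>M spectral_measure_on (cp y) g') Q = 0" using Qn[OF f(2) g(2)] by simp
  then have i: "(\<integral>\<^sup>+ p. emeasure (spectral_measure_on (cp y) g') (Pair p -` Q) \<partial>spectral_measure_on y f') = 0"
    using dG'.emeasure_pair_measure_alt[of Q "spectral_measure_on y f'"] Q sP by simp
  have m': "(\<lambda>p. emeasure (spectral_measure_on (cp y) v) (Pair p -` Q)) \<in> borel_measurable (spectral_measure_on y u)" if "sigma_finite_measure (spectral_measure_on (cp y) v)" for u v
    by (rule sigma_finite_measure.measurable_emeasure_Pair[OF that]) (use Q sP in simp)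
  \<comment> \<open>\<open>spectral_measure_on_null\<close> speaks of sets of the field
    \<open>Sig (cp y)\<close>, to which the sections of Q belong.\<close>
  have Ps: "Pair p -` Q \<in> Sig (cp y)" for p
    using sets_Pair1[OF Q, of p] by (simp add: sets_Sig[OF cy])
  have m1: "(\<lambda>p. emeasure (spectral_measure_on (cp y) g') (Pair p -` Q)) \<in> borel_measurable (spectral_measure_on y f')"
    by (rule m'[OF dG'.sigma_finite_measure_axioms])
  have "AE p in spectral_measure_on y f'. emeasure (spectral_measure_on (cp y) g') (Pair p -` Q) = 0"
    using i nn_integral_0_iff_AE[OF m1] by simp
  moreover have sp: "space (spectral_measure_on y f') = space \<mu>" by (simp add: spectral_measure_on_def space_measure_of_conv)
  moreover have "{p \<in> space (spectral_measure_on y f'). emeasure (spectral_measure_on (cp y) g') (Pair p -` Q) \<noteq> 0} \<in> sets (spectral_measure_on y f')"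
  proof -
    have "{p \<in> space (spectral_measure_on y f'). emeasure (spectral_measure_on (cp y) g') (Pair p -` Q) \<noteq> 0} =
        (\<lambda>p. emeasure (spectral_measure_on (cp y) g') (Pair p -` Q)) -` (- {0}) \<inter> space (spectral_measure_on y f')" by auto
    then show ?thesis using measurable_sets[OF m1, of "- {0}"] by simp
  qed
  ultimately have z: "{p \<in> space \<mu>. emeasure (spectral_measure_on (cp y) g') (Pair p -` Q) \<noteq> 0} \<in> null_sets (spectral_measure_on y f')"
    using AE_iff_null[of "spectral_measure_on y f'" "\<lambda>p. emeasure (spectral_measure_on (cp y) g') (Pair p -` Q) = 0"] by simp
  then have "{p \<in> space \<mu>. emeasure (spectral_measure_on (cp y) g') (Pair p -` Q) \<noteq> 0} \<in> null_sets (spectral_measure_on y f)"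
    using spectral_measure_on_null[OF y L2_sub_L2[OF f(1)] L2_sub_L2[OF f(2)] acf] by (auto simp: null_sets_def sd y)
  then have "AE p in spectral_measure_on y f. p \<notin> {p \<in> space \<mu>. emeasure (spectral_measure_on (cp y) g') (Pair p -` Q) \<noteq> 0}" by (rule AE_not_in)
  then have "AE p in spectral_measure_on y f. emeasure (spectral_measure_on (cp y) g) (Pair p -` Q) = 0"
    using AE_space
  proof eventually_elim
    case (elim p)
    then have "emeasure (spectral_measure_on (cp y) g') (Pair p -` Q) = 0" by (simp add: spectral_measure_on_def space_measure_of_conv)
    then show ?case by (rule spectral_measure_on_null[OF cy L2_sub_L2[OF g(1)] L2_sub_L2[OF g(2)] acg Ps])
  qed
  then have "(\<integral>\<^sup>+ p. emeasure (spectral_measure_on (cp y) g) (Pair p -` Q) \<partial>spectral_measure_on y f) = 0"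
    using nn_integral_0_iff_AE[OF m'[OF dG.sigma_finite_measure_axioms]] by simp
  then have "emeasure (spectral_measure_on y f \<Otimes>\<^sub>M spectral_measure_on (cp y) g) Q = 0"
    using dG.emeasure_pair_measure_alt[of Q "spectral_measure_on y f"] Q sP by simp
  then have "AE s in \<mu>. \<Psi> (\<lambda>\<omega>. f \<omega> * g \<omega>) s \<noteq> 0 \<longrightarrow> (s, s) \<notin> Q" using Qn[OF f(1) g(1)] by simp
  with EQ AE_space show ?thesis by eventually_elim auto
qed

text \<open>The whole first chaos is carried by the points unsplit in the full space, the empty one
  excluded, and \<open>unsplit_FC\<close> says that conversely these points carry only first chaos
  vectors. Projecting a vector of full support to them gives X.\<close>

lemma FC_full_support:
  "\<exists>X\<in>FC. \<forall>Y\<in>FC. AE s in \<mu>. \<Psi> X s = 0 \<longrightarrow> \<Psi> Y s = 0"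
proof -
  obtain f where f: "f \<in> L2 M" and f0: "AE s in \<mu>. \<Psi> f s \<noteq> 0" by (rule full_support)
  let ?A = "unsplit (sets M) - S Bot"
  have A: "?A \<in> sets \<mu>" using unsplit_Sig[OF top_B top_B order_refl] Sig_sets[OF top_B] S_sets[OF Bot_B] by auto
  have X: "Pr ?A f \<in> FC" by (rule unsplit_FC[OF top_B]) (simp add: L2_sub_top f)
  have "AE s in \<mu>. \<Psi> (Pr ?A f) s = 0 \<longrightarrow> \<Psi> Y s = 0" if Y: "Y \<in> FC" for Y
  proof -
    have fc: "AE s in \<mu>. \<Psi> Y s \<noteq> 0 \<longrightarrow> (s \<in> S z \<longleftrightarrow> s \<notin> S (cp z))" if "z \<in> B" for z
      using Y that FC_iff_\<Psi>[OF FC_L2[OF Y]] by simp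
    have "AE s in \<mu>. \<Psi> Y s \<noteq> 0 \<longrightarrow> s \<notin> split_by (sets M) (split_seq (sets M) k)" for k
    proof -
      let ?y = "split_seq (sets M) k"
      have y: "?y \<in> B" by (rule split_seq_B[OF top_B])
      then have eq: "sets M \<inter> ?y = ?y" "sets M \<inter> cp ?y = cp ?y" using B_le_top[OF y] B_le_top[OF cp_B[OF y]] by auto
      from fc[OF y] show ?thesis by eventually_elim (use y eq in \<open>auto simp: split_by_def\<close>)
    qed
    then have "AE s in \<mu>. \<forall>k. \<Psi> Y s \<noteq> 0 \<longrightarrow> s \<notin> split_by (sets M) (split_seq (sets M) k)" by (subst AE_all_countable) blast
    \<comment> \<open>The first chaos condition for \<open>Bot\<close>, whose complement is the full
      field, excludes \<open>S Bot\<close>.\<close>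
    with fc[OF Bot_B] S_top \<Psi>_Pr[OF A f] f0 AE_space show ?thesis
      unfolding cp_Bot by eventually_elim (auto simp: unsplit_def split: split_indicator_asm)
  qed
  with X show ?thesis by blast
qed

end

section \<open>Multiplicative vectors\<close>

context noise
begin

lemma cexp_indep:
  assumes x: "x \<in> B" and y: "y \<in> B" and d: "x \<inter> y \<subseteq> Bot" and V: "V \<in> L2_sub M y"
  shows "AE \<omega> in M. cexp M x V \<omega> = expectation V"
proof -
  have V2: "V \<in> L2 M" by (rule L2_sub_L2[OF V])
  have xy: "y \<inter> x = Bot" using d Bot_le[OF x] Bot_le[OF y] by auto
  have "AE \<omega> in M. cexp M x V \<omega> = cexp M x (cexp M y V) \<omega>"
    by (rule cexp_cong[OF B_sub[OF x] V2 cexp_L2[OF B_sub[OF y] V2] L2_sub_AE[OF V]])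
  with cexp_cexp[OF y x V2] cexp_Bot[OF V2] show ?thesis unfolding xy by eventually_elim simp
qed

text \<open>The cross terms vanish, as the parts in the two halves are independent and
  centred.\<close>

lemma FC_ip_split:
  assumes X: "X \<in> FC" and Y: "Y \<in> FC" and a: "a \<in> B" and z: "z \<in> B"
  shows "ip M (cexp M a X) (cexp M a Y) =
    ip M (cexp M (a \<inter> z) X) (cexp M (a \<inter> z) Y) + ip M (cexp M (a \<inter> cp z) X) (cexp M (a \<inter> cp z) Y)"
proof -
  note X2 = FC_L2[OF X] and Y2 = FC_L2[OF Y]
  have B: "a \<inter> z \<in> B" "a \<inter> cp z \<in> B" using a z by auto
  let ?X1 = "cexp M (a \<inter> z) X" and ?X2 = "cexp M (a \<inter> cp z) X" and ?Y1 = "cexp M (a \<inter> z) Y" and ?Y2 = "cexp M (a \<inter> cp z) Y"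
  have s: "?X1 \<in> L2_sub M (a \<inter> z)" "?Y1 \<in> L2_sub M (a \<inter> z)" "?X2 \<in> L2_sub M (a \<inter> cp z)" "?Y2 \<in> L2_sub M (a \<inter> cp z)"
    using B X2 Y2 by (auto intro!: cexp_L2_sub)
  note l = L2_sub_L2[OF s(1)] L2_sub_L2[OF s(2)] L2_sub_L2[OF s(3)] L2_sub_L2[OF s(4)]
  have m: "expectation ?X1 = 0" "expectation ?Y1 = 0"
    using expectation_cexp[OF B_sub[OF B(1)]] X2 Y2 FC_mean X Y by auto
  have c: "ip M ?X1 ?Y2 = 0" "ip M ?X2 ?Y1 = 0"
    using indep_product(2)[OF B_sub[OF B(1)] B_sub[OF B(2)] indep_split[OF a z] s(1) s(4)]
      indep_product(2)[OF B_sub[OF B(1)] B_sub[OF B(2)] indep_split[OF a z] s(2) s(3)] m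
    by (simp_all add: ip_def mult.commute)
  have "ip M (cexp M a X) (cexp M a Y) = ip M (\<lambda>\<omega>. ?X1 \<omega> + ?X2 \<omega>) (\<lambda>\<omega>. ?Y1 \<omega> + ?Y2 \<omega>)"
    by (rule ip_cong_AE[OF cexp_L2[OF B_sub[OF a] X2] cexp_L2[OF B_sub[OF a] Y2] L2_add[OF l(1,3)] L2_add[OF l(2,4)]
          FC_split[OF X a z] FC_split[OF Y a z]])
  also have "\<dots> = ip M ?X1 ?Y1 + ip M ?X2 ?Y2"
    using l c by (simp add: ip_add_left ip_add_right L2_add)
  finally show ?thesis .
qed

section \<open>Exponential products over partitions\<close>

primrec exp_product :: "('a \<Rightarrow> real) \<Rightarrow> 'a set set list \<Rightarrow> 'a set set \<Rightarrow> 'a \<Rightarrow> real" where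
  "exp_product X [] a = (\<lambda>\<omega>. 1 + cexp M a X \<omega>)"
| "exp_product X (z # zs) a = (\<lambda>\<omega>. exp_product X zs (a \<inter> z) \<omega> * exp_product X zs (a \<inter> cp z) \<omega>)"

lemma exp_product_move: "exp_product X (xs @ y # zs) a = exp_product X (y # xs @ zs) a"
proof (induction xs arbitrary: a)
  case (Cons x xs)
  have "exp_product X ((x # xs) @ y # zs) a = exp_product X (x # y # xs @ zs) a"
    by (simp only: append_Cons exp_product.simps(2)[of X x] Cons.IH)
  also have "\<dots> = exp_product X (y # x # xs @ zs) a"
    by (simp add: Int_ac mult_ac)
  finally show ?case by simp
qed simp

text \<open>Two partitions have a common refinement, reached by appending either list to the other;
  this makes products along unrelated partitions comparable.\<close>

lemma exp_product_append_commute: "exp_product X (xs @ ys) a = exp_product X (ys @ xs) a"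
proof (induction xs arbitrary: a)
  case (Cons x xs)
  have "exp_product X ((x # xs) @ ys) a = exp_product X (x # ys @ xs) a"
    by (simp only: append_Cons exp_product.simps(2)[of X x] Cons.IH)
  also have "\<dots> = exp_product X (ys @ x # xs) a" by (simp only: exp_product_move)
  finally show ?case .
qed simp

context
  fixes X assumes X: "X \<in> FC"
begin

lemma one_add_sub: "a \<in> B \<Longrightarrow> (\<lambda>\<omega>. 1 + cexp M a X \<omega>) \<in> L2_sub M a"
  by (intro closed_subspace_add[OF closed_subspace_L2_sub] L2_sub_const cexp_L2_sub FC_L2[OF X]) auto

lemma exp_product_sub: "set zs \<subseteq> B \<Longrightarrow> a \<in> B \<Longrightarrow> exp_product X zs a \<in> L2_sub M a"
proof (induction zs arbitrary: a)
  case Nil then show ?case by (simp add: one_add_sub)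
next
  case (Cons z zs)
  then have B: "z \<in> B" "a \<in> B" "a \<inter> z \<in> B" "a \<inter> cp z \<in> B" "set zs \<subseteq> B" by auto
  show ?case unfolding exp_product.simps
    by (rule indep_product_sub[OF B_sub[OF B(3)] B_sub[OF B(4)] B_sub[OF B(2)] _ _ indep_split[OF B(2,1)]
          Cons.IH[OF B(5,3)] Cons.IH[OF B(5,4)]]) auto
qed

lemma exp_product_L2: "set zs \<subseteq> B \<Longrightarrow> a \<in> B \<Longrightarrow> exp_product X zs a \<in> L2 M"
  by (rule L2_sub_L2[OF exp_product_sub])

lemma cexp_X_mean: "a \<in> B \<Longrightarrow> expectation (cexp M a X) = 0"
  using expectation_cexp[OF B_sub FC_L2[OF X]] FC_mean[OF X] by simp

lemma exp_product_mean: "set zs \<subseteq> B \<Longrightarrow> a \<in> B \<Longrightarrow> expectation (exp_product X zs a) = 1"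
proof (induction zs arbitrary: a)
  case Nil
  then show ?case using L2_integrable[OF cexp_L2[OF B_sub[OF Nil(2)] FC_L2[OF X]]] cexp_X_mean
    by (simp add: prob_space)
next
  case (Cons z zs)
  then have B: "z \<in> B" "a \<in> B" "a \<inter> z \<in> B" "a \<inter> cp z \<in> B" "set zs \<subseteq> B" by auto
  show ?case unfolding exp_product.simps
    using indep_product(2)[OF B_sub[OF B(3)] B_sub[OF B(4)] indep_split[OF B(2,1)] exp_product_sub[OF B(5,3)] exp_product_sub[OF B(5,4)]]
      Cons.IH[OF B(5,3)] Cons.IH[OF B(5,4)] by simp
qed

text \<open>Pairing with the first chaos sees only the first order part of the product, because each
  factor that is not paired has mean 1. The value is the same for all partitions.\<close>

lemma exp_product_ip_FC:
  "set zs \<subseteq> B \<Longrightarrow> a \<in> B \<Longrightarrow> Y \<in> FC \<Longrightarrow> ip M (exp_product X zs a) (cexp M a Y) = ip M (cexp M a X) (cexp M a Y)"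
proof (induction zs arbitrary: a)
  case Nil
  have l: "cexp M a X \<in> L2 M" "cexp M a Y \<in> L2 M" using Nil FC_L2 X by (auto intro!: cexp_L2)
  have "expectation (cexp M a Y) = 0" using expectation_cexp[OF B_sub[OF Nil(2)] FC_L2[OF Nil(3)]] FC_mean[OF Nil(3)] by simp
  then have "ip M (\<lambda>\<omega>. 1) (cexp M a Y) = 0" by (simp add: ip_def)
  then show ?case unfolding exp_product.simps using ip_add_left[OF L2_const l(1) l(2), of 1] by simp
next
  case (Cons z zs)
  then have B: "z \<in> B" "a \<in> B" "a \<inter> z \<in> B" "a \<inter> cp z \<in> B" "set zs \<subseteq> B" and Y: "Y \<in> FC" by auto
  let ?U = "exp_product X zs (a \<inter> z)" and ?V = "exp_product X zs (a \<inter> cp z)" and ?Y1 = "cexp M (a \<inter> z) Y" and ?Y2 = "cexp M (a \<inter> cp z) Y"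
  note U = exp_product_sub[OF B(5,3)] and V = exp_product_sub[OF B(5,4)]
  have Y1: "?Y1 \<in> L2_sub M (a \<inter> z)" and Y2: "?Y2 \<in> L2_sub M (a \<inter> cp z)" using B FC_L2[OF Y] by (auto intro!: cexp_L2_sub)
  note IP = ip_indep_product[OF B_sub[OF B(3)] B_sub[OF B(4)] indep_split[OF B(2,1)] U _ V]
  have UV: "(\<lambda>\<omega>. ?U \<omega> * ?V \<omega>) \<in> L2 M" using exp_product_L2[of "z # zs" a] Cons.prems by simp
  have one: "ip M ?U (\<lambda>\<omega>. 1) = 1" "ip M ?V (\<lambda>\<omega>. 1) = 1" using exp_product_mean[OF B(5,3)] exp_product_mean[OF B(5,4)] by (simp_all add: ip_def)
  have 1: "ip M (\<lambda>\<omega>. ?U \<omega> * ?V \<omega>) ?Y1 = ip M ?U ?Y1"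
    using IP[OF Y1 L2_sub_const[OF B_sub[OF B(4)], of 1]] one by simp
  have 2: "ip M (\<lambda>\<omega>. ?U \<omega> * ?V \<omega>) ?Y2 = ip M ?V ?Y2"
    using IP[OF L2_sub_const[OF B_sub[OF B(3)], of 1] Y2] one by simp
  have "ip M (\<lambda>\<omega>. ?U \<omega> * ?V \<omega>) (cexp M a Y) = ip M (\<lambda>\<omega>. ?U \<omega> * ?V \<omega>) (\<lambda>\<omega>. ?Y1 \<omega> + ?Y2 \<omega>)"
    by (rule ip_cong_AE[OF UV cexp_L2[OF B_sub[OF B(2)] FC_L2[OF Y]] UV L2_add[OF L2_sub_L2[OF Y1] L2_sub_L2[OF Y2]] _ FC_split[OF Y B(2,1)]]) simp
  also have "\<dots> = ip M ?U ?Y1 + ip M ?V ?Y2"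
    using ip_add_right[OF L2_sub_L2[OF Y1] L2_sub_L2[OF Y2] UV] 1 2 by simp
  also have "\<dots> = ip M (cexp M a X) (cexp M a Y)"
    using Cons.IH[OF B(5,3) Y] Cons.IH[OF B(5,4) Y] FC_ip_split[OF X Y B(2,1)] by simp
  finally show ?case unfolding exp_product.simps .
qed

lemma ip_one_add:
  assumes a: "a \<in> B" and U: "U \<in> L2 M" "expectation U = 1"
  shows "ip M U (\<lambda>\<omega>. 1 + cexp M a X \<omega>) = 1 + ip M U (cexp M a X)"
  using ip_add_right[OF L2_const cexp_L2[OF B_sub[OF a] FC_L2[OF X]] U(1), of 1] U(2) by (simp add: ip_const)

lemma exp_product_leaf_norm: "a \<in> B \<Longrightarrow> ip M (exp_product X [] a) (exp_product X [] a) = 1 + ip M (cexp M a X) (cexp M a X)"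
  using ip_one_add[of a "exp_product X [] a"] exp_product_L2[of "[]" a] exp_product_mean[of "[]" a] exp_product_ip_FC[of "[]" a X] X by simp

text \<open>The squared norm is the product of 1 + |P_a X|^2 over the cells, and 1 + t \<le> exp t;
  the exponents add up by \<open>FC_ip_split\<close>. The bound does not involve the
  partition.\<close>

lemma exp_product_norm_le:
  "set zs \<subseteq> B \<Longrightarrow> a \<in> B \<Longrightarrow> ip M (exp_product X zs a) (exp_product X zs a) \<le> exp (ip M (cexp M a X) (cexp M a X))"
proof (induction zs arbitrary: a)
  case Nil
  then show ?case using exp_product_leaf_norm exp_ge_add_one_self by (simp del: exp_product.simps)
next
  case (Cons z zs)
  then have B: "z \<in> B" "a \<in> B" "a \<inter> z \<in> B" "a \<inter> cp z \<in> B" "set zs \<subseteq> B" by auto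
  note U = exp_product_sub[OF B(5,3)] and V = exp_product_sub[OF B(5,4)]
  have "ip M (exp_product X (z # zs) a) (exp_product X (z # zs) a) =
      ip M (exp_product X zs (a \<inter> z)) (exp_product X zs (a \<inter> z)) * ip M (exp_product X zs (a \<inter> cp z)) (exp_product X zs (a \<inter> cp z))"
    unfolding exp_product.simps by (rule ip_indep_product[OF B_sub[OF B(3)] B_sub[OF B(4)] indep_split[OF B(2,1)] U U V V])
  also have "\<dots> \<le> exp (ip M (cexp M (a \<inter> z) X) (cexp M (a \<inter> z) X)) * exp (ip M (cexp M (a \<inter> cp z) X) (cexp M (a \<inter> cp z) X))"
    by (intro mult_mono Cons.IH B ip_self_nonneg) simp
  also have "\<dots> = exp (ip M (cexp M a X) (cexp M a X))"
    unfolding FC_ip_split[OF X X B(2,1)] by (simp add: exp_add)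
  finally show ?case .
qed

text \<open>Orthogonality of increments, as for a martingale. Both sides factor over the halves, and
  in a single cell a product is paired with 1 + P_a X through its mean and its pairing with the
  first chaos.\<close>

lemma exp_product_extend:
  "set zs \<subseteq> B \<Longrightarrow> set ys \<subseteq> B \<Longrightarrow> a \<in> B \<Longrightarrow> ip M (exp_product X (zs @ ys) a) (exp_product X zs a) = ip M (exp_product X zs a) (exp_product X zs a)"
proof (induction zs arbitrary: a)
  case Nil
  have "ip M (exp_product X ys a) (exp_product X [] a) = 1 + ip M (exp_product X ys a) (cexp M a X)"
    using ip_one_add[OF Nil(3) exp_product_L2[OF Nil(2,3)] exp_product_mean[OF Nil(2,3)]] by simp
  then show ?case using exp_product_leaf_norm[OF Nil(3)] exp_product_ip_FC[OF Nil(2,3) X] by (simp only: append_Nil)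
next
  case (Cons z zs)
  then have B: "z \<in> B" "a \<in> B" "a \<inter> z \<in> B" "a \<inter> cp z \<in> B" "set zs \<subseteq> B" "set ys \<subseteq> B" "set (zs @ ys) \<subseteq> B" by auto
  note IP = ip_indep_product[OF B_sub[OF B(3)] B_sub[OF B(4)] indep_split[OF B(2,1)]]
  show ?case unfolding append_Cons exp_product.simps
      IP[OF exp_product_sub[OF B(7,3)] exp_product_sub[OF B(5,3)] exp_product_sub[OF B(7,4)] exp_product_sub[OF B(5,4)]]
      IP[OF exp_product_sub[OF B(5,3)] exp_product_sub[OF B(5,3)] exp_product_sub[OF B(5,4)] exp_product_sub[OF B(5,4)]]
      Cons.IH[OF B(5,6,3)] Cons.IH[OF B(5,6,4)] ..
qed

lemma exp_product_extend_norm: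
  assumes "set zs \<subseteq> B" "set ys \<subseteq> B" "a \<in> B"
  shows "(L2_norm M (\<lambda>\<omega>. exp_product X (zs @ ys) a \<omega> - exp_product X zs a \<omega>))\<^sup>2 =
    ip M (exp_product X (zs @ ys) a) (exp_product X (zs @ ys) a) - ip M (exp_product X zs a) (exp_product X zs a)"
proof -
  have l: "exp_product X (zs @ ys) a \<in> L2 M" "exp_product X zs a \<in> L2 M" using assms by (auto intro!: exp_product_L2)
  show ?thesis
    using exp_product_extend[OF assms] l
    by (simp add: L2_norm_square ip_diff_left ip_diff_right L2_diff ip_commute[of M "exp_product X zs a" "exp_product X (zs @ ys) a"])
qed

text \<open>Appending x cuts every cell by x, so the factors can be regrouped into those inside x
  and those inside its complement.\<close>

lemma exp_product_factor:
  "set zs \<subseteq> B \<Longrightarrow> x \<in> B \<Longrightarrow> a \<in> B \<Longrightarrow>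
   \<exists>U\<in>L2_sub M (a \<inter> x). \<exists>V\<in>L2_sub M (a \<inter> cp x). exp_product X (zs @ [x]) a = (\<lambda>\<omega>. U \<omega> * V \<omega>)"
proof (induction zs arbitrary: a)
  case Nil
  then show ?case using one_add_sub[of "a \<inter> x"] one_add_sub[of "a \<inter> cp x"] by auto
next
  case (Cons z zs)
  then have B: "z \<in> B" "a \<in> B" "a \<inter> z \<in> B" "a \<inter> cp z \<in> B" "set zs \<subseteq> B" "x \<in> B" by auto
  obtain U1 V1 where 1: "U1 \<in> L2_sub M (a \<inter> z \<inter> x)" "V1 \<in> L2_sub M (a \<inter> z \<inter> cp x)" "exp_product X (zs @ [x]) (a \<inter> z) = (\<lambda>\<omega>. U1 \<omega> * V1 \<omega>)"
    using Cons.IH[OF B(5,6,3)] by blast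
  obtain U2 V2 where 2: "U2 \<in> L2_sub M (a \<inter> cp z \<inter> x)" "V2 \<in> L2_sub M (a \<inter> cp z \<inter> cp x)" "exp_product X (zs @ [x]) (a \<inter> cp z) = (\<lambda>\<omega>. U2 \<omega> * V2 \<omega>)"
    using Cons.IH[OF B(5,6,4)] by blast
  have P: "(\<lambda>\<omega>. u \<omega> * v \<omega>) \<in> L2_sub M (a \<inter> w)" if w: "w \<in> B" and u: "u \<in> L2_sub M (a \<inter> z \<inter> w)" and v: "v \<in> L2_sub M (a \<inter> cp z \<inter> w)" for u v w
  proof (rule indep_product_sub[OF _ _ _ _ _ _ u v])
    show "indep_set (a \<inter> z \<inter> w) (a \<inter> cp z \<inter> w)" using B w meet_cp[OF B(1)] by (intro indep_disjoint) auto
  qed (use B w in auto)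
  have u: "(\<lambda>\<omega>. U1 \<omega> * U2 \<omega>) \<in> L2_sub M (a \<inter> x)" and v: "(\<lambda>\<omega>. V1 \<omega> * V2 \<omega>) \<in> L2_sub M (a \<inter> cp x)"
    using P[OF B(6) 1(1) 2(1)] P[OF cp_B[OF B(6)] 1(2) 2(2)] by auto
  have "exp_product X ((z # zs) @ [x]) a = (\<lambda>\<omega>. (U1 \<omega> * U2 \<omega>) * (V1 \<omega> * V2 \<omega>))"
    using 1(3) 2(3) by (simp add: mult_ac)
  then show ?case
    by (intro bexI[of _ "\<lambda>\<omega>. U1 \<omega> * U2 \<omega>"] bexI[of _ "\<lambda>\<omega>. V1 \<omega> * V2 \<omega>"] u v)
qed

text \<open>The two conditional expectations are U E(V) and V E(U), and E(U) E(V) = 1. The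
  factorisation thus becomes canonical, in a form that passes to limits.\<close>

lemma multiplicative_factor:
  assumes x: "x \<in> B" and U: "U \<in> L2_sub M x" and V: "V \<in> L2_sub M (cp x)" and one: "expectation (\<lambda>\<omega>. U \<omega> * V \<omega>) = 1"
  shows "AE \<omega> in M. U \<omega> * V \<omega> = cexp M x (\<lambda>\<omega>. U \<omega> * V \<omega>) \<omega> * cexp M (cp x) (\<lambda>\<omega>. U \<omega> * V \<omega>) \<omega>"
proof -
  note sx = B_sub[OF x] and sc = B_sub[OF cp_B[OF x]] and ind = cp_indep[OF x]
  have UV: "(\<lambda>\<omega>. U \<omega> * V \<omega>) \<in> L2 M" by (rule indep_product(1)[OF sx sc ind U V])
  then have VU: "(\<lambda>\<omega>. V \<omega> * U \<omega>) \<in> L2 M" by (simp add: mult.commute)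
  have e: "expectation U * expectation V = 1" using indep_product(2)[OF sx sc ind U V] one by simp
  have 1: "AE \<omega> in M. cexp M x V \<omega> = expectation V"
    by (rule cexp_indep[OF x cp_B[OF x] _ V]) (simp add: meet_cp[OF x])
  have 2: "AE \<omega> in M. cexp M (cp x) U \<omega> = expectation U"
    by (rule cexp_indep[OF cp_B[OF x] x _ U]) (use meet_cp[OF x] in auto)
  have 3: "AE \<omega> in M. cexp M x (\<lambda>\<omega>. U \<omega> * V \<omega>) \<omega> = U \<omega> * cexp M x V \<omega>"
    by (rule cexp_pull_out[OF sx U L2_sub_L2[OF V] UV])
  have 4: "AE \<omega> in M. cexp M (cp x) (\<lambda>\<omega>. V \<omega> * U \<omega>) \<omega> = V \<omega> * cexp M (cp x) U \<omega>"
    by (rule cexp_pull_out[OF sc V L2_sub_L2[OF U] VU])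
  have eq: "(\<lambda>\<omega>. V \<omega> * U \<omega>) = (\<lambda>\<omega>. U \<omega> * V \<omega>)" by (simp add: mult.commute)
  from 1 2 3 4[unfolded eq] show ?thesis
  proof eventually_elim
    case (elim \<omega>)
    have "cexp M x (\<lambda>\<omega>. U \<omega> * V \<omega>) \<omega> * cexp M (cp x) (\<lambda>\<omega>. U \<omega> * V \<omega>) \<omega> = U \<omega> * V \<omega> * (expectation U * expectation V)"
      unfolding elim by (simp only: mult_ac)
    then show ?case unfolding e by simp
  qed
qed

text \<open>The limit of the products \<open>\<Prod>(1 + \<E>(X | a\<^sub>i))\<close> along refining partitions is the exponential vector of \<open>X\<close>.\<close>

lemma exponential_vector:
  obtains Z where "Z \<in> L2 M" "expectation Z = 1"
    "\<And>x. x \<in> B \<Longrightarrow> AE \<omega> in M. Z \<omega> = cexp M x Z \<omega> * cexp M (cp x) Z \<omega>"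
    "\<And>Y. Y \<in> FC \<Longrightarrow> ip M Z Y = ip M X Y"
proof -
  let ?Z = "\<lambda>zs. exp_product X zs (sets M)"
  let ?q = "\<lambda>zs. ip M (?Z zs) (?Z zs)"
  let ?L = "{zs. set zs \<subseteq> B}"
  \<comment> \<open>Products along nearly maximal partitions play the part of a limit along the
    directed set of all partitions.\<close>
  define c where "c = (SUP zs\<in>?L. ?q zs)"
  have L: "?L \<noteq> {}" by (auto intro: exI[of _ "[]"])
  have bdd: "bdd_above (?q ` ?L)"
    by (rule bdd_aboveI[of _ "exp (ip M (cexp M (sets M) X) (cexp M (sets M) X))"]) (use exp_product_norm_le in auto)
  have le: "?q zs \<le> c" if "set zs \<subseteq> B" for zs unfolding c_def by (rule cSUP_upper[OF _ bdd]) (use that in auto)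
  have "\<exists>zs\<in>?L. c - 1 / real (Suc n) < ?q zs" for n
    using less_cSUP_iff[OF L bdd, of "c - 1 / real (Suc n)"] by (simp add: c_def)
  then have "\<exists>zs. set zs \<subseteq> B \<and> c - 1 / real (Suc n) < ?q zs" for n by blast
  then obtain zs where zs: "\<And>n. set (zs n) \<subseteq> B" and zc: "\<And>n. c - 1 / real (Suc n) < ?q (zs n)" by metis
  define d where "d n = sqrt (1 / real (Suc n))" for n
  have d0: "d \<longlonglongrightarrow> 0"
  proof -
    have "(\<lambda>n. sqrt (1 / real (Suc n))) \<longlonglongrightarrow> sqrt 0" by (intro tendsto_real_sqrt LIMSEQ_Suc[OF lim_inverse_n'])
    then show ?thesis by (simp add: d_def[abs_def])
  qed
  \<comment> \<open>Any further refinement raises the squared norm by at most 1/(n+1), and by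
    orthogonality of increments this raise is the squared distance.\<close>
  have ext: "L2_norm M (\<lambda>\<omega>. ?Z (zs n @ ys) \<omega> - ?Z (zs n) \<omega>) \<le> d n" if ys: "set ys \<subseteq> B" for n ys
  proof -
    have "(L2_norm M (\<lambda>\<omega>. ?Z (zs n @ ys) \<omega> - ?Z (zs n) \<omega>))\<^sup>2 \<le> 1 / real (Suc n)"
      using exp_product_extend_norm[OF zs ys top_B, of n] le[of "zs n @ ys"] zs[of n] ys zc[of n] by simp
    then show ?thesis unfolding d_def by (rule real_le_rsqrt)
  qed
  define F where "F n = ?Z (zs n)" for n
  have F: "F n \<in> L2 M" for n unfolding F_def by (rule exp_product_L2[OF zs top_B])
  have "L2_norm M (\<lambda>\<omega>. F m \<omega> - F n \<omega>) \<le> d m + d n" for m n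
  proof -
    \<comment> \<open>The common refinement, which is close to both \<open>F m\<close> and
      \<open>F n\<close>.\<close>
    have G: "?Z (zs m @ zs n) \<in> L2 M" using zs by (intro exp_product_L2) auto
    have 1: "L2_norm M (\<lambda>\<omega>. F m \<omega> - ?Z (zs m @ zs n) \<omega>) \<le> d m"
      using ext[OF zs, of m n] by (simp add: F_def L2_norm_minus_commute[of M "?Z (zs m)"])
    have 2: "L2_norm M (\<lambda>\<omega>. ?Z (zs m @ zs n) \<omega> - F n \<omega>) \<le> d n"
      using ext[OF zs, of n m] exp_product_append_commute[of X "zs m" "zs n" "sets M"] by (simp add: F_def)
    show ?thesis using L2_norm_triangle_diff[OF F G F, of m n] 1 2 by simp
  qed
  note dd = this
  have "\<exists>N. \<forall>m\<ge>N. \<forall>n\<ge>N. L2_norm M (\<lambda>\<omega>. F m \<omega> - F n \<omega>) < \<epsilon>" if e: "0 < \<epsilon>" for \<epsilon>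
  proof -
    have "\<forall>\<^sub>F n in sequentially. d n < \<epsilon> / 2" using order_tendstoD(2)[OF d0, of "\<epsilon> / 2"] e by simp
    then obtain N where N: "\<And>n. N \<le> n \<Longrightarrow> d n < \<epsilon> / 2" by (auto simp: eventually_sequentially)
    have "L2_norm M (\<lambda>\<omega>. F m \<omega> - F n \<omega>) < \<epsilon>" if "N \<le> m" "N \<le> n" for m n
      using dd[of m n] N[OF that(1)] N[OF that(2)] by simp
    then show ?thesis by blast
  qed
  from L2_complete[OF F this] obtain Z where Z: "Z \<in> L2 M" and lim: "L2_lim M F Z" by blast
  have mean: "expectation Z = 1"
  proof -
    have "(\<lambda>n. ip M (F n) (\<lambda>\<omega>. 1)) \<longlonglongrightarrow> ip M Z (\<lambda>\<omega>. 1)" by (rule L2_lim_ip[OF F Z L2_const lim])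
    moreover have "ip M (F n) (\<lambda>\<omega>. 1) = 1" for n using exp_product_mean[OF zs top_B] by (simp add: F_def ip_def)
    ultimately show ?thesis by (simp add: ip_def LIMSEQ_const_iff)
  qed
  have fc: "ip M Z Y = ip M X Y" if Y: "Y \<in> FC" for Y
  proof -
    have t: "ip M U (cexp M (sets M) Y) = ip M U Y" if "U \<in> L2 M" for U
      by (rule ip_cong_AE[OF that cexp_L2[OF B_sub[OF top_B] FC_L2[OF Y]] that FC_L2[OF Y] _ cexp_top[OF FC_L2[OF Y]]]) simp
    have tX: "ip M (cexp M (sets M) X) Y = ip M X Y"
      by (rule ip_cong_AE[OF cexp_L2[OF B_sub[OF top_B] FC_L2[OF X]] FC_L2[OF Y] FC_L2[OF X] FC_L2[OF Y] cexp_top[OF FC_L2[OF X]]]) simp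
    have "ip M (F n) Y = ip M X Y" for n
      using exp_product_ip_FC[OF zs top_B Y, of n] t[OF F, of n] t[OF cexp_L2[OF B_sub[OF top_B] FC_L2[OF X]]] tX by (simp add: F_def)
    then show ?thesis using L2_lim_ip[OF F Z FC_L2[OF Y] lim] by (simp add: LIMSEQ_const_iff)
  qed
  have mult: "AE \<omega> in M. Z \<omega> = cexp M x Z \<omega> * cexp M (cp x) Z \<omega>" if x: "x \<in> B" for x
  proof -
    note sx = B_sub[OF x] and sc = B_sub[OF cp_B[OF x]] and ind = cp_indep[OF x]
    \<comment> \<open>Appending x makes the product factorise along x while moving it by at most
      \<open>d n\<close>, so the limit is the same.\<close>
    define W where "W n = ?Z (zs n @ [x])" for n
    have zx: "set (zs n @ [x]) \<subseteq> B" for n using zs[of n] x by simp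
    have W: "W n \<in> L2 M" for n unfolding W_def by (rule exp_product_L2[OF zx top_B])
    have WF: "L2_norm M (\<lambda>\<omega>. W n \<omega> - F n \<omega>) \<le> d n" for n
      unfolding W_def F_def using ext[of "[x]" n] x by simp
    have limW: "L2_lim M W Z"
      unfolding L2_lim_def
    proof (rule Lim_null_comparison[OF always_eventually], rule allI)
      show "norm (L2_norm M (\<lambda>\<omega>. W n \<omega> - Z \<omega>)) \<le> d n + L2_norm M (\<lambda>\<omega>. F n \<omega> - Z \<omega>)" for n
        using L2_norm_triangle_diff[OF W F Z, of n n] WF[of n] by simp
      show "(\<lambda>n. d n + L2_norm M (\<lambda>\<omega>. F n \<omega> - Z \<omega>)) \<longlonglongrightarrow> 0"
        using tendsto_add[OF d0 lim[unfolded L2_lim_def]] by simp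
    qed
    have fac: "AE \<omega> in M. W n \<omega> = cexp M x (W n) \<omega> * cexp M (cp x) (W n) \<omega>" for n
    proof -
      have "sets M \<inter> x = x" "sets M \<inter> cp x = cp x" using B_le_top[OF x] B_le_top[OF cp_B[OF x]] by auto
      then obtain U V where UV: "U \<in> L2_sub M x" "V \<in> L2_sub M (cp x)" "W n = (\<lambda>\<omega>. U \<omega> * V \<omega>)"
        using exp_product_factor[OF zs x top_B, of n] unfolding W_def by auto
      have "expectation (\<lambda>\<omega>. U \<omega> * V \<omega>) = 1" using exp_product_mean[OF zx top_B, of n] UV(3) by (simp add: W_def)
      from multiplicative_factor[OF x UV(1,2) this] show ?thesis unfolding UV(3) .
    qed
    note P = cexp_L2_sub[OF sx] and Q = cexp_L2_sub[OF sc]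
    have l: "L2_lim M (\<lambda>n \<omega>. cexp M x (W n) \<omega> * cexp M (cp x) (W n) \<omega>) (\<lambda>\<omega>. cexp M x Z \<omega> * cexp M (cp x) Z \<omega>)"
      by (rule L2_lim_indep_product[OF sx sc ind P[OF W] P[OF Z] Q[OF W] Q[OF Z]
            L2_lim_cexp[OF sx W Z limW] L2_lim_cexp[OF sc W Z limW]])
    note pW = indep_product(1)[OF sx sc ind P[OF W] Q[OF W]] and pZ = indep_product(1)[OF sx sc ind P[OF Z] Q[OF Z]]
    have "L2_norm M (\<lambda>\<omega>. W n \<omega> - cexp M x Z \<omega> * cexp M (cp x) Z \<omega>) =
        L2_norm M (\<lambda>\<omega>. cexp M x (W n) \<omega> * cexp M (cp x) (W n) \<omega> - cexp M x Z \<omega> * cexp M (cp x) Z \<omega>)" for n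
      by (rule L2_norm_cong_AE[OF L2_diff[OF W pZ] L2_diff[OF pW pZ]]) (use fac[of n] in eventually_elim, simp)
    then have "L2_lim M W (\<lambda>\<omega>. cexp M x Z \<omega> * cexp M (cp x) Z \<omega>)" using l by (simp add: L2_lim_def)
    from L2_lim_unique[OF W Z pZ limW this] show ?thesis .
  qed
  from Z mean mult fc show ?thesis by (rule that)
qed

end

end

section \<open>Classicality, blackness and spectral independence\<close>

context prob_space
begin

lemma L2_sub_mult:
  assumes x: "x \<in> subfields M" and f: "f \<in> L2_sub M x" and g: "g \<in> L2_sub M x" and fg: "(\<lambda>\<omega>. f \<omega> * g \<omega>) \<in> L2 M"
  shows "(\<lambda>\<omega>. f \<omega> * g \<omega>) \<in> L2_sub M x"
proof (rule L2_subI[OF x fg])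
  show "(\<lambda>\<omega>. cexp M x f \<omega> * cexp M x g \<omega>) \<in> borel_measurable (sigma (space M) x)"
    by (intro borel_measurable_times cexp_borel_measurable)
  show "AE \<omega> in M. f \<omega> * g \<omega> = cexp M x f \<omega> * cexp M x g \<omega>"
    using L2_sub_AE[OF f] L2_sub_AE[OF g] by eventually_elim simp
qed

lemma generated_field_subfields:
  assumes "G \<subseteq> borel_measurable M" shows "generated_field M G \<in> subfields M"
proof -
  have "{f -` A \<inter> space M |f A. f \<in> G \<and> A \<in> sets borel} \<union> null_sets M \<subseteq> sets M"
    using assms by (auto simp: measurable_sets)
  then show ?thesis
    unfolding subfields_def generated_field_def
    using sigma_algebra_sigma_sets[OF order_trans[OF _ sets.space_closed]] sets.sigma_sets_subset by blast
qed

lemma generated_field_L2_sub: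
  assumes G: "G \<subseteq> L2 M" and f: "f \<in> G" shows "f \<in> L2_sub M (generated_field M G)"
proof (rule L2_subI[of _ _ f])
  have s: "generated_field M G \<in> subfields M" by (rule generated_field_subfields) (use G L2_measurable in blast)
  then show "generated_field M G \<in> subfields M" .
  show "f \<in> L2 M" using G f by blast
  show "f \<in> borel_measurable (sigma (space M) (generated_field M G))"
  proof (rule measurableI)
    fix A :: "real set" assume "A \<in> sets borel"
    then have "f -` A \<inter> space M \<in> generated_field M G"
      unfolding generated_field_def using f by (intro sigma_sets.Basic) blast
    then show "f -` A \<inter> space (sigma (space M) (generated_field M G)) \<in> sets (sigma (space M) (generated_field M G))"
      by (simp add: sets_subfield[OF s] space_subfield)
  qed simp
qed simp

lemma generated_field_L2:
  assumes G: "G \<subseteq> L2 M" and L: "L2 M \<subseteq> L2_sub M (generated_field M G)" shows "generated_field M G = sets M"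
proof -
  let ?C = "generated_field M G"
  have s: "?C \<in> subfields M" by (rule generated_field_subfields) (use G L2_measurable in blast)
  interpret C: sigma_algebra "space M" ?C using s by (simp add: subfields_def)
  have null: "N \<in> ?C" if "N \<in> null_sets M" for N
    using that unfolding generated_field_def by (intro sigma_sets.Basic) simp
  have "A \<in> ?C" if A: "A \<in> sets M" for A
  proof -
    let ?k = "cexp M ?C (indicator A)"
    have "(indicator A :: _ \<Rightarrow> real) \<in> L2_sub M ?C" using L2_indicator[OF A] L by blast
    then have ae: "AE \<omega> in M. indicator A \<omega> = ?k \<omega>" by (rule L2_sub_AE)
    \<comment> \<open>A version of A inside the generated field. It differs from A by null sets,
      which that field contains.\<close>
    define E where "E = ?k -` {1} \<inter> space M"
    have "?k -` {1} \<inter> space (sigma (space M) ?C) \<in> sets (sigma (space M) ?C)"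
      by (rule measurable_sets[OF cexp_borel_measurable]) simp
    then have E: "E \<in> ?C" by (simp add: E_def sets_subfield[OF s] space_subfield)
    then have EM: "E \<in> sets M" using s by (auto simp: subfields_def)
    have "AE \<omega> in M. \<omega> \<notin> (A - E) \<and> \<omega> \<notin> (E - A)"
      using ae AE_space by eventually_elim (auto simp: E_def split: split_indicator_asm)
    then have "A - E \<in> null_sets M" "E - A \<in> null_sets M"
      using A EM by (auto intro!: AE_iff_null_sets[THEN iffD2] elim: eventually_mono)
    then have "E - (E - A) \<union> (A - E) \<in> ?C" using null E by blast
    moreover have "E - (E - A) \<union> (A - E) = A" by auto
    ultimately show ?thesis by simp
  qed
  then show ?thesis using s by (auto simp: subfields_def)
qed

end

context noise_spectral
begin

text \<open>For each x the vector is a product of a factor for x and one for its complement, so its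
  spectral measure factorises on the two spectral fields. The part on \<open>S Bot\<close> is the
  mean, which explains the mass found there.\<close>

lemma spectral_probability_of_vector:
  assumes Z: "Z \<in> L2 M" and mean: "expectation Z = 1"
    and mult: "\<And>x. x \<in> B \<Longrightarrow> AE \<omega> in M. Z \<omega> = cexp M x Z \<omega> * cexp M (cp x) Z \<omega>"
  obtains \<nu> where "spectral_independence_probability M B \<mu> \<Psi> \<nu>"
    "measure \<nu> (S Bot) = 1 / ip M Z Z"
    "(AE s in \<mu>. \<Psi> Z s \<noteq> 0) \<Longrightarrow> equivalent_measures \<nu> \<mu>"
proof -
  have one: "ip M Z (\<lambda>\<omega>. 1) = 1" using mean by (simp add: ip_def)
  have "1 \<le> L2_norm M Z" using Cauchy_Schwarz_L2[OF Z L2_const[of 1]] one L2_norm_one by simp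
  \<comment> \<open>The mean 1 forces norm at least 1, so the division makes sense.\<close>
  define c where "c = 1 / L2_norm M Z"
  have c: "0 < c" using \<open>1 \<le> L2_norm M Z\<close> by (simp add: c_def)
  have c2: "c * c * ip M Z Z = 1"
    using \<open>1 \<le> L2_norm M Z\<close> by (simp add: c_def L2_norm_square[symmetric] power2_eq_square)
  then have c3: "c * c = 1 / ip M Z Z" by (metis div_by_0 eq_divide_eq mult_zero_right zero_neq_one)
  define W where "W = (\<lambda>\<omega>. c * Z \<omega>)"
  have W: "W \<in> L2 M" unfolding W_def by (rule L2_scale[OF Z])
  have WW: "ip M W W = 1"
    using c2 by (simp add: W_def ip_def mult_ac)
  let ?\<nu> = "spectral_measure W"
  have emp: "measure ?\<nu> A = ip M (Pr A W) (Pr A W)" if "A \<in> sets \<mu>" for A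
    using emeasure_spectral_measure[OF W that] by (simp add: measure_def ip_self_nonneg)
  have PW: "AE \<omega> in M. Pr (space \<mu>) W \<omega> = W \<omega>"
  proof -
    have "AE s in \<mu>. \<Psi> W s = indicator (space \<mu>) s *\<^sub>R \<Psi> W s" using AE_space by eventually_elim simp
    from Pr_eqI[OF sets.top W W this] show ?thesis by eventually_elim simp
  qed
  have "ip M (Pr (space \<mu>) W) (Pr (space \<mu>) W) = ip M W W"
    by (rule ip_cong_AE[OF Pr_L2[OF sets.top W] Pr_L2[OF sets.top W] W W PW PW])
  then have "emeasure ?\<nu> (space \<mu>) = 1" using emeasure_spectral_measure[OF W sets.top] WW by simp
  then interpret \<nu>: prob_space ?\<nu> by (intro prob_spaceI) simp
  have Bot: "measure ?\<nu> (S Bot) = 1 / ip M Z Z"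
  proof -
    have SB: "S Bot \<in> sets \<mu>" by (rule S_sets[OF Bot_B])
    have "AE \<omega> in M. Pr (S Bot) W \<omega> = c"
      using cexp_Pr[OF Bot_B W] cexp_Bot[OF W] by eventually_elim (simp add: W_def mean)
    then have "ip M (Pr (S Bot) W) (Pr (S Bot) W) = ip M (\<lambda>_. c) (\<lambda>_. c)"
      by (intro ip_cong_AE Pr_L2 SB W L2_const)
    then show ?thesis using emp[OF SB] c3 by (simp add: ip_def prob_space)
  qed
  have ind: "\<nu>.indep_set (Sig x) (Sig (cp x))" if x: "x \<in> B" for x
  proof (rule \<nu>.indep_setI)
    note cx = cp_B[OF x]
    show "Sig x \<subseteq> sets ?\<nu>" "Sig (cp x) \<subseteq> sets ?\<nu>" using Sig_sets[OF x] Sig_sets[OF cx] by simp_all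
    define U where "U = cexp M x Z"
    \<comment> \<open>The normalising constant goes into one of the two factors.\<close>
    define V where "V = (\<lambda>\<omega>. c * cexp M (cp x) Z \<omega>)"
    have U: "U \<in> L2_sub M x" unfolding U_def by (rule cexp_L2_sub[OF B_sub[OF x] Z])
    have V: "V \<in> L2_sub M (cp x)" unfolding V_def
      by (rule closed_subspace_scale[OF closed_subspace_L2_sub[OF B_sub[OF cx]] cexp_L2_sub[OF B_sub[OF cx] Z]])
    note sx = B_sub[OF x] and sc = B_sub[OF cx] and i = cp_indep[OF x]
    have UV: "(\<lambda>\<omega>. U \<omega> * V \<omega>) \<in> L2 M" by (rule indep_product(1)[OF sx sc i U V])
    have WUV: "AE \<omega> in M. W \<omega> = U \<omega> * V \<omega>"
      using mult[OF x] by eventually_elim (simp add: W_def U_def V_def)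
    define u where "u A = ip M (Pr A U) (Pr A U)" for A
    define v where "v A = ip M (Pr A V) (Pr A V)" for A
    have prod: "measure ?\<nu> (A \<inter> C) = u A * v C" if A: "A \<in> Sig x" and C: "C \<in> Sig (cp x)" for A C
    proof -
      have A': "A \<in> sets \<mu>" and C': "C \<in> sets \<mu>" using A C Sig_sets[OF x] Sig_sets[OF cx] by auto
      then have AC: "A \<inter> C \<in> sets \<mu>" by auto
      note PU = Pr_L2_sub[OF A' x U] and PV = Pr_L2_sub[OF C' cx V]
      have ae: "AE \<omega> in M. Pr (A \<inter> C) W \<omega> = Pr A U \<omega> * Pr C V \<omega>"
        using Pr_cong[OF AC W UV WUV] Pr_product2[OF x A C U V] by eventually_elim simp
      have "measure ?\<nu> (A \<inter> C) = ip M (\<lambda>\<omega>. Pr A U \<omega> * Pr C V \<omega>) (\<lambda>\<omega>. Pr A U \<omega> * Pr C V \<omega>)"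
        unfolding emp[OF AC]
        by (intro ip_cong_AE Pr_L2[OF AC W] indep_product(1)[OF sx sc i PU PV] ae)
      then show ?thesis using ip_indep_product[OF sx sc i PU PU PV PV] by (simp add: u_def v_def)
    qed
    have top: "space \<mu> \<in> Sig x" "space \<mu> \<in> Sig (cp x)"
      using sigma_algebra_Sig[OF x] sigma_algebra_Sig[OF cx] by (auto intro: sigma_algebra.sigma_sets_subset algebra.top sigma_algebra.axioms)
    fix A C assume A: "A \<in> Sig x" and C: "C \<in> Sig (cp x)"
    have A': "A \<subseteq> space \<mu>" and C': "C \<subseteq> space \<mu>"
      using A C Sig_sets[OF x] Sig_sets[OF cx] by (auto dest: sets.sets_into_space)
    have "measure ?\<nu> A = u A * v (space \<mu>)" using prod[OF A top(2)] A' by (simp add: Int_absorb2)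
    moreover have "measure ?\<nu> C = u (space \<mu>) * v C" using prod[OF top(1) C] C' by (simp add: Int_absorb1)
    \<comment> \<open>Neither u nor v has to have total mass 1; only the product of the two masses
      is 1, and that is enough for independence.\<close>
    moreover have "1 = u (space \<mu>) * v (space \<mu>)" using prod[OF top] \<nu>.prob_space by simp
    ultimately have "measure ?\<nu> A * measure ?\<nu> C = u A * v C * 1"
      by (simp add: mult_ac)
    then show "measure ?\<nu> (A \<inter> C) = measure ?\<nu> A * measure ?\<nu> C" using prod[OF A C] by simp
  qed
  have ac: "absolutely_continuous \<mu> ?\<nu>"
    unfolding spectral_measure_def by (rule absolutely_continuousI_density) (use \<Psi>_norm_measurable[OF W] in auto)
  have "0 < ip M Z Z" using c2 ip_self_nonneg[of M Z] by (cases "ip M Z Z = 0") auto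
  then have "spectral_independence_probability M B \<mu> \<Psi> ?\<nu>"
    unfolding spectral_independence_probability_def
    using \<nu>.prob_space_axioms ac ind Bot by simp
  moreover have "equivalent_measures ?\<nu> \<mu>" if Z0: "AE s in \<mu>. \<Psi> Z s \<noteq> 0"
  proof -
    have "AE s in \<mu>. \<Psi> W s = c *\<^sub>R \<Psi> Z s" unfolding W_def using \<Psi>_lin[OF Z Z, of c 0] by simp
    with Z0 have W0: "AE s in \<mu>. \<Psi> W s \<noteq> 0" by eventually_elim (use c in auto)
    have "A \<in> null_sets \<mu>" if A: "A \<in> null_sets ?\<nu>" for A
    proof -
      have "AE s in \<mu>. \<Psi> W s \<noteq> 0 \<longrightarrow> s \<notin> A" using AE_not_in[OF A] by (simp add: AE_spectral_measure[OF W])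
      with W0 have "AE s in \<mu>. s \<notin> A" by eventually_elim blast
      then show ?thesis using A by (subst AE_iff_null_sets) (auto dest: null_setsD2)
    qed
    then show ?thesis using ac by (auto simp: equivalent_measures_def absolutely_continuous_def)
  qed
  ultimately show ?thesis using Bot that by blast
qed

lemma measure_empty_point:
  assumes "spectral_independence_probability M B \<mu> \<Psi> \<nu>" shows "measure \<nu> {ept} = measure \<nu> (S Bot)"
proof -
  interpret \<nu>: prob_space \<nu> using assms by (simp add: spectral_independence_probability_def)
  have sets: "sets \<nu> = sets \<mu>" and ac: "absolutely_continuous \<mu> \<nu>"
    using assms by (auto simp: spectral_independence_probability_def)
  have "AE s in \<nu>. s \<in> {ept} \<longleftrightarrow> s \<in> S Bot"
    using absolutely_continuous_AE[OF sets ac empty_point(2)] by eventually_elim simp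
  then show ?thesis
    by (rule \<nu>.finite_measure_eq_AE) (use sets empty_point(1) S_sets[OF Bot_B] in auto)
qed

lemma classical_imp_spectral_independence:
  assumes c: "classical M B"
  shows "\<exists>\<nu>. spectral_independence_probability M B \<mu> \<Psi> \<nu> \<and> equivalent_measures \<nu> \<mu>"
proof -
  obtain X where X: "X \<in> FC" and Xf: "\<And>Y. Y \<in> FC \<Longrightarrow> AE s in \<mu>. \<Psi> X s = 0 \<longrightarrow> \<Psi> Y s = 0"
    using FC_full_support by blast
  obtain Z where Z: "Z \<in> L2 M" and mean: "expectation Z = 1"
    and mult: "\<And>x. x \<in> B \<Longrightarrow> AE \<omega> in M. Z \<omega> = cexp M x Z \<omega> * cexp M (cp x) Z \<omega>"
    and fc: "\<And>Y. Y \<in> FC \<Longrightarrow> ip M Z Y = ip M X Y"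
    using exponential_vector[OF X] by blast
  note X2 = FC_L2[OF X]
  define D where "D = {f \<in> L2 M. AE s in \<mu>. \<Psi> Z s = 0 \<longrightarrow> \<Psi> f s = 0}"
  have E: "space \<mu> - {s \<in> space \<mu>. \<Psi> Z s \<noteq> 0} \<in> sets \<mu>" (is "?E \<in> _") using \<Psi>_nonzero_sets[OF Z] by auto
  have ZE: "AE s in \<mu>. \<Psi> (Pr ?E Z) s = 0"
    using \<Psi>_Pr[OF E Z] AE_space by eventually_elim (auto split: split_indicator)
  \<comment> \<open>Absolute continuity means that the projection to the zeros of
    \<open>\<Psi> Z\<close> vanishes. In this form closedness of D follows from
    \<open>closed_subspace_Pr_vimage\<close>.\<close>
  have D_eq: "D = {f \<in> L2 M. Pr ?E f \<in> {k \<in> L2 M. AE \<omega> in M. k \<omega> = 0}}"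
  proof -
    have "(AE s in \<mu>. \<Psi> Z s = 0 \<longrightarrow> \<Psi> f s = 0) \<longleftrightarrow> (AE \<omega> in M. Pr ?E f \<omega> = 0)" if f: "f \<in> L2 M" for f
    proof -
      have "(AE s in \<mu>. \<Psi> Z s = 0 \<longrightarrow> \<Psi> f s = 0) \<longleftrightarrow> (AE s in \<mu>. \<Psi> (Pr ?E f) s = 0)"
        by (rule eventually_subst)
          (use \<Psi>_Pr[OF E f] AE_space in \<open>eventually_elim, auto split: split_indicator\<close>)
      then show ?thesis using \<Psi>_eq_0[OF Pr_L2[OF E f]] by simp
    qed
    then show ?thesis using Pr_L2[OF E] by (auto simp: D_def)
  qed
  have null: "closed_subspace M {k \<in> L2 M. AE \<omega> in M. k \<omega> = 0}"
    unfolding closed_subspace_def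
  proof (intro conjI ballI allI impI)
    show "{k \<in> L2 M. AE \<omega> in M. k \<omega> = 0} \<noteq> {}" using L2_zero by fastforce
    fix f g a b assume "f \<in> {k \<in> L2 M. AE \<omega> in M. k \<omega> = 0}" "g \<in> {k \<in> L2 M. AE \<omega> in M. k \<omega> = 0}"
    then have f: "f \<in> L2 M" "AE \<omega> in M. f \<omega> = 0" and g: "g \<in> L2 M" "AE \<omega> in M. g \<omega> = 0" by auto
    from f(2) g(2) have "AE \<omega> in M. a * f \<omega> + b * g \<omega> = 0" by eventually_elim simp
    then show "(\<lambda>\<omega>. a * f \<omega> + b * g \<omega>) \<in> {k \<in> L2 M. AE \<omega> in M. k \<omega> = 0}" using L2_lin[OF f(1) g(1)] by simp
  next
    fix f assume f: "f \<in> L2 M"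
      and a: "\<forall>\<epsilon>>0. \<exists>g\<in>{k \<in> L2 M. AE \<omega> in M. k \<omega> = 0}. L2_norm M (\<lambda>\<omega>. f \<omega> - g \<omega>) < \<epsilon>"
    have "L2_norm M f \<le> 0 + \<epsilon>" if "0 < \<epsilon>" for \<epsilon>
    proof -
      obtain g where g: "g \<in> L2 M" "AE \<omega> in M. g \<omega> = 0" "L2_norm M (\<lambda>\<omega>. f \<omega> - g \<omega>) < \<epsilon>" using a \<open>0 < \<epsilon>\<close> by blast
      have "L2_norm M f = L2_norm M (\<lambda>\<omega>. f \<omega> - g \<omega>)"
        by (rule L2_norm_cong_AE[OF f L2_diff[OF f g(1)]]) (use g(2) in eventually_elim, simp)
      then show ?thesis using g(3) by simp
    qed
    then have "L2_norm M f \<le> 0" by (rule field_le_epsilon)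
    then have "L2_norm M f = 0" by (simp add: antisym)
    then show "f \<in> {k \<in> L2 M. AE \<omega> in M. k \<omega> = 0}" using L2_norm_eq_0[OF f] f by simp
  qed auto
  have DI: "f \<in> D" if "f \<in> L2 M" "AE s in \<mu>. \<Psi> Z s = 0 \<longrightarrow> \<Psi> f s = 0" for f using that by (simp add: D_def)
  have "tight \<subseteq> D"
  proof (rule tight_subset)
    show "closed_subspace M D" unfolding D_eq by (rule closed_subspace_Pr_vimage[OF E null])
    show "(\<lambda>\<omega>. 1) \<in> D"
    proof (rule DI[OF L2_const])
      \<comment> \<open>The constant 1 is the projection of Z to \<open>Bot\<close>, that is the
        part of Z on \<open>S Bot\<close>.\<close>
      have "AE s in \<mu>. \<Psi> (cexp M Bot Z) s = \<Psi> (\<lambda>\<omega>. 1) s"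
        by (rule \<Psi>_cong[OF cexp_L2[OF B_sub[OF Bot_B] Z] L2_const]) (use cexp_Bot[OF Z] mean in simp)
      with S_cexp[OF Bot_B Z] show "AE s in \<mu>. \<Psi> Z s = 0 \<longrightarrow> \<Psi> (\<lambda>\<omega>. 1) s = 0"
        by eventually_elim auto
    qed
    show "FC \<subseteq> D"
    proof
      fix Y assume Y: "Y \<in> FC"
      text \<open>\<open>Z - X\<close> is orthogonal to the first chaos, which contains \<open>Pr E X\<close>.\<close>
      have PX: "Pr ?E X \<in> FC" by (rule Pr_FC[OF E X])
      note PX2 = FC_L2[OF PX]
      have "AE s in \<mu>. \<Psi> Z s \<bullet> \<Psi> (Pr ?E X) s = 0"
        using \<Psi>_Pr[OF E X2] AE_space by eventually_elim (auto split: split_indicator)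
      then have "(LINT s|\<mu>. \<Psi> Z s \<bullet> \<Psi> (Pr ?E X) s) = 0" by (rule integral_eq_zero_AE)
      then have "ip M X (Pr ?E X) = 0" using \<Psi>_inner(2)[OF Z PX2] fc[OF PX] by simp
      moreover have "ip M X (Pr ?E X) = ip M (Pr ?E X) (Pr ?E X)"
      proof -
        have "(LINT s|\<mu>. \<Psi> X s \<bullet> \<Psi> (Pr ?E X) s) = (LINT s|\<mu>. \<Psi> (Pr ?E X) s \<bullet> \<Psi> (Pr ?E X) s)"
        proof (rule integral_cong_AE)
          show "AE s in \<mu>. \<Psi> X s \<bullet> \<Psi> (Pr ?E X) s = \<Psi> (Pr ?E X) s \<bullet> \<Psi> (Pr ?E X) s"
            using \<Psi>_Pr[OF E X2] by eventually_elim (auto split: split_indicator)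
        qed (use \<Psi>_inner(1)[OF X2 PX2] \<Psi>_inner(1)[OF PX2 PX2] in auto)
        then show ?thesis using \<Psi>_inner(2)[OF X2 PX2] \<Psi>_inner(2)[OF PX2 PX2] by simp
      qed
      ultimately have "L2_norm M (Pr ?E X) = 0" by (simp add: L2_norm_ip)
      then have "AE s in \<mu>. \<Psi> (Pr ?E X) s = 0" using L2_norm_eq_0[OF PX2] \<Psi>_eq_0[OF PX2] by simp
      with \<Psi>_Pr[OF E X2] Xf[OF Y] AE_space have "AE s in \<mu>. \<Psi> Z s = 0 \<longrightarrow> \<Psi> Y s = 0"
        by eventually_elim (auto split: split_indicator_asm)
      then show "Y \<in> D" by (rule DI[OF FC_L2[OF Y]])
    qed
    fix y f g assume y: "y \<in> B" and f: "f \<in> D" "f \<in> L2_sub M y" and g: "g \<in> D" "g \<in> L2_sub M (cp y)"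
    note cy = cp_B[OF y]
    note prod = indep_product(1)[OF B_sub[OF y] B_sub[OF cy] cp_indep[OF y]]
    \<comment> \<open>A vector k measurable for x lives on \<open>S x\<close>, where Z and its
      projection to x agree under \<open>\<Psi>\<close>.\<close>
    have restr: "AE s in \<mu>. \<Psi> (cexp M x Z) s = 0 \<longrightarrow> \<Psi> k s = 0" if "x \<in> B" "k \<in> D" "k \<in> L2_sub M x" for x k
    proof -
      have k: "k \<in> L2 M" "AE s in \<mu>. \<Psi> Z s = 0 \<longrightarrow> \<Psi> k s = 0" using that(2) by (auto simp: D_def)
      have "AE s in \<mu>. \<Psi> k s \<noteq> 0 \<longrightarrow> s \<in> S x" using L2_sub_iff_\<Psi>[OF that(1) k(1)] that(3) by simp
      with k(2) S_cexp[OF that(1) Z] show ?thesis by eventually_elim (auto split: split_indicator_asm)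
    qed
    let ?U = "cexp M y Z" and ?V = "cexp M (cp y) Z"
    have U: "?U \<in> L2_sub M y" and V: "?V \<in> L2_sub M (cp y)" using y cy Z by (auto intro: cexp_L2_sub)
    have "AE s in \<mu>. \<Psi> (\<lambda>\<omega>. ?U \<omega> * ?V \<omega>) s = 0 \<longrightarrow> \<Psi> (\<lambda>\<omega>. f \<omega> * g \<omega>) s = 0"
      by (rule product_absolutely_continuous[OF y f(2) U g(2) V restr[OF y f] restr[OF cy g]])
    with \<Psi>_cong[OF Z prod[OF U V] mult[OF y]]
    have "AE s in \<mu>. \<Psi> Z s = 0 \<longrightarrow> \<Psi> (\<lambda>\<omega>. f \<omega> * g \<omega>) s = 0" by eventually_elim simp
    then show "(\<lambda>\<omega>. f \<omega> * g \<omega>) \<in> D" by (rule DI[OF prod[OF f(2) g(2)]])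
  qed
  then have sub: "L2 M \<subseteq> D" using classical_tight[OF c] by simp
  obtain f where f: "f \<in> L2 M" and f0: "AE s in \<mu>. \<Psi> f s \<noteq> 0" by (rule full_support)
  have "AE s in \<mu>. \<Psi> Z s = 0 \<longrightarrow> \<Psi> f s = 0" using f sub by (auto simp: D_def)
  with f0 have "AE s in \<mu>. \<Psi> Z s \<noteq> 0" by eventually_elim blast
  with spectral_probability_of_vector[OF Z mean mult] show ?thesis by metis
qed

text \<open>Equivalence makes the density positive almost everywhere, so every vector is tight. The
  closure principle is applied to the functions measurable for the field generated by the first
  chaos.\<close>

lemma spectral_independence_imp_classical:
  assumes sip: "spectral_independence_probability M B \<mu> \<Psi> \<nu>" and eq: "equivalent_measures \<nu> \<mu>"
  shows "classical M B"
proof -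
  obtain D where D: "D \<in> borel_measurable \<mu>" "\<And>s. 0 \<le> D s" "\<nu> = density \<mu> (\<lambda>s. ennreal (D s))"
    and t: "\<And>f. f \<in> L2 M \<Longrightarrow> AE s in \<mu>. D s = 0 \<longrightarrow> \<Psi> f s = 0 \<Longrightarrow> f \<in> tight"
    using spectral_independence_tight[OF sip] by blast
  have Dm: "(\<lambda>s. ennreal (D s)) \<in> borel_measurable \<mu>" using D(1) by simp
  have pos: "AE s in \<nu>. 0 < ennreal (D s)" unfolding D(3) using AE_density[OF Dm] by simp
  have ac: "absolutely_continuous \<nu> \<mu>" using eq by (simp add: equivalent_measures_def)
  have sets: "sets \<mu> = sets \<nu>" using sip by (simp add: spectral_independence_probability_def)
  from absolutely_continuous_AE[OF sets ac pos] have D0: "AE s in \<mu>. D s \<noteq> 0" by eventually_elim auto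
  have "f \<in> tight" if "f \<in> L2 M" for f by (rule t[OF that]) (use D0 in eventually_elim, simp)
  then have tL: "L2 M \<subseteq> tight" by blast
  let ?C = "generated_field M FC"
  have F2: "FC \<subseteq> L2 M" using FC_L2 by blast
  have s: "?C \<in> subfields M" by (rule generated_field_subfields) (use FC_L2 L2_measurable in blast)
  have "tight \<subseteq> L2_sub M ?C"
  proof (rule tight_subset[OF closed_subspace_L2_sub[OF s] L2_sub_const[OF s]])
    show "FC \<subseteq> L2_sub M ?C" using generated_field_L2_sub[OF F2] by blast
    fix y f g assume "y \<in> B" "f \<in> L2_sub M ?C" "f \<in> L2_sub M y" "g \<in> L2_sub M ?C" "g \<in> L2_sub M (cp y)"
    then show "(\<lambda>\<omega>. f \<omega> * g \<omega>) \<in> L2_sub M ?C"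
      by (intro L2_sub_mult[OF s] indep_product(1)[OF B_sub B_sub cp_indep]) auto
  qed
  then show ?thesis using tL generated_field_L2[OF F2] by (auto simp: classical_def)
qed

text \<open>Without first chaos the closure principle applies to the constants, so tight vectors are
  constant. A vector of full support, cut down to the set where the density of \<open>\<nu>\<close>
  is non-zero, is tight; hence that set lies in \<open>S Bot\<close> up to a null set.\<close>

lemma black_imp_trivial:
  assumes bl: "\<And>f. f \<in> FC \<Longrightarrow> AE \<omega> in M. f \<omega> = 0" and sip: "spectral_independence_probability M B \<mu> \<Psi> \<nu>"
  shows "measure \<nu> {ept} = 1"
proof -
  interpret \<nu>: prob_space \<nu> using sip by (simp add: spectral_independence_probability_def)
  obtain D where D: "D \<in> borel_measurable \<mu>" "\<And>s. 0 \<le> D s" "\<nu> = density \<mu> (\<lambda>s. ennreal (D s))"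
    and t: "\<And>f. f \<in> L2 M \<Longrightarrow> AE s in \<mu>. D s = 0 \<longrightarrow> \<Psi> f s = 0 \<Longrightarrow> f \<in> tight"
    using spectral_independence_tight[OF sip] by blast
  note s = B_sub[OF Bot_B]
  have "tight \<subseteq> L2_sub M Bot"
  proof (rule tight_subset[OF closed_subspace_L2_sub[OF s] L2_sub_const[OF s]])
    show "FC \<subseteq> L2_sub M Bot"
    proof
      fix f assume f: "f \<in> FC"
      show "f \<in> L2_sub M Bot" by (rule L2_subI[OF s FC_L2[OF f] _ bl[OF f]]) simp
    qed
    fix y f g assume "y \<in> B" "f \<in> L2_sub M Bot" "f \<in> L2_sub M y" "g \<in> L2_sub M Bot" "g \<in> L2_sub M (cp y)"
    then show "(\<lambda>\<omega>. f \<omega> * g \<omega>) \<in> L2_sub M Bot"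
      by (intro L2_sub_mult[OF s] indep_product(1)[OF B_sub B_sub cp_indep]) auto
  qed
  obtain f where f: "f \<in> L2 M" and f0: "AE s in \<mu>. \<Psi> f s \<noteq> 0" by (rule full_support)
  let ?A = "{s \<in> space \<mu>. D s \<noteq> 0}"
  have A: "?A \<in> sets \<mu>" using D(1) by measurable
  have "AE s in \<mu>. D s = 0 \<longrightarrow> \<Psi> (Pr ?A f) s = 0"
    using \<Psi>_Pr[OF A f] by eventually_elim (auto split: split_indicator)
  then have "Pr ?A f \<in> L2_sub M Bot" using t[OF Pr_L2[OF A f]] \<open>tight \<subseteq> L2_sub M Bot\<close> by blast
  then have "AE s in \<mu>. \<Psi> (Pr ?A f) s \<noteq> 0 \<longrightarrow> s \<in> S Bot" using L2_sub_iff_\<Psi>[OF Bot_B Pr_L2[OF A f]] by simp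
  with \<Psi>_Pr[OF A f] f0 AE_space have "AE s in \<mu>. 0 < ennreal (D s) \<longrightarrow> s \<in> S Bot"
    by eventually_elim (auto split: split_indicator_asm)
  moreover have Dm: "(\<lambda>s. ennreal (D s)) \<in> borel_measurable \<mu>" using D(1) by simp
  ultimately have "AE s in \<nu>. s \<in> S Bot" unfolding D(3) using AE_density[OF Dm] by simp
  then have "measure \<nu> (S Bot) = 1"
    using \<nu>.prob_eq_1[of "S Bot"] S_sets[OF Bot_B] sip by (simp add: spectral_independence_probability_def)
  then show ?thesis using measure_empty_point[OF sip] by simp
qed

text \<open>The mass of the empty point is 1/|Z|^2 with |Z|^2 = 1 + |Z - 1|^2. It equals 1 only if Z
  = 1, and then |X|^2 = <Z, X> would be the mean of X, which is 0.\<close>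

lemma FC_nonzero_imp_nontrivial:
  assumes X: "X \<in> FC" and nz: "\<not> (AE \<omega> in M. X \<omega> = 0)"
  shows "\<exists>\<nu>. spectral_independence_probability M B \<mu> \<Psi> \<nu> \<and> nontrivial_spectral_probability M \<mu> \<Psi> \<nu>"
proof -
  obtain Z where Z: "Z \<in> L2 M" and mean: "expectation Z = 1"
    and mult: "\<And>x. x \<in> B \<Longrightarrow> AE \<omega> in M. Z \<omega> = cexp M x Z \<omega> * cexp M (cp x) Z \<omega>"
    and fc: "\<And>Y. Y \<in> FC \<Longrightarrow> ip M Z Y = ip M X Y"
    using exponential_vector[OF X] by blast
  obtain \<nu> where \<nu>: "spectral_independence_probability M B \<mu> \<Psi> \<nu>" "measure \<nu> (S Bot) = 1 / ip M Z Z"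
    using spectral_probability_of_vector[OF Z mean mult] by metis
  have d: "(\<lambda>\<omega>. Z \<omega> - 1) \<in> L2 M" by (rule L2_diff[OF Z L2_const])
  have "ip M (\<lambda>\<omega>. Z \<omega> - 1) (\<lambda>\<omega>. Z \<omega> - 1) = ip M Z Z - 1"
    using Z d mean L2_integrable[OF Z] by (simp add: ip_diff_left ip_diff_right L2_const ip_const ip_commute[of M "\<lambda>_. 1"] prob_space)
  moreover have "ip M (\<lambda>\<omega>. Z \<omega> - 1) (\<lambda>\<omega>. Z \<omega> - 1) \<noteq> 0"
  proof
    assume "ip M (\<lambda>\<omega>. Z \<omega> - 1) (\<lambda>\<omega>. Z \<omega> - 1) = 0"
    then have "AE \<omega> in M. Z \<omega> - 1 = 0" by (intro L2_norm_eq_0[OF d]) (simp add: L2_norm_ip)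
    then have "AE \<omega> in M. Z \<omega> = 1" by eventually_elim simp
    then have "ip M Z X = ip M (\<lambda>\<omega>. 1) X" by (intro ip_cong_AE Z L2_const FC_L2[OF X]) auto
    then have "ip M X X = 0" using fc[OF X] FC_mean[OF X] by (simp add: ip_def)
    then show False using L2_norm_eq_0[OF FC_L2[OF X]] nz by (simp add: L2_norm_ip)
  qed
  ultimately have "1 < ip M Z Z" using ip_self_nonneg[of M "\<lambda>\<omega>. Z \<omega> - 1"] by simp
  then have "measure \<nu> {ept} < 1" using \<nu>(2) measure_empty_point[OF \<nu>(1)] by simp
  then show ?thesis using \<nu>(1) by (auto simp: nontrivial_spectral_probability_def)
qed

end

theorem theorem9p17:
  fixes M :: "'a measure" and B :: "'a set set set"
    and \<mu> :: "'s measure" and H :: "'s \<Rightarrow> 'h::real_inner set" and \<Gamma> :: "('s \<Rightarrow> 'h) set"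
    and \<Psi> :: "('a \<Rightarrow> real) \<Rightarrow> 's \<Rightarrow> 'h"
  assumes "prob_space M" and "essentially_separable M"
    and "noise_boolean_algebra M B"
    and "spectral_resolution M B \<mu> H \<Gamma> \<Psi>"
  shows "(classical M B \<longleftrightarrow>
            (\<exists>\<nu>. spectral_independence_probability M B \<mu> \<Psi> \<nu> \<and> equivalent_measures \<nu> \<mu>)) \<and>
         (trivial_field M \<noteq> sets M \<longrightarrow>
            (black M B \<longleftrightarrow>
              \<not> (\<exists>\<nu>. spectral_independence_probability M B \<mu> \<Psi> \<nu> \<and>
                     nontrivial_spectral_probability M \<mu> \<Psi> \<nu>)))"
proof -
  interpret noise_spectral M B \<mu> H \<Gamma> \<Psi>
    using assms by (intro noise_spectral.intro noise.intro noise_axioms.intro noise_spectral_axioms.intro)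
  have "black M B \<longleftrightarrow> \<not> (\<exists>\<nu>. spectral_independence_probability M B \<mu> \<Psi> \<nu> \<and>
      nontrivial_spectral_probability M \<mu> \<Psi> \<nu>)" if nt: "trivial_field M \<noteq> sets M"
  proof
    assume "black M B"
    then have "\<And>f. f \<in> FC \<Longrightarrow> AE \<omega> in M. f \<omega> = 0" by (simp add: black_def)
    from black_imp_trivial[OF this]
    show "\<not> (\<exists>\<nu>. spectral_independence_probability M B \<mu> \<Psi> \<nu> \<and> nontrivial_spectral_probability M \<mu> \<Psi> \<nu>)"
      by (auto simp: nontrivial_spectral_probability_def)
  next
    assume "\<not> (\<exists>\<nu>. spectral_independence_probability M B \<mu> \<Psi> \<nu> \<and> nontrivial_spectral_probability M \<mu> \<Psi> \<nu>)"
    then show "black M B" using FC_nonzero_imp_nontrivial nt by (auto simp: black_def)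
  qed
  then show ?thesis using classical_imp_spectral_independence spectral_independence_imp_classical by blast
qed

end
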